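(* With respect to the natural $\mathrm{SL}(2,\mathbb{R})$-invariant measure, $$\mathrm{Vol}\left(\mathcal{U}^+_1(\mathbb{R}^6)/\mathrm{Sp}(6,\mathbb{Z})\right)=\infty.$$
   Context: Let $V=\mathbb{R}^{6}$ with its standard symplectic form $\omega$, and $n=3$. A $3$-form $\Omega$ on $V$ is primitive if $\Omega\wedge\omega=0$; $\Lambda^3_{\mathrm{pr}}V^\vee$ is the real vector space of primitive $3$-forms. $\mathcal{U}(V)\subset(\Lambda^3_{\mathrm{pr}}V^\vee)\otimes_{\mathbb R}\mathbb{C}$ is the (open) set of those $\Omega$ whose restriction to every Lagrangian subspace $L\subset V$ is non-zero. For $\Omega\in\mathcal{U}(V)$ define $\phi_\Omega:\mathrm{LGr}(V)\to\mathbb{R}/\pi\mathbb{Z}$, $L\mapsto\mathrm{Arg}(\Omega|_L)$, on the Lagrangian Grassmannian (well defined modulo $\pi$). The canonical generator of $\pi_1(\mathrm{LGr}(V))\cong\mathbb{Z}$ is, after identifying $V=\mathbb{C}^3$ with $z_k=x_k+iy_k$, $\omega=\sum_k dx_k\wedge dy_k$, the loop $\mathbb{R}/\pi\mathbb{Z}\ni\theta\mapsto e^{i\theta}\mathbb{R}\times\mathbb{R}^{2}$. $\mathcal{U}^+(V)$ is the set of $\Omega\in\mathcal{U}(V)$ such that $\phi_\Omega$ sends this generator to the positive generator of $\pi_1(\mathbb{R}/\pi\mathbb{Z})$. The space $(\Lambda^3_{\mathrm{pr}}V^\vee)\otimes\mathbb{C}$ (of real dimension $28$) has the real symplectic form $$(\Omega_1,\Omega_2)\mapsto\mathrm{Im}(\Omega_1\wedge\Omega_2)\left(\frac{\omega^3}{3!}\right)^{-1},$$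 which is invariant under $\mathrm{Sp}(V)$ (acting by pullback); its associated volume form is invariant under $\mathrm{Sp}(V)$ and under $\mathrm{SL}(2,\mathbb{R})$, acting via its action on $\mathbb{C}=\mathbb{R}^2$. Put $$\mathcal{U}^+_1(V):=\left\{\Omega\in\mathcal{U}^+(V)\;\middle|\;\frac{\omega^3}{3!}=(-1)^{3}\left(\frac{i}{2}\right)^3\Omega\wedge\overline{\Omega}\right\},$$ a hypersurface preserved by $\mathrm{Sp}(V)$ and $\mathrm{SL}(2,\mathbb{R})$. It is of contact type, with the Euler vector field $E$ (generating the scaling $\Omega\mapsto e^t\Omega$) as Liouville vector field. The natural volume form on $\mathcal{U}^+_1(V)$ is the restriction of the contraction with $E$ of the volume form on $(\Lambda^3_{\mathrm{pr}}V^\vee)\otimes\mathbb{C}$ associated with the symplectic form $(\Omega_1,\Omega_2)\mapsto\mathrm{Im}(\Omega_1\wedge\Omega_2)\left(\frac{\omega^3}{3!}\right)^{-1}$ (equivalently, up to a constant, the contact volume form); it is invariant under $\mathrm{Sp}(V)$ and $\mathrm{SL}(2,\mathbb{R})$. The discrete group $\mathrm{Sp}(6,\mathbb{Z})\subset\mathrm{Sp}(V)$ acts properly on $\mathcal{U}^+_1(V)$, and $\mathrm{Vol}$ denotes the total mass of the induced measure on the orbifold quotient $\mathcal{U}^+_1(\mathbb{R}^6)/\mathrm{Sp}(6,\mathbb{Z})$ (the measure of a fundamental domain). *)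

theory Defs
  imports "HOL-Analysis.Analysis" "HOL-Combinatorics.Permutations"
begin

section \<open>Wedge products\<close>

text \<open>
  A \<open>k\<close>-form on a vector space \<open>'v\<close> is represented by a function of a sequence of vectors that
  depends only on the first \<open>k\<close> of them (the arguments are numbered from \<open>0\<close>).  The wedge product is
  normalised so that \<open>(a \<and> b)(u, v) = a(u) b(v) - a(v) b(u)\<close> for one-forms, i.e. \<open>dx \<and> dy\<close> takes
  the value \<open>1\<close> on the standard basis of the plane.
\<close>

type_synonym ('v, 'k) form = "(nat \<Rightarrow> 'v) \<Rightarrow> 'k"

definition wedge :: "nat \<Rightarrow> nat \<Rightarrow> ('v, 'k::field_char_0) form \<Rightarrow> ('v, 'k) form \<Rightarrow> ('v, 'k) form"
  where "wedge p q \<alpha> \<beta> v =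
    (\<Sum>\<pi> | \<pi> permutes {..<p + q}.
        of_int (sign \<pi>) * \<alpha> (\<lambda>i. v (\<pi> i)) * \<beta> (\<lambda>i. v (\<pi> (p + i)))) / (fact p * fact q)"

primrec wedge_power :: "nat \<Rightarrow> ('v, 'k::field_char_0) form \<Rightarrow> ('v, 'k) form"
  \<comment> \<open>iterated wedge product of a two-form with itself\<close>
  where
    "wedge_power 0 \<alpha> = (\<lambda>v. 1)"
  | "wedge_power (Suc m) \<alpha> = wedge (2 * m) 2 (wedge_power m \<alpha>) \<alpha>"

definition liouville_form :: "nat \<Rightarrow> ('v, 'k::field_char_0) form \<Rightarrow> ('v, 'k) form"
  \<comment> \<open>the volume form \<open>\<omega>\<^sup>m / m!\<close> of a symplectic form on a space of dimension \<open>2m\<close>\<close>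
  where "liouville_form m \<alpha> v = wedge_power m \<alpha> v / fact m"

definition interior_product :: "'v \<Rightarrow> ('v, 'k) form \<Rightarrow> ('v, 'k) form"
  where "interior_product x \<alpha> v = \<alpha> (case_nat x v)"

text \<open>
  Since \<open>of_nat\<close> enumerates a numeral index type cyclically, \<open>i \<mapsto> coord_vec i\<close> runs, for
  \<open>i < CARD('n)\<close>, once through the standard basis.
\<close>

definition coord_vec :: "nat \<Rightarrow> real ^ 'n::{finite, semiring_1}"
  where "coord_vec i = axis (of_nat i) 1"


section \<open>The symplectic space\<close>

type_synonym V = "real ^ 6"

text \<open>The coordinates are \<open>(x\<^sub>1, x\<^sub>2, x\<^sub>3, y\<^sub>1, y\<^sub>2, y\<^sub>3)\<close> and the form is the sum of the \<open>dx\<^sub>k \<and> dy\<^sub>k\<close>.\<close>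

definition omega :: "V \<Rightarrow> V \<Rightarrow> real"
  where "omega u v = (\<Sum>k\<in>{1, 2, 3}. u $ k * v $ (k + 3) - u $ (k + 3) * v $ k)"

definition omega_form :: "(V, real) form"
  where "omega_form v = omega (v 0) (v 1)"

definition lagrangian :: "V set \<Rightarrow> bool"
  where "lagrangian L \<longleftrightarrow> subspace L \<and> dim L = 3 \<and> (\<forall>u\<in>L. \<forall>v\<in>L. omega u v = 0)"

definition Sp6_int :: "(real ^ 6 ^ 6) set"
  where "Sp6_int = {A. (\<forall>i j. A $ i $ j \<in> \<int>) \<and> (\<forall>u v. omega (A *v u) (A *v v) = omega u v)}"


section \<open>Primitive complex three-forms\<close>

text \<open>
  Complex three-forms are the complex-valued, real-trilinear alternating maps; boundedness is
  automatic in finite dimension, and the type of bounded linear maps provides the topology.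
\<close>

type_synonym trilinear = "V \<Rightarrow>\<^sub>L V \<Rightarrow>\<^sub>L V \<Rightarrow>\<^sub>L complex"

definition tri :: "trilinear \<Rightarrow> V \<Rightarrow> V \<Rightarrow> V \<Rightarrow> complex"
  where "tri \<Omega> u v w = blinfun_apply (blinfun_apply (blinfun_apply \<Omega> u) v) w"

definition form3 :: "trilinear \<Rightarrow> (V, complex) form"
  where "form3 \<Omega> v = tri \<Omega> (v 0) (v 1) (v 2)"

definition alternating :: "trilinear \<Rightarrow> bool"
  where "alternating \<Omega> \<longleftrightarrow> (\<forall>u v. tri \<Omega> u u v = 0 \<and> tri \<Omega> u v u = 0 \<and> tri \<Omega> v u u = 0)"

definition primitive_forms :: "trilinear set"
  where "primitive_forms =
    {\<Omega>. alternating \<Omega> \<and> (\<forall>v. wedge 3 2 (form3 \<Omega>) (\<lambda>w. complex_of_real (omega_form w)) v = 0)}"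

definition pullback :: "real ^ 6 ^ 6 \<Rightarrow> trilinear \<Rightarrow> trilinear"
  where "pullback A \<Omega> =
    Blinfun (\<lambda>u. Blinfun (\<lambda>v. Blinfun (\<lambda>w. tri \<Omega> (A *v u) (A *v v) (A *v w))))"

lemma tri_pullback: "tri (pullback A \<Omega>) u v w = tri \<Omega> (A *v u) (A *v v) (A *v w)"
proof -
  have 1: "bounded_linear ((*v) A)"
    by (rule matrix_vector_mul_bounded_linear)
  define a where "a = Blinfun ((*v) A)"
  have a: "blinfun_apply a x = A *v x" for x
    unfolding a_def using 1 by (simp add: bounded_linear_Blinfun_apply)
  have w: "Blinfun (\<lambda>w. tri \<Omega> x y (A *v w)) = blinfun_apply (blinfun_apply \<Omega> x) y o\<^sub>L a" for x y
    by (rule trans[OF _ blinfun_apply_inverse]) (auto simp: tri_def a intro!: arg_cong[of _ _ Blinfun])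
  define c where "c = Blinfun (\<lambda>f :: V \<Rightarrow>\<^sub>L complex. f o\<^sub>L a)"
  have c: "blinfun_apply c f = f o\<^sub>L a" for f
    unfolding c_def
    by (subst bounded_linear_Blinfun_apply) (auto intro!: bounded_linear_intros)
  have v: "Blinfun (\<lambda>v. blinfun_apply (blinfun_apply \<Omega> x) (A *v v) o\<^sub>L a)
      = c o\<^sub>L blinfun_apply \<Omega> x o\<^sub>L a" for x
    by (rule trans[OF _ blinfun_apply_inverse]) (auto simp: c a intro!: arg_cong[of _ _ Blinfun])
  define d where "d = Blinfun (\<lambda>f :: V \<Rightarrow>\<^sub>L V \<Rightarrow>\<^sub>L complex. c o\<^sub>L f o\<^sub>L a)"
  have d: "blinfun_apply d f = c o\<^sub>L f o\<^sub>L a" for f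
    unfolding d_def
    by (subst bounded_linear_Blinfun_apply) (auto intro!: bounded_linear_intros)
  have "Blinfun (\<lambda>u. c o\<^sub>L blinfun_apply \<Omega> (A *v u) o\<^sub>L a) = d o\<^sub>L \<Omega> o\<^sub>L a"
    by (rule trans[OF _ blinfun_apply_inverse]) (auto simp: d a intro!: arg_cong[of _ _ Blinfun])
  then have "pullback A \<Omega> = d o\<^sub>L \<Omega> o\<^sub>L a"
    unfolding pullback_def w v .
  then show ?thesis
    by (simp add: tri_def d c a)
qed


section \<open>Forms that do not vanish on any Lagrangian subspace\<close>

definition U_forms :: "trilinear set"
  where "U_forms =
    {\<Omega> \<in> primitive_forms. \<forall>L. lagrangian L \<longrightarrow> (\<exists>u\<in>L. \<exists>v\<in>L. \<exists>w\<in>L. tri \<Omega> u v w \<noteq> 0)}"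

text \<open>
  The circle \<open>\<real>/\<pi>\<int>\<close> is identified with the unit circle by \<open>t \<mapsto> cis (2 * t)\<close>, so that the class
  modulo \<open>\<pi>\<close> of the argument of \<open>z\<close> becomes \<open>(z / \<bar>z\<bar>)\<^sup>2\<close>.  The values of \<open>\<Omega>\<close> on triples in
  a Lagrangian \<open>L\<close> are real multiples of each other, so any non-zero value determines the phase.
\<close>

definition phase :: "trilinear \<Rightarrow> V set \<Rightarrow> complex"
  where "phase \<Omega> L =
    (THE p. \<exists>u\<in>L. \<exists>v\<in>L. \<exists>w\<in>L. tri \<Omega> u v w \<noteq> 0 \<and> p = (sgn (tri \<Omega> u v w))\<^sup>2)"

text \<open>The loop \<open>\<theta> \<mapsto> e\<^sup>i\<^sup>\<theta> \<real> \<times> \<real>\<^sup>2\<close> for \<open>\<theta> = \<pi> s\<close> with \<open>0 \<le> s \<le> 1\<close>.\<close>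

definition lgr_loop :: "real \<Rightarrow> V set"
  where "lgr_loop s =
    span {cos (pi * s) *\<^sub>R axis 1 1 + sin (pi * s) *\<^sub>R axis 4 1, axis 2 1, axis 3 1}"

text \<open>
  The loop \<open>s \<mapsto> cis (2 * pi * s)\<close> is the positive generator \<open>\<theta> \<mapsto> \<theta>\<close> of the fundamental group of
  \<open>\<real>/\<pi>\<int>\<close>; this group is abelian, so free homotopy of loops is equality of classes.
\<close>

definition U_plus :: "trilinear set"
  where "U_plus =
    {\<Omega> \<in> U_forms. homotopic_loops (sphere 0 1) (\<lambda>s. phase \<Omega> (lgr_loop s)) (\<lambda>s. cis (2 * pi * s))}"

definition U1_plus :: "trilinear set"
  where "U1_plus =
    {\<Omega> \<in> U_plus. \<forall>v. complex_of_real (liouville_form 3 omega_form v)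
        = (- 1) ^ 3 * (\<i> / 2) ^ 3 * wedge 3 3 (form3 \<Omega>) (\<lambda>w. cnj (form3 \<Omega> w)) v}"


section \<open>The natural volume form and the measure it induces\<close>

text \<open>
  The space of six-forms on \<open>V\<close> is one-dimensional, so the quotient of a six-form by \<open>\<omega>\<^sup>3 / 3!\<close> may be
  evaluated on the standard basis.
\<close>

definition sigma :: "trilinear \<Rightarrow> trilinear \<Rightarrow> real"
  where "sigma \<Omega>1 \<Omega>2 =
    Im (wedge 3 3 (form3 \<Omega>1) (form3 \<Omega>2) coord_vec) / liouville_form 3 omega_form coord_vec"

definition sigma_volume :: "(trilinear, real) form"
  \<comment> \<open>a volume form on the \<open>28\<close>-dimensional real vector space \<^const>\<open>primitive_forms\<close>\<close>
  where "sigma_volume = liouville_form 14 (\<lambda>w. sigma (w 0) (w 1))"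

definition euler_field :: "trilinear \<Rightarrow> trilinear"
  \<comment> \<open>the generator of the flow \<open>\<Omega> \<mapsto> e\<^sup>t \<Omega>\<close>\<close>
  where "euler_field \<Omega> = \<Omega>"

definition natural_volume_form :: "trilinear \<Rightarrow> (trilinear, real) form"
  where "natural_volume_form \<Omega> = interior_product (euler_field \<Omega>) sigma_volume"

text \<open>\<open>D u\<close> is the derivative at \<open>u\<close> of the local \<open>C\<^sup>1\<close> parametrisation \<open>\<psi>\<close> of \<open>S\<close>.\<close>

definition local_parametrization ::
    "'v::real_normed_vector set \<Rightarrow> 'u::real_normed_vector set \<Rightarrow> ('u \<Rightarrow> 'v) \<Rightarrow> ('u \<Rightarrow> 'u \<Rightarrow>\<^sub>L 'v) \<Rightarrow> bool"
  where "local_parametrization S U \<psi> D \<longleftrightarrow>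
    open U \<and> openin (top_of_set S) (\<psi> ` U) \<and> (\<exists>\<phi>. homeomorphism U (\<psi> ` U) \<psi> \<phi>) \<and>
    (\<forall>u\<in>U. (\<psi> has_derivative blinfun_apply (D u)) (at u) \<and> inj (blinfun_apply (D u))) \<and>
    continuous_on U D"

text \<open>
  The measure on the \<open>27\<close>-dimensional hypersurface \<^const>\<open>U1_plus\<close> given by integration of the (absolute
  value of the) restriction of \<^const>\<open>natural_volume_form\<close>: on the image of a parametrisation \<open>\<psi>\<close> it is
  the Lebesgue integral of the pulled-back form evaluated on the coordinate vector fields.
\<close>

definition natural_measure :: "trilinear measure"
  where "natural_measure = (THE M. sets M = sets (restrict_space borel U1_plus) \<and>
    (\<forall>(U :: (real ^ 27) set) \<psi> D. local_parametrization U1_plus U \<psi> D \<longrightarrow>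
      (\<forall>B\<in>sets borel. B \<subseteq> U \<longrightarrow>
        emeasure M (\<psi> ` B) =
          (\<integral>\<^sup>+u\<in>B. ennreal \<bar>natural_volume_form (\<psi> u) (\<lambda>i. blinfun_apply (D u) (coord_vec i))\<bar> \<partial>lborel))))"


section \<open>Volume of a quotient\<close>

text \<open>
  As \<open>-1\<close> acts on three-forms as multiplication by \<open>-1\<close>, no non-trivial element of \<^const>\<open>Sp6_int\<close> acts
  trivially, so distinct group elements have to move a fundamental domain to essentially disjoint sets.
\<close>

definition fundamental_domain :: "'g set \<Rightarrow> ('g \<Rightarrow> 'a \<Rightarrow> 'a) \<Rightarrow> 'a measure \<Rightarrow> 'a set \<Rightarrow> bool"
  where "fundamental_domain G act M F \<longleftrightarrow>
    F \<in> sets M \<and>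
    space M - (\<Union>g\<in>G. act g ` F) \<in> null_sets M \<and>
    (\<forall>g\<in>G. \<forall>h\<in>G. g \<noteq> h \<longrightarrow> act g ` F \<inter> act h ` F \<in> null_sets M)"

definition quotient_volume :: "'g set \<Rightarrow> ('g \<Rightarrow> 'a \<Rightarrow> 'a) \<Rightarrow> 'a measure \<Rightarrow> ennreal"
  \<comment> \<open>the common measure of all fundamental domains\<close>
  where "quotient_volume G act M = (THE c. \<exists>F. fundamental_domain G act M F \<and> c = emeasure M F)"

end

theory Submission
  imports Defs "HOL-Complex_Analysis.Winding_Numbers"
begin

text \<open>
  The volume is infinite because a non-compact group of symmetries commutes with \<open>Sp(6,\<int>)\<close> and moves
  an invariant function to infinity.  The matrix \<open>diag(c, 1/c)\<close> in \<open>SL(2,\<real>)\<close> acts on the values of a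
  form by \<open>\<Omega> \<mapsto> c Re \<Omega> + \<i> c\<inverse> Im \<Omega>\<close>.  It preserves \<^const>\<open>U1_plus\<close> and its natural measure and
  commutes with pullback by matrices.  On the other hand, contracting four copies of the real three-form
  \<open>Re \<Omega>\<close> with the Poisson bivector of \<open>\<omega>\<close> gives a quartic function \<open>Q\<close> of \<open>\<Omega>\<close>
  that is invariant under \<open>Sp(6,\<int>)\<close> and is multiplied by \<open>c\<^sup>4\<close> under this action.  Let
  \<open>q > 0\<close> be the value of \<open>Q\<close> at \<open>dz\<^sub>1 \<and> dz\<^sub>2 \<and> dz\<^sub>3\<close>.  The shells
  \<open>16\<^sup>k q / 2 < Q < 16\<^sup>k 2 q\<close> are disjoint and invariant, and the element with \<open>c = 2\<^sup>k\<close> maps the shell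
  of index \<open>0\<close> onto the shell of index \<open>k\<close>.  A fundamental domain \<open>F\<close> and its image under the element are both
  fundamental domains, so they have the same mass in every invariant set; hence \<open>F\<close> has
  the same mass in all shells.  This mass is positive since the shell of index \<open>0\<close> contains a non-empty open
  subset (lemmas \<open>fundamental_domain_measure_unique\<close>, \<open>fundamental_domain_positive\<close> and
  \<open>fundamental_domain_infinite\<close>).

  Most of the work goes into giving this argument its meaning.

  The natural measure is defined by a characterisation, so it has to be constructed.  An explicit
  Darboux basis of the primitive forms (\<open>sigma_basis_form\<close>) identifies them with \<open>\<real>\<^sup>2\<^sup>8\<close> such that the
  symplectic volume becomes Lebesgue measure.  Then \<open>28\<close> times the Lebesgue measure of the cone over a set has the
  required values by the change of variables formula in polar coordinates
  (\<open>cone_measure_parametrization\<close>), and covering the hypersurface by radial charts shows that these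
  values determine the measure (\<open>is_natural_measure_unique\<close>).  Uniqueness also yields the invariance
  under every linear map that preserves the symplectic form and the hypersurface
  (locale \<open>symplectic_symmetry\<close>).

  That \<^const>\<open>U_plus\<close> is preserved by the symplectic matrices and by the stretches is a topological
  statement about the phase loop.  It is reduced to the sign of a determinant: the loop is positive iff
  \<open>x \<mapsto> \<Omega>(x, u, v)\<close> maps the symplectic plane that belongs to an isotropic plane \<open>u, v\<close> to the complex numbers
  preserving orientation (\<open>line_phase_homotopic_iff\<close>), and this sign is the same for all isotropic
  planes (\<open>positive_pair_constant\<close>).

  A fundamental domain exists because the action is proper and generically free.  Properness comes from an estimate
  (\<open>symplectic_norm_bound\<close>): if a form is bounded below on unitary frames, then the norm of a symplectic
  matrix is bounded in terms of the norm of the pulled-back form.  Stabilisers are trivial outside a null set because only the identity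
  matrix fixes all primitive forms (\<open>trivial_action_imp_one\<close>), so fixed points lie in proper linear
  subspaces.
\<close>

section \<open>Shuffle expansion of the wedge product\<close>

definition antisymmetric_form :: "nat \<Rightarrow> ('v, 'k::field_char_0) form \<Rightarrow> bool"
  where "antisymmetric_form k F \<longleftrightarrow>
    (\<forall>\<tau> v. \<tau> permutes {..<k} \<longrightarrow> F (\<lambda>i. v (\<tau> i)) = of_int (sign \<tau>) * F v)"

definition local_form :: "nat \<Rightarrow> ('v, 'k) form \<Rightarrow> bool"
  where "local_form k F \<longleftrightarrow> (\<forall>v w. (\<forall>i<k. v i = w i) \<longrightarrow> F v = F w)"

definition multilinear_form :: "nat \<Rightarrow> ('v::real_vector, 'k::real_normed_field) form \<Rightarrow> bool"
  where "multilinear_form k F \<longleftrightarrow> (\<forall>v. \<forall>i<k. linear (\<lambda>x. F (v(i := x))))"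

abbreviation wedge_summand :: "nat \<Rightarrow> ('v, 'k::field_char_0) form \<Rightarrow> ('v, 'k) form \<Rightarrow> (nat \<Rightarrow> 'v) \<Rightarrow> (nat \<Rightarrow> nat) \<Rightarrow> 'k"
  where "wedge_summand p \<alpha> \<beta> v \<pi> \<equiv>
    of_int (sign \<pi>) * \<alpha> (\<lambda>i. v (\<pi> i)) * \<beta> (\<lambda>i. v (\<pi> (p + i)))"

lemma sign_mult_permutes:
  assumes "finite A" "\<pi> permutes A" "\<rho> permutes A"
  shows "sign (\<pi> \<circ> \<rho>) = sign \<pi> * sign \<rho>"
  using assms by (meson permutes_imp_permutation sign_compose)

lemma antisymmetric_wedge: "antisymmetric_form (p + q) (wedge p q \<alpha> \<beta>)"
proof (unfold antisymmetric_form_def, intro allI impI)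
  fix \<tau> :: "nat \<Rightarrow> nat" and v :: "nat \<Rightarrow> 'a"
  assume \<tau>: "\<tau> permutes {..<p + q}"
  have "(\<Sum>\<pi> | \<pi> permutes {..<p + q}. wedge_summand p \<alpha> \<beta> v \<pi>)
      = (\<Sum>\<pi> | \<pi> permutes {..<p + q}. wedge_summand p \<alpha> \<beta> v (\<tau> \<circ> \<pi>))"
    by (rule setum_permutations_compose_left[OF \<tau>])
  also have "\<dots> = (\<Sum>\<pi> | \<pi> permutes {..<p + q}. of_int (sign \<tau>) * wedge_summand p \<alpha> \<beta> (\<lambda>i. v (\<tau> i)) \<pi>)"
    by (rule sum.cong) (auto simp: sign_mult_permutes[OF finite_lessThan \<tau>] algebra_simps)
  finally have "(\<Sum>\<pi> | \<pi> permutes {..<p + q}. wedge_summand p \<alpha> \<beta> v \<pi>) =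
      of_int (sign \<tau>) * (\<Sum>\<pi> | \<pi> permutes {..<p + q}. wedge_summand p \<alpha> \<beta> (\<lambda>i. v (\<tau> i)) \<pi>)"
    by (simp add: sum_distrib_left)
  then have "of_int (sign \<tau>) * (\<Sum>\<pi> | \<pi> permutes {..<p + q}. wedge_summand p \<alpha> \<beta> v \<pi>) =
      (\<Sum>\<pi> | \<pi> permutes {..<p + q}. wedge_summand p \<alpha> \<beta> (\<lambda>i. v (\<tau> i)) \<pi>)"
    by (cases \<tau> rule: sign_cases) simp_all
  then show "wedge p q \<alpha> \<beta> (\<lambda>i. v (\<tau> i)) = of_int (sign \<tau>) * wedge p q \<alpha> \<beta> v"
    unfolding wedge_def by (simp only: times_divide_eq_right)
qed

lemma local_wedge:
  assumes "local_form p \<alpha>" "local_form q \<beta>"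
  shows "local_form (p + q) (wedge p q \<alpha> \<beta>)"
proof (unfold local_form_def, intro allI impI)
  fix v w :: "nat \<Rightarrow> 'a"
  assume vw: "\<forall>i<p + q. v i = w i"
  have "wedge_summand p \<alpha> \<beta> v \<pi> = wedge_summand p \<alpha> \<beta> w \<pi>" if "\<pi> permutes {..<p + q}" for \<pi>
  proof -
    have "\<pi> i < p + q" if "i < p + q" for i
      using permutes_in_image[OF \<open>\<pi> permutes _\<close>, of i] that by simp
    then have "\<alpha> (\<lambda>i. v (\<pi> i)) = \<alpha> (\<lambda>i. w (\<pi> i))" "\<beta> (\<lambda>i. v (\<pi> (p + i))) = \<beta> (\<lambda>i. w (\<pi> (p + i)))"
      using vw assms[unfolded local_form_def] by auto
    then show ?thesis by simp
  qed
  then show "wedge p q \<alpha> \<beta> v = wedge p q \<alpha> \<beta> w"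
    unfolding wedge_def by (intro arg_cong2[of _ _ _ _ "(/)"] sum.cong) auto
qed

lemma linear_mult_const:
  fixes f :: "'v::real_vector \<Rightarrow> 'k::real_normed_field"
  assumes "linear f"
  shows "linear (\<lambda>x. c * f x * d)"
  using assms unfolding linear_iff by (auto simp: algebra_simps)

lemma multilinear_wedge:
  fixes \<alpha> \<beta> :: "('v::real_vector, 'k::real_normed_field) form"
  assumes "multilinear_form p \<alpha>" "multilinear_form q \<beta>" "local_form p \<alpha>"
  shows "multilinear_form (p + q) (wedge p q \<alpha> \<beta>)"
proof (unfold multilinear_form_def, intro allI impI)
  fix v :: "nat \<Rightarrow> 'v" and j assume j: "j < p + q"
  have "linear (\<lambda>x. wedge_summand p \<alpha> \<beta> (v(j := x)) \<pi>)" if \<pi>: "\<pi> permutes {..<p + q}" for \<pi>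
  proof -
    define i where "i = inv \<pi> j"
    have ij: "\<pi> k = j \<longleftrightarrow> k = i" for k
      using permutes_inverses[OF \<pi>] by (auto simp: i_def)
    have i: "i < p + q"
      using permutes_in_image[OF \<pi>, of i] ij[of i] j by simp
    show ?thesis
    proof (cases "i < p")
      case True
      have "(\<lambda>l. (v(j := x)) (\<pi> l)) = (\<lambda>l. v (\<pi> l))(i := x)" for x
        using ij by (auto simp: fun_eq_iff)
      moreover have "(\<lambda>l. (v(j := x)) (\<pi> (p + l))) = (\<lambda>l. v (\<pi> (p + l)))" for x
        using ij True by (auto simp: fun_eq_iff)
      moreover have "linear (\<lambda>x. \<alpha> ((\<lambda>l. v (\<pi> l))(i := x)))"
        using assms(1) True by (auto simp: multilinear_form_def)
      ultimately show ?thesis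
        by (simp add: linear_mult_const)
    next
      case False
      then obtain i' where i': "i = p + i'" "i' < q"
        using i False by (intro that[of "i - p"]) auto
      have "\<alpha> (\<lambda>l. (v(j := x)) (\<pi> l)) = \<alpha> (\<lambda>l. v (\<pi> l))" for x
        by (rule assms(3)[unfolded local_form_def, rule_format]) (use ij False in auto)
      moreover have "(\<lambda>l. (v(j := x)) (\<pi> (p + l))) = (\<lambda>l. v (\<pi> (p + l)))(i' := x)" for x
        using ij i' by (auto simp: fun_eq_iff)
      moreover have "linear (\<lambda>x. \<beta> ((\<lambda>l. v (\<pi> (p + l)))(i' := x)))"
        using assms(2) i' by (auto simp: multilinear_form_def)
      ultimately show ?thesis
        using linear_mult_const[of "\<lambda>x. \<beta> ((\<lambda>l. v (\<pi> (p + l)))(i' := x))" _ 1] by simp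
    qed
  qed
  then have "linear (\<lambda>x. \<Sum>\<pi> | \<pi> permutes {..<p + q}. wedge_summand p \<alpha> \<beta> (v(j := x)) \<pi>)"
    by (intro linear_compose_sum) auto
  from linear_mult_const[OF this, of 1 "1 / (fact p * fact q)"]
  show "linear (\<lambda>x. wedge p q \<alpha> \<beta> (v(j := x)))"
    by (simp add: wedge_def)
qed

text \<open>
  Two permutations that send the first \<open>p\<close> positions to the same set differ by a permutation of
  the first \<open>p\<close> positions followed by one of the last \<open>q\<close>.  Each factor contributes its sign once
  through the sign of the whole permutation and once through the antisymmetry of a form, and the two
  contributions cancel.
\<close>

lemma wedge_summand_invariant:
  assumes \<alpha>: "antisymmetric_form p \<alpha>" "local_form p \<alpha>"
    and \<beta>: "antisymmetric_form q \<beta>" "local_form q \<beta>"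
    and \<pi>: "\<pi> permutes {..<p + q}" and \<pi>': "\<pi>' permutes {..<p + q}"
    and eq: "\<pi>' ` {..<p} = \<pi> ` {..<p}"
  shows "wedge_summand p \<alpha> \<beta> v \<pi>' = wedge_summand p \<alpha> \<beta> v \<pi>"
proof -
  define \<rho> where "\<rho> = inv \<pi> \<circ> \<pi>'"
  have \<rho>: "\<rho> permutes {..<p + q}"
    unfolding \<rho>_def by (intro permutes_compose permutes_inv \<pi> \<pi>')
  have \<pi>': "\<pi>' = \<pi> \<circ> \<rho>"
    using permutes_inverses[OF \<pi>] by (auto simp: \<rho>_def fun_eq_iff)
  have im: "\<rho> ` {..<p} = {..<p}"
    unfolding \<rho>_def image_comp[symmetric] eq using permutes_inverses[OF \<pi>] by (simp add: image_comp)
  have inj: "inj \<rho>"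
    using \<rho> by (rule permutes_inj)
  define \<rho>1 where "\<rho>1 = (\<lambda>i. if i < p then \<rho> i else i)"
  define \<rho>2 where "\<rho>2 = (\<lambda>i. if i < p then i else \<rho> i)"
  have im2: "\<rho> ` {p..<p + q} = {p..<p + q}"
  proof -
    have "{p..<p + q} = {..<p + q} - {..<p}" by auto
    then show ?thesis
      using inj im permutes_image[OF \<rho>] by (metis image_set_diff)
  qed
  have 1: "\<rho>1 permutes {..<p}"
  proof (rule bij_imp_permutes)
    show "bij_betw \<rho>1 {..<p} {..<p}"
      using im inj by (auto simp: bij_betw_def \<rho>1_def inj_on_def inj_def)
  qed (simp add: \<rho>1_def)
  have 2: "\<rho>2 permutes {p..<p + q}"
  proof (rule bij_imp_permutes)
    have "\<rho>2 ` {p..<p + q} = \<rho> ` {p..<p + q}"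
      by (rule image_cong) (auto simp: \<rho>2_def)
    then show "bij_betw \<rho>2 {p..<p + q} {p..<p + q}"
      using im2 inj by (auto simp: bij_betw_def \<rho>2_def inj_on_def inj_def)
    show "\<rho>2 i = i" if "i \<notin> {p..<p + q}" for i
      using that permutes_not_in[OF \<rho>, of i] by (auto simp: \<rho>2_def)
  qed
  define \<rho>2' where "\<rho>2' = map_permutation {p..<p + q} (\<lambda>i. i - p) \<rho>2"
  have two': "\<rho>2' permutes {..<q}"
    unfolding \<rho>2'_def
  proof (rule map_permutation_permutes[OF _ 2])
    show "bij_betw (\<lambda>i. i - p) {p..<p + q} {..<q}"
      by (rule bij_betwI[of _ _ _ "\<lambda>i. i + p"]) auto
  qed
  have sgn2: "sign \<rho>2' = sign \<rho>2"
    unfolding \<rho>2'_def by (rule sign_map_permutation) (use 2 in \<open>auto simp: inj_on_def\<close>)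
  have \<rho>2'_eq: "\<rho> (p + i) = p + \<rho>2' i" if "i < q" for i
  proof -
    have "\<rho>2' ((p + i) - p) = \<rho>2 (p + i) - p"
      unfolding \<rho>2'_def by (rule map_permutation_apply) (use that in \<open>auto simp: inj_on_def\<close>)
    moreover have "\<rho> (p + i) \<ge> p"
      using im2 that by (metis add_less_cancel_left atLeastLessThan_iff image_eqI le_add1)
    ultimately show ?thesis by (simp add: \<rho>2_def)
  qed
  have "\<rho> = \<rho>1 \<circ> \<rho>2"
  proof
    fix i
    have "\<not> \<rho>2 i < p" if "\<not> i < p"
    proof (cases "i < p + q")
      case True
      then show ?thesis using 2 that permutes_in_image[OF 2, of i] by auto
    next
      case False
      then show ?thesis using that permutes_not_in[OF 2, of i] by auto
    qed
    then show "\<rho> i = (\<rho>1 \<circ> \<rho>2) i"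
      by (auto simp: \<rho>1_def \<rho>2_def)
  qed
  moreover have "sign (\<rho>1 \<circ> \<rho>2) = sign \<rho>1 * sign \<rho>2"
    by (rule sign_mult_permutes[of "{..<p + q}"])
      (auto intro: permutes_subset[OF 1] permutes_subset[OF 2])
  ultimately have sgn: "sign \<rho> = sign \<rho>1 * sign \<rho>2'"
    using sgn2 by simp
  have a: "\<alpha> (\<lambda>i. v (\<pi>' i)) = of_int (sign \<rho>1) * \<alpha> (\<lambda>i. v (\<pi> i))"
  proof -
    have "\<alpha> (\<lambda>i. v (\<pi>' i)) = \<alpha> (\<lambda>i. (\<lambda>i. v (\<pi> i)) (\<rho>1 i))"
      by (rule \<alpha>(2)[unfolded local_form_def, rule_format]) (simp add: \<pi>' \<rho>1_def)
    also have "\<dots> = of_int (sign \<rho>1) * \<alpha> (\<lambda>i. v (\<pi> i))"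
      by (rule \<alpha>(1)[unfolded antisymmetric_form_def, rule_format, OF 1])
    finally show ?thesis .
  qed
  have b: "\<beta> (\<lambda>i. v (\<pi>' (p + i))) = of_int (sign \<rho>2') * \<beta> (\<lambda>i. v (\<pi> (p + i)))"
  proof -
    have "\<beta> (\<lambda>i. v (\<pi>' (p + i))) = \<beta> (\<lambda>i. (\<lambda>i. v (\<pi> (p + i))) (\<rho>2' i))"
      by (rule \<beta>(2)[unfolded local_form_def, rule_format]) (simp add: \<pi>' \<rho>2'_eq)
    also have "\<dots> = of_int (sign \<rho>2') * \<beta> (\<lambda>i. v (\<pi> (p + i)))"
      by (rule \<beta>(1)[unfolded antisymmetric_form_def, rule_format, OF two'])
    finally show ?thesis .
  qed
  have s: "sign \<pi>' = sign \<pi> * (sign \<rho>1 * sign \<rho>2')"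
    unfolding \<pi>' sgn[symmetric] by (rule sign_mult_permutes[OF finite_lessThan \<pi> \<rho>])
  have "(of_int (sign \<rho>1 * sign \<rho>1) :: 'b) = 1" "(of_int (sign \<rho>2' * sign \<rho>2') :: 'b) = 1"
    by simp_all
  then have "(of_int (sign \<rho>1) :: 'b) * of_int (sign \<rho>1) = 1" "(of_int (sign \<rho>2') :: 'b) * of_int (sign \<rho>2') = 1"
    by (simp_all only: of_int_mult)
  moreover have "r1 * r1 = 1 \<Longrightarrow> r2 * r2 = 1 \<Longrightarrow> (s * (r1 * r2)) * (r1 * A) * (r2 * B) = s * A * B"
    for r1 r2 s A B :: 'b
  proof -
    assume r: "r1 * r1 = 1" "r2 * r2 = 1"
    have "(s * (r1 * r2)) * (r1 * A) * (r2 * B) = (r1 * r1) * (r2 * r2) * (s * A * B)"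
      by (simp only: ac_simps)
    then show "(s * (r1 * r2)) * (r1 * A) * (r2 * B) = s * A * B"
      by (simp add: r)
  qed
  ultimately show ?thesis
    unfolding a b s by (simp only: of_int_mult)
qed

lemma subset_is_permutation_image:
  assumes "S \<subseteq> {..<p + q}" "card S = p"
  obtains \<pi> where "\<pi> permutes {..<p + q}" "\<pi> ` {..<p} = S"
proof -
  have fin: "finite S" using assms(1) finite_subset by blast
  obtain f where f: "bij_betw f {..<p} S"
    using fin assms(2) by (metis bij_betw_iff_card card_lessThan finite_lessThan)
  have "card ({..<p + q} - S) = q"
    using assms fin by (simp add: card_Diff_subset)
  then obtain g where g: "bij_betw g {p..<p + q} ({..<p + q} - S)"
    by (metis bij_betw_iff_card card_atLeastLessThan diff_add_inverse finite_Diff finite_atLeastLessThan finite_lessThan)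
  define \<pi> where "\<pi> = (\<lambda>i. if i < p then f i else if i < p + q then g i else i)"
  have "bij_betw \<pi> ({..<p} \<union> {p..<p + q}) (S \<union> ({..<p + q} - S))"
  proof (rule bij_betw_combine)
    show "bij_betw \<pi> {..<p} S"
      using f by (rule bij_betw_cong[THEN iffD1, rotated]) (auto simp: \<pi>_def)
    show "bij_betw \<pi> {p..<p + q} ({..<p + q} - S)"
      using g by (rule bij_betw_cong[THEN iffD1, rotated]) (auto simp: \<pi>_def)
  qed auto
  moreover have "{..<p} \<union> {p..<p + q} = {..<p + q}" "S \<union> ({..<p + q} - S) = {..<p + q}"
    using assms by auto
  ultimately have "\<pi> permutes {..<p + q}"
    by (intro bij_imp_permutes) (auto simp: \<pi>_def)
  moreover have "\<pi> ` {..<p} = S"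
    using f by (auto simp: \<pi>_def bij_betw_def)
  ultimately show ?thesis using that by blast
qed

lemma card_permutations_with_image:
  assumes "S \<subseteq> {..<p + q}" "card S = p"
  shows "card {\<pi>. \<pi> permutes {..<p + q} \<and> \<pi> ` {..<p} = S} = fact p * fact q"
proof -
  let ?fib = "\<lambda>S. {\<pi>. \<pi> permutes {..<p + q} \<and> \<pi> ` {..<p} = S}"
  let ?Sub = "{S. S \<subseteq> {..<p + q} \<and> card S = p}"
  let ?c = "card (?fib {..<p})"
  have fib: "card (?fib S) = ?c" if S: "S \<in> ?Sub" for S
  proof -
    obtain \<pi> where \<pi>: "\<pi> permutes {..<p + q}" "\<pi> ` {..<p} = S"
      using subset_is_permutation_image S by blast
    have "bij_betw (\<lambda>\<rho>. \<pi> \<circ> \<rho>) (?fib {..<p}) (?fib S)"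
    proof (rule bij_betwI[of _ _ _ "\<lambda>\<rho>. inv \<pi> \<circ> \<rho>"], goal_cases)
      case 1
      have "(\<pi> \<circ> \<rho>) ` {..<p} = S" if "\<rho> ` {..<p} = {..<p}" for \<rho>
        using that \<pi>(2) by (metis image_comp)
      then show ?case
        using \<pi> by (intro Pi_I) (auto intro: permutes_compose simp del: o_apply)
    next
      case 2
      have "inv \<pi> ` S = {..<p}"
        using permutes_inverses[OF \<pi>(1)] \<pi>(2) by (auto simp: image_comp)
      then have "(inv \<pi> \<circ> \<rho>) ` {..<p} = {..<p}" if "\<rho> ` {..<p} = S" for \<rho>
        using that by (metis image_comp)
      then show ?case
        using permutes_inv[OF \<pi>(1)] by (intro Pi_I) (auto intro: permutes_compose simp del: o_apply)
    qed (use permutes_inverses[OF \<pi>(1)] in \<open>auto simp: fun_eq_iff\<close>)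
    from bij_betw_same_card[OF this] show ?thesis
      by (rule sym)
  qed
  have "{\<pi>. \<pi> permutes {..<p + q}} = (\<Union>S\<in>?Sub. ?fib S)"
  proof -
    have "\<pi> ` {..<p} \<in> ?Sub" if "\<pi> permutes {..<p + q}" for \<pi>
      using permutes_in_image[OF that] card_image[OF inj_on_subset[OF permutes_inj[OF that] subset_UNIV]]
      by auto
    then show ?thesis by auto
  qed
  then have "card {\<pi>. \<pi> permutes {..<p + q}} = card (\<Union>S\<in>?Sub. ?fib S)"
    by (rule arg_cong)
  also have "\<dots> = (\<Sum>S\<in>?Sub. card (?fib S))"
    by (rule card_UN_disjoint) (auto intro: finite_subset[OF _ finite_permutations[OF finite_lessThan[of "p + q"]]])
  also have "\<dots> = (\<Sum>S\<in>?Sub. ?c)"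
    by (rule sum.cong[OF refl fib])
  also have "\<dots> = ((p + q) choose p) * ?c"
    by (simp add: n_subsets)
  finally have "fact (p + q) = ((p + q) choose p) * ?c"
    by (simp add: card_permutations)
  moreover have "fact p * fact q * ((p + q) choose p) = (fact (p + q) :: nat)"
    using binomial_fact_lemma[OF le_add1[of p q]] by (simp only: diff_add_inverse)
  ultimately have "?c * ((p + q) choose p) = (fact p * fact q) * ((p + q) choose p)"
    by (simp add: ac_simps)
  then have "?c = fact p * fact q"
    by (rule mult_right_cancel[THEN iffD1, rotated]) simp
  with fib[of S] assms show ?thesis
    by (simp only: mem_Collect_eq simp_thms)
qed

text \<open>
  Grouping the permutations by the image of the first \<open>p\<close> positions turns the average over all
  permutations into a sum over \<open>p\<close>-element subsets: every group has \<open>p! q!\<close> equal summands, which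
  is the factor that the definition of the wedge product divides by.
\<close>

lemma wedge_shuffle:
  assumes \<alpha>: "antisymmetric_form p \<alpha>" "local_form p \<alpha>"
    and \<beta>: "antisymmetric_form q \<beta>" "local_form q \<beta>"
    and rep: "\<And>S. S \<subseteq> {..<p + q} \<Longrightarrow> card S = p \<Longrightarrow> rep S permutes {..<p + q} \<and> rep S ` {..<p} = S"
  shows "wedge p q \<alpha> \<beta> v = (\<Sum>S | S \<subseteq> {..<p + q} \<and> card S = p. wedge_summand p \<alpha> \<beta> v (rep S))"
proof -
  let ?fib = "\<lambda>S. {\<pi>. \<pi> permutes {..<p + q} \<and> \<pi> ` {..<p} = S}"
  let ?Sub = "{S. S \<subseteq> {..<p + q} \<and> card S = p}"
  let ?P = "{\<pi>. \<pi> permutes {..<p + q}}"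
  have im: "(\<lambda>\<pi>. \<pi> ` {..<p}) ` ?P \<subseteq> ?Sub"
  proof (rule image_subsetI)
    fix \<pi> assume "\<pi> \<in> ?P"
    then have \<pi>: "\<pi> permutes {..<p + q}" by simp
    show "\<pi> ` {..<p} \<in> ?Sub"
      using permutes_in_image[OF \<pi>] card_image[OF inj_on_subset[OF permutes_inj[OF \<pi>] subset_UNIV]]
      by auto
  qed
  have "(\<Sum>\<pi>\<in>?P. wedge_summand p \<alpha> \<beta> v \<pi>)
      = (\<Sum>S\<in>?Sub. \<Sum>\<pi> | \<pi> \<in> ?P \<and> \<pi> ` {..<p} = S. wedge_summand p \<alpha> \<beta> v \<pi>)"
    by (rule sum.group[symmetric]) (use im in \<open>auto simp: finite_permutations\<close>)
  also have "\<dots> = (\<Sum>S\<in>?Sub. of_nat (fact p * fact q) * wedge_summand p \<alpha> \<beta> v (rep S))"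
  proof (rule sum.cong[OF refl])
    fix S assume S: "S \<in> ?Sub"
    have "(\<Sum>\<pi> | \<pi> \<in> ?P \<and> \<pi> ` {..<p} = S. wedge_summand p \<alpha> \<beta> v \<pi>)
        = (\<Sum>\<pi> | \<pi> \<in> ?P \<and> \<pi> ` {..<p} = S. wedge_summand p \<alpha> \<beta> v (rep S))"
      by (intro sum.cong[OF refl] wedge_summand_invariant[OF \<alpha> \<beta>]) (use rep S in auto)
    also have "\<dots> = of_nat (fact p * fact q) * wedge_summand p \<alpha> \<beta> v (rep S)"
      using card_permutations_with_image[of S p q] S by simp
    finally show "(\<Sum>\<pi> | \<pi> \<in> ?P \<and> \<pi> ` {..<p} = S. wedge_summand p \<alpha> \<beta> v \<pi>)
        = of_nat (fact p * fact q) * wedge_summand p \<alpha> \<beta> v (rep S)" .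
  qed
  finally show ?thesis
    unfolding wedge_def by (simp add: sum_distrib_left[symmetric])
qed

text \<open>
  For concrete \<open>p\<close> and \<open>q\<close> the representatives are given as an explicit list.  The binary number with
  digits at the positions \<open>\<pi> 0, \<dots>, \<pi> (p - 1)\<close> encodes the image of the first \<open>p\<close> positions, so
  distinctness of the images becomes distinctness of numbers, which the simplifier decides.
\<close>

lemma wedge_shuffle_list:
  assumes \<alpha>: "antisymmetric_form p \<alpha>" "local_form p \<alpha>"
    and \<beta>: "antisymmetric_form q \<beta>" "local_form q \<beta>"
    and L: "\<And>\<pi>. \<pi> \<in> set L \<Longrightarrow> \<pi> permutes {..<p + q}"
    and code: "distinct (map (\<lambda>\<pi>. \<Sum>i<p. 2 ^ \<pi> i :: nat) L)" and len: "length L = (p + q) choose p"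
  shows "wedge p q \<alpha> \<beta> v = (\<Sum>\<pi>\<leftarrow>L. wedge_summand p \<alpha> \<beta> v \<pi>)"
proof -
  let ?Sub = "{S. S \<subseteq> {..<p + q} \<and> card S = p}"
  let ?im = "\<lambda>\<pi> :: nat \<Rightarrow> nat. \<pi> ` {..<p}"
  have inj: "inj \<pi>" if "\<pi> \<in> set L" for \<pi>
    using L[OF that] by (rule permutes_inj)
  have code_im: "(\<Sum>i<p. 2 ^ \<pi> i) = (\<Sum>k\<in>?im \<pi>. 2 ^ k :: nat)" if "\<pi> \<in> set L" for \<pi>
    using inj[OF that] by (subst sum.reindex) (auto simp: inj_on_def inj_def)
  have inj_im: "inj_on ?im (set L)"
  proof (rule inj_onI)
    fix \<pi> \<pi>' assume *: "\<pi> \<in> set L" "\<pi>' \<in> set L" "?im \<pi> = ?im \<pi>'"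
    then have "(\<Sum>i<p. 2 ^ \<pi> i :: nat) = (\<Sum>i<p. 2 ^ \<pi>' i)"
      by (simp only: code_im)
    with code * show "\<pi> = \<pi>'"
      by (auto simp: distinct_map dest: inj_onD)
  qed
  have sub: "?im ` set L \<subseteq> ?Sub"
  proof (rule image_subsetI)
    fix \<pi> assume \<pi>: "\<pi> \<in> set L"
    show "?im \<pi> \<in> ?Sub"
      using permutes_in_image[OF L[OF \<pi>]] card_image[OF inj_on_subset[OF inj[OF \<pi>] subset_UNIV]] by auto
  qed
  have "card (?im ` set L) = card ?Sub"
    using card_image[OF inj_im] distinct_card[of L] code len by (simp add: distinct_map n_subsets)
  then have im: "?im ` set L = ?Sub"
    using sub by (intro card_subset_eq) auto
  define rep where "rep = inv_into (set L) ?im"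
  have rep: "rep S permutes {..<p + q} \<and> rep S ` {..<p} = S" if "S \<subseteq> {..<p + q}" "card S = p" for S
  proof -
    have "S \<in> ?im ` set L" using im that by blast
    then show ?thesis
      using L inv_into_into[of S ?im "set L"] f_inv_into_f[of S ?im "set L"] by (simp add: rep_def)
  qed
  have "wedge p q \<alpha> \<beta> v = (\<Sum>S\<in>?im ` set L. wedge_summand p \<alpha> \<beta> v (rep S))"
    unfolding im by (rule wedge_shuffle[OF \<alpha> \<beta> rep])
  also have "\<dots> = (\<Sum>\<pi>\<in>set L. wedge_summand p \<alpha> \<beta> v \<pi>)"
    by (subst sum.reindex[OF inj_im]) (auto simp: rep_def inv_into_f_f[OF inj_im] intro!: sum.cong)
  also have "\<dots> = (\<Sum>\<pi>\<leftarrow>L. wedge_summand p \<alpha> \<beta> v \<pi>)"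
    using code by (simp add: sum_list_distinct_conv_sum_set distinct_map)
  finally show ?thesis .
qed

lemma antisymmetric_formI:
  assumes "\<And>a b v. a < b \<Longrightarrow> b < k \<Longrightarrow> F (\<lambda>i. v (Transposition.transpose a b i)) = - F v"
  shows "antisymmetric_form k F"
proof (unfold antisymmetric_form_def, intro allI impI)
  have sym: "F (\<lambda>i. v (Transposition.transpose a b i)) = - F v" if "a < k" "b < k" "a \<noteq> b" for a b v
    using assms[of a b v] assms[of b a v] that by (cases "a < b") (auto simp: transpose_commute)
  fix \<tau> :: "nat \<Rightarrow> nat" and v :: "nat \<Rightarrow> 'a"
  assume "\<tau> permutes {..<k}"
  from finite_lessThan[of k] this show "F (\<lambda>i. v (\<tau> i)) = of_int (sign \<tau>) * F v"
  proof (induction arbitrary: v rule: permutes_rev_induct)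
    case (swap a b p)
    show ?case
    proof (cases "a = b")
      case False
      have "F (\<lambda>i. v ((p \<circ> Transposition.transpose a b) i)) = - F (\<lambda>i. v (p i))"
        using sym[of a b "\<lambda>i. v (p i)"] swap False by simp
      also have "F (\<lambda>i. v (p i)) = of_int (sign p) * F v"
        by (rule swap.IH)
      finally have "F (\<lambda>i. v ((p \<circ> Transposition.transpose a b) i)) = - of_int (sign p) * F v"
        by simp
      moreover have "sign (p \<circ> Transposition.transpose a b) = - sign p"
        using False swap by (subst sign_mult_permutes[OF finite_lessThan[of k]])
          (auto simp: sign_swap_id permutes_swap_id)
      ultimately show ?thesis by (simp only: of_int_minus)
    qed (use swap in simp)
  qed simp
qed

lemma antisymmetric_form_transpose:
  assumes "antisymmetric_form k F" "a < k" "b < k" "a \<noteq> b"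
  shows "F (\<lambda>i. v (Transposition.transpose a b i)) = - F v"
proof -
  have "Transposition.transpose a b permutes {..<k}"
    using assms by (simp add: permutes_swap_id)
  from assms(1)[unfolded antisymmetric_form_def, rule_format, OF this] show ?thesis
    using assms(4) by (simp add: sign_swap_id)
qed

lemma antisymmetric_form_eq_0:
  assumes "antisymmetric_form k F" "a < k" "b < k" "a \<noteq> b" "v a = v b"
  shows "F v = 0"
proof -
  have "(\<lambda>i. v (Transposition.transpose a b i)) = v"
    using assms(5) by (auto simp: fun_eq_iff Transposition.transpose_def)
  then show ?thesis
    using antisymmetric_form_transpose[OF assms(1-4), of v] by (simp add: eq_neg_iff_add_eq_0)
qed

lemma local_wedge_power: "local_form 2 \<alpha> \<Longrightarrow> local_form (2 * m) (wedge_power m \<alpha>)"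
proof (induction m)
  case (Suc m)
  then show ?case
    using local_wedge[of "2 * m" "wedge_power m \<alpha>" 2 \<alpha>] by (simp add: algebra_simps)
qed (simp add: local_form_def)

lemma antisymmetric_wedge_power: "antisymmetric_form (2 * m) (wedge_power m \<alpha>)"
proof (cases m)
  case (Suc n)
  then show ?thesis
    using antisymmetric_wedge[of "2 * n" 2 "wedge_power n \<alpha>" \<alpha>] by (simp add: algebra_simps)
qed (simp add: antisymmetric_form_def)

lemma multilinear_wedge_power:
  fixes \<alpha> :: "('v::real_vector, 'k::real_normed_field) form"
  assumes "multilinear_form 2 \<alpha>" "local_form 2 \<alpha>"
  shows "multilinear_form (2 * m) (wedge_power m \<alpha>)"
proof (induction m)
  case (Suc m)
  then show ?case
    using multilinear_wedge[OF Suc assms(1) local_wedge_power[OF assms(2)]] by (simp add: algebra_simps)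
qed (simp add: multilinear_form_def)

section \<open>Liouville forms and determinants\<close>

text \<open>The Gram matrix of a Darboux basis \<open>e\<^sub>0, f\<^sub>0, e\<^sub>1, f\<^sub>1, \<dots>\<close>, listed in this interleaved order.\<close>

definition symplectic_unit :: "nat \<Rightarrow> nat \<Rightarrow> 'k::field_char_0"
  where "symplectic_unit i j = (if even i \<and> j = Suc i then 1 else if even j \<and> i = Suc j then - 1 else 0)"

text \<open>
  In the shuffle expansion of \<open>\<alpha>\<^sup>m \<and> \<alpha>\<close> on a Darboux basis only those splittings survive that give
  one of the \<open>m + 1\<close> Darboux pairs to the last factor.  The corresponding representative exchanges
  this pair with the last one; it is even and preserves the Gram matrix, so the summand is the value
  \<open>m!\<close> of the previous power.
\<close>

lemma wedge_power_symplectic_basis: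
  fixes A :: "'v \<Rightarrow> 'v \<Rightarrow> 'k::field_char_0"
  assumes anti: "\<And>x y. A x y = - A y x"
    and "\<And>i j. i < 2 * m \<Longrightarrow> j < 2 * m \<Longrightarrow> A (v i) (v j) = symplectic_unit i j"
  shows "wedge_power m (\<lambda>w. A (w 0) (w 1)) v = fact m"
  using assms(2)
proof (induction m arbitrary: v)
  case (Suc m)
  let ?\<alpha> = "\<lambda>w. A (w 0) (w 1)"
  let ?n = "2 * m + 2"
  have \<alpha>: "antisymmetric_form 2 ?\<alpha>"
  proof (rule antisymmetric_formI)
    fix a b :: nat and v :: "nat \<Rightarrow> 'v" assume "a < b" "b < 2"
    then have "a = 0" "b = 1" by auto
    then show "A (v (Transposition.transpose a b 0)) (v (Transposition.transpose a b 1)) = - A (v 0) (v 1)"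
      by (simp add: anti[of "v (Suc 0)" "v 0"])
  qed
  have \<alpha>': "local_form 2 ?\<alpha>"
    by (auto simp: local_form_def)
  define \<tau> :: "nat \<Rightarrow> nat \<Rightarrow> nat" where "\<tau> j = Transposition.transpose (2 * j) (2 * m) \<circ>
    Transposition.transpose (2 * j + 1) (2 * m + 1)" for j
  define C where "C j = {..<?n} - {2 * j, 2 * j + 1}" for j
  define J where "J S = (SOME j. j \<le> m \<and> S = C j)" for S
  define rep where "rep S = (if \<exists>j\<le>m. S = C j then \<tau> (J S)
    else SOME \<pi>. \<pi> permutes {..<?n} \<and> \<pi> ` {..<2 * m} = S)" for S
  have \<tau>_perm: "\<tau> j permutes {..<?n}" if "j \<le> m" for j
    unfolding \<tau>_def using that by (intro permutes_compose permutes_swap_id) auto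
  have parity: "2 * a \<noteq> Suc (2 * b)" "Suc (2 * b) \<noteq> 2 * a" for a b :: nat
    by presburger+
  have \<tau>_last: "\<tau> j (2 * m) = 2 * j" "\<tau> j (2 * m + 1) = 2 * j + 1" if "j \<le> m" for j
    unfolding \<tau>_def using that by (simp_all add: Transposition.transpose_def parity)
  have \<tau>_image: "\<tau> j ` {..<2 * m} = C j" if "j \<le> m" for j
  proof -
    have "{..<2 * m} = {..<?n} - {2 * m, 2 * m + 1}" by auto
    then have "\<tau> j ` {..<2 * m} = \<tau> j ` {..<?n} - \<tau> j ` {2 * m, 2 * m + 1}"
      using image_set_diff[OF permutes_inj[OF \<tau>_perm[OF that]]] by metis
    then show ?thesis
      using permutes_image[OF \<tau>_perm[OF that]] \<tau>_last[OF that] by (simp add: C_def)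
  qed
  have C_inj: "j = j'" if "C j = C j'" "j \<le> m" "j' \<le> m" for j j'
  proof -
    have "2 * j \<notin> C j'" unfolding that(1)[symmetric] by (simp add: C_def)
    then show ?thesis using that(2) by (auto simp: C_def)
  qed
  have J: "J (C j) = j" if "j \<le> m" for j
    unfolding J_def by (rule some_equality) (use that C_inj in auto)
  have rep: "rep S permutes {..<?n} \<and> rep S ` {..<2 * m} = S"
    if "S \<subseteq> {..<?n}" "card S = 2 * m" for S
  proof (cases "\<exists>j\<le>m. S = C j")
    case True
    then obtain j where j: "j \<le> m" "S = C j" by blast
    then have "rep S = \<tau> j" using True J by (simp add: rep_def)
    with j \<tau>_perm \<tau>_image show ?thesis by simp
  next
    case False
    have "\<exists>\<pi>. \<pi> permutes {..<?n} \<and> \<pi> ` {..<2 * m} = S"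
      using subset_is_permutation_image[OF that] by blast
    from someI_ex[OF this] show ?thesis unfolding rep_def if_not_P[OF False] .
  qed
  let ?T = "wedge_summand (2 * m) (wedge_power m ?\<alpha>) ?\<alpha> v"
  let ?Sub = "{S. S \<subseteq> {..<?n} \<and> card S = 2 * m}"
  have C_sub: "C ` {..m} \<subseteq> ?Sub"
  proof (rule image_subsetI)
    fix j assume "j \<in> {..m}"
    then have "card (C j) = 2 * m"
      using card_Diff_subset[of "{2 * j, 2 * j + 1}" "{..<?n}"] by (simp add: C_def)
    then show "C j \<in> ?Sub" by (auto simp: C_def)
  qed
  have zero: "?T (rep S) = 0" if S: "S \<in> ?Sub - C ` {..m}" for S
  proof -
    let ?\<pi> = "rep S"
    have \<pi>: "?\<pi> permutes {..<?n}" "?\<pi> ` {..<2 * m} = S" using rep S by auto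
    have "{..<?n} - S = ?\<pi> ` ({..<?n} - {..<2 * m})"
      unfolding image_set_diff[OF permutes_inj[OF \<pi>(1)]] permutes_image[OF \<pi>(1)] \<pi>(2) ..
    also have "{..<?n} - {..<2 * m} = {2 * m, 2 * m + 1}" by auto
    finally have compl: "{..<?n} - S = {?\<pi> (2 * m), ?\<pi> (2 * m + 1)}" by simp
    have lt: "?\<pi> (2 * m) < ?n" "?\<pi> (2 * m + 1) < ?n"
      using permutes_in_image[OF \<pi>(1)] by auto
    have "symplectic_unit (?\<pi> (2 * m)) (?\<pi> (2 * m + 1)) = (0 :: 'k)"
    proof (rule ccontr)
      assume "symplectic_unit (?\<pi> (2 * m)) (?\<pi> (2 * m + 1)) \<noteq> (0 :: 'k)"
      then obtain j where j: "{?\<pi> (2 * m), ?\<pi> (2 * m + 1)} = {2 * j, 2 * j + 1}"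
        unfolding symplectic_unit_def by (auto simp: insert_commute split: if_splits elim!: evenE)
      then have "2 * j + 1 < ?n" using lt by (metis insertCI insertE singletonD)
      then have "j \<le> m" by simp
      moreover have "S = {..<?n} - ({..<?n} - S)" using S by auto
      then have "S = C j" unfolding compl j C_def .
      ultimately show False using S by auto
    qed
    then have "A (v (?\<pi> (2 * m))) (v (?\<pi> (2 * m + 1))) = 0"
      using Suc.prems lt by simp
    then show ?thesis by simp
  qed
  have one: "?T (rep (C j)) = fact m" if j: "j \<le> m" for j
  proof -
    have rep_j: "rep (C j) = \<tau> j"
      using j J by (auto simp: rep_def)
    have sgn: "sign (\<tau> j) = 1"
    proof (cases "j = m")
      case False
      have "sign (\<tau> j) = sign (Transposition.transpose (2 * j) (2 * m)) *
          sign (Transposition.transpose (2 * j + 1) (2 * m + 1))"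
        unfolding \<tau>_def by (rule sign_compose) (auto simp: permutation_swap_id)
      with False show ?thesis by (simp add: sign_swap_id)
    qed (simp add: \<tau>_def)
    have unit: "symplectic_unit (\<tau> j i) (\<tau> j k) = (symplectic_unit i k :: 'k)" if "i < ?n" "k < ?n" for i k
    proof -
      have *: "\<tau> j i = (if i = 2 * j then 2 * m else if i = 2 * j + 1 then 2 * m + 1 else
        if i = 2 * m then 2 * j else if i = 2 * m + 1 then 2 * j + 1 else i)" for i
        unfolding \<tau>_def by (auto simp: Transposition.transpose_def parity)
      have even_\<tau>: "even (\<tau> j i) = even i" for i
        unfolding * by auto
      have Suc_\<tau>: "\<tau> j (Suc i) = Suc (\<tau> j i)" if "even i" for i
        unfolding * using that by (auto simp: parity)
      have inj: "\<tau> j i = \<tau> j k \<longleftrightarrow> i = k" for i k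
        using permutes_inj[OF \<tau>_perm[OF j]] by (auto dest: injD)
      have "(even i \<and> \<tau> j k = Suc (\<tau> j i)) = (even i \<and> k = Suc i)" for i k
        using Suc_\<tau>[of i] inj[of k "Suc i"] by auto
      then show ?thesis
        unfolding symplectic_unit_def even_\<tau> by (simp only:)
    qed
    have "wedge_power m ?\<alpha> (\<lambda>i. v (\<tau> j i)) = fact m"
    proof (rule Suc.IH)
      fix i k assume ik: "i < 2 * m" "k < 2 * m"
      then have "\<tau> j i < ?n" "\<tau> j k < ?n"
        using permutes_in_image[OF \<tau>_perm[OF j]] by auto
      then show "A (v (\<tau> j i)) (v (\<tau> j k)) = symplectic_unit i k"
        using Suc.prems unit[of i k] ik by simp
    qed
    moreover have "A (v (\<tau> j (2 * m))) (v (\<tau> j (2 * m + 1))) = 1"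
      using \<tau>_last[OF j] Suc.prems j by (simp add: symplectic_unit_def)
    ultimately show ?thesis
      unfolding rep_j sgn by simp
  qed
  have "wedge (2 * m) 2 (wedge_power m ?\<alpha>) ?\<alpha> v = (\<Sum>S\<in>?Sub. ?T (rep S))"
    by (rule wedge_shuffle[OF antisymmetric_wedge_power local_wedge_power[OF \<alpha>'] \<alpha> \<alpha>' rep])
  also have "\<dots> = (\<Sum>S\<in>C ` {..m}. ?T (rep S))"
    by (rule sum.mono_neutral_right[OF _ C_sub]) (use zero in auto)
  also have "\<dots> = (\<Sum>j\<le>m. ?T (rep (C j)))"
    by (rule sum.reindex_cong[of C]) (auto simp: inj_on_def dest: C_inj)
  also have "\<dots> = (\<Sum>j\<le>m. fact m)"
    by (rule sum.cong) (use one in auto)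
  finally show ?case by simp
qed simp

text \<open>
  Both sides change in the same way when \<open>X\<close> is multiplied on the left by an elementary matrix, and
  every square matrix is a product of elementary ones.  The enumeration \<open>ix\<close> of the index type and the
  linear map \<open>L\<close> allow the lemma to be used for forms on any space that is parametrised by \<open>\<real>\<^sup>n\<close>.
\<close>

lemma top_form_det:
  fixes F :: "('v::real_vector, 'k::real_normed_field) form" and X :: "real ^ 'n ^ 'n::finite"
  assumes F: "antisymmetric_form n F" "local_form n F" "multilinear_form n F"
    and ix: "bij_betw ix {..<n} (UNIV :: 'n set)" and L: "linear L"
  shows "F (\<lambda>i. L (X $ ix i)) = of_real (det X) * F (\<lambda>i. L (axis (ix i) 1))"
proof -
  define G where "G X = F (\<lambda>i. L (X $ ix i))" for X :: "real ^ 'n ^ 'n"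
  have inj: "ix i = ix j \<longleftrightarrow> i = j" if "i < n" "j < n" for i j
    using ix that by (auto simp: bij_betw_def inj_on_def)
  have surj: "\<exists>i<n. ix i = k" for k
    using ix by (metis bij_betw_iff_bijections UNIV_I lessThan_iff)
  have cong: "F v = F w" if "\<And>i. i < n \<Longrightarrow> v i = w i" for v w
    using F(2) that by (auto simp: local_form_def)
  have lin: "linear (\<lambda>x. F (v(i := L x)))" if "i < n" for v i
    using linear_compose[OF L, of "\<lambda>x. F (v(i := x))"] F(3) that by (simp add: multilinear_form_def o_def)
  have upd: "G (\<chi> k. if k = ix i then x else Y $ k) = F ((\<lambda>j. L (Y $ ix j))(i := L x))" if "i < n" for Y x i
    unfolding G_def by (rule cong) (use that inj in auto)
  have G_scale: "G (\<chi> k. if k = l then c *\<^sub>R (Y $ l) else Y $ k) = c *\<^sub>R G Y" for l c Y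
  proof -
    obtain i where i: "i < n" "ix i = l" using surj by blast
    have "G (\<chi> k. if k = l then c *\<^sub>R (Y $ l) else Y $ k) = c *\<^sub>R F ((\<lambda>j. L (Y $ ix j))(i := L (Y $ l)))"
      using upd[OF i(1), of "c *\<^sub>R (Y $ l)" Y] linear_scale[OF lin[OF i(1)]] i(2) by simp
    also have "(\<lambda>j. L (Y $ ix j))(i := L (Y $ l)) = (\<lambda>j. L (Y $ ix j))"
      using i by auto
    finally show ?thesis by (simp add: G_def)
  qed
  have G_eq: "G Y = 0" if "l \<noteq> l'" "Y $ l = Y $ l'" for l l' Y
  proof -
    obtain i i' where "i < n" "ix i = l" "i' < n" "ix i' = l'" using surj by metis
    then show ?thesis
      unfolding G_def using that by (intro antisymmetric_form_eq_0[OF F(1), of i i']) auto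
  qed
  have main: "G (X ** Y) = of_real (det X) * G Y" for Y
  proof (induction X arbitrary: Y rule: induct_matrix_elementary[case_names mult zero_row diagonal swap1 idplus])
    case (mult A B)
    then show ?case
      by (simp add: matrix_mul_assoc[symmetric] det_mul)
  next
    case (zero_row A l)
    have "(A ** Y) $ l = 0"
      using zero_row by (simp add: vec_eq_iff matrix_matrix_mult_def row_def)
    then have "(\<chi> k. if k = l then 0 *\<^sub>R ((A ** Y) $ l) else (A ** Y) $ k) = A ** Y"
      by (simp add: vec_eq_iff)
    then have "G (A ** Y) = 0"
      using G_scale[of l 0 "A ** Y"] by simp
    then show ?case
      using zero_row by (simp add: det_zero_row(2))
  next
    case (diagonal A)
    have row: "(A ** Y) $ k = (A $ k $ k) *\<^sub>R (Y $ k)" for k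
    proof -
      have "(\<Sum>j\<in>UNIV. A $ k $ j * Y $ j $ i) = A $ k $ k * Y $ k $ i" for i
        by (subst sum.remove[of _ k]) (auto intro!: sum.neutral simp: diagonal)
      then show ?thesis by (simp add: vec_eq_iff matrix_matrix_mult_def)
    qed
    have "G (\<chi> k. if k \<in> K then (A $ k $ k) *\<^sub>R (Y $ k) else Y $ k) = of_real (\<Prod>k\<in>K. A $ k $ k) * G Y"
      if "finite K" for K
      using that
    proof (induction K)
      case (insert l K)
      let ?Z = "\<chi> k. if k \<in> K then (A $ k $ k) *\<^sub>R (Y $ k) else Y $ k"
      have "(\<chi> k. if k \<in> insert l K then (A $ k $ k) *\<^sub>R (Y $ k) else Y $ k) =
          (\<chi> k. if k = l then (A $ l $ l) *\<^sub>R (?Z $ l) else ?Z $ k)"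
        using insert.hyps by (auto simp: vec_eq_iff)
      then show ?case
        using insert G_scale[of l "A $ l $ l" ?Z] by (simp add: scaleR_conv_of_real)
    qed (simp add: vec_lambda_eta)
    from this[of UNIV] have "G (\<chi> k. (A $ k $ k) *\<^sub>R (Y $ k)) = of_real (\<Prod>k\<in>UNIV. A $ k $ k) * G Y"
      by simp
    moreover have "(\<chi> k. (A $ k $ k) *\<^sub>R (Y $ k)) = A ** Y"
      using row by (simp add: vec_eq_iff)
    ultimately show ?case
      using diagonal by (simp add: det_diagonal)
  next
    case (swap1 l l')
    let ?A = "\<chi> i j. mat 1 $ i $ Transposition.transpose l l' j :: real ^ 'n ^ 'n"
    have row: "(?A ** Y) $ k = Y $ Transposition.transpose l l' k" for k
    proof -
      have "(\<Sum>j\<in>UNIV. mat 1 $ k $ Transposition.transpose l l' j * Y $ j $ i)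
          = Y $ Transposition.transpose l l' k $ i" for i
        by (subst sum.remove[of _ "Transposition.transpose l l' k"])
          (auto intro!: sum.neutral simp: mat_def Transposition.transpose_def split: if_splits)
      then show ?thesis by (simp add: vec_eq_iff matrix_matrix_mult_def)
    qed
    obtain a b where ab: "a < n" "ix a = l" "b < n" "ix b = l'" using surj by metis
    with swap1 have "a \<noteq> b" by auto
    have "ix (Transposition.transpose a b i) = Transposition.transpose l l' (ix i)" if "i < n" for i
      using ab inj[OF that] by (auto simp: Transposition.transpose_def)
    then have "G (?A ** Y) = F (\<lambda>i. (\<lambda>i. L (Y $ ix i)) (Transposition.transpose a b i))"
      unfolding G_def row by (intro cong) simp
    also have "\<dots> = - G Y"
      using antisymmetric_form_transpose[OF F(1) ab(1,3) \<open>a \<noteq> b\<close>] by (simp add: G_def)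
    moreover have "det ?A = - 1"
    proof -
      have p: "Transposition.transpose l l' permutes (UNIV :: 'n set)" by (simp add: permutes_swap_id)
      show ?thesis
        using det_permute_columns[OF p, of "mat 1 :: real ^ 'n ^ 'n"] swap1
        by (simp add: sign_swap_id)
    qed
    ultimately show ?case by simp
  next
    case (idplus l l' c)
    let ?A = "\<chi> i j. if i = l \<and> j = l' then c else of_bool (i = j) :: real ^ 'n ^ 'n"
    have "?A ** Y = (\<chi> k. if k = l then Y $ l + c *\<^sub>R (Y $ l') else Y $ k)"
      using idplus unfolding matrix_matrix_mult_def of_bool_def
      by (auto simp: vec_eq_iff if_distrib [of "\<lambda>x. x * y" for y] sum.remove cong: if_cong)
    moreover obtain i where i: "i < n" "ix i = l" using surj by blast
    then have "G (\<chi> k. if k = l then Y $ l + c *\<^sub>R (Y $ l') else Y $ k) =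
        G (\<chi> k. if k = l then Y $ l else Y $ k) + c *\<^sub>R G (\<chi> k. if k = l then Y $ l' else Y $ k)"
      using upd[OF i(1), of _ Y] linear_add[OF lin[OF i(1)]] linear_scale[OF lin[OF i(1)]] by simp
    moreover have "(\<chi> k. if k = l then Y $ l else Y $ k) = Y"
      by (simp add: vec_eq_iff)
    moreover have "G (\<chi> k. if k = l then Y $ l' else Y $ k) = 0"
      using idplus by (intro G_eq[of l l']) auto
    moreover have "det ?A = 1"
    proof -
      have "?A = (\<chi> k. if k = l then row l (mat 1) + c *s row l' (mat 1) else row k (mat 1))"
        using idplus by (auto simp: vec_eq_iff row_def mat_def)
      then show ?thesis
        using det_row_operation[OF idplus, of "mat 1 :: real ^ 'n ^ 'n" c] by simp
    qed
    ultimately show ?case by simp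
  qed
  have "G (X ** mat 1) = of_real (det X) * G (mat 1)" by (rule main)
  moreover have "G (mat 1) = F (\<lambda>i. L (axis (ix i) 1))"
    unfolding G_def by (intro cong arg_cong[of _ _ L]) (auto simp: vec_eq_iff mat_def axis_def)
  ultimately show ?thesis by (simp add: G_def)
qed

section \<open>Coordinates for vectors and trilinear maps\<close>

lemma bij_of_nat_bit0: "bij_betw (of_nat :: nat \<Rightarrow> 'a::finite bit0) {..<CARD('a bit0)} UNIV"
proof -
  have "x \<in> of_nat ` {..<CARD('a bit0)}" for x :: "'a bit0"
  proof (cases x)
    case (of_int z)
    then show ?thesis
      by (intro image_eqI[of _ _ "nat z"]) auto
  qed
  then have im: "of_nat ` {..<CARD('a bit0)} = (UNIV :: 'a bit0 set)" by blast
  moreover have "inj_on (of_nat :: nat \<Rightarrow> 'a bit0) {..<CARD('a bit0)}"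
    by (rule eq_card_imp_inj_on) (simp_all only: im finite_lessThan card_lessThan)
  ultimately show ?thesis by (simp add: bij_betw_def)
qed

lemma bij_of_nat_bit1: "bij_betw (of_nat :: nat \<Rightarrow> 'a::finite bit1) {..<CARD('a bit1)} UNIV"
proof -
  have "x \<in> of_nat ` {..<CARD('a bit1)}" for x :: "'a bit1"
  proof (cases x)
    case (of_int z)
    then show ?thesis
      by (intro image_eqI[of _ _ "nat z"]) auto
  qed
  then have im: "of_nat ` {..<CARD('a bit1)} = (UNIV :: 'a bit1 set)" by blast
  moreover have "inj_on (of_nat :: nat \<Rightarrow> 'a bit1) {..<CARD('a bit1)}"
    by (rule eq_card_imp_inj_on) (simp_all only: im finite_lessThan card_lessThan)
  ultimately show ?thesis by (simp add: bij_betw_def)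
qed

lemma bij_of_nat_6: "bij_betw (of_nat :: nat \<Rightarrow> 6) {..<6} UNIV"
  using bij_of_nat_bit0[where 'a = 3] by simp
lemma bij_of_nat_28: "bij_betw (of_nat :: nat \<Rightarrow> 28) {..<28} UNIV"
  using bij_of_nat_bit0[where 'a = 14] by simp
lemma bij_of_nat_27: "bij_betw (of_nat :: nat \<Rightarrow> 27) {..<27} UNIV"
  using bij_of_nat_bit1[where 'a = 13] by simp

lemma UNIV_6: "UNIV = {1, 2, 3, 4, 5, 6 :: 6}"
proof -
  have "of_nat ` {..<6} = (UNIV :: 6 set)"
    using bij_of_nat_6 by (simp add: bij_betw_def)
  moreover have "{..<6} = {0, 1, 2, 3, 4, 5 :: nat}" by auto
  ultimately have "(UNIV :: 6 set) = of_nat ` {0, 1, 2, 3, 4, 5 :: nat}" by metis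
  also have "\<dots> = {0, 1, 2, 3, 4, 5 :: 6}"
    by (simp only: image_insert image_empty of_nat_0 of_nat_1 of_nat_numeral)
  also have "(0 :: 6) = 6" by simp
  also have "{6, 1, 2, 3, 4, 5 :: 6} = {1, 2, 3, 4, 5, 6}" by blast
  finally show ?thesis .
qed

lemma sum_6: "(\<Sum>i\<in>UNIV. f (i :: 6)) = f 1 + f 2 + f 3 + f 4 + f 5 + f 6"
  by (subst UNIV_6) (simp add: add.assoc)

lemma forall_6: "(\<forall>i :: 6. P i) \<longleftrightarrow> P 1 \<and> P 2 \<and> P 3 \<and> P 4 \<and> P 5 \<and> P 6"
proof -
  have "(\<forall>i :: 6. P i) \<longleftrightarrow> (\<forall>i\<in>UNIV. P i)" by simp
  then show ?thesis unfolding UNIV_6 by simp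
qed

abbreviation unit_vec :: "6 \<Rightarrow> V" ("\<e>") where "\<e> k \<equiv> axis k 1"

lemma V_expansion: "(u :: V) = u $ 1 *\<^sub>R \<e> 1 + u $ 2 *\<^sub>R \<e> 2 + u $ 3 *\<^sub>R \<e> 3
    + u $ 4 *\<^sub>R \<e> 4 + u $ 5 *\<^sub>R \<e> 5 + u $ 6 *\<^sub>R \<e> 6"
  by (simp add: vec_eq_iff forall_6 axis_def)

lemmas tri_linear = tri_def blinfun.add_left blinfun.add_right blinfun.scaleR_left blinfun.scaleR_right
  blinfun.diff_left blinfun.diff_right blinfun.minus_left blinfun.minus_right blinfun.zero_left blinfun.zero_right

lemma tri_add: "tri \<Omega> (x + y) v w = tri \<Omega> x v w + tri \<Omega> y v w"
  "tri \<Omega> v (x + y) w = tri \<Omega> v x w + tri \<Omega> v y w"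
  "tri \<Omega> v w (x + y) = tri \<Omega> v w x + tri \<Omega> v w y"
  "tri (\<Omega> + \<Omega>') u v w = tri \<Omega> u v w + tri \<Omega>' u v w"
  by (simp_all add: tri_linear)

lemma tri_diff: "tri \<Omega> (x - y) v w = tri \<Omega> x v w - tri \<Omega> y v w"
  "tri \<Omega> v (x - y) w = tri \<Omega> v x w - tri \<Omega> v y w"
  "tri \<Omega> v w (x - y) = tri \<Omega> v w x - tri \<Omega> v w y"
  "tri (\<Omega> - \<Omega>') u v w = tri \<Omega> u v w - tri \<Omega>' u v w"
  by (simp_all add: tri_linear)

lemma tri_scaleR: "tri \<Omega> (c *\<^sub>R x) v w = c *\<^sub>R tri \<Omega> x v w"
  "tri \<Omega> v (c *\<^sub>R x) w = c *\<^sub>R tri \<Omega> v x w"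
  "tri \<Omega> v w (c *\<^sub>R x) = c *\<^sub>R tri \<Omega> v w x"
  "tri (c *\<^sub>R \<Omega>) u v w = c *\<^sub>R tri \<Omega> u v w"
  by (simp_all add: tri_linear)

lemma tri_minus: "tri \<Omega> (- x) v w = - tri \<Omega> x v w"
  "tri \<Omega> v (- x) w = - tri \<Omega> v x w"
  "tri \<Omega> v w (- x) = - tri \<Omega> v w x"
  "tri (- \<Omega>) u v w = - tri \<Omega> u v w"
  by (simp_all add: tri_linear)

lemma tri_zero: "tri \<Omega> 0 v w = 0" "tri \<Omega> v 0 w = 0" "tri \<Omega> v w 0 = 0" "tri 0 u v w = 0"
  by (simp_all add: tri_linear)

lemma tri_sum: "tri (\<Sum>i\<in>I. f i) u v w = (\<Sum>i\<in>I. tri (f i) u v w)"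
  by (induction I rule: infinite_finite_induct) (simp_all add: tri_zero tri_add)

lemma tri_eqI: "(\<And>u v w. tri \<Omega> u v w = tri \<Omega>' u v w) \<Longrightarrow> \<Omega> = \<Omega>'"
  unfolding tri_def by (intro blinfun_eqI) auto

lemma bounded_linear_tri: "bounded_linear (\<lambda>\<Omega>. tri \<Omega> u v w)"
  unfolding tri_def by (intro bounded_linear_intros)

lemma linear_tri_args:
  "linear (\<lambda>x. tri \<Omega> x v w)" "linear (\<lambda>x. tri \<Omega> v x w)" "linear (\<lambda>x. tri \<Omega> v w x)"
  by (auto intro!: linearI simp: tri_add tri_scaleR)

lemma norm_tri_le: "norm (tri \<Omega> u v w) \<le> norm \<Omega> * norm u * norm v * norm w"
proof -
  have "norm (tri \<Omega> u v w) \<le> norm (blinfun_apply (blinfun_apply \<Omega> u) v) * norm w"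
    unfolding tri_def by (rule norm_blinfun)
  also have "\<dots> \<le> norm (blinfun_apply \<Omega> u) * norm v * norm w"
    by (intro mult_right_mono norm_blinfun) auto
  also have "\<dots> \<le> norm \<Omega> * norm u * norm v * norm w"
    by (intro mult_right_mono norm_blinfun) auto
  finally show ?thesis .
qed

text \<open>\<open>cube z a b c\<close> is the trilinear form \<open>dx\<^sub>a \<otimes> dx\<^sub>b \<otimes> dx\<^sub>c\<close> with the complex coefficient \<open>z\<close>.\<close>

definition cube :: "complex \<Rightarrow> 6 \<Rightarrow> 6 \<Rightarrow> 6 \<Rightarrow> trilinear"
  where "cube z a b c = Blinfun (\<lambda>u. (u $ a) *\<^sub>R Blinfun (\<lambda>v. (v $ b) *\<^sub>R Blinfun (\<lambda>w. (w $ c) *\<^sub>R z)))"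

lemma bounded_linear_component_scaleR: "bounded_linear (\<lambda>u :: real ^ 'n. (u $ a) *\<^sub>R X)"
  by (intro bounded_linear_scaleR_const bounded_linear_vec_nth)

lemma tri_cube: "tri (cube z a b c) u v w = (u $ a * v $ b * w $ c) *\<^sub>R z"
  unfolding tri_def cube_def
  by (simp add: bounded_linear_Blinfun_apply[OF bounded_linear_component_scaleR] blinfun.scaleR_left)

lemma cube_linear: "cube z a b c = Re z *\<^sub>R cube 1 a b c + Im z *\<^sub>R cube \<i> a b c"
  by (rule tri_eqI) (simp add: tri_cube tri_add tri_scaleR complex_eq_iff)

definition trilinear_of :: "(6 \<Rightarrow> 6 \<Rightarrow> 6 \<Rightarrow> complex) \<Rightarrow> trilinear"
  where "trilinear_of t = (\<Sum>a\<in>UNIV. \<Sum>b\<in>UNIV. \<Sum>c\<in>UNIV. cube (t a b c) a b c)"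

lemma tri_trilinear_of:
  assumes "\<And>v w. linear (\<lambda>x. t x v w)" "\<And>v w. linear (\<lambda>x. t v x w)" "\<And>v w. linear (\<lambda>x. t v w x)"
  shows "tri (trilinear_of (\<lambda>a b c. t (\<e> a) (\<e> b) (\<e> c))) u v w = t u v w"
proof -
  have exp: "u = (\<Sum>a\<in>UNIV. (u $ a) *\<^sub>R \<e> a)" for u :: V
    by (simp add: sum_6 V_expansion[symmetric])
  have "t u v w = (\<Sum>a\<in>UNIV. u $ a *\<^sub>R t (\<e> a) v w)"
    by (subst exp[of u]) (simp add: linear_sum[OF assms(1)] linear_scale[OF assms(1)])
  also have "\<dots> = (\<Sum>a\<in>UNIV. u $ a *\<^sub>R (\<Sum>b\<in>UNIV. v $ b *\<^sub>R t (\<e> a) (\<e> b) w))"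
    by (subst exp[of v]) (simp add: linear_sum[OF assms(2)] linear_scale[OF assms(2)])
  also have "\<dots> = (\<Sum>a\<in>UNIV. u $ a *\<^sub>R (\<Sum>b\<in>UNIV. v $ b *\<^sub>R (\<Sum>c\<in>UNIV. w $ c *\<^sub>R t (\<e> a) (\<e> b) (\<e> c))))"
    by (subst exp[of w]) (simp add: linear_sum[OF assms(3)] linear_scale[OF assms(3)])
  finally show ?thesis
    by (simp add: trilinear_of_def tri_sum tri_cube scaleR_sum_right mult.assoc)
qed

lemma bounded_linear_trilinear_of:
  assumes "\<And>a b c. bounded_linear (\<lambda>x. t x a b c)"
  shows "bounded_linear (\<lambda>x. trilinear_of (t x))"
proof -
  have "bounded_linear (\<lambda>x. Re (t x a b c) *\<^sub>R cube 1 a b c + Im (t x a b c) *\<^sub>R cube \<i> a b c)" for a b c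
    by (intro bounded_linear_add bounded_linear_scaleR_const
        bounded_linear_compose[OF bounded_linear_Re assms] bounded_linear_compose[OF bounded_linear_Im assms])
  then show ?thesis
    unfolding trilinear_of_def by (subst cube_linear) (intro bounded_linear_sum)
qed

text \<open>
  Building the form from its coefficients gives a bounded trilinear map for every \<open>S\<close>; it is the
  composition with \<open>S\<close> as soon as \<open>S\<close> is linear over the reals, which covers complex conjugation and
  the action of \<open>SL(2,\<real>)\<close>.
\<close>

definition postcompose :: "(complex \<Rightarrow> complex) \<Rightarrow> trilinear \<Rightarrow> trilinear"
  where "postcompose S \<Omega> = trilinear_of (\<lambda>a b c. S (tri \<Omega> (\<e> a) (\<e> b) (\<e> c)))"

lemma tri_postcompose: "linear S \<Longrightarrow> tri (postcompose S \<Omega>) u v w = S (tri \<Omega> u v w)"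
  unfolding postcompose_def
  by (rule tri_trilinear_of[where t = "\<lambda>u v w. S (tri \<Omega> u v w)"])
    (auto intro!: linear_compose[of _ S, unfolded o_def] linear_tri_args)

lemma bounded_linear_postcompose: "linear S \<Longrightarrow> bounded_linear (postcompose S)"
  unfolding postcompose_def
  by (rule bounded_linear_trilinear_of, rule bounded_linear_compose[OF _ bounded_linear_tri])
    (simp add: linear_conv_bounded_linear)

lemma pullback_eq: "pullback A \<Omega> = trilinear_of (\<lambda>a b c. tri \<Omega> (A *v \<e> a) (A *v \<e> b) (A *v \<e> c))"
proof (rule tri_eqI)
  fix u v w
  show "tri (pullback A \<Omega>) u v w = tri (trilinear_of (\<lambda>a b c. tri \<Omega> (A *v \<e> a) (A *v \<e> b) (A *v \<e> c))) u v w"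
    unfolding tri_pullback
    by (subst tri_trilinear_of[where t = "\<lambda>u v w. tri \<Omega> (A *v u) (A *v v) (A *v w)"])
      (auto intro!: linearI simp: tri_add tri_scaleR matrix_vector_right_distrib matrix_vector_mult_scaleR)
qed

lemma bounded_linear_pullback: "bounded_linear (pullback A)"
  unfolding pullback_eq by (intro bounded_linear_trilinear_of bounded_linear_tri)

section \<open>Wedge products of three-forms\<close>

lemma alternating_swap:
  assumes "alternating \<Omega>"
  shows "tri \<Omega> v u w = - tri \<Omega> u v w" "tri \<Omega> u w v = - tri \<Omega> u v w" "tri \<Omega> w v u = - tri \<Omega> u v w"
proof -
  have z: "tri \<Omega> x x y = 0" "tri \<Omega> x y x = 0" "tri \<Omega> y x x = 0" for x y
    using assms unfolding alternating_def by blast+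
  have "tri \<Omega> v u w + tri \<Omega> u v w = 0"
    using z(1)[of "v + u" w] by (simp only: tri_add z add_0_left add_0_right add.commute)
  moreover have "tri \<Omega> u w v + tri \<Omega> u v w = 0"
    using z(3)[of u "w + v"] by (simp only: tri_add z add_0_left add_0_right add.commute)
  moreover have "tri \<Omega> w v u + tri \<Omega> u v w = 0"
    using z(2)[of "w + u" v] by (simp only: tri_add z add_0_left add_0_right add.commute)
  ultimately show "tri \<Omega> v u w = - tri \<Omega> u v w" "tri \<Omega> u w v = - tri \<Omega> u v w" "tri \<Omega> w v u = - tri \<Omega> u v w"
    by (simp_all only: eq_neg_iff_add_eq_0)
qed

lemma antisymmetric_form3: "alternating \<Omega> \<Longrightarrow> antisymmetric_form 3 (form3 \<Omega>)"
proof (rule antisymmetric_formI)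
  fix a b :: nat and v :: "nat \<Rightarrow> V" assume \<Omega>: "alternating \<Omega>" and ab: "a < b" "b < 3"
  then have "a = 0 \<and> b = 1 \<or> a = 0 \<and> b = 2 \<or> a = 1 \<and> b = 2" by auto
  then show "form3 \<Omega> (\<lambda>i. v (Transposition.transpose a b i)) = - form3 \<Omega> v"
    using alternating_swap(1)[OF \<Omega>, of "v 1" "v 0" "v 2"] alternating_swap(2)[OF \<Omega>, of "v 0" "v 2" "v 1"]
      alternating_swap(3)[OF \<Omega>, of "v 2" "v 1" "v 0"]
    unfolding form3_def by (elim disjE conjE) simp_all
qed

lemma local_form3: "local_form 3 (form3 \<Omega>)"
  by (simp add: local_form_def form3_def)

lemma multilinear_form3: "multilinear_form 3 (form3 \<Omega>)"
proof (unfold multilinear_form_def, intro allI impI)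
  fix v :: "nat \<Rightarrow> V" and i :: nat assume "i < 3"
  then have "i = 0 \<or> i = 1 \<or> i = 2" by auto
  then show "linear (\<lambda>x. form3 \<Omega> (v(i := x)))"
    by (auto simp: form3_def linear_tri_args)
qed

abbreviation wedge33 :: "trilinear \<Rightarrow> trilinear \<Rightarrow> (V, complex) form"
  where "wedge33 \<alpha> \<beta> \<equiv> wedge 3 3 (form3 \<alpha>) (form3 \<beta>)"

lemma wedge33_expansion:
  assumes "alternating \<alpha>" "alternating \<beta>"
  defines "a \<equiv> \<lambda>v i j k. tri \<alpha> (v i) (v j) (v k)" and "b \<equiv> \<lambda>v i j k. tri \<beta> (v i) (v j) (v k)"
  shows "wedge33 \<alpha> \<beta> v = a v 0 1 2 * b v 3 4 5
    - a v 3 1 2 * b v 0 4 5 - a v 4 1 2 * b v 3 0 5 - a v 5 1 2 * b v 3 4 0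
    - a v 0 3 2 * b v 1 4 5 - a v 0 4 2 * b v 3 1 5 - a v 0 5 2 * b v 3 4 1
    - a v 0 1 3 * b v 2 4 5 - a v 0 1 4 * b v 3 2 5 - a v 0 1 5 * b v 3 4 2
    + a v 0 4 5 * b v 3 1 2 + a v 0 3 5 * b v 1 4 2 + a v 0 3 4 * b v 1 2 5
    + a v 4 1 5 * b v 3 0 2 + a v 3 1 5 * b v 0 4 2 + a v 3 1 4 * b v 0 2 5
    + a v 4 5 2 * b v 3 0 1 + a v 3 5 2 * b v 0 4 1 + a v 3 4 2 * b v 0 1 5
    - a v 3 4 5 * b v 0 1 2"
proof -
  let ?t = "Transposition.transpose :: nat \<Rightarrow> nat \<Rightarrow> nat \<Rightarrow> nat"
  let ?L = "[id, ?t 0 3, ?t 0 4, ?t 0 5, ?t 1 3, ?t 1 4, ?t 1 5, ?t 2 3, ?t 2 4, ?t 2 5,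
    ?t 1 4 \<circ> ?t 2 5, ?t 1 3 \<circ> ?t 2 5, ?t 1 3 \<circ> ?t 2 4, ?t 0 4 \<circ> ?t 2 5, ?t 0 3 \<circ> ?t 2 5,
    ?t 0 3 \<circ> ?t 2 4, ?t 0 4 \<circ> ?t 1 5, ?t 0 3 \<circ> ?t 1 5, ?t 0 3 \<circ> ?t 1 4, ?t 0 3 \<circ> (?t 1 4 \<circ> ?t 2 5)]"
  have three: "{..<3} = {0, 1, 2 :: nat}" by auto
  have "wedge33 \<alpha> \<beta> v = (\<Sum>\<pi>\<leftarrow>?L. wedge_summand 3 (form3 \<alpha>) (form3 \<beta>) v \<pi>)"
  proof (rule wedge_shuffle_list[OF antisymmetric_form3 local_form3 antisymmetric_form3 local_form3])
    show "\<pi> permutes {..<3 + 3}" if "\<pi> \<in> set ?L" for \<pi>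
      using that by (auto intro!: permutes_compose permutes_swap_id simp del: o_apply)
    show "distinct (map (\<lambda>\<pi>. \<Sum>i<3. 2 ^ \<pi> i :: nat) ?L)"
      by (simp add: three Transposition.transpose_def)
    show "length ?L = (3 + 3) choose 3"
      by (simp add: numeral_eq_Suc)
  qed (use assms in auto)
  also have "\<dots> = a v 0 1 2 * b v 3 4 5
    - a v 3 1 2 * b v 0 4 5 - a v 4 1 2 * b v 3 0 5 - a v 5 1 2 * b v 3 4 0
    - a v 0 3 2 * b v 1 4 5 - a v 0 4 2 * b v 3 1 5 - a v 0 5 2 * b v 3 4 1
    - a v 0 1 3 * b v 2 4 5 - a v 0 1 4 * b v 3 2 5 - a v 0 1 5 * b v 3 4 2
    + a v 0 4 5 * b v 3 1 2 + a v 0 3 5 * b v 1 4 2 + a v 0 3 4 * b v 1 2 5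
    + a v 4 1 5 * b v 3 0 2 + a v 3 1 5 * b v 0 4 2 + a v 3 1 4 * b v 0 2 5
    + a v 4 5 2 * b v 3 0 1 + a v 3 5 2 * b v 0 4 1 + a v 3 4 2 * b v 0 1 5
    - a v 3 4 5 * b v 0 1 2"
    by (simp add: sign_compose sign_swap_id permutation_swap_id permutation_compose form3_def
        a_def b_def Transposition.transpose_def)
  finally show ?thesis .
qed

abbreviation omega_complex :: "(V, complex) form"
  where "omega_complex \<equiv> \<lambda>w. complex_of_real (omega_form w)"

lemma omega_eq: "omega u v = (u $ 1 * v $ 4 - u $ 4 * v $ 1) + (u $ 2 * v $ 5 - u $ 5 * v $ 2) + (u $ 3 * v $ 6 - u $ 6 * v $ 3)"
  by (simp add: omega_def)

lemma omega_linear: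
  "omega (x + y) v = omega x v + omega y v" "omega v (x + y) = omega v x + omega v y"
  "omega (c *\<^sub>R x) v = c * omega x v" "omega v (c *\<^sub>R x) = c * omega v x"
  "omega (x - y) v = omega x v - omega y v" "omega v (x - y) = omega v x - omega v y"
  "omega (- x) v = - omega x v" "omega v (- x) = - omega v x" "omega 0 v = 0" "omega v 0 = 0"
  by (simp_all add: omega_eq algebra_simps)

lemma omega_anti: "omega u v = - omega v u"
  by (simp add: omega_eq)

lemma omega_self [simp]: "omega u u = 0"
  by (simp add: omega_eq)

lemma antisymmetric_omega: "antisymmetric_form 2 omega_complex"
proof (rule antisymmetric_formI)
  fix a b :: nat and v :: "nat \<Rightarrow> V" assume "a < b" "b < 2"
  then have "a = 0" "b = 1" by auto
  then show "omega_complex (\<lambda>i. v (Transposition.transpose a b i)) = - omega_complex v"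
    using omega_anti[of "v 1" "v 0"] by (simp add: omega_form_def)
qed

lemma local_omega: "local_form 2 omega_complex"
  by (simp add: local_form_def omega_form_def)

lemma wedge32_expansion:
  assumes "alternating \<alpha>"
  defines "a \<equiv> \<lambda>v i j k. tri \<alpha> (v i) (v j) (v k)" and "b \<equiv> \<lambda>v i j. complex_of_real (omega (v i) (v j))"
  shows "wedge 3 2 (form3 \<alpha>) omega_complex v = a v 0 1 2 * b v 3 4
    - a v 3 1 2 * b v 0 4 - a v 4 1 2 * b v 3 0 - a v 0 3 2 * b v 1 4 - a v 0 4 2 * b v 3 1
    - a v 0 1 3 * b v 2 4 - a v 0 1 4 * b v 3 2
    + a v 0 3 4 * b v 1 2 + a v 3 1 4 * b v 0 2 + a v 3 4 2 * b v 0 1"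
proof -
  let ?t = "Transposition.transpose :: nat \<Rightarrow> nat \<Rightarrow> nat \<Rightarrow> nat"
  let ?L = "[id, ?t 0 3, ?t 0 4, ?t 1 3, ?t 1 4, ?t 2 3, ?t 2 4,
    ?t 1 3 \<circ> ?t 2 4, ?t 0 3 \<circ> ?t 2 4, ?t 0 3 \<circ> ?t 1 4]"
  have three: "{..<3} = {0, 1, 2 :: nat}" by auto
  have "wedge 3 2 (form3 \<alpha>) omega_complex v = (\<Sum>\<pi>\<leftarrow>?L. wedge_summand 3 (form3 \<alpha>) omega_complex v \<pi>)"
  proof (rule wedge_shuffle_list[OF antisymmetric_form3 local_form3 antisymmetric_omega local_omega])
    show "\<pi> permutes {..<3 + 2}" if "\<pi> \<in> set ?L" for \<pi>
      using that by (auto intro!: permutes_compose permutes_swap_id simp del: o_apply)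
    show "distinct (map (\<lambda>\<pi>. \<Sum>i<3. 2 ^ \<pi> i :: nat) ?L)"
      by (simp add: three Transposition.transpose_def)
    show "length ?L = (3 + 2) choose 3"
      by (simp add: numeral_eq_Suc)
  qed (use assms in auto)
  also have "\<dots> = a v 0 1 2 * b v 3 4
    - a v 3 1 2 * b v 0 4 - a v 4 1 2 * b v 3 0 - a v 0 3 2 * b v 1 4 - a v 0 4 2 * b v 3 1
    - a v 0 1 3 * b v 2 4 - a v 0 1 4 * b v 3 2
    + a v 0 3 4 * b v 1 2 + a v 3 1 4 * b v 0 2 + a v 3 4 2 * b v 0 1"
    by (simp add: sign_compose sign_swap_id permutation_swap_id permutation_compose form3_def
        a_def b_def Transposition.transpose_def omega_form_def)
  finally show ?thesis .
qed

text \<open>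
  Evaluating \<open>\<Omega> \<and> \<omega> = 0\<close> on two Darboux pairs and a basis vector that belongs to neither leaves two
  summands.  These are the six complex equations that cut the primitive forms out of the alternating
  ones.
\<close>

lemma primitive_contraction:
  assumes "\<Omega> \<in> primitive_forms"
  shows "tri \<Omega> (\<e> 1) (\<e> 4) (\<e> 3) = - tri \<Omega> (\<e> 2) (\<e> 5) (\<e> 3)"
    "tri \<Omega> (\<e> 1) (\<e> 4) (\<e> 6) = - tri \<Omega> (\<e> 2) (\<e> 5) (\<e> 6)"
    "tri \<Omega> (\<e> 1) (\<e> 4) (\<e> 2) = - tri \<Omega> (\<e> 3) (\<e> 6) (\<e> 2)"
    "tri \<Omega> (\<e> 1) (\<e> 4) (\<e> 5) = - tri \<Omega> (\<e> 3) (\<e> 6) (\<e> 5)"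
    "tri \<Omega> (\<e> 2) (\<e> 5) (\<e> 1) = - tri \<Omega> (\<e> 3) (\<e> 6) (\<e> 1)"
    "tri \<Omega> (\<e> 2) (\<e> 5) (\<e> 4) = - tri \<Omega> (\<e> 3) (\<e> 6) (\<e> 4)"
proof -
  have alt: "alternating \<Omega>" and w: "wedge 3 2 (form3 \<Omega>) omega_complex v = 0" for v
    using assms by (auto simp: primitive_forms_def)
  have *: "tri \<Omega> (\<e> i) (\<e> j) (\<e> m) = - tri \<Omega> (\<e> k) (\<e> l) (\<e> m)"
    if "omega (\<e> i) (\<e> j) = 1" "omega (\<e> k) (\<e> l) = 1" "omega (\<e> i) (\<e> k) = 0" "omega (\<e> i) (\<e> l) = 0"
      "omega (\<e> j) (\<e> k) = 0" "omega (\<e> j) (\<e> l) = 0" "\<forall>n\<in>{i, j, k, l}. omega (\<e> n) (\<e> m) = 0"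
    for i j k l m
  proof -
    define v where "v n = [\<e> i, \<e> j, \<e> m, \<e> k, \<e> l] ! n" for n
    have v: "v 0 = \<e> i" "v 1 = \<e> j" "v 2 = \<e> m" "v 3 = \<e> k" "v 4 = \<e> l"
      by (simp_all add: v_def)
    have flip: "omega (\<e> n) (\<e> n') = 0 \<Longrightarrow> omega (\<e> n') (\<e> n) = 0" for n n'
      using omega_anti[of "\<e> n'" "\<e> n"] by simp
    have "tri \<Omega> (\<e> i) (\<e> j) (\<e> m) + tri \<Omega> (\<e> k) (\<e> l) (\<e> m) = 0"
      using w[of v] that flip by (simp add: wedge32_expansion[OF alt] v[unfolded One_nat_def] v)
    then show ?thesis by (simp add: eq_neg_iff_add_eq_0)
  qed
  show "tri \<Omega> (\<e> 1) (\<e> 4) (\<e> 3) = - tri \<Omega> (\<e> 2) (\<e> 5) (\<e> 3)"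
    "tri \<Omega> (\<e> 1) (\<e> 4) (\<e> 6) = - tri \<Omega> (\<e> 2) (\<e> 5) (\<e> 6)"
    "tri \<Omega> (\<e> 1) (\<e> 4) (\<e> 2) = - tri \<Omega> (\<e> 3) (\<e> 6) (\<e> 2)"
    "tri \<Omega> (\<e> 1) (\<e> 4) (\<e> 5) = - tri \<Omega> (\<e> 3) (\<e> 6) (\<e> 5)"
    "tri \<Omega> (\<e> 2) (\<e> 5) (\<e> 1) = - tri \<Omega> (\<e> 3) (\<e> 6) (\<e> 1)"
    "tri \<Omega> (\<e> 2) (\<e> 5) (\<e> 4) = - tri \<Omega> (\<e> 3) (\<e> 6) (\<e> 4)"
    by (rule *; simp add: omega_eq axis_def)+
qed

lemma primitive_alternating: "\<Omega> \<in> primitive_forms \<Longrightarrow> alternating \<Omega>"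
  by (simp add: primitive_forms_def)

lemma subspace_primitive: "subspace primitive_forms"
proof (rule subspaceI)
  show "0 \<in> primitive_forms"
  proof -
    have alt: "alternating 0" by (simp add: alternating_def tri_zero)
    then show ?thesis
      by (simp add: primitive_forms_def wedge32_expansion[OF alt] tri_zero)
  qed
  fix \<alpha> \<beta> assume a: "\<alpha> \<in> primitive_forms" and b: "\<beta> \<in> primitive_forms"
  have alt: "alternating (\<alpha> + \<beta>)"
    using a b by (auto simp: alternating_def primitive_forms_def tri_add)
  have "wedge 3 2 (form3 (\<alpha> + \<beta>)) omega_complex v =
      wedge 3 2 (form3 \<alpha>) omega_complex v + wedge 3 2 (form3 \<beta>) omega_complex v" for v
    using a b by (simp add: wedge32_expansion alt primitive_alternating tri_add algebra_simps)
  then show "\<alpha> + \<beta> \<in> primitive_forms"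
    using a b alt by (simp add: primitive_forms_def)
next
  fix c \<alpha> assume a: "\<alpha> \<in> primitive_forms"
  have alt: "alternating (c *\<^sub>R \<alpha>)"
    using a by (auto simp: alternating_def primitive_forms_def tri_scaleR)
  have "wedge 3 2 (form3 (c *\<^sub>R \<alpha>)) omega_complex v = c *\<^sub>R wedge 3 2 (form3 \<alpha>) omega_complex v" for v
    using a by (simp add: wedge32_expansion alt primitive_alternating tri_scaleR algebra_simps)
  then show "c *\<^sub>R \<alpha> \<in> primitive_forms"
    using a alt by (simp add: primitive_forms_def)
qed

section \<open>A Darboux basis of the primitive forms\<close>

text \<open>The form \<open>z dx\<^sub>a \<and> dx\<^sub>b \<and> dx\<^sub>c\<close>.\<close>

definition elementary :: "complex \<Rightarrow> 6 \<Rightarrow> 6 \<Rightarrow> 6 \<Rightarrow> trilinear"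
  where "elementary z a b c = cube z a b c + cube z b c a + cube z c a b
    - cube z a c b - cube z b a c - cube z c b a"

lemma tri_elementary: "tri (elementary z a b c) u v w =
    (u $ a * v $ b * w $ c + u $ b * v $ c * w $ a + u $ c * v $ a * w $ b
     - u $ a * v $ c * w $ b - u $ b * v $ a * w $ c - u $ c * v $ b * w $ a) *\<^sub>R z"
  by (simp add: elementary_def tri_add tri_diff tri_cube scaleR_add_left scaleR_diff_left)

lemma alternating_elementary: "alternating (elementary z a b c)"
  by (simp add: alternating_def tri_elementary algebra_simps)

lemma alternating_diff: "alternating \<alpha> \<Longrightarrow> alternating \<beta> \<Longrightarrow> alternating (\<alpha> - \<beta>)"
  by (simp add: alternating_def tri_diff)

text \<open>
  Checking that an elementary form is primitive means expanding \<open>dx\<^sub>a \<and> dx\<^sub>b \<and> dx\<^sub>c \<and> \<omega>\<close> on five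
  vectors.  The next definitions state this as a polynomial identity in the coordinate rows
  \<open>i \<mapsto> v i $ a\<close>, where it follows from two facts on wedge products of one-forms: a repeated factor
  gives zero, and \<open>x \<and> y \<and> l \<and> x' \<and> y' = x' \<and> y' \<and> l \<and> x \<and> y\<close>.
\<close>

definition det_of_rows :: "(nat \<Rightarrow> real) \<Rightarrow> (nat \<Rightarrow> real) \<Rightarrow> (nat \<Rightarrow> real) \<Rightarrow> nat \<Rightarrow> nat \<Rightarrow> nat \<Rightarrow> real"
  where "det_of_rows x y z i j k =
    x i * y j * z k + y i * z j * x k + z i * x j * y k - x i * z j * y k - y i * x j * z k - z i * y j * x k"

definition shuffle_sum32 :: "(nat \<Rightarrow> nat \<Rightarrow> nat \<Rightarrow> real) \<Rightarrow> (nat \<Rightarrow> nat \<Rightarrow> real) \<Rightarrow> real"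
  where "shuffle_sum32 d w = d 0 1 2 * w 3 4 - d 3 1 2 * w 0 4 - d 4 1 2 * w 3 0 - d 0 3 2 * w 1 4 - d 0 4 2 * w 3 1
    - d 0 1 3 * w 2 4 - d 0 1 4 * w 3 2 + d 0 3 4 * w 1 2 + d 3 1 4 * w 0 2 + d 3 4 2 * w 0 1"

definition area_of_rows :: "(nat \<Rightarrow> real) \<Rightarrow> (nat \<Rightarrow> real) \<Rightarrow> nat \<Rightarrow> nat \<Rightarrow> real"
  where "area_of_rows x y i j = x i * y j - y i * x j"

lemma shuffle_sum32_linear:
  "shuffle_sum32 d (\<lambda>i j. w i j + w' i j) = shuffle_sum32 d w + shuffle_sum32 d w'"
  "shuffle_sum32 (\<lambda>i j k. d i j k - d' i j k) w = shuffle_sum32 d w - shuffle_sum32 d' w"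
  by (simp_all add: shuffle_sum32_def ring_distribs)

lemma shuffle_sum32_common_factor: "shuffle_sum32 (det_of_rows x y z) (area_of_rows x m) = 0"
  by (simp add: shuffle_sum32_def det_of_rows_def area_of_rows_def algebra_simps)

lemma shuffle_sum32_exchange:
  "shuffle_sum32 (det_of_rows x y l) (area_of_rows x' y') = shuffle_sum32 (det_of_rows x' y' l) (area_of_rows x y)"
  by (simp add: shuffle_sum32_def det_of_rows_def area_of_rows_def algebra_simps)

lemma det_of_rows_rotate: "det_of_rows x y z = det_of_rows y z x"
  by (simp add: fun_eq_iff det_of_rows_def)

lemma decomposable_wedge_zero:
  "shuffle_sum32 (det_of_rows x1 x2 x3)
     (\<lambda>i j. area_of_rows x1 y1 i j + area_of_rows x2 y2 i j + area_of_rows x3 y3 i j) = 0"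
proof -
  have "shuffle_sum32 (det_of_rows x1 x2 x3) (area_of_rows x2 y2) = 0"
    by (subst det_of_rows_rotate) (rule shuffle_sum32_common_factor)
  moreover have "shuffle_sum32 (det_of_rows x1 x2 x3) (area_of_rows x3 y3) = 0"
    by (subst det_of_rows_rotate, subst det_of_rows_rotate) (rule shuffle_sum32_common_factor)
  ultimately show ?thesis
    by (simp add: shuffle_sum32_linear shuffle_sum32_common_factor)
qed

lemma difference_wedge_zero:
  "shuffle_sum32 (\<lambda>i j k. det_of_rows x1 y1 x3 i j k - det_of_rows x2 y2 x3 i j k)
     (\<lambda>i j. area_of_rows x1 y1 i j + area_of_rows x2 y2 i j + area_of_rows x3 y3 i j) = 0"
proof -
  have last: "shuffle_sum32 (det_of_rows x y x3) (area_of_rows x3 y3) = 0" for x y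
    by (subst det_of_rows_rotate, subst det_of_rows_rotate) (rule shuffle_sum32_common_factor)
  show ?thesis
    by (simp add: shuffle_sum32_linear shuffle_sum32_common_factor last
        shuffle_sum32_exchange[of x1 y1 x3 x2 y2])
qed

lemma wedge32_zero_of_real:
  assumes alt: "alternating \<Omega>" and tri: "\<And>i j k. tri \<Omega> (v i) (v j) (v k) = d i j k *\<^sub>R z"
    and w: "\<And>i j. omega (v i) (v j) = w i j"
    and 0: "shuffle_sum32 d w = 0"
  shows "wedge 3 2 (form3 \<Omega>) omega_complex v = 0"
proof -
  have *: "(r *\<^sub>R z) * complex_of_real s = (r * s) *\<^sub>R z" for r s
    by (simp add: scaleR_conv_of_real)
  have "wedge 3 2 (form3 \<Omega>) omega_complex v = shuffle_sum32 d w *\<^sub>R z"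
    unfolding wedge32_expansion[OF alt] tri w * shuffle_sum32_def scaleR_diff_left scaleR_add_left ..
  then show ?thesis unfolding 0 by simp
qed

text \<open>
  The hypothesis says that each of the three Darboux pairs contains one of the coordinates
  \<open>a, b, c\<close>, so every summand of \<open>\<omega>\<close> repeats a factor of the elementary form.
\<close>

lemma primitive_elementary:
  assumes "\<And>u v. omega u v = (u $ a * m1 v - m1 u * v $ a) + (u $ b * m2 v - m2 u * v $ b) + (u $ c * m3 v - m3 u * v $ c)"
  shows "elementary z a b c \<in> primitive_forms"
proof -
  have "wedge 3 2 (form3 (elementary z a b c)) omega_complex v = 0" for v
  proof (rule wedge32_zero_of_real[OF alternating_elementary])
    show "tri (elementary z a b c) (v i) (v j) (v k) =
        det_of_rows (\<lambda>i. v i $ a) (\<lambda>i. v i $ b) (\<lambda>i. v i $ c) i j k *\<^sub>R z" for i j k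
      by (simp add: tri_elementary det_of_rows_def)
    show "omega (v i) (v j) = area_of_rows (\<lambda>i. v i $ a) (\<lambda>i. m1 (v i)) i j
        + area_of_rows (\<lambda>i. v i $ b) (\<lambda>i. m2 (v i)) i j + area_of_rows (\<lambda>i. v i $ c) (\<lambda>i. m3 (v i)) i j" for i j
      by (simp add: assms area_of_rows_def)
  qed (rule decomposable_wedge_zero)
  then show ?thesis by (simp add: primitive_forms_def alternating_elementary)
qed

text \<open>
  If \<open>(a, b)\<close> and \<open>(a', b')\<close> are Darboux pairs, then \<open>dx\<^sub>a \<and> dx\<^sub>b \<and> dx\<^sub>c\<close> alone is not primitive,
  but its product with \<open>\<omega>\<close> is \<open>dx\<^sub>a \<and> dx\<^sub>b \<and> dx\<^sub>c \<and> dx\<^sub>a\<^sub>' \<and> dx\<^sub>b\<^sub>'\<close>, which is symmetric in the two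
  pairs and therefore cancels in the difference.
\<close>

lemma primitive_elementary_diff:
  assumes "\<And>u v. omega u v = (u $ a * v $ b - u $ b * v $ a) + (u $ a' * v $ b' - u $ b' * v $ a') + (u $ c * m v - m u * v $ c)"
  shows "elementary z a b c - elementary z a' b' c \<in> primitive_forms"
proof -
  have "wedge 3 2 (form3 (elementary z a b c - elementary z a' b' c)) omega_complex v = 0" for v
  proof (rule wedge32_zero_of_real[OF alternating_diff[OF alternating_elementary alternating_elementary]])
    show "tri (elementary z a b c - elementary z a' b' c) (v i) (v j) (v k) =
      (det_of_rows (\<lambda>i. v i $ a) (\<lambda>i. v i $ b) (\<lambda>i. v i $ c) i j k
       - det_of_rows (\<lambda>i. v i $ a') (\<lambda>i. v i $ b') (\<lambda>i. v i $ c) i j k) *\<^sub>R z" for i j k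
      by (simp add: tri_diff tri_elementary det_of_rows_def scaleR_diff_left)
    show "omega (v i) (v j) = area_of_rows (\<lambda>i. v i $ a) (\<lambda>i. v i $ b) i j
        + area_of_rows (\<lambda>i. v i $ a') (\<lambda>i. v i $ b') i j + area_of_rows (\<lambda>i. v i $ c) (\<lambda>i. m (v i)) i j" for i j
      by (simp add: assms area_of_rows_def)
  qed (rule difference_wedge_zero)
  then show ?thesis by (simp add: primitive_forms_def alternating_elementary alternating_diff)
qed

text \<open>
  Over the complex numbers the primitive forms have dimension \<open>20 - 6 = 14\<close>.  The basis is split into
  two halves of seven forms, \<open>form_A\<close> and \<open>form_B\<close>, such that the wedge product pairs the
  \<open>k\<close>-th form of one half only with the \<open>k\<close>-th form of the other; \<open>coord_A\<close> and \<open>coord_B\<close> are the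
  dual coordinates.  The list entries from index \<open>4\<close> on are differences, which makes their
  \<open>pairing_weight\<close> have absolute value \<open>2\<close>.
\<close>

definition form_A :: "complex \<Rightarrow> nat \<Rightarrow> trilinear"
  where "form_A z k = [elementary z 1 2 3, elementary z 4 2 3, elementary z 1 5 3, elementary z 1 2 6,
    elementary z 1 4 3 - elementary z 2 5 3, elementary z 3 6 2 - elementary z 1 4 2,
    elementary z 2 5 1 - elementary z 3 6 1] ! k"

definition form_B :: "complex \<Rightarrow> nat \<Rightarrow> trilinear"
  where "form_B z k = [elementary z 4 5 6, elementary z 1 5 6, elementary z 4 2 6, elementary z 4 5 3,
    elementary z 2 5 6 - elementary z 1 4 6, elementary z 1 4 5 - elementary z 3 6 5,
    elementary z 3 6 4 - elementary z 2 5 4] ! k"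

definition coord_A :: "nat \<Rightarrow> trilinear \<Rightarrow> complex"
  where "coord_A k \<Omega> = [tri \<Omega> (\<e> 1) (\<e> 2) (\<e> 3), tri \<Omega> (\<e> 4) (\<e> 2) (\<e> 3), tri \<Omega> (\<e> 1) (\<e> 5) (\<e> 3),
    tri \<Omega> (\<e> 1) (\<e> 2) (\<e> 6), tri \<Omega> (\<e> 5) (\<e> 2) (\<e> 3), tri \<Omega> (\<e> 6) (\<e> 2) (\<e> 3), tri \<Omega> (\<e> 1) (\<e> 6) (\<e> 3)] ! k"

definition coord_B :: "nat \<Rightarrow> trilinear \<Rightarrow> complex"
  where "coord_B k \<Omega> = [tri \<Omega> (\<e> 4) (\<e> 5) (\<e> 6), tri \<Omega> (\<e> 1) (\<e> 5) (\<e> 6), tri \<Omega> (\<e> 4) (\<e> 2) (\<e> 6),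
    tri \<Omega> (\<e> 4) (\<e> 5) (\<e> 3), tri \<Omega> (\<e> 4) (\<e> 1) (\<e> 6), tri \<Omega> (\<e> 4) (\<e> 5) (\<e> 1), tri \<Omega> (\<e> 4) (\<e> 5) (\<e> 2)] ! k"

definition pairing_weight :: "nat \<Rightarrow> real"
  where "pairing_weight k = [1, - 1, - 1, - 1, - 2, - 2, - 2] ! k"

lemma less_7_cases:
  assumes "(k :: nat) < 7"
  obtains "k = 0" | "k = 1" | "k = 2" | "k = 3" | "k = 4" | "k = 5" | "k = 6"
  using assms by linarith

lemma lessThan_7: "{..<7} = {0, 1, 2, 3, 4, 5, 6 :: nat}"
  by auto

lemma primitive_form_A:
  assumes "k < 7"
  shows "form_A z k \<in> primitive_forms"
  using assms
proof (cases k rule: less_7_cases)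
  case 1
  have "elementary z 1 2 3 \<in> primitive_forms"
      by (rule primitive_elementary[where ?m1.0 = "\<lambda>u. u $ 4" and ?m2.0 = "\<lambda>u. u $ 5" and ?m3.0 = "\<lambda>u. u $ 6"]) (simp add: omega_eq)
  then show ?thesis by (simp add: form_A_def 1)
next
  case 2
  have "elementary z 4 2 3 \<in> primitive_forms"
      by (rule primitive_elementary[where ?m1.0 = "\<lambda>u. - u $ 1" and ?m2.0 = "\<lambda>u. u $ 5" and ?m3.0 = "\<lambda>u. u $ 6"]) (simp add: omega_eq)
  then show ?thesis by (simp add: form_A_def 2)
next
  case 3
  have "elementary z 1 5 3 \<in> primitive_forms"
      by (rule primitive_elementary[where ?m1.0 = "\<lambda>u. u $ 4" and ?m2.0 = "\<lambda>u. - u $ 2" and ?m3.0 = "\<lambda>u. u $ 6"]) (simp add: omega_eq)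
  then show ?thesis by (simp add: form_A_def 3)
next
  case 4
  have "elementary z 1 2 6 \<in> primitive_forms"
      by (rule primitive_elementary[where ?m1.0 = "\<lambda>u. u $ 4" and ?m2.0 = "\<lambda>u. u $ 5" and ?m3.0 = "\<lambda>u. - u $ 3"]) (simp add: omega_eq)
  then show ?thesis by (simp add: form_A_def 4)
next
  case 5
  have "elementary z 1 4 3 - elementary z 2 5 3 \<in> primitive_forms"
      by (rule primitive_elementary_diff[where m = "\<lambda>u. u $ 6"]) (simp add: omega_eq)
  then show ?thesis by (simp add: form_A_def 5)
next
  case 6
  have "elementary z 3 6 2 - elementary z 1 4 2 \<in> primitive_forms"
      by (rule primitive_elementary_diff[where m = "\<lambda>u. u $ 5"]) (simp add: omega_eq)
  then show ?thesis by (simp add: form_A_def 6)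
next
  case 7
  have "elementary z 2 5 1 - elementary z 3 6 1 \<in> primitive_forms"
      by (rule primitive_elementary_diff[where m = "\<lambda>u. u $ 4"]) (simp add: omega_eq)
  then show ?thesis by (simp add: form_A_def 7)
qed

lemma primitive_form_B:
  assumes "k < 7"
  shows "form_B z k \<in> primitive_forms"
  using assms
proof (cases k rule: less_7_cases)
  case 1
  have "elementary z 4 5 6 \<in> primitive_forms"
      by (rule primitive_elementary[where ?m1.0 = "\<lambda>u. - u $ 1" and ?m2.0 = "\<lambda>u. - u $ 2" and ?m3.0 = "\<lambda>u. - u $ 3"]) (simp add: omega_eq)
  then show ?thesis by (simp add: form_B_def 1)
next
  case 2
  have "elementary z 1 5 6 \<in> primitive_forms"
      by (rule primitive_elementary[where ?m1.0 = "\<lambda>u. u $ 4" and ?m2.0 = "\<lambda>u. - u $ 2" and ?m3.0 = "\<lambda>u. - u $ 3"]) (simp add: omega_eq)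
  then show ?thesis by (simp add: form_B_def 2)
next
  case 3
  have "elementary z 4 2 6 \<in> primitive_forms"
      by (rule primitive_elementary[where ?m1.0 = "\<lambda>u. - u $ 1" and ?m2.0 = "\<lambda>u. u $ 5" and ?m3.0 = "\<lambda>u. - u $ 3"]) (simp add: omega_eq)
  then show ?thesis by (simp add: form_B_def 3)
next
  case 4
  have "elementary z 4 5 3 \<in> primitive_forms"
      by (rule primitive_elementary[where ?m1.0 = "\<lambda>u. - u $ 1" and ?m2.0 = "\<lambda>u. - u $ 2" and ?m3.0 = "\<lambda>u. u $ 6"]) (simp add: omega_eq)
  then show ?thesis by (simp add: form_B_def 4)
next
  case 5
  have "elementary z 2 5 6 - elementary z 1 4 6 \<in> primitive_forms"
      by (rule primitive_elementary_diff[where m = "\<lambda>u. - u $ 3"]) (simp add: omega_eq)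
  then show ?thesis by (simp add: form_B_def 5)
next
  case 6
  have "elementary z 1 4 5 - elementary z 3 6 5 \<in> primitive_forms"
      by (rule primitive_elementary_diff[where m = "\<lambda>u. - u $ 2"]) (simp add: omega_eq)
  then show ?thesis by (simp add: form_B_def 6)
next
  case 7
  have "elementary z 3 6 4 - elementary z 2 5 4 \<in> primitive_forms"
      by (rule primitive_elementary_diff[where m = "\<lambda>u. - u $ 1"]) (simp add: omega_eq)
  then show ?thesis by (simp add: form_B_def 7)
qed

lemma unit_vec_nth:
  "\<e> 1 $ 1 = 1" "\<e> 1 $ 2 = 0" "\<e> 1 $ 3 = 0" "\<e> 1 $ 4 = 0" "\<e> 1 $ 5 = 0" "\<e> 1 $ 6 = 0"
  "\<e> 2 $ 1 = 0" "\<e> 2 $ 2 = 1" "\<e> 2 $ 3 = 0" "\<e> 2 $ 4 = 0" "\<e> 2 $ 5 = 0" "\<e> 2 $ 6 = 0"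
  "\<e> 3 $ 1 = 0" "\<e> 3 $ 2 = 0" "\<e> 3 $ 3 = 1" "\<e> 3 $ 4 = 0" "\<e> 3 $ 5 = 0" "\<e> 3 $ 6 = 0"
  "\<e> 4 $ 1 = 0" "\<e> 4 $ 2 = 0" "\<e> 4 $ 3 = 0" "\<e> 4 $ 4 = 1" "\<e> 4 $ 5 = 0" "\<e> 4 $ 6 = 0"
  "\<e> 5 $ 1 = 0" "\<e> 5 $ 2 = 0" "\<e> 5 $ 3 = 0" "\<e> 5 $ 4 = 0" "\<e> 5 $ 5 = 1" "\<e> 5 $ 6 = 0"
  "\<e> 6 $ 1 = 0" "\<e> 6 $ 2 = 0" "\<e> 6 $ 3 = 0" "\<e> 6 $ 4 = 0" "\<e> 6 $ 5 = 0" "\<e> 6 $ 6 = 1"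
  by (simp_all add: axis_def)

lemma coord_form_conj:
  assumes "j < 7" "k < 7"
  shows "(coord_A j (form_A z k) = (if j = k then z else 0) \<and> coord_B j (form_A z k) = 0) \<and>
    (coord_B j (form_B z k) = (if j = k then z else 0) \<and> coord_A j (form_B z k) = 0)"
  by (rule less_7_cases[OF assms(1)]; rule less_7_cases[OF assms(2)];
      simp add: coord_A_def coord_B_def form_A_def form_B_def tri_diff tri_elementary unit_vec_nth)

lemma coord_form:
  assumes "j < 7" "k < 7"
  shows "coord_A j (form_A z k) = (if j = k then z else 0)" "coord_B j (form_A z k) = 0"
    "coord_B j (form_B z k) = (if j = k then z else 0)" "coord_A j (form_B z k) = 0"
  using coord_form_conj[OF assms] by blast+

lemma bounded_linear_coord:
  assumes "k < 7"
  shows "bounded_linear (coord_A k)" "bounded_linear (coord_B k)"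
proof -
  have "bounded_linear (\<lambda>\<Omega>. coord_A k \<Omega>) \<and> bounded_linear (\<lambda>\<Omega>. coord_B k \<Omega>)"
    unfolding coord_A_def coord_B_def
    by (rule less_7_cases[OF assms]; simp add: bounded_linear_tri)
  then show "bounded_linear (coord_A k)" "bounded_linear (coord_B k)" by auto
qed

lemma coord_linear:
  assumes "k < 7"
  shows "coord_A k (x + y) = coord_A k x + coord_A k y" "coord_A k (c *\<^sub>R x) = c *\<^sub>R coord_A k x"
    "coord_A k (x - y) = coord_A k x - coord_A k y"
    "coord_B k (x + y) = coord_B k x + coord_B k y" "coord_B k (c *\<^sub>R x) = c *\<^sub>R coord_B k x"
    "coord_B k (x - y) = coord_B k x - coord_B k y"
  using bounded_linear_coord[OF assms, THEN bounded_linear.linear]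
  by (simp_all add: linear_add linear_scale linear_diff)

lemma coord_sum:
  assumes "k < 7"
  shows "coord_A k (\<Sum>i\<in>I. f i) = (\<Sum>i\<in>I. coord_A k (f i))" "coord_B k (\<Sum>i\<in>I. f i) = (\<Sum>i\<in>I. coord_B k (f i))"
  using linear_sum[OF bounded_linear.linear[OF bounded_linear_coord(1)[OF assms]], of f I]
    linear_sum[OF bounded_linear.linear[OF bounded_linear_coord(2)[OF assms]], of f I] by auto

lemma alternating_zero:
  assumes "alternating \<Omega>" "tri \<Omega> u v w = 0"
  shows "tri \<Omega> u v w = 0" "tri \<Omega> u w v = 0" "tri \<Omega> v u w = 0" "tri \<Omega> v w u = 0" "tri \<Omega> w u v = 0" "tri \<Omega> w v u = 0"
proof -
  note s = alternating_swap[OF assms(1)]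
  show 0: "tri \<Omega> u v w = 0" by fact
  show 1: "tri \<Omega> u w v = 0" using s(2)[of u w v] 0 by simp
  show 2: "tri \<Omega> v u w = 0" using s(1)[of v u w] 0 by simp
  show "tri \<Omega> w v u = 0" using s(3)[of w v u] 0 by simp
  show "tri \<Omega> v w u = 0" using s(2)[of v w u] 2 by simp
  show "tri \<Omega> w u v = 0" using s(1)[of w u v] 1 by simp
qed

lemma alternating_sorted:
  fixes \<Omega> u v w
  assumes "alternating \<Omega>"
  shows "tri \<Omega> u w v = - tri \<Omega> u v w" "tri \<Omega> v u w = - tri \<Omega> u v w" "tri \<Omega> w v u = - tri \<Omega> u v w"
    "tri \<Omega> v w u = tri \<Omega> u v w" "tri \<Omega> w u v = tri \<Omega> u v w"
proof -
  note s = alternating_swap[OF assms]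
  show 1: "tri \<Omega> u w v = - tri \<Omega> u v w" by (rule s(2))
  show 2: "tri \<Omega> v u w = - tri \<Omega> u v w" by (rule s(1))
  show "tri \<Omega> w v u = - tri \<Omega> u v w" by (rule s(3))
  show "tri \<Omega> v w u = tri \<Omega> u v w" using s(2)[of v w u] 2 by simp
  show "tri \<Omega> w u v = tri \<Omega> u v w" using s(1)[of w u v] 1 by simp
qed

text \<open>
  The fourteen coordinates and the six contraction equations determine the values on all twenty
  triples of distinct basis vectors.
\<close>

lemma primitive_zeroI:
  assumes prim: "\<Omega> \<in> primitive_forms" and A: "\<And>k. k < 7 \<Longrightarrow> coord_A k \<Omega> = 0" and B: "\<And>k. k < 7 \<Longrightarrow> coord_B k \<Omega> = 0"
  shows "\<Omega> = 0"
proof -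
  have alt: "alternating \<Omega>" using prim by (rule primitive_alternating)
  note z = alternating_zero[OF alt]
  have diag: "tri \<Omega> x x y = 0" "tri \<Omega> x y x = 0" "tri \<Omega> y x x = 0" for x y
    using alt unfolding alternating_def by blast+
  have a: "tri \<Omega> (\<e> 1) (\<e> 2) (\<e> 3) = 0" "tri \<Omega> (\<e> 4) (\<e> 2) (\<e> 3) = 0" "tri \<Omega> (\<e> 1) (\<e> 5) (\<e> 3) = 0"
    "tri \<Omega> (\<e> 1) (\<e> 2) (\<e> 6) = 0" "tri \<Omega> (\<e> 5) (\<e> 2) (\<e> 3) = 0" "tri \<Omega> (\<e> 6) (\<e> 2) (\<e> 3) = 0" "tri \<Omega> (\<e> 1) (\<e> 6) (\<e> 3) = 0"
    using A[of 0] A[of 1] A[of 2] A[of 3] A[of 4] A[of 5] A[of 6] by (simp_all add: coord_A_def)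
  have b: "tri \<Omega> (\<e> 4) (\<e> 5) (\<e> 6) = 0" "tri \<Omega> (\<e> 1) (\<e> 5) (\<e> 6) = 0" "tri \<Omega> (\<e> 4) (\<e> 2) (\<e> 6) = 0"
    "tri \<Omega> (\<e> 4) (\<e> 5) (\<e> 3) = 0" "tri \<Omega> (\<e> 4) (\<e> 1) (\<e> 6) = 0" "tri \<Omega> (\<e> 4) (\<e> 5) (\<e> 1) = 0" "tri \<Omega> (\<e> 4) (\<e> 5) (\<e> 2) = 0"
    using B[of 0] B[of 1] B[of 2] B[of 3] B[of 4] B[of 5] B[of 6] by (simp_all add: coord_B_def)
  note za = a[THEN z(1)] a[THEN z(2)] a[THEN z(3)] a[THEN z(4)] a[THEN z(5)] a[THEN z(6)]
  note zb = b[THEN z(1)] b[THEN z(2)] b[THEN z(3)] b[THEN z(4)] b[THEN z(5)] b[THEN z(6)]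
  have c1: "tri \<Omega> (\<e> 1) (\<e> 4) (\<e> 3) = 0"
    using primitive_contraction(1)[OF prim] by (simp add: za zb)
  have c2: "tri \<Omega> (\<e> 2) (\<e> 5) (\<e> 6) = 0"
    using primitive_contraction(2)[OF prim] by (simp add: za zb)
  have c3: "tri \<Omega> (\<e> 1) (\<e> 4) (\<e> 2) = 0"
    using primitive_contraction(3)[OF prim] by (simp add: za zb)
  have c4: "tri \<Omega> (\<e> 3) (\<e> 6) (\<e> 5) = 0"
    using primitive_contraction(4)[OF prim] by (simp add: za zb)
  have c5: "tri \<Omega> (\<e> 2) (\<e> 5) (\<e> 1) = 0"
    using primitive_contraction(5)[OF prim] by (simp add: za zb)
  have c6: "tri \<Omega> (\<e> 3) (\<e> 6) (\<e> 4) = 0"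
    using primitive_contraction(6)[OF prim] by (simp add: za zb)
  note c = c1 c2 c3 c4 c5 c6
  note zc = c[THEN z(1)] c[THEN z(2)] c[THEN z(3)] c[THEN z(4)] c[THEN z(5)] c[THEN z(6)]
  have "\<forall>i j k. tri \<Omega> (\<e> i) (\<e> j) (\<e> k) = 0"
    unfolding forall_6 by (simp only: za zb zc diag simp_thms)
  then have "trilinear_of (\<lambda>i j k. tri \<Omega> (\<e> i) (\<e> j) (\<e> k)) = trilinear_of (\<lambda>i j k. tri 0 (\<e> i) (\<e> j) (\<e> k))"
    by (simp add: tri_zero)
  then have "tri \<Omega> u v w = tri 0 u v w" for u v w
    using tri_trilinear_of[OF linear_tri_args, of \<Omega> u v w] tri_trilinear_of[OF linear_tri_args, of 0 u v w] by metis
  then show ?thesis by (rule tri_eqI)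
qed

lemma primitive_eqI:
  assumes "\<alpha> \<in> primitive_forms" "\<beta> \<in> primitive_forms"
    and "\<And>k. k < 7 \<Longrightarrow> coord_A k \<alpha> = coord_A k \<beta>" "\<And>k. k < 7 \<Longrightarrow> coord_B k \<alpha> = coord_B k \<beta>"
  shows "\<alpha> = \<beta>"
proof -
  have "\<alpha> - \<beta> \<in> primitive_forms" using assms subspace_primitive by (simp add: subspace_diff)
  then have "\<alpha> - \<beta> = 0" by (rule primitive_zeroI) (simp_all add: coord_linear assms)
  then show ?thesis by simp
qed

definition std_frame :: "nat \<Rightarrow> V" where "std_frame i = \<e> (of_nat (Suc i))"

lemma std_frame_simps: "std_frame 0 = \<e> 1" "std_frame (Suc 0) = \<e> 2" "std_frame 1 = \<e> 2" "std_frame 2 = \<e> 3"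
  "std_frame 3 = \<e> 4" "std_frame 4 = \<e> 5" "std_frame 5 = \<e> 6"
  by (simp_all add: std_frame_def)

lemma wedge33_std:
  assumes \<alpha>: "\<alpha> \<in> primitive_forms" and \<beta>: "\<beta> \<in> primitive_forms"
  shows "wedge33 \<alpha> \<beta> std_frame =
    (\<Sum>k<7. of_real (pairing_weight k) * (coord_A k \<alpha> * coord_B k \<beta> - coord_B k \<alpha> * coord_A k \<beta>))"
proof -
  have red: "tri \<Omega> (\<e> 1) (\<e> 4) (\<e> 3) = tri \<Omega> (\<e> 5) (\<e> 2) (\<e> 3)"
    "tri \<Omega> (\<e> 1) (\<e> 2) (\<e> 4) = tri \<Omega> (\<e> 6) (\<e> 2) (\<e> 3)"
    "tri \<Omega> (\<e> 1) (\<e> 2) (\<e> 5) = tri \<Omega> (\<e> 1) (\<e> 6) (\<e> 3)"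
    "tri \<Omega> (\<e> 1) (\<e> 4) (\<e> 6) = - tri \<Omega> (\<e> 4) (\<e> 1) (\<e> 6)"
    "tri \<Omega> (\<e> 1) (\<e> 4) (\<e> 5) = tri \<Omega> (\<e> 4) (\<e> 5) (\<e> 1)"
    "tri \<Omega> (\<e> 5) (\<e> 2) (\<e> 6) = - tri \<Omega> (\<e> 4) (\<e> 1) (\<e> 6)"
    "tri \<Omega> (\<e> 4) (\<e> 2) (\<e> 5) = - tri \<Omega> (\<e> 4) (\<e> 5) (\<e> 2)"
    "tri \<Omega> (\<e> 5) (\<e> 6) (\<e> 3) = tri \<Omega> (\<e> 4) (\<e> 5) (\<e> 1)"
    "tri \<Omega> (\<e> 4) (\<e> 6) (\<e> 3) = - tri \<Omega> (\<e> 4) (\<e> 5) (\<e> 2)"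
    "tri \<Omega> (\<e> 2) (\<e> 5) (\<e> 6) = tri \<Omega> (\<e> 4) (\<e> 1) (\<e> 6)"
    "tri \<Omega> (\<e> 3) (\<e> 5) (\<e> 6) = tri \<Omega> (\<e> 4) (\<e> 5) (\<e> 1)"
    "tri \<Omega> (\<e> 4) (\<e> 3) (\<e> 6) = tri \<Omega> (\<e> 4) (\<e> 5) (\<e> 2)"
    "tri \<Omega> (\<e> 2) (\<e> 3) (\<e> 6) = tri \<Omega> (\<e> 6) (\<e> 2) (\<e> 3)"
    "tri \<Omega> (\<e> 2) (\<e> 5) (\<e> 3) = - tri \<Omega> (\<e> 5) (\<e> 2) (\<e> 3)"
    "tri \<Omega> (\<e> 4) (\<e> 1) (\<e> 3) = - tri \<Omega> (\<e> 5) (\<e> 2) (\<e> 3)"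
    "tri \<Omega> (\<e> 1) (\<e> 3) (\<e> 6) = - tri \<Omega> (\<e> 1) (\<e> 6) (\<e> 3)"
    "tri \<Omega> (\<e> 4) (\<e> 1) (\<e> 2) = tri \<Omega> (\<e> 6) (\<e> 2) (\<e> 3)"
    "tri \<Omega> (\<e> 1) (\<e> 5) (\<e> 2) = - tri \<Omega> (\<e> 1) (\<e> 6) (\<e> 3)"
    if prim: "\<Omega> \<in> primitive_forms" for \<Omega>
  proof -
    have alt: "alternating \<Omega>" using prim by (rule primitive_alternating)
    note sorted = alternating_sorted[OF alt, where u = "\<e> 1" and v = "\<e> 3" and w = "\<e> 4"]
      alternating_sorted[OF alt, where u = "\<e> 2" and v = "\<e> 3" and w = "\<e> 5"]
      alternating_sorted[OF alt, where u = "\<e> 1" and v = "\<e> 2" and w = "\<e> 4"]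
      alternating_sorted[OF alt, where u = "\<e> 2" and v = "\<e> 3" and w = "\<e> 6"]
      alternating_sorted[OF alt, where u = "\<e> 1" and v = "\<e> 2" and w = "\<e> 5"]
      alternating_sorted[OF alt, where u = "\<e> 1" and v = "\<e> 3" and w = "\<e> 6"]
      alternating_sorted[OF alt, where u = "\<e> 1" and v = "\<e> 4" and w = "\<e> 6"]
      alternating_sorted[OF alt, where u = "\<e> 2" and v = "\<e> 5" and w = "\<e> 6"]
      alternating_sorted[OF alt, where u = "\<e> 1" and v = "\<e> 4" and w = "\<e> 5"]
      alternating_sorted[OF alt, where u = "\<e> 3" and v = "\<e> 5" and w = "\<e> 6"]
      alternating_sorted[OF alt, where u = "\<e> 2" and v = "\<e> 4" and w = "\<e> 5"]
      alternating_sorted[OF alt, where u = "\<e> 3" and v = "\<e> 4" and w = "\<e> 6"]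
    show "tri \<Omega> (\<e> 1) (\<e> 4) (\<e> 3) = tri \<Omega> (\<e> 5) (\<e> 2) (\<e> 3)"
    "tri \<Omega> (\<e> 1) (\<e> 2) (\<e> 4) = tri \<Omega> (\<e> 6) (\<e> 2) (\<e> 3)"
    "tri \<Omega> (\<e> 1) (\<e> 2) (\<e> 5) = tri \<Omega> (\<e> 1) (\<e> 6) (\<e> 3)"
    "tri \<Omega> (\<e> 1) (\<e> 4) (\<e> 6) = - tri \<Omega> (\<e> 4) (\<e> 1) (\<e> 6)"
    "tri \<Omega> (\<e> 1) (\<e> 4) (\<e> 5) = tri \<Omega> (\<e> 4) (\<e> 5) (\<e> 1)"
    "tri \<Omega> (\<e> 5) (\<e> 2) (\<e> 6) = - tri \<Omega> (\<e> 4) (\<e> 1) (\<e> 6)"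
    "tri \<Omega> (\<e> 4) (\<e> 2) (\<e> 5) = - tri \<Omega> (\<e> 4) (\<e> 5) (\<e> 2)"
    "tri \<Omega> (\<e> 5) (\<e> 6) (\<e> 3) = tri \<Omega> (\<e> 4) (\<e> 5) (\<e> 1)"
    "tri \<Omega> (\<e> 4) (\<e> 6) (\<e> 3) = - tri \<Omega> (\<e> 4) (\<e> 5) (\<e> 2)"
    "tri \<Omega> (\<e> 2) (\<e> 5) (\<e> 6) = tri \<Omega> (\<e> 4) (\<e> 1) (\<e> 6)"
    "tri \<Omega> (\<e> 3) (\<e> 5) (\<e> 6) = tri \<Omega> (\<e> 4) (\<e> 5) (\<e> 1)"
    "tri \<Omega> (\<e> 4) (\<e> 3) (\<e> 6) = tri \<Omega> (\<e> 4) (\<e> 5) (\<e> 2)"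
    "tri \<Omega> (\<e> 2) (\<e> 3) (\<e> 6) = tri \<Omega> (\<e> 6) (\<e> 2) (\<e> 3)"
    "tri \<Omega> (\<e> 2) (\<e> 5) (\<e> 3) = - tri \<Omega> (\<e> 5) (\<e> 2) (\<e> 3)"
    "tri \<Omega> (\<e> 4) (\<e> 1) (\<e> 3) = - tri \<Omega> (\<e> 5) (\<e> 2) (\<e> 3)"
    "tri \<Omega> (\<e> 1) (\<e> 3) (\<e> 6) = - tri \<Omega> (\<e> 1) (\<e> 6) (\<e> 3)"
    "tri \<Omega> (\<e> 4) (\<e> 1) (\<e> 2) = tri \<Omega> (\<e> 6) (\<e> 2) (\<e> 3)"
    "tri \<Omega> (\<e> 1) (\<e> 5) (\<e> 2) = - tri \<Omega> (\<e> 1) (\<e> 6) (\<e> 3)"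
      using primitive_contraction[OF prim] unfolding sorted by auto (metis minus_minus)+
  qed
  show ?thesis
    unfolding wedge33_expansion[OF primitive_alternating[OF \<alpha>] primitive_alternating[OF \<beta>]] std_frame_simps lessThan_7
    unfolding red[OF \<alpha>] red[OF \<beta>]
    by (simp add: coord_A_def coord_B_def pairing_weight_def algebra_simps)
qed

lemma multilinear_liouville_omega: "multilinear_form 6 (liouville_form 3 omega_form)"
  and antisymmetric_liouville_omega: "antisymmetric_form 6 (liouville_form 3 omega_form)"
  and local_liouville_omega: "local_form 6 (liouville_form 3 omega_form)"
proof -
  have m: "multilinear_form 2 omega_form"
  proof (unfold multilinear_form_def, intro allI impI)
    fix v :: "nat \<Rightarrow> V" and i :: nat assume "i < 2"
    then have "i = 0 \<or> i = 1" by auto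
    then show "linear (\<lambda>x. omega_form (v(i := x)))"
      by (auto simp: omega_form_def omega_linear intro!: linearI)
  qed
  have l: "local_form 2 omega_form" by (simp add: local_form_def omega_form_def)
  show "multilinear_form 6 (liouville_form 3 omega_form)"
  proof (unfold multilinear_form_def, intro allI impI)
    fix v :: "nat \<Rightarrow> V" and i :: nat assume "i < 6"
    then have "linear (\<lambda>x. wedge_power 3 omega_form (v(i := x)))"
      using multilinear_wedge_power[OF m l, of 3] by (simp add: multilinear_form_def)
    from linear_mult_const[OF this, of 1 "1 / fact 3"]
    show "linear (\<lambda>x. liouville_form 3 omega_form (v(i := x)))"
      by (simp add: liouville_form_def)
  qed
  show "local_form 6 (liouville_form 3 omega_form)"
    using local_wedge_power[OF l, of 3] unfolding local_form_def liouville_form_def by simp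
  show "antisymmetric_form 6 (liouville_form 3 omega_form)"
    using antisymmetric_wedge_power[of 3 omega_form] by (simp add: antisymmetric_form_def liouville_form_def)
qed

text \<open>
  The sign is that of the permutation from the Darboux ordering \<open>x\<^sub>1, y\<^sub>1, x\<^sub>2, y\<^sub>2, x\<^sub>3, y\<^sub>3\<close> to
  \<open>x\<^sub>1, x\<^sub>2, x\<^sub>3, y\<^sub>1, y\<^sub>2, y\<^sub>3\<close>, which has three inversions.
\<close>

lemma liouville_std_frame: "liouville_form 3 omega_form std_frame = - 1"
proof -
  let ?t = "Transposition.transpose :: nat \<Rightarrow> nat \<Rightarrow> nat \<Rightarrow> nat"
  define w where "w i = [\<e> 1, \<e> 4, \<e> 2, \<e> 5, \<e> 3, \<e> 6] ! i" for i
  have "wedge_power 3 (\<lambda>v. omega (v 0) (v 1)) w = fact 3"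
  proof (rule wedge_power_symplectic_basis)
    fix i j :: nat assume "i < 2 * 3" "j < 2 * 3"
    then have "i \<in> {0, 1, 2, 3, 4, 5}" "j \<in> {0, 1, 2, 3, 4, 5}" by auto
    then show "omega (w i) (w j) = symplectic_unit i j"
      by (elim insertE emptyE; simp add: w_def omega_eq unit_vec_nth symplectic_unit_def)
  qed (rule omega_anti)
  then have 1: "liouville_form 3 omega_form w = 1"
    by (simp add: liouville_form_def omega_form_def[abs_def])
  have swap: "liouville_form 3 omega_form (\<lambda>i. v (?t a b i)) = - liouville_form 3 omega_form v"
    if "a < 6" "b < 6" "a \<noteq> b" for a b v
    by (rule antisymmetric_form_transpose[OF antisymmetric_liouville_omega that])
  have "liouville_form 3 omega_form std_frame = liouville_form 3 omega_form (\<lambda>i. w (?t 1 2 (?t 2 4 (?t 3 4 i))))"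
  proof (rule local_liouville_omega[unfolded local_form_def, rule_format])
    fix i :: nat assume "i < 6"
    then have "i \<in> {0, 1, 2, 3, 4, 5}" by auto
    then show "std_frame i = w (?t 1 2 (?t 2 4 (?t 3 4 i)))"
      by (auto simp: w_def std_frame_def Transposition.transpose_def)
  qed
  also have "\<dots> = - 1"
    using swap[of 3 4 "\<lambda>i. w (?t 1 2 (?t 2 4 i))"] swap[of 2 4 "\<lambda>i. w (?t 1 2 i)"] swap[of 1 2 w] 1 by simp
  finally show ?thesis .
qed

definition volume_factor :: "(nat \<Rightarrow> V) \<Rightarrow> real"
  where "volume_factor v = det (\<chi> k. v (inv_into {..<6} (\<lambda>i. of_nat (Suc i)) k))"

lemma bij_of_nat_Suc_6: "bij_betw (\<lambda>i. of_nat (Suc i) :: 6) {..<6} UNIV"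
proof -
  have "bij_betw (\<lambda>x. 1 + x) (UNIV :: 6 set) UNIV"
    by (rule bij_betwI[of _ _ _ "\<lambda>x. x - 1"]) auto
  from bij_betw_trans[OF bij_of_nat_6 this] show ?thesis by (simp add: o_def)
qed

text \<open>
  The space of six-forms is a line, so any two of them can be compared by their values on one frame.
  For this reason the symplectic form on three-forms and the condition that defines \<open>U1_plus\<close> only
  involve values on the standard frame.
\<close>

lemma six_form_eq:
  fixes F :: "(V, 'k::real_normed_field) form"
  assumes F: "antisymmetric_form 6 F" "local_form 6 F" "multilinear_form 6 F"
  shows "F v = of_real (volume_factor v) * F std_frame"
proof -
  let ?ix = "\<lambda>i. of_nat (Suc i) :: 6"
  let ?X = "\<chi> k. v (inv_into {..<6} ?ix k)"
  have "F v = F (\<lambda>i. id (?X $ ?ix i))"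
    by (rule F(2)[unfolded local_form_def, rule_format])
      (simp add: inv_into_f_f[OF bij_betw_imp_inj_on[OF bij_of_nat_Suc_6]] del: of_nat_Suc)
  also have "\<dots> = of_real (det ?X) * F (\<lambda>i. id (axis (?ix i) 1))"
    by (rule top_form_det[OF F bij_of_nat_Suc_6 linear_id])
  finally show ?thesis by (simp add: volume_factor_def std_frame_def[abs_def])
qed

lemma wedge33_form:
  "antisymmetric_form 6 (wedge33 \<alpha> \<beta>)" "local_form 6 (wedge33 \<alpha> \<beta>)"
  "alternating \<alpha> \<Longrightarrow> alternating \<beta> \<Longrightarrow> multilinear_form 6 (wedge33 \<alpha> \<beta>)"
  using antisymmetric_wedge[of 3 3 "form3 \<alpha>" "form3 \<beta>"] local_wedge[OF local_form3 local_form3, of \<alpha> \<beta>]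
    multilinear_wedge[OF multilinear_form3 multilinear_form3 local_form3, of \<alpha> \<beta>] by simp_all

lemma volume_factor_coord_vec: "volume_factor coord_vec \<noteq> 0"
proof
  assume "volume_factor coord_vec = 0"
  then have 0: "liouville_form 3 omega_form coord_vec = 0"
    using six_form_eq[OF antisymmetric_liouville_omega local_liouville_omega multilinear_liouville_omega, of coord_vec]
    by simp
  let ?X = "\<chi> k. std_frame (inv_into {..<6} (of_nat :: nat \<Rightarrow> 6) k)"
  have "liouville_form 3 omega_form std_frame = liouville_form 3 omega_form (\<lambda>i. id (?X $ of_nat i))"
    by (rule local_liouville_omega[unfolded local_form_def, rule_format])
      (simp add: inv_into_f_f[OF bij_betw_imp_inj_on[OF bij_of_nat_6]])
  also have "\<dots> = of_real (det ?X) * liouville_form 3 omega_form (\<lambda>i. id (axis (of_nat i) 1))"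
    by (rule top_form_det[OF antisymmetric_liouville_omega local_liouville_omega multilinear_liouville_omega
        bij_of_nat_6 linear_id])
  also have "(\<lambda>i. id (axis (of_nat i) 1)) = coord_vec"
    by (simp add: coord_vec_def fun_eq_iff)
  finally show False using 0 liouville_std_frame by simp
qed

lemma sigma_std_frame:
  assumes "alternating \<alpha>" "alternating \<beta>"
  shows "sigma \<alpha> \<beta> = - Im (wedge33 \<alpha> \<beta> std_frame)"
proof -
  have "wedge33 \<alpha> \<beta> coord_vec = of_real (volume_factor coord_vec) * wedge33 \<alpha> \<beta> std_frame"
    by (rule six_form_eq) (use assms wedge33_form in auto)
  moreover have "liouville_form 3 omega_form coord_vec = volume_factor coord_vec * - 1"
    using six_form_eq[OF antisymmetric_liouville_omega local_liouville_omega multilinear_liouville_omega, of coord_vec]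
    by (simp add: liouville_std_frame)
  ultimately show ?thesis
    using volume_factor_coord_vec by (simp add: sigma_def)
qed

lemma sigma_coord:
  assumes "\<alpha> \<in> primitive_forms" "\<beta> \<in> primitive_forms"
  shows "sigma \<alpha> \<beta> = - (\<Sum>k<7. pairing_weight k * Im (coord_A k \<alpha> * coord_B k \<beta> - coord_B k \<alpha> * coord_A k \<beta>))"
  unfolding sigma_std_frame[OF assms[THEN primitive_alternating]] wedge33_std[OF assms] Im_sum
  by simp

section \<open>The normalisation of a form\<close>

definition conj_form :: "trilinear \<Rightarrow> trilinear" where "conj_form = postcompose cnj"

lemma linear_cnj: "linear cnj"
  by (auto intro!: linearI)

lemma tri_conj_form: "tri (conj_form \<Omega>) u v w = cnj (tri \<Omega> u v w)"
  by (simp add: conj_form_def tri_postcompose linear_cnj)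

lemma alternating_postcompose: "linear S \<Longrightarrow> alternating \<Omega> \<Longrightarrow> alternating (postcompose S \<Omega>)"
  by (auto simp: alternating_def tri_postcompose linear_0)

lemma primitive_postcompose:
  assumes S: "linear S" and \<Omega>: "\<Omega> \<in> primitive_forms"
  shows "postcompose S \<Omega> \<in> primitive_forms"
proof -
  have alt: "alternating \<Omega>" "alternating (postcompose S \<Omega>)"
    using \<Omega> S by (auto intro: primitive_alternating alternating_postcompose)
  have r: "z * complex_of_real r = r *\<^sub>R z" for z r
    by (simp add: scaleR_conv_of_real mult.commute)
  have "wedge 3 2 (form3 (postcompose S \<Omega>)) omega_complex v = S (wedge 3 2 (form3 \<Omega>) omega_complex v)" for v
    unfolding wedge32_expansion[OF alt(1)] wedge32_expansion[OF alt(2)] tri_postcompose[OF S] r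
    by (simp add: linear_add[OF S] linear_diff[OF S] linear_scale[OF S])
  then show ?thesis
    using \<Omega> alt S by (simp add: primitive_forms_def linear_0)
qed

lemma coord_postcompose:
  assumes "linear S" "k < 7"
  shows "coord_A k (postcompose S \<Omega>) = S (coord_A k \<Omega>)" "coord_B k (postcompose S \<Omega>) = S (coord_B k \<Omega>)"
proof -
  have "coord_A k (postcompose S \<Omega>) = S (coord_A k \<Omega>) \<and> coord_B k (postcompose S \<Omega>) = S (coord_B k \<Omega>)"
    by (rule less_7_cases[OF assms(2)]; simp add: coord_A_def coord_B_def tri_postcompose[OF assms(1)])
  then show "coord_A k (postcompose S \<Omega>) = S (coord_A k \<Omega>)" "coord_B k (postcompose S \<Omega>) = S (coord_B k \<Omega>)"
    by auto
qed

text \<open>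
  The quadratic form for which the equation that defines \<open>U1_plus\<close> says that its value is \<open>1\<close>.  It is
  \<open>- sigma \<Omega> (conj_form \<Omega>) / 8\<close>, and every map that preserves \<open>sigma\<close> and commutes with complex
  conjugation preserves it.
\<close>

definition normalization :: "trilinear \<Rightarrow> real"
  where "normalization \<Omega> = (\<Sum>k<7. pairing_weight k * Im (coord_A k \<Omega> * cnj (coord_B k \<Omega>))) / 4"

lemma wedge33_conj:
  assumes "\<Omega> \<in> primitive_forms"
  shows "wedge33 \<Omega> (conj_form \<Omega>) std_frame = 8 * \<i> * of_real (normalization \<Omega>)"
proof -
  have "conj_form \<Omega> \<in> primitive_forms"
    unfolding conj_form_def by (rule primitive_postcompose[OF linear_cnj assms])
  have c: "coord_A k (conj_form \<Omega>) = cnj (coord_A k \<Omega>)" "coord_B k (conj_form \<Omega>) = cnj (coord_B k \<Omega>)" if "k < 7" for k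
    unfolding conj_form_def by (rule coord_postcompose[OF linear_cnj that])+
  have z: "a * cnj b - b * cnj a = 2 * \<i> * of_real (Im (a * cnj b))" for a b
    by (simp add: complex_eq_iff)
  have "wedge33 \<Omega> (conj_form \<Omega>) std_frame =
      (\<Sum>k<7. 2 * \<i> * of_real (pairing_weight k * Im (coord_A k \<Omega> * cnj (coord_B k \<Omega>))))"
    unfolding wedge33_std[OF assms \<open>conj_form \<Omega> \<in> primitive_forms\<close>]
    by (rule sum.cong) (auto simp: c z)
  also have "\<dots> = 8 * \<i> * of_real (normalization \<Omega>)"
    by (simp only: normalization_def sum_distrib_left[symmetric] of_real_sum[symmetric]) simp
  finally show ?thesis .
qed

lemma normalization_sigma:
  assumes "\<Omega> \<in> primitive_forms"
  shows "normalization \<Omega> = - sigma \<Omega> (conj_form \<Omega>) / 8"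
  using sigma_std_frame[of \<Omega> "conj_form \<Omega>"] wedge33_conj[OF assms] assms
  by (simp add: primitive_alternating alternating_postcompose linear_cnj conj_form_def)

lemma U1_plus_eq: "U1_plus = {\<Omega> \<in> U_plus. normalization \<Omega> = 1}"
proof -
  have "(\<forall>v. complex_of_real (liouville_form 3 omega_form v)
        = (- 1) ^ 3 * (\<i> / 2) ^ 3 * wedge 3 3 (form3 \<Omega>) (\<lambda>w. cnj (form3 \<Omega> w)) v) \<longleftrightarrow> normalization \<Omega> = 1"
    if \<Omega>: "\<Omega> \<in> primitive_forms" for \<Omega>
  proof -
    have cf: "(\<lambda>w. cnj (form3 \<Omega> w)) = form3 (conj_form \<Omega>)"
      by (simp add: fun_eq_iff form3_def tri_conj_form)
    have c: "(- 1) ^ 3 * (\<i> / 2) ^ 3 = \<i> / 8"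
      by (simp add: power3_eq_cube complex_eq_iff)
    have 1: "wedge33 \<Omega> (conj_form \<Omega>) v = of_real (volume_factor v) * (8 * \<i> * of_real (normalization \<Omega>))" for v
      unfolding wedge33_conj[OF \<Omega>, symmetric]
      by (rule six_form_eq)
        (auto intro: wedge33_form primitive_alternating[OF \<Omega>] alternating_postcompose[OF linear_cnj] simp: conj_form_def)
    have 2: "liouville_form 3 omega_form v = volume_factor v * - 1" for v
      using six_form_eq[OF antisymmetric_liouville_omega local_liouville_omega multilinear_liouville_omega, of v]
      by (simp add: liouville_std_frame)
    have "(\<i> / 8) * (of_real (volume_factor v) * (8 * \<i> * of_real (normalization \<Omega>)))
        = of_real (volume_factor v * - normalization \<Omega>)" for v
      by (simp add: complex_eq_iff)
    then show ?thesis
      unfolding cf c 1 2 of_real_eq_iff using volume_factor_coord_vec by (auto simp: of_real_eq_iff[symmetric] simp del: of_real_eq_iff)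
  qed
  then show ?thesis
    by (auto simp: U1_plus_def U_plus_def U_forms_def)
qed

section \<open>The symplectic volume form in coordinates\<close>

lemma wedge33_linear:
  "wedge33 (x + y) \<beta> v = wedge33 x \<beta> v + wedge33 y \<beta> v" "wedge33 (c *\<^sub>R x) \<beta> v = c *\<^sub>R wedge33 x \<beta> v"
  "wedge33 \<beta> (x + y) v = wedge33 \<beta> x v + wedge33 \<beta> y v" "wedge33 \<beta> (c *\<^sub>R x) v = c *\<^sub>R wedge33 \<beta> x v"
  unfolding wedge_def form3_def
  by (simp_all add: tri_add tri_scaleR scaleR_conv_of_real ring_distribs sum.distrib add_divide_distrib
      sum_distrib_left mult_ac)

lemma linear_sigma: "linear (\<lambda>\<alpha>. sigma \<alpha> \<beta>)" "linear (\<lambda>\<beta>. sigma \<alpha> \<beta>)"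
  unfolding sigma_def
  by (auto intro!: linearI simp: wedge33_linear add_divide_distrib)

lemma sigma_anti: "sigma \<alpha> \<beta> = - sigma \<beta> \<alpha>"
proof -
  let ?t = "Transposition.transpose :: nat \<Rightarrow> nat \<Rightarrow> nat \<Rightarrow> nat"
  let ?s = "?t 0 3 \<circ> (?t 1 4 \<circ> ?t 2 5)"
  have s: "?s permutes {..<3 + 3}"
    by (intro permutes_compose permutes_swap_id) auto
  have sgn: "sign ?s = - 1"
    by (simp add: sign_compose sign_swap_id permutation_swap_id permutation_compose del: o_apply)
  have "wedge33 \<alpha> \<beta> v = - wedge33 \<beta> \<alpha> v" for v
  proof -
    have "(\<Sum>\<pi> | \<pi> permutes {..<3 + 3}. wedge_summand 3 (form3 \<alpha>) (form3 \<beta>) v \<pi>)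
        = (\<Sum>\<pi> | \<pi> permutes {..<3 + 3}. wedge_summand 3 (form3 \<alpha>) (form3 \<beta>) v (\<pi> \<circ> ?s))"
      by (rule sum_permutations_compose_right[OF s])
    also have "\<dots> = (\<Sum>\<pi> | \<pi> permutes {..<3 + 3}. - wedge_summand 3 (form3 \<beta>) (form3 \<alpha>) v \<pi>)"
    proof (rule sum.cong[OF refl])
      fix \<pi> :: "nat \<Rightarrow> nat" assume "\<pi> \<in> {\<pi>. \<pi> permutes {..<3 + 3}}"
      then have "sign (\<pi> \<circ> ?s) = - sign \<pi>"
        using sign_mult_permutes[OF finite_lessThan _ s, of \<pi>] sgn by simp
      then show "wedge_summand 3 (form3 \<alpha>) (form3 \<beta>) v (\<pi> \<circ> ?s) = - wedge_summand 3 (form3 \<beta>) (form3 \<alpha>) v \<pi>"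
        by (simp only: o_apply form3_def) (simp add: Transposition.transpose_def)
    qed
    finally show ?thesis unfolding wedge_def by (simp add: sum_negf)
  qed
  then show ?thesis by (simp add: sigma_def)
qed

text \<open>
  The real basis consists of the quadruples
  \<open>form_A 1 k, form_B (- \<i> / p) k, form_A \<i> k, form_B (- 1 / p) k\<close> with \<open>p = pairing_weight k\<close>.  The division
  by the weight makes consecutive members of a quadruple two Darboux pairs for \<open>sigma\<close>.
\<close>

definition basis_form :: "nat \<Rightarrow> trilinear"
  where "basis_form i =
    (if i mod 4 = 0 then form_A 1 (i div 4)
     else if i mod 4 = 1 then form_B (- \<i> / of_real (pairing_weight (i div 4))) (i div 4)
     else if i mod 4 = 2 then form_A \<i> (i div 4)
     else form_B (- 1 / of_real (pairing_weight (i div 4))) (i div 4))"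

definition form_coord :: "nat \<Rightarrow> trilinear \<Rightarrow> real"
  where "form_coord i \<Omega> =
    (if i mod 4 = 0 then Re (coord_A (i div 4) \<Omega>)
     else if i mod 4 = 1 then - pairing_weight (i div 4) * Im (coord_B (i div 4) \<Omega>)
     else if i mod 4 = 2 then Im (coord_A (i div 4) \<Omega>)
     else - pairing_weight (i div 4) * Re (coord_B (i div 4) \<Omega>))"

lemma pairing_weight_nonzero: "k < 7 \<Longrightarrow> pairing_weight k \<noteq> 0"
  by (erule less_7_cases; simp add: pairing_weight_def)

lemma sigma_forms:
  assumes "k < 7" "l < 7"
  shows "sigma (form_A z k) (form_B z' l) = (if k = l then - pairing_weight k * Im (z * z') else 0)"
    "sigma (form_B z k) (form_A z' l) = (if k = l then pairing_weight k * Im (z * z') else 0)"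
    "sigma (form_A z k) (form_A z' l) = 0" "sigma (form_B z k) (form_B z' l) = 0"
proof -
  have p: "form_A z k \<in> primitive_forms" "form_B z k \<in> primitive_forms"
    "form_A z' l \<in> primitive_forms" "form_B z' l \<in> primitive_forms"
    using assms by (auto intro: primitive_form_A primitive_form_B)
  have AB: "sigma (form_A z k) (form_B z' l) = (if k = l then - pairing_weight k * Im (z * z') else 0)"
    if "k < 7" "l < 7" for k l z z'
  proof -
    have "sigma (form_A z k) (form_B z' l) =
        - (\<Sum>j<7. if j = k then if k = l then pairing_weight k * Im (z * z') else 0 else 0)"
      unfolding sigma_coord[OF primitive_form_A[OF that(1)] primitive_form_B[OF that(2)]]
      by (intro arg_cong[of _ _ uminus] sum.cong) (auto simp: coord_form that)
    then show ?thesis using that by (simp add: sum.delta)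
  qed
  show "sigma (form_A z k) (form_B z' l) = (if k = l then - pairing_weight k * Im (z * z') else 0)"
    by (rule AB[OF assms])
  show "sigma (form_B z k) (form_A z' l) = (if k = l then pairing_weight k * Im (z * z') else 0)"
    using AB[OF assms(2,1), of z' z] sigma_anti[of "form_B z k" "form_A z' l"] by (simp add: algebra_simps)
  show "sigma (form_A z k) (form_A z' l) = 0" "sigma (form_B z k) (form_B z' l) = 0"
    unfolding sigma_coord[OF p(1,3)] sigma_coord[OF p(2,4)] using assms by (simp_all add: coord_form)
qed

lemma primitive_basis_form: "i < 28 \<Longrightarrow> basis_form i \<in> primitive_forms"
  by (simp add: basis_form_def primitive_form_A primitive_form_B)

lemma mod_4_cases:
  obtains "(i :: nat) mod 4 = 0" | "i mod 4 = 1" | "i mod 4 = 2" | "i mod 4 = 3"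
  by linarith

lemma eq_div_mod_4: "(i :: nat) = 4 * (i div 4) + i mod 4"
  by simp

lemma sigma_basis_form:
  assumes "i < 28" "j < 28"
  shows "sigma (basis_form i) (basis_form j) = symplectic_unit i j"
proof -
  define k l where kl: "k = i div 4" "l = j div 4"
  have k: "k < 7" "l < 7" using assms by (auto simp: kl)
  have w: "pairing_weight k \<noteq> 0" "pairing_weight l \<noteq> 0" using k pairing_weight_nonzero by blast+
  have pairs: "(even i \<and> j = Suc i) = ((i mod 4 = 0 \<and> j mod 4 = 1 \<or> i mod 4 = 2 \<and> j mod 4 = 3) \<and> i div 4 = j div 4)"
    for i j :: nat
  proof -
    have "even i = (i mod 4 = 0 \<or> i mod 4 = 2)" by presburger
    moreover have "((r = 0 \<or> r = 2) \<and> 4 * b + s = Suc (4 * a + r)) = ((r = 0 \<and> s = 1 \<or> r = 2 \<and> s = 3) \<and> a = b)"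
      if "r < 4" "s < 4" for a b r s :: nat
      using that by presburger
    from this[of "i mod 4" "j mod 4" "j div 4" "i div 4"]
    have "((i mod 4 = 0 \<or> i mod 4 = 2) \<and> j = Suc i) = ((i mod 4 = 0 \<and> j mod 4 = 1 \<or> i mod 4 = 2 \<and> j mod 4 = 3) \<and> i div 4 = j div 4)"
      by simp
    ultimately show ?thesis by (simp only:)
  qed
  show ?thesis
    unfolding symplectic_unit_def pairs
    by (cases i rule: mod_4_cases; cases j rule: mod_4_cases)
      (simp_all add: basis_form_def kl[symmetric] sigma_forms k w)
qed

lemma form_coord_basis_form:
  assumes "i < 28" "j < 28"
  shows "form_coord i (basis_form j) = (if i = j then 1 else 0)"
proof -
  define k l where kl: "k = i div 4" "l = j div 4"
  have k: "k < 7" "l < 7" using assms by (auto simp: kl)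
  have w: "pairing_weight k \<noteq> 0" "pairing_weight l \<noteq> 0" using k pairing_weight_nonzero by blast+
  have eq: "i = j \<longleftrightarrow> i mod 4 = j mod 4 \<and> k = l"
    unfolding kl by (metis eq_div_mod_4)
  show ?thesis
    unfolding eq
    by (cases i rule: mod_4_cases; cases j rule: mod_4_cases)
      (simp_all add: basis_form_def form_coord_def kl[symmetric] coord_form k w)
qed

lemma bounded_linear_form_coord: "i < 28 \<Longrightarrow> bounded_linear (form_coord i)"
proof -
  assume "i < 28"
  then have k: "i div 4 < 7" by simp
  note bl = bounded_linear_compose[OF bounded_linear_Re bounded_linear_coord(1)[OF k]]
    bounded_linear_compose[OF bounded_linear_Im bounded_linear_coord(1)[OF k]]
    bounded_linear_const_mult[OF bounded_linear_compose[OF bounded_linear_Re bounded_linear_coord(2)[OF k]]]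
    bounded_linear_const_mult[OF bounded_linear_compose[OF bounded_linear_Im bounded_linear_coord(2)[OF k]]]
  show "bounded_linear (form_coord i)"
    unfolding form_coord_def[abs_def] using bl bl(3,4)[THEN bounded_linear_minus] by (cases i rule: mod_4_cases) (simp_all only: if_True if_False, simp_all)
qed

definition param_form :: "real ^ 28 \<Rightarrow> trilinear"
  where "param_form x = (\<Sum>i<28. (x $ of_nat i) *\<^sub>R basis_form i)"

definition form_coords :: "trilinear \<Rightarrow> real ^ 28"
  where "form_coords \<Omega> = (\<Sum>i<28. form_coord i \<Omega> *\<^sub>R axis (of_nat i) 1)"

lemma bounded_linear_param_form: "bounded_linear param_form"
  unfolding param_form_def[abs_def] by (intro bounded_linear_sum bounded_linear_component_scaleR)

lemma bounded_linear_form_coords: "bounded_linear form_coords"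
  unfolding form_coords_def[abs_def]
  by (intro bounded_linear_sum bounded_linear_scaleR_const bounded_linear_form_coord) auto

lemma primitive_param_form: "param_form x \<in> primitive_forms"
  unfolding param_form_def
  by (intro subspace_sum[OF subspace_primitive] subspace_scale[OF subspace_primitive] primitive_basis_form) auto

lemma of_nat_28_eq: "i < 28 \<Longrightarrow> j < 28 \<Longrightarrow> (of_nat i :: 28) = of_nat j \<longleftrightarrow> i = j"
  using bij_of_nat_28 by (auto simp: bij_betw_def inj_on_def)

lemma of_nat_28_cases:
  obtains j where "j < 28" "(k :: 28) = of_nat j"
  using bij_of_nat_28 by (metis UNIV_I bij_betw_imp_surj_on imageE lessThan_iff)

lemma coords_axis_sum:
  assumes "j < 28"
  shows "(\<Sum>i<28. f i *\<^sub>R axis (of_nat i) 1 :: real ^ 28) $ of_nat j = f j"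
proof -
  have "(\<Sum>i<28. f i *\<^sub>R axis (of_nat i) 1 :: real ^ 28) $ of_nat j = (\<Sum>i<28. if i = j then f i else 0)"
    unfolding sum_component by (rule sum.cong) (auto simp: axis_def of_nat_28_eq assms)
  then show ?thesis using assms by simp
qed

lemma form_coords_param_form: "form_coords (param_form x) = x"
proof (subst vec_eq_iff, rule allI)
  fix k :: 28
  obtain j where j: "j < 28" "k = of_nat j" by (rule of_nat_28_cases)
  have "form_coords (param_form x) $ k = form_coord j (\<Sum>i<28. (x $ of_nat i) *\<^sub>R basis_form i)"
    unfolding form_coords_def j(2) coords_axis_sum[OF j(1)] param_form_def ..
  also have "\<dots> = (\<Sum>i<28. (x $ of_nat i) * form_coord j (basis_form i))"
    using bounded_linear.linear[OF bounded_linear_form_coord[OF j(1)]] by (simp add: linear_sum linear_scale)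
  also have "\<dots> = (\<Sum>i<28. if i = j then x $ of_nat i else 0)"
    by (rule sum.cong) (auto simp: form_coord_basis_form j)
  finally show "form_coords (param_form x) $ k = x $ k" using j by simp
qed

lemma param_form_form_coords:
  assumes "\<Omega> \<in> primitive_forms"
  shows "param_form (form_coords \<Omega>) = \<Omega>"
proof -
  let ?f = "\<lambda>i. form_coord i \<Omega> *\<^sub>R basis_form i"
  have "param_form (form_coords \<Omega>) = (\<Sum>i<7 * 4. ?f i)"
    unfolding param_form_def form_coords_def by (rule sum.cong) (simp_all only: coords_axis_sum lessThan_iff, simp)
  also have "\<dots> = (\<Sum>m<7. sum ?f {m * 4..<m * 4 + 4})"
    by (rule sum.nat_group[symmetric])
  also have "\<dots> = (\<Sum>m<7. ?f (4 * m) + ?f (4 * m + 1) + ?f (4 * m + 2) + ?f (4 * m + 3))"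
  proof (rule sum.cong[OF refl])
    fix m :: nat
    have "{m * 4..<m * 4 + 4} = {4 * m, 4 * m + 1, 4 * m + 2, 4 * m + 3}" by auto
    then show "sum ?f {m * 4..<m * 4 + 4} = ?f (4 * m) + ?f (4 * m + 1) + ?f (4 * m + 2) + ?f (4 * m + 3)"
      by (simp add: add.assoc)
  qed
  finally have eq: "param_form (form_coords \<Omega>) =
      (\<Sum>m<7. ?f (4 * m) + ?f (4 * m + 1) + ?f (4 * m + 2) + ?f (4 * m + 3))" .
  have dm: "(4 * m + r) mod 4 = r" "(4 * m + r) div 4 = m" if "r < 4" for m r :: nat
    using that by simp_all
  show ?thesis
  proof (rule primitive_eqI[OF primitive_param_form assms])
    fix k :: nat assume k: "k < 7"
    have "coord_A k (param_form (form_coords \<Omega>)) = (\<Sum>m<7. if m = k then coord_A k \<Omega> else 0)"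
      unfolding eq coord_sum[OF k]
      by (rule sum.cong[OF refl])
        (use k dm[of 0] dm[of 1] dm[of 2] dm[of 3] in
          \<open>simp add: coord_linear[OF k] form_coord_def basis_form_def coord_form complex_eq_iff\<close>)
    then show "coord_A k (param_form (form_coords \<Omega>)) = coord_A k \<Omega>" using k by simp
    have "coord_B k (param_form (form_coords \<Omega>)) = (\<Sum>m<7. if m = k then coord_B k \<Omega> else 0)"
      unfolding eq coord_sum[OF k]
      by (rule sum.cong[OF refl])
        (use k dm[of 0] dm[of 1] dm[of 2] dm[of 3] pairing_weight_nonzero[OF k] in
          \<open>simp add: coord_linear[OF k] form_coord_def basis_form_def coord_form complex_eq_iff\<close>)
    then show "coord_B k (param_form (form_coords \<Omega>)) = coord_B k \<Omega>" using k by simp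
  qed
qed

lemma sigma_volume_form:
  "antisymmetric_form 28 sigma_volume" "local_form 28 sigma_volume" "multilinear_form 28 sigma_volume"
proof -
  let ?s = "\<lambda>w :: nat \<Rightarrow> trilinear. sigma (w 0) (w 1)"
  have l: "local_form 2 ?s" by (simp add: local_form_def)
  have m: "multilinear_form 2 ?s"
  proof (unfold multilinear_form_def, intro allI impI)
    fix v :: "nat \<Rightarrow> trilinear" and i :: nat assume "i < 2"
    then have "i = 0 \<or> i = 1" by auto
    then show "linear (\<lambda>x. ?s (v(i := x)))" by (auto simp: linear_sigma)
  qed
  show "local_form 28 sigma_volume"
    using local_wedge_power[OF l, of 14] unfolding local_form_def sigma_volume_def liouville_form_def by simp
  show "antisymmetric_form 28 sigma_volume"
    using antisymmetric_wedge_power[of 14 ?s]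
    by (simp add: antisymmetric_form_def sigma_volume_def liouville_form_def)
  show "multilinear_form 28 sigma_volume"
  proof (unfold multilinear_form_def, intro allI impI)
    fix v :: "nat \<Rightarrow> trilinear" and i :: nat assume "i < 28"
    then have "linear (\<lambda>x. wedge_power 14 ?s (v(i := x)))"
      using multilinear_wedge_power[OF m l, of 14] by (simp add: multilinear_form_def)
    from linear_mult_const[OF this, of 1 "1 / fact 14"]
    show "linear (\<lambda>x. sigma_volume (v(i := x)))"
      by (simp add: sigma_volume_def liouville_form_def)
  qed
qed

lemma sigma_volume_basis_form: "sigma_volume basis_form = 1"
proof -
  have "wedge_power 14 (\<lambda>w. sigma (w 0) (w 1)) basis_form = fact 14"
    by (rule wedge_power_symplectic_basis[OF sigma_anti]) (simp add: sigma_basis_form)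
  then show ?thesis by (simp add: sigma_volume_def liouville_form_def)
qed

abbreviation index_28 :: "28 \<Rightarrow> nat" where "index_28 \<equiv> inv_into {..<28} of_nat"

lemma index_28_of_nat: "i < 28 \<Longrightarrow> index_28 (of_nat i) = i"
  by (rule inv_into_f_f[OF bij_betw_imp_inj_on[OF bij_of_nat_28]]) simp

text \<open>
  The Liouville volume of the Darboux basis \<open>basis_form\<close> is \<open>1\<close>, so in these coordinates it is the
  standard determinant, and the corresponding measure is Lebesgue measure.
\<close>

lemma sigma_volume_det:
  assumes "\<And>i. i < 28 \<Longrightarrow> v i \<in> primitive_forms"
  shows "sigma_volume v = det (\<chi> k. form_coords (v (index_28 k)))"
proof -
  let ?X = "\<chi> k. form_coords (v (index_28 k))"
  have "sigma_volume v = sigma_volume (\<lambda>i. param_form (?X $ of_nat i))"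
    by (rule sigma_volume_form(2)[unfolded local_form_def, rule_format])
      (simp add: index_28_of_nat param_form_form_coords assms)
  also have "\<dots> = of_real (det ?X) * sigma_volume (\<lambda>i. param_form (axis (of_nat i) 1))"
    by (rule top_form_det[OF sigma_volume_form bij_of_nat_28 bounded_linear.linear[OF bounded_linear_param_form]])
  also have "sigma_volume (\<lambda>i. param_form (axis (of_nat i) 1)) = sigma_volume basis_form"
  proof (rule sigma_volume_form(2)[unfolded local_form_def, rule_format])
    fix j :: nat assume j: "j < 28"
    have "param_form (axis (of_nat j) 1) = (\<Sum>i<28. if i = j then basis_form i else 0)"
      unfolding param_form_def by (rule sum.cong) (auto simp: axis_def of_nat_28_eq j)
    then show "param_form (axis (of_nat j) 1) = basis_form j" using j by simp
  qed
  finally show ?thesis by (simp add: sigma_volume_basis_form)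
qed

section \<open>Symmetries of the symplectic form on primitive forms\<close>

definition symplectic_matrix :: "real ^ 6 ^ 6 \<Rightarrow> bool"
  where "symplectic_matrix A \<longleftrightarrow> (\<forall>u v. omega (A *v u) (A *v v) = omega u v)"

lemma form3_pullback: "form3 (pullback A \<Omega>) v = form3 \<Omega> (\<lambda>i. A *v v i)"
  by (simp add: form3_def tri_pullback)

lemma alternating_pullback: "alternating \<Omega> \<Longrightarrow> alternating (pullback A \<Omega>)"
  by (simp add: alternating_def tri_pullback)

lemma primitive_pullback:
  assumes A: "symplectic_matrix A" and \<Omega>: "\<Omega> \<in> primitive_forms"
  shows "pullback A \<Omega> \<in> primitive_forms"
proof -
  have "wedge 3 2 (form3 (pullback A \<Omega>)) omega_complex v = wedge 3 2 (form3 \<Omega>) omega_complex (\<lambda>i. A *v v i)" for v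
    using A by (simp add: wedge_def form3_pullback omega_form_def symplectic_matrix_def)
  then show ?thesis
    using \<Omega> by (simp add: primitive_forms_def alternating_pullback)
qed

text \<open>
  The hypothesis on \<open>\<alpha>\<close> is restricted to a set \<open>P\<close> because \<open>sigma\<close> has good invariance properties only on
  the primitive forms.
\<close>

lemma wedge_power_transport:
  assumes "\<And>v. (\<And>i. v i \<in> P) \<Longrightarrow> \<alpha> (\<lambda>i. f (v i)) = \<alpha> v" and "\<And>i. v i \<in> P"
  shows "wedge_power m \<alpha> (\<lambda>i. f (v i)) = wedge_power m \<alpha> v"
  using assms(2)
proof (induction m arbitrary: v)
  case (Suc m)
  then show ?case using assms(1) by (simp add: wedge_def)
qed simp

text \<open>A symplectic matrix preserves \<open>\<omega>\<^sup>3 / 3!\<close>, so it has determinant \<open>1\<close> and preserves every six-form.\<close>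

lemma sigma_pullback:
  assumes A: "symplectic_matrix A" and "alternating \<alpha>" "alternating \<beta>"
  shows "sigma (pullback A \<alpha>) (pullback A \<beta>) = sigma \<alpha> \<beta>"
proof -
  let ?Av = "\<lambda>i. A *v std_frame i"
  have "liouville_form 3 omega_form ?Av = liouville_form 3 omega_form std_frame"
    unfolding liouville_form_def
    by (subst wedge_power_transport[where P = UNIV and f = "\<lambda>x. A *v x"])
      (use A in \<open>simp_all add: omega_form_def symplectic_matrix_def\<close>)
  then have 1: "volume_factor ?Av = 1"
    using six_form_eq[OF antisymmetric_liouville_omega local_liouville_omega multilinear_liouville_omega, of ?Av]
    by (simp add: liouville_std_frame)
  have "wedge33 (pullback A \<alpha>) (pullback A \<beta>) std_frame = wedge33 \<alpha> \<beta> ?Av"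
    by (simp add: wedge_def form3_pullback)
  also have "\<dots> = wedge33 \<alpha> \<beta> std_frame"
    using six_form_eq[OF wedge33_form, of \<alpha> \<beta> ?Av] 1 assms by simp
  finally show ?thesis
    using assms by (simp add: sigma_std_frame alternating_pullback)
qed

lemma postcompose_pullback: "linear S \<Longrightarrow> postcompose S (pullback A \<Omega>) = pullback A (postcompose S \<Omega>)"
  by (rule tri_eqI) (simp add: tri_postcompose tri_pullback)

lemma normalization_pullback:
  assumes A: "symplectic_matrix A" and \<Omega>: "\<Omega> \<in> primitive_forms"
  shows "normalization (pullback A \<Omega>) = normalization \<Omega>"
  unfolding normalization_sigma[OF \<Omega>] normalization_sigma[OF primitive_pullback[OF assms]] conj_form_def
    postcompose_pullback[OF linear_cnj]
  by (subst sigma_pullback[OF A]) (auto intro: primitive_alternating[OF \<Omega>] alternating_postcompose linear_cnj)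

text \<open>
  The element \<open>diag(c, 1/c)\<close> of \<open>SL(2,\<real>)\<close> acting on \<open>\<complex> = \<real>\<^sup>2\<close>.  It multiplies the real part of a form
  by \<open>c\<close>, which is what finally produces infinite volume.
\<close>

definition stretch :: "real \<Rightarrow> complex \<Rightarrow> complex"
  where "stretch c z = Complex (c * Re z) (Im z / c)"

lemma linear_stretch: "linear (stretch c)"
  by (auto intro!: linearI simp: stretch_def complex_eq_iff algebra_simps add_divide_distrib)

lemma sigma_stretch:
  assumes "c \<noteq> 0" "\<alpha> \<in> primitive_forms" "\<beta> \<in> primitive_forms"
  shows "sigma (postcompose (stretch c) \<alpha>) (postcompose (stretch c) \<beta>) = sigma \<alpha> \<beta>"
  unfolding sigma_coord[OF assms(2,3)] sigma_coord[OF assms(2,3)[THEN primitive_postcompose[OF linear_stretch]]]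
  using assms(1) by (simp add: coord_postcompose linear_stretch stretch_def)

lemma normalization_stretch:
  assumes "c \<noteq> 0"
  shows "normalization (postcompose (stretch c) \<Omega>) = normalization \<Omega>"
  using assms by (simp add: normalization_def coord_postcompose linear_stretch stretch_def)

lemma normalization_scaleR: "normalization (c *\<^sub>R \<Omega>) = c\<^sup>2 * normalization \<Omega>"
  by (simp add: normalization_def coord_linear sum_distrib_left power2_eq_square algebra_simps)

lemma continuous_normalization: "continuous_on UNIV normalization"
  unfolding normalization_def
  by (intro continuous_intros linear_continuous_on[OF bounded_linear_coord(1)] linear_continuous_on[OF bounded_linear_coord(2)])
    auto

section \<open>Frames of Lagrangian subspaces\<close>

definition isotropic3 :: "V \<Rightarrow> V \<Rightarrow> V \<Rightarrow> bool"
  where "isotropic3 u v w \<longleftrightarrow> omega u v = 0 \<and> omega u w = 0 \<and> omega v w = 0"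

definition independent3 :: "V \<Rightarrow> V \<Rightarrow> V \<Rightarrow> bool"
  where "independent3 u v w \<longleftrightarrow> (\<forall>a b c. a *\<^sub>R u + b *\<^sub>R v + c *\<^sub>R w = 0 \<longrightarrow> a = 0 \<and> b = 0 \<and> c = 0)"

lemma span3:
  assumes "x \<in> span {u, v, w}"
  obtains a b c where "x = a *\<^sub>R u + b *\<^sub>R v + c *\<^sub>R (w :: 'a::real_vector)"
proof -
  from assms obtain a where "x - a *\<^sub>R u \<in> span {v, w}" by (auto simp: span_insert)
  then obtain b where "x - a *\<^sub>R u - b *\<^sub>R v \<in> span {w}" by (auto simp: span_insert)
  then obtain c where "x - a *\<^sub>R u - b *\<^sub>R v = c *\<^sub>R w" by (auto simp: span_singleton)
  then have "x = a *\<^sub>R u + b *\<^sub>R v + c *\<^sub>R w" by (simp add: algebra_simps)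
  then show ?thesis by (rule that)
qed

lemma tri_span3:
  assumes alt: "alternating \<Omega>" and "x \<in> span {u, v, w}" "y \<in> span {u, v, w}" "z \<in> span {u, v, w}"
  obtains r :: real where "tri \<Omega> x y z = r *\<^sub>R tri \<Omega> u v w"
proof -
  obtain a b c where x: "x = a *\<^sub>R u + b *\<^sub>R v + c *\<^sub>R w" using span3 assms(2) by blast
  obtain a' b' c' where y: "y = a' *\<^sub>R u + b' *\<^sub>R v + c' *\<^sub>R w" using span3 assms(3) by blast
  obtain a'' b'' c'' where z: "z = a'' *\<^sub>R u + b'' *\<^sub>R v + c'' *\<^sub>R w" using span3 assms(4) by blast
  have d: "tri \<Omega> s s t = 0" "tri \<Omega> s t s = 0" "tri \<Omega> t s s = 0" for s t
    using alt unfolding alternating_def by blast+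
  note s = alternating_sorted[OF alt, where u = u and v = v and w = w]
  have "tri \<Omega> x y z = (a * b' * c'' - a * c' * b'' - b * a' * c'' + b * c' * a'' + c * a' * b'' - c * b' * a'') *\<^sub>R tri \<Omega> u v w"
    unfolding x y z by (simp add: tri_add tri_scaleR d s algebra_simps)
  then show ?thesis by (rule that)
qed

lemma independent3_dim:
  assumes "independent3 u v w"
  shows "dim (span {u, v, w}) = 3"
proof -
  have ne: "u \<noteq> v" "u \<noteq> w" "v \<noteq> w"
    using assms[unfolded independent3_def, rule_format, of 1 "- 1" 0]
      assms[unfolded independent3_def, rule_format, of 1 0 "- 1"]
      assms[unfolded independent3_def, rule_format, of 0 1 "- 1"] by auto
  have "independent {u, v, w}"
  proof (rule independent_if_scalars_zero)
    fix f x assume f: "(\<Sum>x\<in>{u, v, w}. f x *\<^sub>R x) = 0" and x: "x \<in> {u, v, w}"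
    have "f u *\<^sub>R u + f v *\<^sub>R v + f w *\<^sub>R w = 0"
      using f ne by (simp add: add.assoc)
    then show "f x = 0" using assms x by (auto simp: independent3_def)
  qed simp
  then show ?thesis
    using ne by (simp add: dim_eq_card_independent)
qed

lemma lagrangian_span:
  assumes "isotropic3 u v w" "independent3 u v w"
  shows "lagrangian (span {u, v, w})"
  unfolding lagrangian_def
proof (intro conjI ballI)
  show "dim (span {u, v, w}) = 3" by (rule independent3_dim) fact
  fix x y assume "x \<in> span {u, v, w}" "y \<in> span {u, v, w}"
  then obtain a b c a' b' c' where "x = a *\<^sub>R u + b *\<^sub>R v + c *\<^sub>R w" "y = a' *\<^sub>R u + b' *\<^sub>R v + c' *\<^sub>R w"
    by (metis span3)
  moreover have "omega v u = 0" "omega w u = 0" "omega w v = 0"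
    using assms(1) omega_anti[of v u] omega_anti[of w u] omega_anti[of w v] by (auto simp: isotropic3_def)
  ultimately show "omega x y = 0"
    using assms(1) by (simp add: isotropic3_def omega_linear)
qed simp

lemma U_forms_nonzero:
  assumes "\<Omega> \<in> U_forms" "isotropic3 u v w" "independent3 u v w"
  shows "tri \<Omega> u v w \<noteq> 0"
proof
  assume 0: "tri \<Omega> u v w = 0"
  obtain x y z where xyz: "x \<in> span {u, v, w}" "y \<in> span {u, v, w}" "z \<in> span {u, v, w}" "tri \<Omega> x y z \<noteq> 0"
    using assms(1) lagrangian_span[OF assms(2,3)] unfolding U_forms_def by blast
  have "alternating \<Omega>" using assms(1) by (auto simp: U_forms_def primitive_alternating)
  from tri_span3[OF this xyz(1-3)] 0 xyz(4) show False by auto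
qed

text \<open>
  Orthonormal bases of Lagrangian subspaces; these are the unitary frames of \<open>\<complex>\<^sup>3\<close> that are obtained by
  regarding \<open>\<real>\<^sup>6\<close> as \<open>\<complex>\<^sup>3\<close>.  They form a compact set and meet every Lagrangian subspace, so the
  condition that a form does not vanish on Lagrangian subspaces becomes a uniform lower bound.
\<close>

definition unitary_frames :: "(V \<times> V \<times> V) set"
  where "unitary_frames = {(u, v, w). norm u = 1 \<and> norm v = 1 \<and> norm w = 1 \<and>
    u \<bullet> v = 0 \<and> u \<bullet> w = 0 \<and> v \<bullet> w = 0 \<and> omega u v = 0 \<and> omega u w = 0 \<and> omega v w = 0}"

lemma orthogonal_independent3:
  assumes "u \<noteq> 0" "v \<noteq> 0" "w \<noteq> 0" "u \<bullet> v = 0" "u \<bullet> w = 0" "v \<bullet> w = 0"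
  shows "independent3 u v w"
  unfolding independent3_def
proof (intro allI impI)
  fix a b c assume 0: "a *\<^sub>R u + b *\<^sub>R v + c *\<^sub>R w = 0"
  have "a * (u \<bullet> u) = 0" "b * (v \<bullet> v) = 0" "c * (w \<bullet> w) = 0"
    using arg_cong[OF 0, of "\<lambda>x. u \<bullet> x"] arg_cong[OF 0, of "\<lambda>x. v \<bullet> x"] arg_cong[OF 0, of "\<lambda>x. w \<bullet> x"] assms(4-6)
    by (simp_all add: inner_add_right inner_commute)
  then show "a = 0 \<and> b = 0 \<and> c = 0" using assms(1-3) by simp
qed

lemma unitary_framesD:
  assumes "(u, v, w) \<in> unitary_frames"
  shows "isotropic3 u v w" "independent3 u v w"
  using assms by (auto simp: unitary_frames_def isotropic3_def intro!: orthogonal_independent3)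

text \<open>
  By the Gram-Schmidt process every Lagrangian subspace has an orthonormal basis, and the values of a
  form on triples in the subspace are multiples of the value on this basis.
\<close>

lemma U_forms_iff:
  "\<Omega> \<in> U_forms \<longleftrightarrow> \<Omega> \<in> primitive_forms \<and> (\<forall>(u, v, w)\<in>unitary_frames. tri \<Omega> u v w \<noteq> 0)"
proof
  assume "\<Omega> \<in> U_forms"
  then show "\<Omega> \<in> primitive_forms \<and> (\<forall>(u, v, w)\<in>unitary_frames. tri \<Omega> u v w \<noteq> 0)"
    using U_forms_nonzero unitary_framesD by (auto simp: U_forms_def)
next
  assume R: "\<Omega> \<in> primitive_forms \<and> (\<forall>(u, v, w)\<in>unitary_frames. tri \<Omega> u v w \<noteq> 0)"
  have "\<exists>u\<in>L. \<exists>v\<in>L. \<exists>w\<in>L. tri \<Omega> u v w \<noteq> 0" if L: "lagrangian L" for L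
  proof -
    have "subspace L" using L by (simp add: lagrangian_def)
    from orthonormal_basis_subspace[OF this] obtain B where
      B: "B \<subseteq> L" "pairwise orthogonal B" "\<And>x. x \<in> B \<Longrightarrow> norm x = 1" "card B = dim L"
      by metis
    have "card B = 3" using B L by (simp add: lagrangian_def)
    then obtain u v w where uvw: "B = {u, v, w}" "u \<noteq> v" "v \<noteq> w" "u \<noteq> w"
      by (auto simp: card_3_iff)
    have "u \<bullet> v = 0" "u \<bullet> w = 0" "v \<bullet> w = 0"
      using B(2) uvw by (auto simp: pairwise_def orthogonal_def)
    moreover have "u \<in> L" "v \<in> L" "w \<in> L" "norm u = 1" "norm v = 1" "norm w = 1"
      using B(1,3) uvw(1) by auto
    moreover have "omega x y = 0" if "x \<in> L" "y \<in> L" for x y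
      using L that unfolding lagrangian_def by blast
    ultimately have "(u, v, w) \<in> unitary_frames"
      by (simp add: unitary_frames_def)
    then have "tri \<Omega> u v w \<noteq> 0" using R by fast
    then show ?thesis using \<open>u \<in> L\<close> \<open>v \<in> L\<close> \<open>w \<in> L\<close> by (intro bexI)
  qed
  then show "\<Omega> \<in> U_forms" using R by (simp add: U_forms_def)
qed

lemma continuous_omega [continuous_intros]:
  "continuous_on S f \<Longrightarrow> continuous_on S g \<Longrightarrow> continuous_on S (\<lambda>x. omega (f x) (g x))"
  unfolding omega_eq by (intro continuous_intros)

lemma continuous_tri [continuous_intros]:
  "continuous_on S f \<Longrightarrow> continuous_on S g \<Longrightarrow> continuous_on S h \<Longrightarrow> continuous_on S (\<lambda>x. tri \<Omega> (f x) (g x) (h x))"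
  unfolding tri_def by (intro continuous_intros)

lemma compact_unitary_frames: "compact unitary_frames"
proof -
  have "bounded unitary_frames"
  proof (rule bounded_subset)
    show "bounded (cball 0 1 \<times> cball 0 1 \<times> cball 0 1 :: (V \<times> V \<times> V) set)"
      by (intro bounded_Times bounded_cball)
  qed (auto simp: unitary_frames_def)
  moreover have "closed unitary_frames"
    unfolding unitary_frames_def case_prod_beta
    by (intro closed_Collect_conj closed_Collect_eq continuous_intros)
  ultimately show ?thesis by (simp add: compact_eq_bounded_closed)
qed

lemma unit_frame: "(\<e> 1, \<e> 2, \<e> 3) \<in> unitary_frames"
  by (simp add: unitary_frames_def omega_eq unit_vec_nth inner_axis_axis norm_eq_1)

lemma U_forms_lower_bound:
  assumes "\<Omega> \<in> U_forms"
  obtains c where "c > 0" "\<And>u v w. (u, v, w) \<in> unitary_frames \<Longrightarrow> c \<le> norm (tri \<Omega> u v w)"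
proof -
  have "continuous_on unitary_frames (\<lambda>p. norm (tri \<Omega> (fst p) (fst (snd p)) (snd (snd p))))"
    by (intro continuous_intros)
  from continuous_attains_inf[OF compact_unitary_frames _ this] unit_frame obtain p where
    p: "p \<in> unitary_frames" "\<And>q. q \<in> unitary_frames \<Longrightarrow>
      norm (tri \<Omega> (fst p) (fst (snd p)) (snd (snd p))) \<le> norm (tri \<Omega> (fst q) (fst (snd q)) (snd (snd q)))"
    by blast
  have "norm (tri \<Omega> (fst p) (fst (snd p)) (snd (snd p))) > 0"
    using assms p(1) by (auto simp: U_forms_iff case_prod_beta)
  then show ?thesis by (rule that) (use p(2) in fastforce)
qed

lemma unitary_frames_perturb:
  assumes "(u, v, w) \<in> unitary_frames"
  shows "norm (tri \<Omega> u v w) \<le> norm (tri \<Omega>' u v w) + norm (\<Omega>' - \<Omega>)"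
proof -
  have "norm (tri (\<Omega>' - \<Omega>) u v w) \<le> norm (\<Omega>' - \<Omega>)"
    using norm_tri_le[of "\<Omega>' - \<Omega>" u v w] assms by (simp add: unitary_frames_def)
  moreover have "norm (tri \<Omega> u v w) \<le> norm (tri \<Omega>' u v w) + norm (tri (\<Omega>' - \<Omega>) u v w)"
    unfolding tri_diff by (metis norm_triangle_sub norm_minus_commute)
  ultimately show ?thesis by linarith
qed

text \<open>
  Halving the lower bound that compactness gives for \<open>\<Omega>\<close> makes it valid on a whole neighbourhood.
  One constant serves as the radius of the neighbourhood and as the bound.
\<close>

lemma U_forms_nearby:
  assumes "\<Omega> \<in> U_forms"
  obtains c where "c > 0"
    "\<And>\<Omega>' u v w. norm (\<Omega>' - \<Omega>) < c \<Longrightarrow> (u, v, w) \<in> unitary_frames \<Longrightarrow> c \<le> norm (tri \<Omega>' u v w)"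
    "\<And>\<Omega>'. \<Omega>' \<in> primitive_forms \<Longrightarrow> norm (\<Omega>' - \<Omega>) < c \<Longrightarrow> \<Omega>' \<in> U_forms"
proof -
  obtain c where c: "c > 0" "\<And>u v w. (u, v, w) \<in> unitary_frames \<Longrightarrow> c \<le> norm (tri \<Omega> u v w)"
    using U_forms_lower_bound[OF assms] by blast
  have *: "c / 2 \<le> norm (tri \<Omega>' u v w)" if "norm (\<Omega>' - \<Omega>) < c / 2" "(u, v, w) \<in> unitary_frames" for \<Omega>' u v w
    using c(2)[OF that(2)] unitary_frames_perturb[OF that(2), of \<Omega> \<Omega>'] that(1) by linarith
  show ?thesis
  proof (rule that[of "c / 2"])
    show "\<Omega>' \<in> U_forms" if "\<Omega>' \<in> primitive_forms" "norm (\<Omega>' - \<Omega>) < c / 2" for \<Omega>'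
      using that c(1) * by (fastforce simp: U_forms_iff)
  qed (use c * in auto)
qed

section \<open>The orientation of a form\<close>

text \<open>
  Fix an isotropic plane spanned by \<open>u\<close> and \<open>v\<close>.  The Lagrangian subspaces that contain it correspond
  to the lines in the symplectic plane \<open>{u, v}\<^sup>\<omega> / span {u, v}\<close>, and \<open>orientation\<close> is the determinant,
  in the basis \<open>g, h\<close>, of the real-linear map \<open>x \<mapsto> \<Omega>(x, u, v)\<close> from this plane to \<open>\<complex>\<close>.  As \<open>\<Omega>\<close> vanishes on no
  Lagrangian subspace, this map is bijective; it preserves or reverses orientation, and this decides
  the direction in which the phase turns.
\<close>

definition orientation :: "trilinear \<Rightarrow> V \<Rightarrow> V \<Rightarrow> V \<Rightarrow> V \<Rightarrow> real"
  where "orientation \<Omega> u v g h = Im (cnj (tri \<Omega> g u v) * tri \<Omega> h u v)"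

definition isotropic_pair :: "V \<Rightarrow> V \<Rightarrow> bool"
  where "isotropic_pair u v \<longleftrightarrow> omega u v = 0 \<and> (\<forall>a b. a *\<^sub>R u + b *\<^sub>R v = 0 \<longrightarrow> a = 0 \<and> b = 0)"

definition dual_pair :: "V \<Rightarrow> V \<Rightarrow> V \<Rightarrow> V \<Rightarrow> bool"
  where "dual_pair u v g h \<longleftrightarrow> omega u g = 0 \<and> omega v g = 0 \<and> omega u h = 0 \<and> omega v h = 0"

lemma Im_cnj_zero_dependent:
  assumes "Im (cnj a * b) = 0"
  obtains r s :: real where "(r, s) \<noteq> (0, 0)" "r *\<^sub>R a + s *\<^sub>R b = 0"
proof (cases "a = 0")
  case True
  then show ?thesis by (intro that[of 1 0]) auto
next
  case False
  have "cnj a * b = of_real (Re (cnj a * b))"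
    using assms by (simp add: complex_eq_iff)
  moreover have "cnj a * a = of_real ((norm a)\<^sup>2)"
    by (metis complex_norm_square mult.commute)
  moreover have "cnj a * (r *\<^sub>R a - s *\<^sub>R b) = of_real r * (cnj a * a) - of_real s * (cnj a * b)" for r s
    by (simp add: scaleR_conv_of_real algebra_simps)
  ultimately have "cnj a * (Re (cnj a * b) *\<^sub>R a - (norm a)\<^sup>2 *\<^sub>R b) = 0"
    by (metis cancel_comm_monoid_add_class.diff_cancel mult.commute)
  then have "Re (cnj a * b) *\<^sub>R a + (- (norm a)\<^sup>2) *\<^sub>R b = 0"
    using False by simp
  then show ?thesis
    by (rule that[rotated]) (use False in simp)
qed

text \<open>
  If the determinant vanished, some combination \<open>x\<close> of \<open>g\<close> and \<open>h\<close> would satisfy \<open>\<Omega>(x, u, v) = 0\<close>, although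
  \<open>x, u, v\<close> span a Lagrangian subspace.
\<close>

lemma orientation_nonzero:
  assumes \<Omega>: "\<Omega> \<in> U_forms" and uv: "isotropic_pair u v" and d: "dual_pair u v g h" and gh: "omega g h \<noteq> 0"
  shows "orientation \<Omega> u v g h \<noteq> 0"
proof
  assume "orientation \<Omega> u v g h = 0"
  then obtain r s :: real where rs: "(r, s) \<noteq> (0, 0)" "r *\<^sub>R tri \<Omega> g u v + s *\<^sub>R tri \<Omega> h u v = 0"
    using Im_cnj_zero_dependent unfolding orientation_def by blast
  define x where "x = r *\<^sub>R g + s *\<^sub>R h"
  have hg: "omega h g = - omega g h" by (rule omega_anti)
  have xgh: "omega x h = r * omega g h" "omega x g = - s * omega g h"
    by (simp_all add: x_def omega_linear hg)
  have gu: "omega g u = 0" "omega g v = 0" "omega h u = 0" "omega h v = 0"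
    using d omega_anti[of g u] omega_anti[of g v] omega_anti[of h u] omega_anti[of h v] by (auto simp: dual_pair_def)
  have "isotropic3 x u v"
    using uv gu by (simp add: isotropic3_def isotropic_pair_def x_def omega_linear)
  moreover have "independent3 x u v"
    unfolding independent3_def
  proof (intro allI impI)
    fix a b c assume 0: "a *\<^sub>R x + b *\<^sub>R u + c *\<^sub>R v = 0"
    have "omega (a *\<^sub>R x + b *\<^sub>R u + c *\<^sub>R v) g = 0" "omega (a *\<^sub>R x + b *\<^sub>R u + c *\<^sub>R v) h = 0"
      unfolding 0 by (simp_all add: omega_linear)
    then have "a * omega x g = 0" "a * omega x h = 0"
      using d by (simp_all add: omega_linear dual_pair_def)
    then have "a = 0" using rs(1) gh by (auto simp: xgh)
    then show "a = 0 \<and> b = 0 \<and> c = 0" using 0 uv by (simp add: isotropic_pair_def)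
  qed
  ultimately have "tri \<Omega> x u v \<noteq> 0" by (rule U_forms_nonzero[OF \<Omega>])
  then show False using rs(2) by (simp add: x_def tri_add tri_scaleR)
qed

lemma orientation_linear:
  "orientation \<Omega> u v (a *\<^sub>R g + b *\<^sub>R g') h = a * orientation \<Omega> u v g h + b * orientation \<Omega> u v g' h"
  "orientation \<Omega> u v h (a *\<^sub>R g + b *\<^sub>R g') = a * orientation \<Omega> u v h g + b * orientation \<Omega> u v h g'"
  "orientation \<Omega> u v g h = - orientation \<Omega> u v h g"
  by (simp_all add: orientation_def tri_add tri_scaleR algebra_simps)

text \<open>
  Both \<open>orientation\<close> and \<open>omega\<close> are area forms on the symplectic plane that belongs to \<open>u\<close> and \<open>v\<close>, hence
  proportional.  Only the sign of the factor is needed: the combination of \<open>h\<close> and \<open>h'\<close> on which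
  \<open>orientation\<close> vanishes has to be one on which \<open>omega\<close> vanishes.
\<close>

lemma orientation_sign_step:
  assumes \<Omega>: "\<Omega> \<in> U_forms" and uv: "isotropic_pair u v"
    and d: "dual_pair u v g h" "dual_pair u v g h'" and "omega g h \<noteq> 0" "omega g h' \<noteq> 0"
  shows "orientation \<Omega> u v g h * omega g h > 0 \<longleftrightarrow> orientation \<Omega> u v g h' * omega g h' > 0"
proof -
  define p p' where p: "p = orientation \<Omega> u v g h" "p' = orientation \<Omega> u v g h'"
  have nz: "p \<noteq> 0" "p' \<noteq> 0"
    unfolding p using orientation_nonzero[OF \<Omega> uv] assms by auto
  define x where "x = p' *\<^sub>R h + (- p) *\<^sub>R h'"
  have "orientation \<Omega> u v g x = 0"
    unfolding x_def orientation_linear(2) by (simp add: p)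
  moreover have "dual_pair u v g x"
    using d by (simp add: dual_pair_def x_def omega_linear)
  ultimately have "omega g x = 0" using orientation_nonzero[OF \<Omega> uv] by blast
  then have "p' * omega g h = p * omega g h'" by (simp add: x_def omega_linear)
  then have "(p * p') * (p * omega g h) = (p * p) * (p * omega g h')" by (simp add: algebra_simps)
  moreover have "(p' * p') * (p * omega g h) = (p * p') * (p * omega g h')"
    using \<open>p' * omega g h = p * omega g h'\<close> by (simp add: algebra_simps)
  moreover have "(p' * p') * (p * omega g h) = p * p * (p' * omega g h')"
    using \<open>p' * omega g h = p * omega g h'\<close> by (simp add: algebra_simps)
  moreover have "p' * p' > 0" "p * p > 0" using nz by (auto simp: zero_less_mult_iff)
  ultimately have "p * omega g h > 0 \<longleftrightarrow> p' * omega g h' > 0"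
    by (metis zero_less_mult_pos zero_less_mult_iff mult_pos_pos)
  then show ?thesis by (simp add: p)
qed

lemma orientation_sign_independent:
  assumes \<Omega>: "\<Omega> \<in> U_forms" and uv: "isotropic_pair u v"
    and d: "dual_pair u v g h" "dual_pair u v g' h'" and nz: "omega g h \<noteq> 0" "omega g' h' \<noteq> 0"
  shows "orientation \<Omega> u v g h * omega g h > 0 \<longleftrightarrow> orientation \<Omega> u v g' h' * omega g' h' > 0"
proof -
  let ?\<rho> = "\<lambda>g h. orientation \<Omega> u v g h * omega g h > 0"
  have sym: "?\<rho> g h = ?\<rho> h g" for g h
    using orientation_linear(3)[of \<Omega> u v g h] omega_anti[of g h] by simp
  have step: "?\<rho> g h = ?\<rho> g h'" if "dual_pair u v g h" "dual_pair u v g h'" "omega g h \<noteq> 0" "omega g h' \<noteq> 0" for g h h'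
    by (rule orientation_sign_step[OF \<Omega> uv that])
  have flip: "omega x y \<noteq> 0 \<Longrightarrow> omega y x \<noteq> 0" for x y using omega_anti[of x y] by simp
  have dd: "dual_pair u v x y" if "x \<in> {g, h, g', h', g + g'}" "y \<in> {g, h, g', h', g + g'}" for x y
    using that d by (auto simp: dual_pair_def omega_linear)
  \<comment> \<open>If the two pairs are linked by a non-zero value of omega, one vector is exchanged at a time.\<close>
  have cross: "?\<rho> g h = ?\<rho> g' h'" if "omega a b \<noteq> 0" "a \<in> {g, h}" "b \<in> {g', h'}" for a b
  proof -
    have "?\<rho> g h = ?\<rho> a b"
    proof (cases "a = g")
      case True
      then show ?thesis using step[of g h b] dd that nz by auto
    next
      case False
      then have "a = h" using that by auto
      then show ?thesis using sym[of g h] step[of h g b] dd that nz flip[of g h] by auto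
    qed
    also have "\<dots> = ?\<rho> g' h'"
    proof (cases "b = g'")
      case True
      then show ?thesis using sym[of a b] step[of g' a h'] dd that nz flip[of a b] by auto
    next
      case False
      then have "b = h'" using that by auto
      then show ?thesis using sym[of a b] sym[of g' h'] step[of h' a g'] dd that nz flip[of a b] flip[of g' h'] by auto
    qed
    finally show ?thesis .
  qed
  show ?thesis
  proof (cases "omega g g' = 0 \<and> omega g h' = 0 \<and> omega h g' = 0 \<and> omega h h' = 0")
    case False
    then show ?thesis using cross[of g g'] cross[of g h'] cross[of h g'] cross[of h h'] by blast
  next
    case True
    then have z: "omega g' h = 0" "omega h g' = 0" "omega h' g = 0" using omega_anti[of g' h] omega_anti[of h' g] by auto
    \<comment> \<open>Otherwise the sum of two members is linked to both pairs.\<close>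
    have nz': "omega (g + g') h \<noteq> 0" "omega (g + g') h' \<noteq> 0"
      using nz True z by (simp_all add: omega_linear)
    have "?\<rho> g h = ?\<rho> h (g + g')"
      using sym[of g h] step[of h g "g + g'"] dd nz flip nz' by auto
    also have "\<dots> = ?\<rho> (g + g') h'"
      using sym[of h "g + g'"] step[of "g + g'" h h'] dd nz' by auto
    also have "\<dots> = ?\<rho> g' h'"
      using sym[of "g + g'" h'] sym[of g' h'] step[of h' "g + g'" g'] dd nz' nz flip by auto
    finally show ?thesis .
  qed
qed

text \<open>
  The orientation of the phase along the Lagrangian subspaces through the plane spanned by \<open>u\<close> and
  \<open>v\<close>, measured against the orientation that \<open>\<omega>\<close> induces.
\<close>

definition positive_pair :: "trilinear \<Rightarrow> V \<Rightarrow> V \<Rightarrow> bool"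
  where "positive_pair \<Omega> u v \<longleftrightarrow> (\<exists>g h. dual_pair u v g h \<and> omega g h \<noteq> 0 \<and> orientation \<Omega> u v g h * omega g h > 0)"

lemma positive_pair_iff:
  assumes "\<Omega> \<in> U_forms" "isotropic_pair u v" "dual_pair u v g h" "omega g h \<noteq> 0"
  shows "positive_pair \<Omega> u v \<longleftrightarrow> orientation \<Omega> u v g h * omega g h > 0"
  using orientation_sign_independent[OF assms(1,2)] assms(3,4) unfolding positive_pair_def by blast

text \<open>The negative of the complex structure: multiplication by \<open>- \<i>\<close> when \<open>(x, y)\<close> is read as \<open>x + \<i> y\<close>.\<close>

definition dual_vec :: "V \<Rightarrow> V"
  where "dual_vec x = (\<chi> i. if i = 1 then x $ 4 else if i = 2 then x $ 5 else if i = 3 then x $ 6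
     else if i = 4 then - x $ 1 else if i = 5 then - x $ 2 else - x $ 3)"

lemma dual_vec_nth: "dual_vec x $ 1 = x $ 4" "dual_vec x $ 2 = x $ 5" "dual_vec x $ 3 = x $ 6"
  "dual_vec x $ 4 = - x $ 1" "dual_vec x $ 5 = - x $ 2" "dual_vec x $ 6 = - x $ 3"
  by (simp_all add: dual_vec_def)

lemma inner_V: "(x :: V) \<bullet> y = x $ 1 * y $ 1 + x $ 2 * y $ 2 + x $ 3 * y $ 3 + x $ 4 * y $ 4 + x $ 5 * y $ 5 + x $ 6 * y $ 6"
  by (simp add: inner_vec_def sum_6)

lemma omega_inner: "omega x y = x \<bullet> dual_vec y"
  by (simp add: omega_eq inner_V dual_vec_nth)

lemma dual_vec_dual_vec: "dual_vec (dual_vec x) = - x"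
  by (simp add: vec_eq_iff forall_6 dual_vec_nth)

lemma omega_dual_vec: "omega x (dual_vec y) = - (x \<bullet> y)" "omega (dual_vec x) (dual_vec y) = omega x y"
  "dual_vec x \<bullet> dual_vec y = x \<bullet> y" "dual_vec x \<bullet> y = - (x \<bullet> dual_vec y)"
  by (simp_all add: omega_eq inner_V dual_vec_nth)

text \<open>
  The component of \<open>v\<close> orthogonal to \<open>S\<close> represents a linear functional that vanishes on \<open>S\<close> and not
  on \<open>v\<close>; \<open>dual_vec\<close> turns it into a functional given by \<open>\<omega>\<close>.
\<close>

lemma omega_dual_exists:
  assumes "v \<notin> span S"
  obtains p where "omega v p = 1" "\<And>s. s \<in> S \<Longrightarrow> omega s p = 0"
proof -
  obtain y z where yz: "y \<in> span S" "\<And>w. w \<in> span S \<Longrightarrow> orthogonal z w" "v = y + z"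
    using orthogonal_subspace_decomp_exists[of S v] by metis
  have "z \<noteq> 0" using assms yz by auto
  have vz: "v \<bullet> z = z \<bullet> z" using yz(2)[OF yz(1)] unfolding yz(3) by (simp add: inner_add_left inner_add_right orthogonal_def inner_commute)
  define p where "p = - (1 / (z \<bullet> z)) *\<^sub>R dual_vec z"
  have om: "omega x p = (x \<bullet> z) / (z \<bullet> z)" for x
    unfolding p_def omega_linear omega_dual_vec by simp
  show ?thesis
  proof (rule that[of p])
    show "omega v p = 1" using \<open>z \<noteq> 0\<close> by (simp add: om vz)
    show "omega s p = 0" if "s \<in> S" for s
      using yz(2)[OF span_base[OF that]] by (simp add: om orthogonal_def inner_commute)
  qed
qed

lemma orthogonal_vector_exists:
  assumes "finite S" "card S \<le> 5"
  obtains x where "x \<noteq> 0" "\<And>s. s \<in> S \<Longrightarrow> s \<bullet> (x :: V) = 0"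
proof -
  have "dim S < DIM(V)"
    using dim_le_card'[OF assms(1)] assms(2) by simp
  then obtain x where "x \<noteq> 0" "\<And>y. y \<in> span S \<Longrightarrow> orthogonal x y"
    using orthogonal_to_subspace_exists by metis
  then show ?thesis using that[of x] span_base by (fastforce simp: orthogonal_def inner_commute)
qed

lemma isotropic_pair_commute: "isotropic_pair u v \<longleftrightarrow> isotropic_pair v u"
  using omega_anti[of u v] by (auto simp: isotropic_pair_def) (metis add.commute)+

lemma positive_pair_commute: "alternating \<Omega> \<Longrightarrow> positive_pair \<Omega> u v \<longleftrightarrow> positive_pair \<Omega> v u"
  unfolding positive_pair_def dual_pair_def orientation_def
  using alternating_swap(2)[of \<Omega> _ u v] by (auto simp: alternating_swap(2)[of \<Omega> _ u v])

text \<open>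
  Inside the Lagrangian subspace spanned by \<open>v, v', z\<close> the plane of \<open>v, z\<close> is rotated into the plane
  of \<open>v', z\<close>.  Along the rotation, with a rotating dual pair, the orientation is a continuous
  function without zeros.
\<close>

lemma positive_pair_rotate:
  assumes \<Omega>: "\<Omega> \<in> U_forms" and iso: "isotropic3 v v' z" and ind: "independent3 v v' z"
  shows "positive_pair \<Omega> v z \<longleftrightarrow> positive_pair \<Omega> v' z"
proof -
  have o: "omega v v' = 0" "omega v z = 0" "omega v' z = 0" "omega v' v = 0" "omega z v = 0" "omega z v' = 0"
    using iso omega_anti[of v' v] omega_anti[of z v] omega_anti[of z v'] by (auto simp: isotropic3_def)
  have "v \<notin> span {v', z}"
  proof
    assume "v \<in> span {v', z}"
    then obtain b c where "v = b *\<^sub>R v' + c *\<^sub>R z" using span3[of v v' z z] by (auto simp: scaleR_add_left[symmetric]) (metis add.assoc scaleR_add_left)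
    then have "1 *\<^sub>R v + (- b) *\<^sub>R v' + (- c) *\<^sub>R z = 0" by simp
    then show False using ind unfolding independent3_def by (metis zero_neq_one)
  qed
  then obtain p where p: "omega v p = 1" "omega v' p = 0" "omega z p = 0"
    by (rule omega_dual_exists) auto
  have "v' \<notin> span {v, z}"
  proof
    assume "v' \<in> span {v, z}"
    then obtain b c where "v' = b *\<^sub>R v + c *\<^sub>R z" using span3[of v' v z z] by (auto simp: scaleR_add_left[symmetric]) (metis add.assoc scaleR_add_left)
    then have "b *\<^sub>R v + (- 1) *\<^sub>R v' + c *\<^sub>R z = 0" by simp
    then show False using ind unfolding independent3_def by (metis neg_equal_0_iff_equal zero_neq_one)
  qed
  then obtain p' where p': "omega v' p' = 1" "omega v p' = 0" "omega z p' = 0"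
    by (rule omega_dual_exists) auto
  \<comment> \<open>The vector and its dual pair rotate together, so the pairing of the two stays 1.\<close>
  define V' where "V' t = cos t *\<^sub>R v + sin t *\<^sub>R v'" for t :: real
  define G where "G t = (- sin t) *\<^sub>R v + cos t *\<^sub>R v'" for t :: real
  define H where "H t = (- sin t) *\<^sub>R p + cos t *\<^sub>R p'" for t :: real
  have dual: "dual_pair (V' t) z (G t) (H t)" and gh: "omega (G t) (H t) = 1" for t
    using sin_cos_squared_add[of t]
    by (simp_all add: dual_pair_def V'_def G_def H_def omega_linear o p p' power2_eq_square)
  have iso': "isotropic_pair (V' t) z" for t
    unfolding isotropic_pair_def
  proof (intro conjI allI impI)
    show "omega (V' t) z = 0" by (simp add: V'_def omega_linear o)
    fix a b assume 0: "a *\<^sub>R V' t + b *\<^sub>R z = 0"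
    then have "(a * cos t) *\<^sub>R v + (a * sin t) *\<^sub>R v' + b *\<^sub>R z = 0" by (simp add: V'_def scaleR_add_right)
    then have z: "a * cos t = 0" "a * sin t = 0" "b = 0" using ind unfolding independent3_def by blast+
    have "a = a * ((sin t)\<^sup>2 + (cos t)\<^sup>2)" by simp
    also have "\<dots> = a * sin t * sin t + a * cos t * cos t" by (simp only: power2_eq_square distrib_left mult.assoc)
    finally show "a = 0" "b = 0" using z by simp_all
  qed
  define f where "f t = orientation \<Omega> (V' t) z (G t) (H t)" for t
  have nz: "f t \<noteq> 0" for t
    unfolding f_def by (rule orientation_nonzero[OF \<Omega> iso' dual]) (simp add: gh)
  have cont: "continuous_on UNIV f"
    unfolding f_def orientation_def V'_def G_def H_def by (intro continuous_intros)
  have "f 0 > 0 \<longleftrightarrow> f (pi / 2) > 0"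
  proof (rule ccontr)
    assume "(f 0 > 0) \<noteq> (f (pi / 2) > 0)"
    then have "f 0 \<le> 0 \<and> 0 \<le> f (pi / 2) \<or> f (pi / 2) \<le> 0 \<and> 0 \<le> f 0" by linarith
    then obtain t where "f t = 0"
      using IVT'[of f 0 0 "pi / 2"] IVT2'[of f "pi / 2" 0 0] continuous_on_subset[OF cont subset_UNIV] pi_half_ge_zero
      by metis
    then show False using nz by blast
  qed
  moreover have "positive_pair \<Omega> (V' t) z \<longleftrightarrow> f t > 0" for t
    using positive_pair_iff[OF \<Omega> iso' dual, of t] by (simp add: gh f_def)
  ultimately have "positive_pair \<Omega> (V' 0) z \<longleftrightarrow> positive_pair \<Omega> (V' (pi / 2)) z" by simp
  then show ?thesis by (simp add: V'_def)
qed

lemma isotropic_pairI: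
  assumes "omega u v = 0" "u \<noteq> 0" "v \<noteq> 0" "u \<bullet> v = 0"
  shows "isotropic_pair u v"
  unfolding isotropic_pair_def
proof (intro conjI allI impI)
  fix a b assume 0: "a *\<^sub>R u + b *\<^sub>R v = 0"
  have "a * (u \<bullet> u) = 0" "b * (v \<bullet> v) = 0"
    using arg_cong[OF 0, of "\<lambda>x. u \<bullet> x"] arg_cong[OF 0, of "\<lambda>x. v \<bullet> x"] assms(4)
    by (simp_all add: inner_add_right inner_commute)
  then show "a = 0" "b = 0" using assms(2,3) by auto
qed (rule assms)

lemma isotropic_pair_nonzero: "isotropic_pair u v \<Longrightarrow> u \<noteq> 0 \<and> v \<noteq> 0"
proof
  assume *: "isotropic_pair u v"
  show "u \<noteq> 0" using *[unfolded isotropic_pair_def, THEN conjunct2, rule_format, of 1 0] by auto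
  show "v \<noteq> 0" using *[unfolded isotropic_pair_def, THEN conjunct2, rule_format, of 0 1] by auto
qed

text \<open>
  If \<open>\<omega>(v, v') = 0\<close>, either \<open>v, v', z\<close> span a Lagrangian subspace or both planes coincide.  In general
  a vector \<open>x\<close> that is \<open>\<omega>\<close>-orthogonal to \<open>v, v', z\<close> serves as an intermediate stop: there are four
  linear conditions on \<open>x\<close> in six dimensions.
\<close>

lemma positive_pair_change_first:
  assumes \<Omega>: "\<Omega> \<in> U_forms" and p: "isotropic_pair v z" and p': "isotropic_pair v' z"
  shows "positive_pair \<Omega> v z \<longleftrightarrow> positive_pair \<Omega> v' z"
proof -
  have oz: "omega v z = 0" "omega v' z = 0" using p p' by (auto simp: isotropic_pair_def)
  have main: "positive_pair \<Omega> v z \<longleftrightarrow> positive_pair \<Omega> v' z"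
    if p: "isotropic_pair v z" and p': "isotropic_pair v' z" and o: "omega v v' = 0" for v v'
  proof (cases "independent3 v v' z")
    case True
    then show ?thesis
      using positive_pair_rotate[OF \<Omega> _ True] p p' o by (simp add: isotropic3_def isotropic_pair_def)
  next
    case False
    then obtain a b c where abc: "a *\<^sub>R v + b *\<^sub>R v' + c *\<^sub>R z = 0" "\<not> (a = 0 \<and> b = 0 \<and> c = 0)"
      by (auto simp: independent3_def)
    have "b \<noteq> 0"
    proof
      assume "b = 0"
      then have "a *\<^sub>R v + c *\<^sub>R z = 0" using abc by simp
      then show False using p abc(2) \<open>b = 0\<close> by (auto simp: isotropic_pair_def)
    qed
    have "a \<noteq> 0"
    proof
      assume "a = 0"
      then have "b *\<^sub>R v' + c *\<^sub>R z = 0" using abc by simp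
      then show False using p' \<open>b \<noteq> 0\<close> by (auto simp: isotropic_pair_def)
    qed
    define r s where "r = - a / b" "s = - c / b"
    have "b *\<^sub>R v' = - (a *\<^sub>R v) - c *\<^sub>R z"
      using abc(1) by (simp add: algebra_simps eq_neg_iff_add_eq_0)
    then have "(1 / b) *\<^sub>R (b *\<^sub>R v') = (1 / b) *\<^sub>R (- (a *\<^sub>R v) - c *\<^sub>R z)" by simp
    then have v': "v' = r *\<^sub>R v + s *\<^sub>R z"
      using \<open>b \<noteq> 0\<close> by (simp add: r_s_def scaleR_diff_right)
    have r: "r \<noteq> 0" using \<open>a \<noteq> 0\<close> \<open>b \<noteq> 0\<close> by (simp add: r_s_def)
    have alt: "tri \<Omega> x z z = 0" for x
      using \<Omega> by (auto simp: U_forms_def primitive_forms_def alternating_def)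
    have or: "orientation \<Omega> v' z g h = r\<^sup>2 * orientation \<Omega> v z g h" for g h
      unfolding orientation_def v' by (simp add: tri_add tri_scaleR alt power2_eq_square algebra_simps)
    have "dual_pair v' z g h \<longleftrightarrow> dual_pair v z g h" for g h
      using r unfolding dual_pair_def v' by (auto simp: omega_linear)
    then show ?thesis
      unfolding positive_pair_def or using r
      by (simp add: mult.assoc zero_less_mult_iff)
  qed
  obtain x where x: "x \<noteq> 0" "\<And>s. s \<in> {dual_vec v, dual_vec v', dual_vec z, z} \<Longrightarrow> s \<bullet> x = 0"
  proof (rule orthogonal_vector_exists)
    show "card {dual_vec v, dual_vec v', dual_vec z, z} \<le> 5"
      using card_length[of "[dual_vec v, dual_vec v', dual_vec z, z]"] by simp
  qed auto
  have o: "omega x v = 0" "omega x v' = 0" "omega x z = 0" "z \<bullet> x = 0"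
    using x(2)[of "dual_vec v"] x(2)[of "dual_vec v'"] x(2)[of "dual_vec z"] x(2)[of z]
    by (simp_all add: omega_inner inner_commute[of x])
  have "isotropic_pair x z"
    using isotropic_pairI[of x z] o x(1) isotropic_pair_nonzero[OF p] by (simp add: inner_commute)
  then show ?thesis
    using main[OF p, of x] main[OF _ p', of x] o omega_anti[of v x] by simp
qed

text \<open>
  Both vectors are replaced one after the other, through a vector \<open>x\<close> that is \<open>\<omega>\<close>-orthogonal to \<open>u\<close> and
  \<open>u'\<close>.  This proves algebraically that the sense in which the phase turns is the same for
  all pencils of Lagrangian subspaces, which replaces the connectedness of the symplectic group in the proof
  that \<open>U_plus\<close> is invariant.
\<close>

lemma positive_pair_constant:
  assumes \<Omega>: "\<Omega> \<in> U_forms" and p: "isotropic_pair u v" and p': "isotropic_pair u' v'"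
  shows "positive_pair \<Omega> u v \<longleftrightarrow> positive_pair \<Omega> u' v'"
proof -
  have alt: "alternating \<Omega>" using \<Omega> by (auto simp: U_forms_def primitive_alternating)
  obtain x where x: "x \<noteq> 0" "\<And>s. s \<in> {dual_vec u, dual_vec u', u, u'} \<Longrightarrow> s \<bullet> x = 0"
  proof (rule orthogonal_vector_exists)
    show "card {dual_vec u, dual_vec u', u, u'} \<le> 5"
      using card_length[of "[dual_vec u, dual_vec u', u, u']"] by simp
  qed auto
  have q: "isotropic_pair x u" "isotropic_pair x u'"
    using x(1) x(2)[of "dual_vec u"] x(2)[of "dual_vec u'"] x(2)[of u] x(2)[of u']
      isotropic_pair_nonzero[OF p] isotropic_pair_nonzero[OF p']
    by (simp_all add: isotropic_pairI omega_inner inner_commute[of x])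
  have "positive_pair \<Omega> u v = positive_pair \<Omega> v u" by (rule positive_pair_commute[OF alt])
  also have "\<dots> = positive_pair \<Omega> x u"
    by (rule positive_pair_change_first[OF \<Omega>]) (use p q isotropic_pair_commute in auto)
  also have "\<dots> = positive_pair \<Omega> u x" by (rule positive_pair_commute[OF alt])
  also have "\<dots> = positive_pair \<Omega> u' x"
    by (rule positive_pair_change_first[OF \<Omega>]) (use q isotropic_pair_commute in auto)
  also have "\<dots> = positive_pair \<Omega> x u'" by (rule positive_pair_commute[OF alt])
  also have "\<dots> = positive_pair \<Omega> v' u'"
    by (rule positive_pair_change_first[OF \<Omega>]) (use p' q isotropic_pair_commute in auto)
  also have "\<dots> = positive_pair \<Omega> u' v'" by (rule positive_pair_commute[OF alt])
  finally show ?thesis .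
qed

section \<open>The phase loop\<close>

lemma phase_span:
  assumes \<Omega>: "alternating \<Omega>" and nz: "tri \<Omega> u v w \<noteq> 0"
  shows "phase \<Omega> (span {u, v, w}) = (sgn (tri \<Omega> u v w))\<^sup>2"
  unfolding phase_def
proof (rule the_equality)
  show "\<exists>x\<in>span {u, v, w}. \<exists>y\<in>span {u, v, w}. \<exists>z\<in>span {u, v, w}.
      tri \<Omega> x y z \<noteq> 0 \<and> (sgn (tri \<Omega> u v w))\<^sup>2 = (sgn (tri \<Omega> x y z))\<^sup>2"
    by (rule bexI[of _ u], rule bexI[of _ v], rule bexI[of _ w]) (auto simp: nz span_base)
  fix p assume "\<exists>x\<in>span {u, v, w}. \<exists>y\<in>span {u, v, w}. \<exists>z\<in>span {u, v, w}.
      tri \<Omega> x y z \<noteq> 0 \<and> p = (sgn (tri \<Omega> x y z))\<^sup>2"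
  then obtain x y z where xyz: "x \<in> span {u, v, w}" "y \<in> span {u, v, w}" "z \<in> span {u, v, w}"
    "tri \<Omega> x y z \<noteq> 0" "p = (sgn (tri \<Omega> x y z))\<^sup>2" by blast
  obtain r :: real where r: "tri \<Omega> x y z = r *\<^sub>R tri \<Omega> u v w" using tri_span3[OF \<Omega> xyz(1-3)] by blast
  have "r \<noteq> 0" using r xyz(4) by auto
  then have "(sgn r)\<^sup>2 = 1" by (simp add: sgn_real_def)
  moreover have "sgn (tri \<Omega> x y z) = sgn r *\<^sub>R sgn (tri \<Omega> u v w)"
    unfolding r by (rule sgn_scaleR)
  ultimately show "p = (sgn (tri \<Omega> u v w))\<^sup>2"
    unfolding xyz(5) by (simp add: scaleR_power)
qed

text \<open>The squared phase of \<open>\<Omega>\<close> along a pencil of Lagrangian subspaces, where \<open>a\<close> and \<open>b\<close> are its values on the two spanning members.\<close>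

definition line_phase :: "complex \<Rightarrow> complex \<Rightarrow> real \<Rightarrow> complex"
  where "line_phase a b s = (sgn (cos (pi * s) *\<^sub>R a + sin (pi * s) *\<^sub>R b))\<^sup>2"

lemma combination_nonzero:
  assumes "Im (cnj a * b) \<noteq> 0"
  shows "cos t *\<^sub>R a + sin t *\<^sub>R b \<noteq> 0"
proof
  assume 0: "cos t *\<^sub>R a + sin t *\<^sub>R b = 0"
  have "Im (cnj a * (cos t *\<^sub>R a + sin t *\<^sub>R b)) = sin t * Im (cnj a * b)"
    by (simp add: algebra_simps)
  moreover have "Im (cnj (cos t *\<^sub>R a + sin t *\<^sub>R b) * b) = cos t * Im (cnj a * b)"
    by (simp add: algebra_simps)
  ultimately have "sin t = 0" "cos t = 0" using assms unfolding 0 by auto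
  then show False using sin_cos_squared_add[of t] by simp
qed

lemma phase_lgr_loop:
  assumes \<Omega>: "\<Omega> \<in> U_forms"
  shows "phase \<Omega> (lgr_loop s) = line_phase (tri \<Omega> (\<e> 1) (\<e> 2) (\<e> 3)) (tri \<Omega> (\<e> 4) (\<e> 2) (\<e> 3)) s"
proof -
  let ?x = "cos (pi * s) *\<^sub>R \<e> 1 + sin (pi * s) *\<^sub>R \<e> 4"
  have "norm ?x = 1"
    by (simp add: norm_eq_1 inner_V unit_vec_nth power2_eq_square[symmetric])
  then have "(?x, \<e> 2, \<e> 3) \<in> unitary_frames"
    by (simp add: unitary_frames_def omega_eq inner_V unit_vec_nth)
  then have "tri \<Omega> ?x (\<e> 2) (\<e> 3) \<noteq> 0" using \<Omega> by (auto simp: U_forms_iff)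
  from phase_span[OF _ this] \<Omega> show ?thesis
    by (simp add: lgr_loop_def line_phase_def U_forms_iff primitive_alternating tri_add tri_scaleR)
qed

text \<open>
  Through pairs \<open>(A, B)\<close> with \<open>Im (cnj A * B) > 0\<close> the pair \<open>(a, b)\<close> is moved linearly to \<open>(u, \<i> u)\<close> with
  \<open>u = sgn a\<close>, for which the loop is the standard one rotated by \<open>u\<^sup>2\<close>.
\<close>

lemma line_phase_homotopic:
  assumes pos: "Im (cnj a * b) > 0"
  shows "homotopic_loops (sphere 0 1) (line_phase a b) (\<lambda>s. cis (2 * pi * s))"
proof -
  have "a \<noteq> 0" using pos by auto
  define u where "u = sgn a"
  have nu: "norm u = 1" using \<open>a \<noteq> 0\<close> by (simp add: u_def norm_sgn)
  have u: "u * cnj u = 1" "norm u = 1" "a = norm a *\<^sub>R u"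
    using \<open>a \<noteq> 0\<close> complex_norm_square[of u] nu by (simp_all add: u_def sgn_div_norm)
  define A B :: "real \<Rightarrow> complex" where "A t = (1 - t) *\<^sub>R a + t *\<^sub>R u" and "B t = (1 - t) *\<^sub>R b + t *\<^sub>R (\<i> * u)" for t
  have "Im (cnj a * b) = norm a * Im (cnj u * b)"
    by (subst u(3)) simp
  then have ub: "Im (cnj u * b) > 0" using pos \<open>a \<noteq> 0\<close> by (simp add: zero_less_mult_iff)
  have AB: "Im (cnj (A t) * B t) > 0" if "t \<in> {0..1}" for t
  proof -
    have A: "A t = ((1 - t) * norm a + t) *\<^sub>R u"
      unfolding A_def by (subst u(3)) (simp add: scaleR_add_left)
    have "cnj u * (\<i> * u) = \<i>" using u(1) by (simp add: mult.commute mult.left_commute)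
    then have "cnj (A t) * B t = ((1 - t) * norm a + t) *\<^sub>R ((1 - t) *\<^sub>R (cnj u * b) + t *\<^sub>R \<i>)"
      unfolding A B_def by (simp add: algebra_simps)
    then have "Im (cnj (A t) * B t) = ((1 - t) * norm a + t) * ((1 - t) * Im (cnj u * b) + t)" by simp
    moreover have "(1 - t) * norm a + t > 0" "(1 - t) * Im (cnj u * b) + t > 0"
      using that \<open>a \<noteq> 0\<close> ub by (cases "t = 1"; simp add: add_pos_nonneg)+
    ultimately show ?thesis by simp
  qed
  \<comment> \<open>The last factor undoes the rotation of the endpoint by the square of u.\<close>
  define h where "h p = (sgn (cos (pi * snd p) *\<^sub>R A (fst p) + sin (pi * snd p) *\<^sub>R B (fst p)))\<^sup>2 *
      cis (- (2 * Arg u) * fst p)" for p :: "real \<times> real"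
  have nz: "cos s *\<^sub>R A t + sin s *\<^sub>R B t \<noteq> 0" if "t \<in> {0..1}" for s t
    using combination_nonzero AB[OF that] by (metis less_irrefl)
  show ?thesis
    unfolding homotopic_loops
  proof (intro exI[of _ h] conjI ballI)
    have c: "continuous_on ({0..1} \<times> {0..1}) (\<lambda>p :: real \<times> real. sgn (cos (pi * snd p) *\<^sub>R A (fst p) + sin (pi * snd p) *\<^sub>R B (fst p)))"
      using nz unfolding A_def B_def by (intro continuous_intros) auto
    show "continuous_on ({0..1} \<times> {0..1}) h"
      unfolding h_def by (rule continuous_on_mult[OF continuous_on_power[OF c]]) (intro continuous_intros)
    show "h \<in> {0..1} \<times> {0..1} \<rightarrow> sphere 0 1"
      using nz by (auto simp: h_def norm_mult norm_power norm_sgn)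
    show "h (0, s) = line_phase a b s" for s
      by (simp add: h_def line_phase_def A_def B_def)
    have cu: "cis (- (2 * Arg u)) * u\<^sup>2 = 1"
    proof -
      have "u = cis (Arg u)" using cis_Arg[of u] u(2) \<open>a \<noteq> 0\<close> by (simp add: u_def sgn_zero_iff)
      from arg_cong[OF this, of "\<lambda>z. z\<^sup>2"] have "u\<^sup>2 = cis (2 * Arg u)" by (simp only: power2_eq_square cis_mult mult_2)
      then show ?thesis by (simp add: cis_mult mult.assoc)
    qed
    show "h (1, s) = cis (2 * pi * s)" for s
    proof -
      have "cos (pi * s) *\<^sub>R u + sin (pi * s) *\<^sub>R (\<i> * u) = cis (pi * s) * u"
        by (simp add: complex_eq_iff cis.ctr algebra_simps)
      then have "h (1, s) = (cis (pi * s))\<^sup>2 * (cis (- (2 * Arg u)) * u\<^sup>2)"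
        using u(2) by (simp add: h_def A_def B_def sgn_div_norm norm_mult power_mult_distrib)
      then have "h (1, s) = cis (pi * s) * cis (pi * s)" unfolding cu by (simp only: mult_1_right power2_eq_square)
      then show ?thesis by (simp add: cis_mult mult.assoc)
    qed
    show "pathfinish (h \<circ> Pair t) = pathstart (h \<circ> Pair t)" for t
      by (simp add: h_def pathfinish_def pathstart_def sgn_minus)
  qed
qed

lemma cis_loops_not_homotopic:
  "\<not> homotopic_loops (sphere 0 1) (\<lambda>s. cis (2 * pi * s)) (\<lambda>s. cis (- (2 * pi * s)))"
proof
  assume "homotopic_loops (sphere 0 1) (\<lambda>s. cis (2 * pi * s)) (\<lambda>s. cis (- (2 * pi * s)))"
  then have hl: "homotopic_loops (- {0}) (\<lambda>s. cis (2 * pi * s)) (\<lambda>s. cis (- (2 * pi * s)))"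
    by (rule homotopic_loops_subset) auto
  have c: "(\<lambda>s. cis (2 * pi * s)) = circlepath 0 1"
    by (simp add: fun_eq_iff circlepath cis_conv_exp mult_ac)
  have "reversepath (circlepath 0 1) s = cis (- (2 * pi * s))" for s
  proof -
    have "reversepath (circlepath 0 1) s = cis (2 * pi * (1 - s))"
      unfolding reversepath_def c[symmetric] ..
    also have "2 * pi * (1 - s) = - (2 * pi * s) + 2 * pi" by (simp add: algebra_simps)
    also have "cis \<dots> = cis (- (2 * pi * s)) * cis (2 * pi)" by (rule cis_mult[symmetric])
    finally show ?thesis by simp
  qed
  then have r: "(\<lambda>s. cis (- (2 * pi * s))) = reversepath (circlepath 0 1)"
    by (simp add: fun_eq_iff)
  have "winding_number (circlepath 0 1) 0 = winding_number (reversepath (circlepath 0 1)) 0"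
    using winding_number_homotopic_loops[OF hl] unfolding c r .
  moreover have "winding_number (circlepath 0 1) 0 = 1"
    by (rule winding_number_circlepath_centre) simp
  moreover have "winding_number (reversepath (circlepath 0 1)) 0 = - winding_number (circlepath 0 1) 0"
    by (rule winding_number_reversepath) auto
  ultimately show False by simp
qed

lemma line_phase_cnj: "line_phase (cnj a) (cnj b) s = cnj (line_phase a b s)"
proof -
  have "sgn (cnj z) = cnj (sgn z)" for z by (simp add: sgn_div_norm)
  moreover have "cos (pi * s) *\<^sub>R cnj a + sin (pi * s) *\<^sub>R cnj b = cnj (cos (pi * s) *\<^sub>R a + sin (pi * s) *\<^sub>R b)" by simp
  ultimately show ?thesis by (simp only: line_phase_def complex_cnj_power)
qed

text \<open>
  For \<open>Im (cnj a * b) < 0\<close> complex conjugation shows that the loop is homotopic to the standard loop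
  run backwards, whose winding number is \<open>-1\<close>.
\<close>

lemma line_phase_homotopic_iff:
  assumes nz: "Im (cnj a * b) \<noteq> 0"
  shows "homotopic_loops (sphere 0 1) (line_phase a b) (\<lambda>s. cis (2 * pi * s)) \<longleftrightarrow> Im (cnj a * b) > 0"
proof
  assume h: "homotopic_loops (sphere 0 1) (line_phase a b) (\<lambda>s. cis (2 * pi * s))"
  show "Im (cnj a * b) > 0"
  proof (rule ccontr)
    assume "\<not> Im (cnj a * b) > 0"
    then have "Im (cnj (cnj a) * cnj b) > 0" using nz by simp
    from line_phase_homotopic[OF this]
    have "homotopic_loops (sphere 0 1) (cnj \<circ> line_phase (cnj a) (cnj b)) (cnj \<circ> (\<lambda>s. cis (2 * pi * s)))"
      by (rule homotopic_loops_continuous_image) (auto intro!: continuous_intros)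
    moreover have "cnj \<circ> line_phase (cnj a) (cnj b) = line_phase a b"
      by (simp add: fun_eq_iff line_phase_cnj)
    moreover have "cnj \<circ> (\<lambda>s. cis (2 * pi * s)) = (\<lambda>s. cis (- (2 * pi * s)))"
      by (simp add: fun_eq_iff cis_cnj)
    ultimately show False
      using h cis_loops_not_homotopic homotopic_loops_sym homotopic_loops_trans by metis
  qed
qed (rule line_phase_homotopic)

lemma std_isotropic_pair: "isotropic_pair (\<e> 2) (\<e> 3)"
  by (rule isotropic_pairI) (auto simp: omega_eq inner_V unit_vec_nth)

lemma std_dual_pair: "dual_pair (\<e> 2) (\<e> 3) (\<e> 1) (\<e> 4)" "omega (\<e> 1) (\<e> 4) = 1"
  by (simp_all add: dual_pair_def omega_eq unit_vec_nth)

lemma U_plus_eq: "U_plus = {\<Omega> \<in> U_forms. orientation \<Omega> (\<e> 2) (\<e> 3) (\<e> 1) (\<e> 4) > 0}"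
proof -
  have "homotopic_loops (sphere 0 1) (\<lambda>s. phase \<Omega> (lgr_loop s)) (\<lambda>s. cis (2 * pi * s)) \<longleftrightarrow>
      orientation \<Omega> (\<e> 2) (\<e> 3) (\<e> 1) (\<e> 4) > 0" if \<Omega>: "\<Omega> \<in> U_forms" for \<Omega>
    unfolding phase_lgr_loop[OF \<Omega>] orientation_def
    by (rule line_phase_homotopic_iff)
      (use orientation_nonzero[OF \<Omega> std_isotropic_pair std_dual_pair(1)] std_dual_pair(2) in \<open>simp add: orientation_def\<close>)
  then show ?thesis unfolding U_plus_def by blast
qed

lemma U_plus_iff_positive_pair:
  "\<Omega> \<in> U_plus \<longleftrightarrow> \<Omega> \<in> U_forms \<and> positive_pair \<Omega> (\<e> 2) (\<e> 3)"
  using positive_pair_iff[OF _ std_isotropic_pair std_dual_pair(1)] std_dual_pair(2) by (auto simp: U_plus_eq)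

section \<open>Invariance of the positive forms\<close>

lemma symplectic_matrix_injective:
  assumes "symplectic_matrix A" "A *v x = 0"
  shows "x = 0"
proof -
  have "omega x y = 0" for y
    using assms unfolding symplectic_matrix_def by (metis omega_linear(9))
  from this[of "dual_vec x"] show ?thesis by (simp add: omega_dual_vec)
qed

lemma U_forms_pullback:
  assumes A: "symplectic_matrix A" and \<Omega>: "\<Omega> \<in> U_forms"
  shows "pullback A \<Omega> \<in> U_forms"
proof -
  have prim: "pullback A \<Omega> \<in> primitive_forms" using assms by (auto simp: U_forms_def intro: primitive_pullback)
  have "tri (pullback A \<Omega>) u v w \<noteq> 0" if uvw: "(u, v, w) \<in> unitary_frames" for u v w
  proof -
  have "isotropic3 (A *v u) (A *v v) (A *v w)"
    using A unitary_framesD(1)[OF uvw] by (simp add: isotropic3_def symplectic_matrix_def)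
  moreover have "independent3 (A *v u) (A *v v) (A *v w)"
    unfolding independent3_def
  proof (intro allI impI)
    fix a b c assume "a *\<^sub>R (A *v u) + b *\<^sub>R (A *v v) + c *\<^sub>R (A *v w) = 0"
    then have "A *v (a *\<^sub>R u + b *\<^sub>R v + c *\<^sub>R w) = 0"
      by (simp add: matrix_vector_right_distrib matrix_vector_mult_scaleR)
    from symplectic_matrix_injective[OF A this] show "a = 0 \<and> b = 0 \<and> c = 0"
      using unitary_framesD(2)[OF uvw] by (simp add: independent3_def)
  qed
  ultimately show ?thesis
    using U_forms_nonzero[OF \<Omega>] by (simp add: tri_pullback)
  qed
  with prim show ?thesis by (auto simp: U_forms_iff)
qed

text \<open>
  Pulling back by \<open>A\<close> moves the standard isotropic plane to its image under \<open>A\<close>, and the orientation is the same for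
  all isotropic planes.
\<close>

lemma U_plus_pullback:
  assumes A: "symplectic_matrix A" and \<Omega>: "\<Omega> \<in> U_plus"
  shows "pullback A \<Omega> \<in> U_plus"
proof -
  have U: "\<Omega> \<in> U_forms" using \<Omega> by (simp add: U_plus_eq)
  have o: "omega (A *v x) (A *v y) = omega x y" for x y using A by (simp add: symplectic_matrix_def)
  have iso: "isotropic_pair (A *v \<e> 2) (A *v \<e> 3)"
    unfolding isotropic_pair_def
  proof (intro conjI allI impI)
    show "omega (A *v \<e> 2) (A *v \<e> 3) = 0" using std_isotropic_pair by (simp add: o isotropic_pair_def)
    fix a b assume "a *\<^sub>R (A *v \<e> 2) + b *\<^sub>R (A *v \<e> 3) = 0"
    then have "A *v (a *\<^sub>R \<e> 2 + b *\<^sub>R \<e> 3) = 0"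
      by (simp add: matrix_vector_right_distrib matrix_vector_mult_scaleR)
    from symplectic_matrix_injective[OF A this] show "a = 0" "b = 0"
      using std_isotropic_pair unfolding isotropic_pair_def by blast+
  qed
  have d: "dual_pair (A *v \<e> 2) (A *v \<e> 3) (A *v \<e> 1) (A *v \<e> 4)" "omega (A *v \<e> 1) (A *v \<e> 4) = 1"
    using std_dual_pair by (simp_all add: dual_pair_def o)
  have "positive_pair \<Omega> (A *v \<e> 2) (A *v \<e> 3)"
    using positive_pair_constant[OF U iso std_isotropic_pair] \<Omega> by (simp add: U_plus_iff_positive_pair)
  then have "orientation \<Omega> (A *v \<e> 2) (A *v \<e> 3) (A *v \<e> 1) (A *v \<e> 4) > 0"
    using positive_pair_iff[OF U iso d(1)] d(2) by simp
  then show ?thesis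
    using U_forms_pullback[OF A U] by (simp add: U_plus_eq orientation_def tri_pullback)
qed

lemma U1_plus_pullback: "symplectic_matrix A \<Longrightarrow> \<Omega> \<in> U1_plus \<Longrightarrow> pullback A \<Omega> \<in> U1_plus"
  using U_plus_pullback normalization_pullback by (auto simp: U1_plus_eq U_plus_def U_forms_def)

lemma U_plus_stretch:
  assumes "c > 0" "\<Omega> \<in> U_plus"
  shows "postcompose (stretch c) \<Omega> \<in> U_plus"
proof -
  have "stretch c z = 0 \<longleftrightarrow> z = 0" for z using assms(1) by (simp add: stretch_def complex_eq_iff)
  then show ?thesis
    using assms by (auto simp: U_plus_eq U_forms_iff primitive_postcompose tri_postcompose linear_stretch
        orientation_def stretch_def)
qed

lemma U1_plus_stretch: "c > 0 \<Longrightarrow> \<Omega> \<in> U1_plus \<Longrightarrow> postcompose (stretch c) \<Omega> \<in> U1_plus"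
  using U_plus_stretch normalization_stretch by (simp add: U1_plus_eq)

lemma U_plus_scaleR:
  assumes "t > 0" "\<Omega> \<in> U_plus"
  shows "t *\<^sub>R \<Omega> \<in> U_plus"
  using assms by (auto simp: U_plus_eq U_forms_iff tri_scaleR orientation_def
      subspace_scale[OF subspace_primitive] zero_less_mult_iff)

lemma U_plus_primitive: "\<Omega> \<in> U_plus \<Longrightarrow> \<Omega> \<in> primitive_forms"
  by (simp add: U_plus_def U_forms_def)

text \<open>In coordinates, because the primitive forms are not open among all trilinear maps.\<close>

lemma open_U_plus_coords: "open {x. param_form x \<in> U_plus}"
proof (rule open_subopen[THEN iffD2], rule ballI)
  fix x assume "x \<in> {x. param_form x \<in> U_plus}"
  then have x: "param_form x \<in> U_forms" "orientation (param_form x) (\<e> 2) (\<e> 3) (\<e> 1) (\<e> 4) > 0"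
    by (auto simp: U_plus_eq)
  obtain c where c: "c > 0" "\<And>\<Omega>'. \<Omega>' \<in> primitive_forms \<Longrightarrow> norm (\<Omega>' - param_form x) < c \<Longrightarrow> \<Omega>' \<in> U_forms"
    using U_forms_nearby[OF x(1)] by metis
  let ?N = "{y. norm (param_form y - param_form x) < c \<and> orientation (param_form y) (\<e> 2) (\<e> 3) (\<e> 1) (\<e> 4) > 0}"
  have "open ?N"
    unfolding orientation_def
    by (intro open_Collect_conj open_Collect_less continuous_intros
        linear_continuous_on[OF bounded_linear_param_form]
        linear_continuous_on[OF bounded_linear_compose[OF bounded_linear_tri bounded_linear_param_form]])
  moreover have "x \<in> ?N" using c(1) x by simp
  moreover have "?N \<subseteq> {x. param_form x \<in> U_plus}"
    using c(2) primitive_param_form by (auto simp: U_plus_eq)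
  ultimately show "\<exists>T. open T \<and> x \<in> T \<and> T \<subseteq> {x. param_form x \<in> U_plus}" by blast
qed

section \<open>Lebesgue measure and polar coordinates\<close>

abbreviation index_27 :: "27 \<Rightarrow> nat" where "index_27 \<equiv> inv_into {..<27} of_nat"

lemma index_27_of_nat: "i < 27 \<Longrightarrow> index_27 (of_nat i) = i"
  by (rule inv_into_f_f[OF bij_betw_imp_inj_on[OF bij_of_nat_27]]) simp

lemma index_27: "index_27 k < 27" "of_nat (index_27 k) = k"
proof -
  have k: "k \<in> of_nat ` {..<27}"
    using bij_of_nat_27 by (simp add: bij_betw_def)
  show "index_27 k < 27" using inv_into_into[OF k] by simp
  show "of_nat (index_27 k) = k" by (rule f_inv_into_f[OF k])
qed

lemma of_nat_Suc_index_27: "of_nat (Suc (index_27 k)) \<noteq> (0 :: 28)"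
  using of_nat_28_eq[of "Suc (index_27 k)" 0] index_27(1)[of k] by simp

lemma forall_28: "(\<forall>k :: 28. P k) \<longleftrightarrow> P (of_nat 0) \<and> (\<forall>k :: 27. P (of_nat (Suc (index_27 k))))"
proof safe
  fix k :: 28 assume P: "P (of_nat 0)" "\<forall>k. P (of_nat (Suc (index_27 k)))"
  obtain j where j: "j < 28" "k = of_nat j" by (rule of_nat_28_cases)
  show "P k"
  proof (cases j)
    case (Suc i)
    then have "index_27 (of_nat i) = i" using j by (simp add: index_27_of_nat)
    then show ?thesis using P(2)[rule_format, of "of_nat i"] j Suc by simp
  qed (use P j in simp)
qed auto

lemma prod_28: "(\<Prod>k\<in>UNIV. f (k :: 28)) = f (of_nat 0) * (\<Prod>k\<in>UNIV. f (of_nat (Suc (index_27 k))))"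
proof -
  have "(\<Prod>k\<in>UNIV. f k) = (\<Prod>i<28. f (of_nat i))"
    by (rule prod.reindex_bij_betw[OF bij_of_nat_28, symmetric])
  also have "\<dots> = f (of_nat 0) * (\<Prod>i<27. f (of_nat (Suc i)))"
    using prod.lessThan_Suc_shift[of "\<lambda>i. f (of_nat i)" 27] by (simp del: of_nat_Suc)
  also have "(\<Prod>i<27. f (of_nat (Suc i))) = (\<Prod>i<27. f (of_nat (Suc (index_27 (of_nat i)))))"
    by (rule prod.cong) (simp_all add: index_27_of_nat del: of_nat_Suc)
  also have "\<dots> = (\<Prod>k\<in>UNIV. f (of_nat (Suc (index_27 k))))"
    by (rule prod.reindex_bij_betw[OF bij_of_nat_27])
  finally show ?thesis .
qed

definition cons_vec :: "real \<times> (real ^ 27) \<Rightarrow> real ^ 28"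
  where "cons_vec p = (\<Sum>i<28. (case i of 0 \<Rightarrow> fst p | Suc k \<Rightarrow> snd p $ of_nat k) *\<^sub>R axis (of_nat i) 1)"

definition tail_vec :: "real ^ 28 \<Rightarrow> real ^ 27"
  where "tail_vec y = (\<chi> k. y $ of_nat (Suc (index_27 k)))"

lemma cons_vec_nth: "cons_vec p $ of_nat 0 = fst p" "i < 27 \<Longrightarrow> cons_vec p $ of_nat (Suc i) = snd p $ of_nat i"
  unfolding cons_vec_def by (subst coords_axis_sum; simp)+

lemma cons_vec_0: "cons_vec p $ 0 = fst p"
  using cons_vec_nth(1)[of p] by simp

lemma tail_cons_vec: "tail_vec (cons_vec p) = snd p"
  by (simp add: vec_eq_iff tail_vec_def cons_vec_nth index_27 del: of_nat_Suc)

lemma bounded_linear_tail_vec: "bounded_linear tail_vec"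
  unfolding linear_conv_bounded_linear[symmetric] by (auto intro!: linearI simp: tail_vec_def vec_eq_iff)

lemma continuous_on_cons_vec: "continuous_on UNIV cons_vec"
proof -
  have "continuous_on UNIV (\<lambda>p :: real \<times> (real ^ 27). case i of 0 \<Rightarrow> fst p | Suc k \<Rightarrow> snd p $ of_nat k)" for i :: nat
    by (cases i) (auto intro!: continuous_intros)
  then show ?thesis unfolding cons_vec_def by (intro continuous_intros)
qed

lemma emeasure_lborel_box_cart:
  fixes l u :: "real ^ 'n"
  assumes "\<And>i. l $ i \<le> u $ i"
  shows "emeasure lborel (box l u) = ennreal (\<Prod>i\<in>UNIV. u $ i - l $ i)"
proof -
  have B: "(Basis :: (real ^ 'n) set) = (\<lambda>i. axis i 1) ` UNIV"
    by (auto simp: Basis_vec_def)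
  have inj: "inj (\<lambda>i :: 'n. axis i (1 :: real))" by (auto simp: inj_def axis_eq_axis)
  have "emeasure lborel (box l u) = (\<Prod>b\<in>Basis. (u - l) \<bullet> b)"
    by (rule emeasure_lborel_box) (use assms in \<open>auto simp: B inner_axis\<close>)
  also have "(\<Prod>b\<in>Basis. (u - l) \<bullet> b) = (\<Prod>i\<in>UNIV. u $ i - l $ i)"
    unfolding B prod.reindex[OF inj] by (simp add: inner_axis)
  finally show ?thesis .
qed

text \<open>Identifying \<open>\<real> \<times> \<real>\<^sup>2\<^sup>7\<close> with \<open>\<real>\<^sup>2\<^sup>8\<close> allows the radial coordinate to be integrated separately.\<close>

lemma lborel_cons_vec: "lborel = distr (lborel :: (real \<times> (real ^ 27)) measure) borel cons_vec"
proof (rule lborel_eqI)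
  have meas: "cons_vec \<in> borel_measurable lborel"
    using borel_measurable_continuous_onI[OF continuous_on_cons_vec] by simp
  fix l u :: "real ^ 28" assume "\<And>b. b \<in> Basis \<Longrightarrow> l \<bullet> b \<le> u \<bullet> b"
  then have lu: "l $ i \<le> u $ i" for i
    using axis_in_Basis_iff[of i "1 :: real"] by (fastforce simp: inner_axis)
  have pre: "cons_vec -` box l u = {l $ of_nat 0 <..< u $ of_nat 0} \<times> box (tail_vec l) (tail_vec u)"
    by (auto simp: mem_box_cart forall_28 cons_vec_0 cons_vec_nth index_27 tail_vec_def simp del: of_nat_Suc)
  have "emeasure (distr lborel borel cons_vec) (box l u) =
      emeasure (lborel \<Otimes>\<^sub>M lborel) ({l $ of_nat 0 <..< u $ of_nat 0} \<times> box (tail_vec l) (tail_vec u))"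
    using meas by (subst emeasure_distr) (simp_all add: pre lborel_prod)
  also have "\<dots> = emeasure lborel {l $ of_nat 0 <..< u $ of_nat 0} * emeasure lborel (box (tail_vec l) (tail_vec u))"
    by (rule lborel.emeasure_pair_measure_Times) auto
  also have "\<dots> = ennreal (u $ of_nat 0 - l $ of_nat 0) * ennreal (\<Prod>i\<in>UNIV. tail_vec u $ i - tail_vec l $ i)"
    using lu by (subst emeasure_lborel_box_cart) (simp_all add: tail_vec_def)
  also have "\<dots> = ennreal (\<Prod>i\<in>UNIV. u $ i - l $ i)"
    unfolding prod_28 using lu by (subst ennreal_mult[symmetric]) (auto simp: tail_vec_def intro!: prod_nonneg)
  also have "\<dots> = emeasure lborel (box l u)"
    by (rule emeasure_lborel_box_cart[symmetric]) (rule lu)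
  also have "\<dots> = (\<Prod>b\<in>Basis. (u - l) \<bullet> b)"
    by (rule emeasure_lborel_box) fact
  finally show "emeasure (distr lborel borel cons_vec) (box l u) = (\<Prod>b\<in>Basis. (u - l) \<bullet> b)" .
qed simp

lemma nn_integral_cons_vec:
  assumes [measurable]: "f \<in> borel_measurable borel"
  shows "(\<integral>\<^sup>+ y. f y \<partial>lborel) = (\<integral>\<^sup>+ t. \<integral>\<^sup>+ u. f (cons_vec (t, u)) \<partial>lborel \<partial>lborel)"
proof -
  have [measurable]: "cons_vec \<in> borel_measurable borel"
    by (rule borel_measurable_continuous_onI[OF continuous_on_cons_vec])
  have "(\<integral>\<^sup>+ y. f y \<partial>lborel) = (\<integral>\<^sup>+ p. f (cons_vec p) \<partial>lborel)"
    by (subst lborel_cons_vec, subst nn_integral_distr) simp_all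
  also have "\<dots> = (\<integral>\<^sup>+ p. f (cons_vec p) \<partial>(lborel \<Otimes>\<^sub>M lborel))"
    by (simp add: lborel_prod)
  also have "\<dots> = (\<integral>\<^sup>+ t. \<integral>\<^sup>+ u. f (cons_vec (t, u)) \<partial>lborel \<partial>lborel)"
    by (rule lborel.nn_integral_fst[symmetric]) (simp add: lborel_prod)
  finally show ?thesis .
qed

text \<open>
  The change of variables formula for gauge integrals compares finite measures; for nonnegative
  integrands the case of an infinite integral is added.
\<close>

lemma emeasure_differentiable_image:
  fixes g :: "real ^ 'n::{finite, wellorder} \<Rightarrow> real ^ 'n::_"
  assumes S: "S \<in> sets borel" and der: "\<And>x. x \<in> S \<Longrightarrow> (g has_derivative g' x) (at x within S)"
    and inj: "inj_on g S" and gS: "g ` S \<in> sets borel"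
    and meas: "(\<lambda>x. indicator S x * \<bar>det (matrix (g' x))\<bar>) \<in> borel_measurable borel"
  shows "emeasure lborel (g ` S) = (\<integral>\<^sup>+ x. ennreal \<bar>det (matrix (g' x))\<bar> * indicator S x \<partial>lborel)" (is "_ = ?I")
proof -
  let ?h = "\<lambda>x. indicator S x * \<bar>det (matrix (g' x))\<bar>"
  have S': "S \<in> sets lebesgue" using S by simp
  note cv = has_measure_differentiable_image[OF S' der inj]
  have I: "?I = (\<integral>\<^sup>+ x. ennreal (?h x) \<partial>lborel)"
    by (rule nn_integral_cong) (auto simp: indicator_def)
  have leb: "emeasure lborel (g ` S) = emeasure lebesgue (g ` S)"
    using gS by simp
  show ?thesis
  proof (cases "?I = \<infinity>")
    case False
    then obtain m where m: "m \<ge> 0" "?I = ennreal m" by (cases ?I) auto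
    have "(?h has_integral m) UNIV"
      by (rule nn_integral_has_integral) (use meas m I in auto)
    then have "((\<lambda>x. \<bar>det (matrix (g' x))\<bar>) has_integral m) S"
      by (subst has_integral_restrict_UNIV[symmetric])
        (erule has_integral_eq[rotated], simp add: indicator_def)
    with cv have gm: "g ` S \<in> lmeasurable" "measure lebesgue (g ` S) = m" by auto
    then show ?thesis unfolding leb m(2) by (simp add: emeasure_eq_measure2)
  next
    case True
    have "g ` S \<notin> lmeasurable"
    proof
      assume "g ` S \<in> lmeasurable"
      then have "((\<lambda>x. \<bar>det (matrix (g' x))\<bar>) has_integral measure lebesgue (g ` S)) S" using cv by blast
      from nn_integral_has_integral_lebesgue'[OF _ this] True show False by simp
    qed
    then have "emeasure lebesgue (g ` S) = \<infinity>"
      using gS by (auto simp: fmeasurable_def top.not_eq_extremum[symmetric])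
    then show ?thesis using leb True by simp
  qed
qed

section \<open>The cone measure\<close>

abbreviation coords_normalization :: "real ^ 28 \<Rightarrow> real"
  where "coords_normalization x \<equiv> normalization (param_form x)"

definition positive_cone :: "(real ^ 28) set"
  where "positive_cone = {x. param_form x \<in> U_plus \<and> 0 < coords_normalization x \<and> coords_normalization x \<le> 1}"

definition radial_projection :: "real ^ 28 \<Rightarrow> trilinear"
  where "radial_projection x = (1 / sqrt (coords_normalization x)) *\<^sub>R param_form x"

text \<open>
  The measure of a set \<open>X\<close> is \<open>28\<close> times the Lebesgue measure of the cone over \<open>X\<close>, with the apex
  at the origin removed.  Since \<open>\<integral>\<^sub>0\<^sup>1 t\<^sup>2\<^sup>7 dt = 1/28\<close>, this is the measure of the contraction of the
  volume form with the Euler field.  In this description every linear symmetry of the form and every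
  linear subspace can be handled through Lebesgue measure.
\<close>

definition cone_measure :: "trilinear measure"
  where "cone_measure = scale_measure 28
    (distr (restrict_space lborel positive_cone) (restrict_space borel U1_plus) radial_projection)"

lemma continuous_param_form [continuous_intros]:
  "continuous_on S f \<Longrightarrow> continuous_on S (\<lambda>x. param_form (f x))"
  by (rule continuous_on_compose2[OF linear_continuous_on[OF bounded_linear_param_form, of UNIV]]) auto

lemma continuous_normalization' [continuous_intros]:
  "continuous_on S f \<Longrightarrow> continuous_on S (\<lambda>x. normalization (f x))"
  by (rule continuous_on_compose2[OF continuous_normalization]) auto

lemma borel_positive_cone: "positive_cone \<in> sets borel"
proof -
  have eq: "positive_cone = {x. param_form x \<in> U_plus} \<inter> {x. 0 < coords_normalization x} \<inter> {x. coords_normalization x \<le> 1}"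
    by (auto simp: positive_cone_def)
  have "open {x. 0 < coords_normalization x}" "closed {x. coords_normalization x \<le> 1}"
    by (intro open_Collect_less closed_Collect_le continuous_intros)+
  then show ?thesis
    unfolding eq by (intro sets.Int borel_open[OF open_U_plus_coords] borel_open borel_closed)
qed

lemma radial_projection_U1_plus:
  assumes "param_form x \<in> U_plus" "coords_normalization x > 0"
  shows "radial_projection x \<in> U1_plus"
  using assms by (simp add: radial_projection_def U1_plus_eq U_plus_scaleR normalization_scaleR power_divide)

lemma continuous_radial_projection: "continuous_on {x. coords_normalization x > 0} radial_projection"
  unfolding radial_projection_def by (intro continuous_intros) auto

lemma measurable_radial_projection:
  "radial_projection \<in> measurable (restrict_space lborel positive_cone) (restrict_space borel U1_plus)"
proof (rule measurable_restrict_space2)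
  show "radial_projection \<in> space (restrict_space lborel positive_cone) \<rightarrow> U1_plus"
    by (auto simp: space_restrict_space positive_cone_def radial_projection_U1_plus)
  have "continuous_on positive_cone radial_projection"
    by (rule continuous_on_subset[OF continuous_radial_projection]) (auto simp: positive_cone_def)
  then have "radial_projection \<in> borel_measurable (restrict_space borel positive_cone)"
    by (rule borel_measurable_continuous_on_restrict)
  then show "radial_projection \<in> borel_measurable (restrict_space lborel positive_cone)"
    by (simp cong: measurable_cong_sets add: sets_restrict_space)
qed

lemma sets_cone_measure: "sets cone_measure = sets (restrict_space borel U1_plus)"
  by (simp add: cone_measure_def)

lemma emeasure_cone_measure:
  assumes "X \<in> sets (restrict_space borel U1_plus)"
  shows "emeasure cone_measure X = 28 * emeasure lborel {x \<in> positive_cone. radial_projection x \<in> X}"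
proof -
  have "emeasure (distr (restrict_space lborel positive_cone) (restrict_space borel U1_plus) radial_projection) X
      = emeasure (restrict_space lborel positive_cone) {x \<in> positive_cone. radial_projection x \<in> X}"
    using assms by (subst emeasure_distr[OF measurable_radial_projection])
      (auto simp: space_restrict_space vimage_def Int_def conj_commute)
  also have "\<dots> = emeasure lborel {x \<in> positive_cone. radial_projection x \<in> X}"
    by (rule emeasure_restrict_space) (use borel_positive_cone in auto)
  finally show ?thesis by (simp add: cone_measure_def)
qed

lemma borel_cone_over:
  assumes "X \<in> sets (restrict_space borel U1_plus)"
  shows "{x \<in> positive_cone. radial_projection x \<in> X} \<in> sets borel"
proof -
  have "radial_projection -` X \<inter> space (restrict_space lborel positive_cone) \<in> sets (restrict_space lborel positive_cone)"
    by (rule measurable_sets[OF measurable_radial_projection assms])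
  then have "{x \<in> positive_cone. radial_projection x \<in> X} \<in> sets (restrict_space lborel positive_cone)"
    by (simp add: space_restrict_space vimage_def Int_def conj_commute)
  then show ?thesis
    using borel_positive_cone by (subst (asm) sets_restrict_space_iff) auto
qed

lemma U1_plus_primitive: "\<Omega> \<in> U1_plus \<Longrightarrow> \<Omega> \<in> primitive_forms"
  by (simp add: U1_plus_eq U_plus_primitive)

lemma parametrization_image_measurable:
  assumes "local_parametrization S U \<psi> D" "B \<in> sets borel" "B \<subseteq> U"
  shows "\<psi> ` B \<in> sets (restrict_space borel S)"
proof -
  from assms(1) obtain \<phi> where \<phi>: "homeomorphism U (\<psi> ` U) \<psi> \<phi>" and o: "openin (top_of_set S) (\<psi> ` U)"
    by (auto simp: local_parametrization_def)
  from o obtain W where W: "open W" "\<psi> ` U = S \<inter> W" by (auto simp: openin_open)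
  have "continuous_on (\<psi> ` U) \<phi>" using \<phi> by (simp add: homeomorphism_def)
  then have "\<phi> \<in> borel_measurable (restrict_space borel (\<psi> ` U))"
    by (rule borel_measurable_continuous_on_restrict)
  from measurable_sets[OF this assms(2)] have "\<phi> -` B \<inter> \<psi> ` U \<in> sets (restrict_space borel (\<psi> ` U))"
    by (simp add: space_restrict_space)
  moreover have "\<phi> -` B \<inter> \<psi> ` U = \<psi> ` B"
    using \<phi> assms(3) by (auto simp: homeomorphism_def)
  ultimately obtain A where A: "A \<in> sets borel" "\<psi> ` B = \<psi> ` U \<inter> A"
    by (auto simp: sets_restrict_space)
  then have "\<psi> ` B = S \<inter> (W \<inter> A)" using W(2) by auto
  then show ?thesis using A(1) W(1) by (auto simp: sets_restrict_space intro!: image_eqI[of _ _ "W \<inter> A"])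
qed

text \<open>
  The parametrisation takes values in the linear subspace of primitive forms, so it is unchanged by
  the linear projection \<open>param_form \<circ> form_coords\<close> onto it, and so is its derivative.
\<close>

lemma parametrization_tangent:
  assumes L: "local_parametrization U1_plus U \<psi> D" and u: "u \<in> U"
  shows "blinfun_apply (D u) h \<in> primitive_forms"
proof -
  have U: "open U" and der: "(\<psi> has_derivative blinfun_apply (D u)) (at u)"
    using L u by (auto simp: local_parametrization_def)
  have in_U1: "\<psi> v \<in> U1_plus" if "v \<in> U" for v
    using L that by (auto simp: local_parametrization_def dest!: openin_imp_subset)
  let ?P = "\<lambda>\<Omega>. param_form (form_coords \<Omega>)"
  have "((\<lambda>v. ?P (\<psi> v)) has_derivative (\<lambda>h. ?P (blinfun_apply (D u) h))) (at u)"
    by (rule bounded_linear.has_derivative[OF bounded_linear_param_form],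
        rule bounded_linear.has_derivative[OF bounded_linear_form_coords], rule der)
  then have "(\<psi> has_derivative (\<lambda>h. ?P (blinfun_apply (D u) h))) (at u)"
    by (rule has_derivative_transform_within_open[OF _ U u])
      (simp add: param_form_form_coords U1_plus_primitive in_U1)
  then have "(\<lambda>h. ?P (blinfun_apply (D u) h)) = blinfun_apply (D u)"
    by (rule has_derivative_unique[OF _ der])
  then have "blinfun_apply (D u) h = ?P (blinfun_apply (D u) h)" by (metis)
  then show ?thesis using primitive_param_form by metis
qed

definition tangent_volume :: "('u \<Rightarrow> trilinear) \<Rightarrow> ('u \<Rightarrow> (real ^ 27) \<Rightarrow>\<^sub>L trilinear) \<Rightarrow> 'u \<Rightarrow> real"
  where "tangent_volume \<psi> D u = natural_volume_form (\<psi> u) (\<lambda>i. blinfun_apply (D u) (coord_vec i))"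

lemma tangent_volume_det:
  assumes L: "local_parametrization U1_plus U \<psi> D" and u: "u \<in> U"
  shows "tangent_volume \<psi> D u =
    det (\<chi> k. form_coords (case_nat (\<psi> u) (\<lambda>i. blinfun_apply (D u) (coord_vec i)) (index_28 k)))"
proof -
  have "\<psi> u \<in> primitive_forms"
    using L u by (auto simp: local_parametrization_def dest!: openin_imp_subset intro!: U1_plus_primitive)
  then show ?thesis
    unfolding tangent_volume_def natural_volume_form_def interior_product_def euler_field_def
    by (intro sigma_volume_det) (auto split: nat.split intro: parametrization_tangent[OF L u])
qed

lemma continuous_on_det:
  fixes f :: "'a::topological_space \<Rightarrow> 'n::finite \<Rightarrow> real ^ 'n"
  assumes "\<And>k. continuous_on S (\<lambda>x. f x k)"
  shows "continuous_on S (\<lambda>x. det (\<chi> k. f x k))"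
  unfolding det_def by (simp, intro continuous_intros assms)

lemma continuous_tangent_volume:
  assumes L: "local_parametrization U1_plus U \<psi> D"
  shows "continuous_on U (tangent_volume \<psi> D)"
proof -
  have \<psi>: "continuous_on U \<psi>" and D: "continuous_on U D"
    using L by (auto simp: local_parametrization_def homeomorphism_def)
  have "continuous_on U (\<lambda>u. form_coords (case_nat (\<psi> u) (\<lambda>i. blinfun_apply (D u) (coord_vec i)) j))" for j
    by (cases j; simp; rule continuous_on_compose2[OF linear_continuous_on[OF bounded_linear_form_coords, of UNIV]])
      (auto intro!: continuous_intros \<psi> D)
  then have "continuous_on U (\<lambda>u. det (\<chi> k. form_coords (case_nat (\<psi> u) (\<lambda>i. blinfun_apply (D u) (coord_vec i)) (index_28 k))))"
    by (rule continuous_on_det)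
  then show ?thesis
    by (rule continuous_on_eq) (simp add: tangent_volume_det[OF L])
qed

lemma nn_integral_power_27: "(\<integral>\<^sup>+ t. ennreal (\<bar>t\<bar> ^ 27) * indicator {0<..1 :: real} t \<partial>lborel) = ennreal (1 / 28)"
proof -
  have "(\<integral>\<^sup>+ t. ennreal (\<bar>t\<bar> ^ 27) * indicator {0<..1 :: real} t \<partial>lborel) =
      (\<integral>\<^sup>+ t. ennreal (t ^ 27) * indicator {0..1 :: real} t \<partial>lborel)"
    by (rule nn_integral_cong) (auto simp: indicator_def)
  also have "\<dots> = ennreal (1 ^ 28 / 28 - 0 ^ 28 / 28)"
  proof (rule nn_integral_FTC_Icc)
    fix x :: real
    show "((\<lambda>x. x ^ 28 / 28) has_real_derivative x ^ 27) (at x)"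
      by (auto intro!: derivative_eq_intros)
  qed auto
  finally show ?thesis by simp
qed

text \<open>
  Polar coordinates: \<open>\<Psi> (t, u) = t \<psi>(u)\<close> maps \<open>(0, 1] \<times> B\<close> bijectively onto the cone over \<open>\<psi> ` B\<close>.
  The rows of its Jacobian matrix are \<open>\<psi>(u)\<close> and \<open>t\<close> times the derivatives of \<open>\<psi>\<close>, so the Jacobian determinant is
  \<open>t\<^sup>2\<^sup>7\<close> times the contracted volume form, and the integral over \<open>t\<close> cancels the factor \<open>28\<close>.
\<close>

lemma cone_measure_parametrization:
  assumes L: "local_parametrization U1_plus U \<psi> D" and B: "B \<in> sets borel" "B \<subseteq> U"
  shows "emeasure cone_measure (\<psi> ` B) =
    (\<integral>\<^sup>+ u. ennreal \<bar>tangent_volume \<psi> D u\<bar> * indicator B u \<partial>lborel)"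
proof -
  have der: "(\<psi> has_derivative blinfun_apply (D u)) (at u)" if "u \<in> U" for u
    using L that by (auto simp: local_parametrization_def)
  have in_U1: "\<psi> u \<in> U1_plus" if "u \<in> U" for u
    using L that by (auto simp: local_parametrization_def dest!: openin_imp_subset)
  have inj: "inj_on \<psi> U"
  proof -
    obtain \<phi> where "homeomorphism U (\<psi> ` U) \<psi> \<phi>" using L by (auto simp: local_parametrization_def)
    then show ?thesis by (intro inj_on_inverseI[of _ \<phi>]) (simp add: homeomorphism_def)
  qed
  define \<Psi> where "\<Psi> y = (y $ of_nat 0) *\<^sub>R form_coords (\<psi> (tail_vec y))" for y
  define \<Psi>' where "\<Psi>' y h = (y $ of_nat 0) *\<^sub>R form_coords (blinfun_apply (D (tail_vec y)) (tail_vec h))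
      + (h $ of_nat 0) *\<^sub>R form_coords (\<psi> (tail_vec y))" for y h
  define S where "S = {y. y $ of_nat 0 \<in> {0<..1} \<and> tail_vec y \<in> B}"
  have meas_tail: "tail_vec \<in> borel_measurable borel"
    by (rule borel_measurable_continuous_onI[OF linear_continuous_on[OF bounded_linear_tail_vec]])
  have S: "S \<in> sets borel"
  proof -
    have "{y. tail_vec y \<in> B} \<in> sets borel"
      using measurable_sets[OF meas_tail B(1)] by (simp add: vimage_def)
    moreover have "{y :: real ^ 28. 0 < y $ of_nat 0} \<in> sets borel" "{y :: real ^ 28. y $ of_nat 0 \<le> 1} \<in> sets borel"
      by (intro borel_open borel_closed open_Collect_less closed_Collect_le continuous_intros)+
    moreover have "S = {y. 0 < y $ of_nat 0} \<inter> {y. y $ of_nat 0 \<le> 1} \<inter> {y. tail_vec y \<in> B}"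
      by (auto simp: S_def)
    ultimately show ?thesis by simp
  qed
  have der\<Psi>: "(\<Psi> has_derivative \<Psi>' y) (at y within S)" if "y \<in> S" for y
  proof -
    have "tail_vec y \<in> U" using that B by (auto simp: S_def)
    have "((\<lambda>y. form_coords (\<psi> (tail_vec y))) has_derivative
        (\<lambda>h. form_coords (blinfun_apply (D (tail_vec y)) (tail_vec h)))) (at y)"
      by (rule bounded_linear.has_derivative[OF bounded_linear_form_coords],
          rule has_derivative_compose[OF bounded_linear_imp_has_derivative[OF bounded_linear_tail_vec] der[OF \<open>tail_vec y \<in> U\<close>]])
    from has_derivative_scaleR[OF bounded_linear_imp_has_derivative[OF bounded_linear_vec_nth] this]
    have "(\<Psi> has_derivative \<Psi>' y) (at y)"
      unfolding \<Psi>_def \<Psi>'_def .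
    then show ?thesis by (rule has_derivative_at_withinI)
  qed
  have norm_\<Psi>: "param_form (\<Psi> y) = (y $ of_nat 0) *\<^sub>R \<psi> (tail_vec y)" if "tail_vec y \<in> U" for y
    using in_U1[OF that] bounded_linear.linear[OF bounded_linear_param_form]
    by (simp add: \<Psi>_def linear_scale param_form_form_coords U1_plus_primitive)
  have inj\<Psi>: "inj_on \<Psi> S"
  proof (rule inj_onI)
    fix y y' assume y: "y \<in> S" "y' \<in> S" and eq: "\<Psi> y = \<Psi> y'"
    let ?t = "y $ of_nat 0" and ?t' = "y' $ of_nat 0"
    have U: "tail_vec y \<in> U" "tail_vec y' \<in> U" and t: "?t > 0" "?t' > 0" using y B by (auto simp: S_def)
    have eq': "?t *\<^sub>R \<psi> (tail_vec y) = ?t' *\<^sub>R \<psi> (tail_vec y')"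
      using eq norm_\<Psi>[OF U(1)] norm_\<Psi>[OF U(2)] by simp
    \<comment> \<open>The normalisation recovers the radius.\<close>
    have "?t\<^sup>2 = ?t'\<^sup>2"
      using arg_cong[OF eq', of normalization] in_U1[OF U(1)] in_U1[OF U(2)]
      by (simp add: normalization_scaleR U1_plus_eq)
    then have tt: "?t = ?t'" using t by (simp add: power2_eq_iff)
    then have "\<psi> (tail_vec y) = \<psi> (tail_vec y')" using eq' t by simp
    then have "tail_vec y = tail_vec y'" using inj U by (simp add: inj_on_def)
    then show "y = y'"
      using tt by (simp add: vec_eq_iff forall_28 tail_vec_def del: of_nat_Suc)
  qed
  have image: "\<Psi> ` S = {x \<in> positive_cone. radial_projection x \<in> \<psi> ` B}"
  proof (intro set_eqI iffI)
    fix x assume "x \<in> \<Psi> ` S"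
    then obtain y where y: "y \<in> S" "x = \<Psi> y" by blast
    let ?t = "y $ of_nat 0"
    have U: "tail_vec y \<in> U" "tail_vec y \<in> B" and t: "0 < ?t" "?t \<le> 1" using y B by (auto simp: S_def)
    have p: "param_form x = ?t *\<^sub>R \<psi> (tail_vec y)" using norm_\<Psi>[OF U(1)] y by simp
    have n: "coords_normalization x = ?t\<^sup>2"
      using in_U1[OF U(1)] by (simp add: p normalization_scaleR U1_plus_eq)
    have "x \<in> positive_cone"
      unfolding positive_cone_def mem_Collect_eq n unfolding p
      using in_U1[OF U(1)] t by (simp add: U1_plus_eq U_plus_scaleR power_le_one)
    moreover have "radial_projection x = \<psi> (tail_vec y)"
      unfolding radial_projection_def n unfolding p using t by simp
    ultimately show "x \<in> {x \<in> positive_cone. radial_projection x \<in> \<psi> ` B}" using U by simp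
  next
    fix x assume "x \<in> {x \<in> positive_cone. radial_projection x \<in> \<psi> ` B}"
    then obtain u where x: "x \<in> positive_cone" and u: "u \<in> B" "radial_projection x = \<psi> u" by blast
    define t where "t = sqrt (coords_normalization x)"
    have t: "0 < t" "t \<le> 1" using x by (auto simp: t_def positive_cone_def)
    have "t *\<^sub>R \<psi> u = param_form x"
      unfolding u(2)[symmetric] radial_projection_def t_def[symmetric] using t by simp
    then have "form_coords (t *\<^sub>R \<psi> u) = x" by (simp add: form_coords_param_form)
    then have "x = \<Psi> (cons_vec (t, u))"
      using bounded_linear.linear[OF bounded_linear_form_coords]
      by (simp add: \<Psi>_def cons_vec_0 tail_cons_vec linear_scale)
    moreover have "cons_vec (t, u) \<in> S"
      using t u by (simp add: S_def cons_vec_0 tail_cons_vec)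
    ultimately show "x \<in> \<Psi> ` S" by blast
  qed
  have X: "\<psi> ` B \<in> sets (restrict_space borel U1_plus)"
    by (rule parametrization_image_measurable[OF L B])
  have detS: "\<bar>det (matrix (\<Psi>' y))\<bar> = \<bar>y $ of_nat 0\<bar> ^ 27 * \<bar>tangent_volume \<psi> D (tail_vec y)\<bar>" if "y \<in> S" for y
  proof -
    let ?t = "y $ of_nat 0" and ?u = "tail_vec y"
    have U: "?u \<in> U" using that B by (auto simp: S_def)
    let ?v = "case_nat (\<psi> ?u) (\<lambda>i. blinfun_apply (D ?u) (coord_vec i))"
    let ?c = "\<lambda>k :: 28. if k = of_nat 0 then 1 else ?t"
    have lin: "linear form_coords" by (rule bounded_linear.linear[OF bounded_linear_form_coords])
    have row: "\<Psi>' y (axis k 1) = ?c k *\<^sub>R form_coords (?v (index_28 k))" for k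
    proof -
      obtain j where j: "j < 28" "k = of_nat j" by (rule of_nat_28_cases)
      show ?thesis
      proof (cases j)
        case 0
        have "tail_vec (axis k 1) = 0"
          using 0 j of_nat_Suc_index_27 by (simp add: vec_eq_iff tail_vec_def axis_def del: of_nat_Suc)
        then show ?thesis
          using 0 j by (simp add: \<Psi>'_def linear_0[OF lin] index_28_of_nat[of 0, simplified] axis_def)
      next
        case (Suc i)
        have i: "i < 27" using Suc j by simp
        have k0: "k \<noteq> of_nat 0" using Suc j of_nat_28_eq[of j 0] by simp
        have "tail_vec (axis k 1) = coord_vec i"
        proof (subst vec_eq_iff, rule allI)
          fix l :: 27
          have "(of_nat (Suc (index_27 l)) :: 28) = of_nat (Suc i) \<longleftrightarrow> index_27 l = i"
            using of_nat_28_eq[of "Suc (index_27 l)" "Suc i"] index_27(1)[of l] i by simp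
          moreover have "index_27 l = i \<longleftrightarrow> l = of_nat i"
            using index_27(2)[of l] index_27_of_nat[OF i] by auto
          ultimately show "tail_vec (axis k 1) $ l = coord_vec i $ l"
            using Suc j by (simp add: tail_vec_def coord_vec_def axis_def del: of_nat_Suc)
        qed
        moreover have "index_28 k = Suc i" using Suc j index_28_of_nat[of "Suc i"] by (simp del: of_nat_Suc)
        moreover have "axis k (1 :: real) $ of_nat 0 = 0" using k0 by (auto simp: axis_def)
        ultimately show ?thesis using k0 by (simp add: \<Psi>'_def)
      qed
    qed
    have tr: "transpose (matrix (\<Psi>' y)) = (\<chi> k. ?c k *s form_coords (?v (index_28 k)))"
      by (simp add: vec_eq_iff transpose_def matrix_def row scalar_mult_eq_scaleR)
    have "det (matrix (\<Psi>' y)) = prod ?c UNIV * det (\<chi> k. form_coords (?v (index_28 k)))"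
      unfolding det_transpose[of "matrix (\<Psi>' y)", symmetric] tr by (rule det_rows_mul)
    moreover have "prod ?c UNIV = ?t ^ 27"
    proof -
      have "of_nat (Suc (index_27 k)) \<noteq> (of_nat 0 :: 28)" for k
        using of_nat_Suc_index_27 by simp
      then show ?thesis unfolding prod_28 by simp
    qed
    ultimately show ?thesis
      by (simp add: tangent_volume_det[OF L U] abs_mult power_abs)
  qed
  define G where "G u = indicator B u * \<bar>tangent_volume \<psi> D u\<bar>" for u
  have G: "G \<in> borel_measurable borel"
  proof -
    have "continuous_on B (\<lambda>u. \<bar>tangent_volume \<psi> D u\<bar>)"
      by (intro continuous_intros continuous_on_subset[OF continuous_tangent_volume[OF L] B(2)])
    from borel_measurable_continuous_on_indicator[OF B(1) this] show ?thesis
      by (simp add: G_def[abs_def])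
  qed
  have J: "indicator S y * \<bar>det (matrix (\<Psi>' y))\<bar> = (\<bar>y $ of_nat 0\<bar> ^ 27 * indicator {0<..1} (y $ of_nat 0)) * G (tail_vec y)" for y
    using detS[of y] by (auto simp: G_def indicator_def S_def)
  have measJ: "(\<lambda>y. indicator S y * \<bar>det (matrix (\<Psi>' y))\<bar>) \<in> borel_measurable borel"
    unfolding J using measurable_compose[OF meas_tail G]
    by (intro borel_measurable_times borel_measurable_power borel_measurable_abs
        measurable_compose[OF borel_measurable_continuous_onI[OF linear_continuous_on[OF bounded_linear_vec_nth]] borel_measurable_indicator])
      (auto intro!: borel_measurable_continuous_onI continuous_intros)
  have "emeasure cone_measure (\<psi> ` B) = 28 * emeasure lborel (\<Psi> ` S)"
    unfolding image by (rule emeasure_cone_measure[OF X])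
  also have "emeasure lborel (\<Psi> ` S) = (\<integral>\<^sup>+ y. ennreal \<bar>det (matrix (\<Psi>' y))\<bar> * indicator S y \<partial>lborel)"
    by (rule emeasure_differentiable_image[OF S der\<Psi> inj\<Psi> _ measJ]) (use borel_cone_over[OF X] image in auto)
  also have "\<dots> = (\<integral>\<^sup>+ y. ennreal (indicator S y * \<bar>det (matrix (\<Psi>' y))\<bar>) \<partial>lborel)"
    by (rule nn_integral_cong) (auto simp: indicator_def)
  also have "\<dots> = (\<integral>\<^sup>+ t. \<integral>\<^sup>+ u. ennreal ((\<bar>t\<bar> ^ 27 * indicator {0<..1} t) * G u) \<partial>lborel \<partial>lborel)"
    using measJ by (subst nn_integral_cons_vec) (simp_all add: J cons_vec_0 tail_cons_vec)
  also have "\<dots> = (\<integral>\<^sup>+ t. ennreal (\<bar>t\<bar> ^ 27 * indicator {0<..1} t) * (\<integral>\<^sup>+ u. ennreal (G u) \<partial>lborel) \<partial>lborel)"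
  proof (rule nn_integral_cong)
    fix t :: real
    have "G u \<ge> 0" for u by (simp add: G_def)
    then have "(\<integral>\<^sup>+ u. ennreal ((\<bar>t\<bar> ^ 27 * indicator {0<..1} t) * G u) \<partial>lborel) =
        (\<integral>\<^sup>+ u. ennreal (\<bar>t\<bar> ^ 27 * indicator {0<..1} t) * ennreal (G u) \<partial>lborel)"
      by (intro nn_integral_cong ennreal_mult) auto
    also have "\<dots> = ennreal (\<bar>t\<bar> ^ 27 * indicator {0<..1} t) * (\<integral>\<^sup>+ u. ennreal (G u) \<partial>lborel)"
      by (rule nn_integral_cmult) (use G in simp)
    finally show "(\<integral>\<^sup>+ u. ennreal ((\<bar>t\<bar> ^ 27 * indicator {0<..1} t) * G u) \<partial>lborel) = \<dots>" .
  qed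
  also have "\<dots> = (\<integral>\<^sup>+ t. ennreal (\<bar>t\<bar> ^ 27) * indicator {0<..1 :: real} t \<partial>lborel) * (\<integral>\<^sup>+ u. ennreal (G u) \<partial>lborel)"
    by (subst nn_integral_multc[symmetric]) (auto intro!: nn_integral_cong simp: indicator_def)
  also have "28 * \<dots> = (\<integral>\<^sup>+ u. ennreal (G u) \<partial>lborel)"
  proof -
    have "28 * (ennreal (1 / 28) * c) = c" for c
    proof -
      have "28 * ennreal (1 / 28) = ennreal (28 * (1 / 28))"
        by (subst ennreal_mult) simp_all
      then show ?thesis by (simp add: mult.assoc[symmetric])
    qed
    then show ?thesis unfolding nn_integral_power_27 .
  qed
  also have "\<dots> = (\<integral>\<^sup>+ u. ennreal \<bar>tangent_volume \<psi> D u\<bar> * indicator B u \<partial>lborel)"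
    by (rule nn_integral_cong) (auto simp: G_def indicator_def)
  finally show ?thesis .
qed

section \<open>Radial charts\<close>

text \<open>The polarisation of the quadratic form \<open>normalization\<close>, which is also its derivative.\<close>

definition normalization_polar :: "trilinear \<Rightarrow> trilinear \<Rightarrow> real"
  where "normalization_polar \<Omega> \<Lambda> = (\<Sum>k<7. pairing_weight k *
    Im (coord_A k \<Omega> * cnj (coord_B k \<Lambda>) + coord_A k \<Lambda> * cnj (coord_B k \<Omega>))) / 4"

lemma has_derivative_normalization: "(normalization has_derivative normalization_polar \<Omega>) (at \<Omega>)"
proof -
  have "((\<lambda>\<Omega>. pairing_weight k * Im (coord_A k \<Omega> * cnj (coord_B k \<Omega>))) has_derivative
      (\<lambda>h. pairing_weight k * Im (coord_A k \<Omega> * cnj (coord_B k h) + coord_A k h * cnj (coord_B k \<Omega>)))) (at \<Omega>)"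
    if "k < 7" for k
  proof -
    have a: "(coord_A k has_derivative coord_A k) (at \<Omega>)"
      by (rule bounded_linear_imp_has_derivative[OF bounded_linear_coord(1)[OF that]])
    have b: "((\<lambda>\<Omega>. cnj (coord_B k \<Omega>)) has_derivative (\<lambda>h. cnj (coord_B k h))) (at \<Omega>)"
      by (rule bounded_linear.has_derivative[OF bounded_linear_cnj bounded_linear_imp_has_derivative[OF bounded_linear_coord(2)[OF that]]])
    show ?thesis
      by (rule bounded_linear.has_derivative[OF bounded_linear_mult_right
          bounded_linear.has_derivative[OF bounded_linear_Im has_derivative_mult[OF a b]]])
  qed
  then have "((\<lambda>\<Omega>. \<Sum>k<7. pairing_weight k * Im (coord_A k \<Omega> * cnj (coord_B k \<Omega>))) has_derivative
      (\<lambda>h. \<Sum>k<7. pairing_weight k * Im (coord_A k \<Omega> * cnj (coord_B k h) + coord_A k h * cnj (coord_B k \<Omega>)))) (at \<Omega>)"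
    by (intro has_derivative_sum) auto
  from bounded_linear.has_derivative[OF bounded_linear_divide[of 4] this] show ?thesis
    by (simp add: normalization_def[abs_def] normalization_polar_def[abs_def])
qed

definition radial_derivative :: "real ^ 28 \<Rightarrow> real ^ 28 \<Rightarrow> trilinear"
  where "radial_derivative x h = (1 / sqrt (coords_normalization x)) *\<^sub>R param_form h +
    (- 1 / (2 * coords_normalization x * sqrt (coords_normalization x)) *
      normalization_polar (param_form x) (param_form h)) *\<^sub>R param_form x"

lemma has_derivative_radial:
  assumes pos: "coords_normalization x > 0"
  shows "(radial_projection has_derivative radial_derivative x) (at x)"
proof -
  let ?N = "coords_normalization"
  have N: "(?N has_derivative (\<lambda>h. normalization_polar (param_form x) (param_form h))) (at x)"
    by (rule has_derivative_compose[OF bounded_linear_imp_has_derivative[OF bounded_linear_param_form]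
        has_derivative_normalization])
  have "((\<lambda>t. 1 / sqrt t) has_real_derivative - 1 / (2 * ?N x * sqrt (?N x))) (at (?N x))"
    using pos by (auto intro!: derivative_eq_intros simp: field_simps)
  then have "((\<lambda>t. 1 / sqrt t) has_derivative (*) (- 1 / (2 * ?N x * sqrt (?N x)))) (at (?N x))"
    by (rule has_field_derivative_imp_has_derivative)
  from has_derivative_compose[OF N this]
  have "((\<lambda>x. 1 / sqrt (?N x)) has_derivative
      (\<lambda>h. - 1 / (2 * ?N x * sqrt (?N x)) * normalization_polar (param_form x) (param_form h))) (at x)" .
  from has_derivative_scaleR[OF this bounded_linear_imp_has_derivative[OF bounded_linear_param_form]]
  show ?thesis
    unfolding radial_projection_def[abs_def] radial_derivative_def[abs_def] .
qed

definition skip_index :: "nat \<Rightarrow> nat \<Rightarrow> nat"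
  where "skip_index i k = (if k < i then k else Suc k)"

definition insert_zero :: "nat \<Rightarrow> real ^ 27 \<Rightarrow> real ^ 28"
  where "insert_zero i h = (\<Sum>k<27. (h $ of_nat k) *\<^sub>R axis (of_nat (skip_index i k)) 1)"

definition drop_index :: "nat \<Rightarrow> real ^ 28 \<Rightarrow> real ^ 27"
  where "drop_index i x = (\<chi> k. x $ of_nat (skip_index i (index_27 k)))"

lemma bounded_linear_insert_zero: "bounded_linear (insert_zero i)"
  unfolding insert_zero_def[abs_def] by (intro bounded_linear_sum bounded_linear_component_scaleR)

lemma bounded_linear_drop_index: "bounded_linear (drop_index i)"
  unfolding linear_conv_bounded_linear[symmetric] by (auto intro!: linearI simp: drop_index_def vec_eq_iff)

lemma skip_index: "i < 28 \<Longrightarrow> k < 27 \<Longrightarrow> skip_index i k < 28" "skip_index i k \<noteq> i"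
  "skip_index i k = skip_index i l \<longleftrightarrow> k = l"
  by (auto simp: skip_index_def)

lemma insert_zero_nth:
  assumes i: "i < 28"
  shows "l < 27 \<Longrightarrow> insert_zero i h $ of_nat (skip_index i l) = h $ of_nat l" "insert_zero i h $ of_nat i = 0"
proof -
  assume l: "l < 27"
  have "insert_zero i h $ of_nat (skip_index i l) = (\<Sum>k<27. if k = l then h $ of_nat k else 0)"
    unfolding insert_zero_def sum_component
    by (rule sum.cong) (use i l in \<open>auto simp: axis_def of_nat_28_eq skip_index\<close>)
  then show "insert_zero i h $ of_nat (skip_index i l) = h $ of_nat l" using l by simp
next
  have "insert_zero i h $ of_nat i = (\<Sum>k<(27 :: nat). 0)"
    unfolding insert_zero_def sum_component
    by (rule sum.cong) (use i in \<open>auto simp: axis_def of_nat_28_eq skip_index skip_index(2)[symmetric]\<close>)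
  then show "insert_zero i h $ of_nat i = 0" by simp
qed

lemma drop_insert_zero: "i < 28 \<Longrightarrow> drop_index i (insert_zero i h) = h"
  by (simp add: vec_eq_iff drop_index_def insert_zero_nth index_27)

lemma insert_drop:
  assumes i: "i < 28"
  shows "(x $ of_nat i) *\<^sub>R axis (of_nat i) 1 + insert_zero i (drop_index i x) = x"
proof (subst vec_eq_iff, rule allI)
  fix m :: 28
  obtain j where j: "j < 28" "m = of_nat j" by (rule of_nat_28_cases)
  show "((x $ of_nat i) *\<^sub>R axis (of_nat i) 1 + insert_zero i (drop_index i x)) $ m = x $ m"
  proof (cases "j = i")
    case True
    then show ?thesis using j i by (simp add: insert_zero_nth axis_def)
  next
    case False
    define l where "l = (if j < i then j else j - 1)"
    have l: "l < 27" "j = skip_index i l" using False i j by (auto simp: l_def skip_index_def)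
    have "(axis (of_nat i) 1 :: real ^ 28) $ m = 0"
      using False i j of_nat_28_eq[of i j] by (auto simp: axis_def)
    then show ?thesis
      using insert_zero_nth(1)[OF i l(1), of "drop_index i x"] index_27_of_nat[OF l(1)] l(2) j
      by (simp add: drop_index_def)
  qed
qed

text \<open>
  The affine hyperplane on which the coordinate \<open>i\<close> equals \<open>s\<close>.  For \<open>s = 1\<close> and \<open>s = -1\<close> its radial
  projection parametrises the forms whose coordinate \<open>i\<close> has the sign \<open>s\<close>, and these \<open>56\<close> charts
  cover \<open>U1_plus\<close>.
\<close>

definition chart_slice :: "nat \<Rightarrow> real \<Rightarrow> real ^ 27 \<Rightarrow> real ^ 28"
  where "chart_slice i s u = s *\<^sub>R axis (of_nat i) 1 + insert_zero i u"

definition chart_domain :: "nat \<Rightarrow> real \<Rightarrow> (real ^ 27) set"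
  where "chart_domain i s = {u. param_form (chart_slice i s u) \<in> U_plus \<and> coords_normalization (chart_slice i s u) > 0}"

definition chart :: "nat \<Rightarrow> real \<Rightarrow> real ^ 27 \<Rightarrow> trilinear"
  where "chart i s u = radial_projection (chart_slice i s u)"

definition chart_derivative :: "nat \<Rightarrow> real \<Rightarrow> real ^ 27 \<Rightarrow> (real ^ 27) \<Rightarrow>\<^sub>L trilinear"
  where "chart_derivative i s u = Blinfun (\<lambda>h. radial_derivative (chart_slice i s u) (insert_zero i h))"

lemma has_derivative_chart_slice: "(chart_slice i s has_derivative insert_zero i) (at u)"
proof -
  have "((\<lambda>u. s *\<^sub>R axis (of_nat i) 1 + insert_zero i u) has_derivative (\<lambda>h. 0 + insert_zero i h)) (at u)"
    by (intro has_derivative_add has_derivative_const bounded_linear_imp_has_derivative bounded_linear_insert_zero)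
  then show ?thesis by (simp add: chart_slice_def[abs_def])
qed

lemma continuous_chart_slice: "continuous_on S (chart_slice i s)"
  by (rule has_derivative_continuous_on) (rule has_derivative_at_withinI[OF has_derivative_chart_slice])

lemma chart_slice_nth: "i < 28 \<Longrightarrow> chart_slice i s u $ of_nat i = s"
  by (simp add: chart_slice_def insert_zero_nth axis_def)

lemma has_derivative_chart:
  assumes "u \<in> chart_domain i s"
  shows "(chart i s has_derivative (\<lambda>h. radial_derivative (chart_slice i s u) (insert_zero i h))) (at u)"
  unfolding chart_def[abs_def]
  by (rule has_derivative_compose[OF has_derivative_chart_slice has_derivative_radial])
    (use assms in \<open>simp add: chart_domain_def\<close>)

lemma chart_derivative_apply:
  "u \<in> chart_domain i s \<Longrightarrow>
    blinfun_apply (chart_derivative i s u) = (\<lambda>h. radial_derivative (chart_slice i s u) (insert_zero i h))"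
  unfolding chart_derivative_def
  by (intro bounded_linear_Blinfun_apply has_derivative_bounded_linear[OF has_derivative_chart])

lemma form_coords_radial:
  "form_coords (radial_projection x) = (1 / sqrt (coords_normalization x)) *\<^sub>R x"
  using bounded_linear.linear[OF bounded_linear_form_coords]
  by (simp add: radial_projection_def linear_scale form_coords_param_form)

lemma open_chart_domain: "open (chart_domain i s)"
proof -
  have "chart_domain i s = chart_slice i s -` {x. param_form x \<in> U_plus} \<inter> {u. coords_normalization (chart_slice i s u) > 0}"
    by (auto simp: chart_domain_def)
  moreover have "open (chart_slice i s -` {x. param_form x \<in> U_plus})"
    by (rule open_vimage[OF open_U_plus_coords continuous_chart_slice])
  moreover have "open {u. coords_normalization (chart_slice i s u) > 0}"
    by (intro open_Collect_less continuous_intros continuous_chart_slice)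
  ultimately show ?thesis by auto
qed

lemma chart_image:
  assumes i: "i < 28" and s: "s = 1 \<or> s = - 1"
  shows "chart i s ` chart_domain i s = U1_plus \<inter> {\<Omega>. s * form_coords \<Omega> $ of_nat i > 0}"
    and "\<Omega> \<in> U1_plus \<Longrightarrow> s * form_coords \<Omega> $ of_nat i > 0 \<Longrightarrow>
      (1 / \<bar>form_coords \<Omega> $ of_nat i\<bar>) *\<^sub>R drop_index i (form_coords \<Omega>) \<in> chart_domain i s \<and>
      chart i s ((1 / \<bar>form_coords \<Omega> $ of_nat i\<bar>) *\<^sub>R drop_index i (form_coords \<Omega>)) = \<Omega>"
proof -
  show B: "(1 / \<bar>form_coords \<Omega> $ of_nat i\<bar>) *\<^sub>R drop_index i (form_coords \<Omega>) \<in> chart_domain i s \<and>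
      chart i s ((1 / \<bar>form_coords \<Omega> $ of_nat i\<bar>) *\<^sub>R drop_index i (form_coords \<Omega>)) = \<Omega>"
    if \<Omega>: "\<Omega> \<in> U1_plus" and pos: "s * form_coords \<Omega> $ of_nat i > 0" for \<Omega>
  proof -
    let ?x = "form_coords \<Omega>"
    define a where "a = \<bar>?x $ of_nat i\<bar>"
    have a: "a > 0" "?x $ of_nat i = a * s" using pos s by (auto simp: a_def abs_if zero_less_mult_iff)
    have "chart_slice i s ((1 / a) *\<^sub>R drop_index i ?x) = (1 / a) *\<^sub>R ((?x $ of_nat i) *\<^sub>R axis (of_nat i) 1 + insert_zero i (drop_index i ?x))"
      unfolding a(2) using a(1) linear_scale[OF bounded_linear.linear[OF bounded_linear_insert_zero]]
      by (simp add: chart_slice_def scaleR_add_right)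
    then have y: "chart_slice i s ((1 / a) *\<^sub>R drop_index i ?x) = (1 / a) *\<^sub>R ?x"
      unfolding insert_drop[OF i] .
    have p: "param_form ((1 / a) *\<^sub>R ?x) = (1 / a) *\<^sub>R \<Omega>"
      using linear_scale[OF bounded_linear.linear[OF bounded_linear_param_form]] \<Omega>
      by (simp add: param_form_form_coords U1_plus_primitive)
    have n: "normalization ((1 / a) *\<^sub>R \<Omega>) = (1 / a)\<^sup>2"
      using \<Omega> by (simp add: normalization_scaleR U1_plus_eq)
    have "(1 / a) *\<^sub>R drop_index i ?x \<in> chart_domain i s"
      unfolding chart_domain_def mem_Collect_eq y p n using \<Omega> a by (simp add: U1_plus_eq U_plus_scaleR)
    moreover have "chart i s ((1 / a) *\<^sub>R drop_index i ?x) = \<Omega>"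
      unfolding chart_def y radial_projection_def p n using a by simp
    ultimately show ?thesis by (simp add: a_def)
  qed
  show "chart i s ` chart_domain i s = U1_plus \<inter> {\<Omega>. s * form_coords \<Omega> $ of_nat i > 0}"
  proof (intro set_eqI iffI)
    fix \<Omega> assume "\<Omega> \<in> chart i s ` chart_domain i s"
    then obtain u where u: "u \<in> chart_domain i s" "\<Omega> = chart i s u" by blast
    then have "\<Omega> \<in> U1_plus" by (simp add: chart_def chart_domain_def radial_projection_U1_plus)
    moreover have "s * form_coords \<Omega> $ of_nat i > 0"
      using u s i by (auto simp: chart_def form_coords_radial chart_slice_nth chart_domain_def)
    ultimately show "\<Omega> \<in> U1_plus \<inter> {\<Omega>. s * form_coords \<Omega> $ of_nat i > 0}" by simp
  next
    fix \<Omega> assume "\<Omega> \<in> U1_plus \<inter> {\<Omega>. s * form_coords \<Omega> $ of_nat i > 0}"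
    then have \<Omega>: "\<Omega> \<in> U1_plus" "s * form_coords \<Omega> $ of_nat i > 0" by auto
    show "\<Omega> \<in> chart i s ` chart_domain i s"
      using imageI[OF conjunct1[OF B[OF \<Omega>]], of "chart i s"] unfolding conjunct2[OF B[OF \<Omega>]] .
  qed
qed

lemma chart_inverse:
  assumes i: "i < 28" and s: "s = 1 \<or> s = - 1" and u: "u \<in> chart_domain i s"
  shows "(1 / \<bar>form_coords (chart i s u) $ of_nat i\<bar>) *\<^sub>R drop_index i (form_coords (chart i s u)) = u"
proof -
  let ?r = "sqrt (coords_normalization (chart_slice i s u))"
  have r: "?r > 0" using u by (simp add: chart_domain_def)
  have c: "form_coords (chart i s u) = (1 / ?r) *\<^sub>R chart_slice i s u"
    by (simp add: chart_def form_coords_radial)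
  have "drop_index i (chart_slice i s u) = u"
  proof -
    have "drop_index i (axis (of_nat i) 1) = 0"
      using i skip_index of_nat_28_eq[of _ i] index_27(1)
      by (auto simp: vec_eq_iff drop_index_def axis_def)
    then show ?thesis
      using linear_add[OF bounded_linear.linear[OF bounded_linear_drop_index]]
        linear_scale[OF bounded_linear.linear[OF bounded_linear_drop_index]] i
      by (simp add: chart_slice_def drop_insert_zero)
  qed
  then have d: "drop_index i (form_coords (chart i s u)) = (1 / ?r) *\<^sub>R u"
    unfolding c linear_scale[OF bounded_linear.linear[OF bounded_linear_drop_index]] by simp
  have "\<bar>form_coords (chart i s u) $ of_nat i\<bar> = \<bar>s\<bar> / ?r"
    unfolding c using r by (simp add: chart_slice_nth[OF i])
  also have "\<bar>s\<bar> = 1" using s by auto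
  finally show ?thesis unfolding d using r by simp
qed

lemma continuous_form_coords [continuous_intros]:
  "continuous_on S f \<Longrightarrow> continuous_on S (\<lambda>x. form_coords (f x))"
  by (rule continuous_on_compose2[OF linear_continuous_on[OF bounded_linear_form_coords, of UNIV]]) auto

lemma continuous_drop_index [continuous_intros]:
  "continuous_on S f \<Longrightarrow> continuous_on S (\<lambda>x. drop_index i (f x))"
  by (rule continuous_on_compose2[OF linear_continuous_on[OF bounded_linear_drop_index, of UNIV]]) auto

lemma continuous_normalization_polar [continuous_intros]:
  "continuous_on S f \<Longrightarrow> continuous_on S (\<lambda>x. normalization_polar (f x) \<Lambda>)"
proof -
  assume f: "continuous_on S f"
  have "continuous_on S (\<lambda>x. coord_A k (f x))" "continuous_on S (\<lambda>x. coord_B k (f x))" if "k < 7" for k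
    by (rule continuous_on_compose2[OF linear_continuous_on[OF bounded_linear_coord(1)[OF that], of UNIV] f]
        continuous_on_compose2[OF linear_continuous_on[OF bounded_linear_coord(2)[OF that], of UNIV] f]; simp)+
  then show ?thesis
    unfolding normalization_polar_def by (intro continuous_intros) auto
qed

text \<open>
  The inverse divides by the absolute value of the coordinate \<open>i\<close>.  The derivative is injective: its kernel consists of
  directions that are tangent to the slice and radial at the same time, and a radial vector changes
  the coordinate \<open>i\<close>, which is \<open>s \<noteq> 0\<close>.
\<close>

lemma local_parametrization_chart:
  assumes i: "i < 28" and s: "s = 1 \<or> s = - 1"
  shows "local_parametrization U1_plus (chart_domain i s) (chart i s) (chart_derivative i s)"
  unfolding local_parametrization_def
proof (intro conjI ballI)
  show "open (chart_domain i s)" by (rule open_chart_domain)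
  have im: "chart i s ` chart_domain i s = U1_plus \<inter> {\<Omega>. s * form_coords \<Omega> $ of_nat i > 0}"
    by (rule chart_image(1)[OF i s])
  have "open {\<Omega>. 0 < s * form_coords \<Omega> $ of_nat i}"
    by (intro open_Collect_less continuous_intros)
  then show "openin (top_of_set U1_plus) (chart i s ` chart_domain i s)"
    unfolding im by (rule openin_open_Int)
  show "\<exists>\<phi>. homeomorphism (chart_domain i s) (chart i s ` chart_domain i s) (chart i s) \<phi>"
  proof (intro exI homeomorphismI)
    show "continuous_on (chart_domain i s) (chart i s)"
      by (rule has_derivative_continuous_on) (rule has_derivative_at_withinI[OF has_derivative_chart])
    show "continuous_on (chart i s ` chart_domain i s) (\<lambda>\<Omega>. (1 / \<bar>form_coords \<Omega> $ of_nat i\<bar>) *\<^sub>R drop_index i (form_coords \<Omega>))"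
      unfolding im by (intro continuous_intros) auto
    show "(\<lambda>\<Omega>. (1 / \<bar>form_coords \<Omega> $ of_nat i\<bar>) *\<^sub>R drop_index i (form_coords \<Omega>)) ` chart i s ` chart_domain i s \<subseteq> chart_domain i s"
      using chart_image(2)[OF i s] unfolding im by auto
    show "(1 / \<bar>form_coords (chart i s u) $ of_nat i\<bar>) *\<^sub>R drop_index i (form_coords (chart i s u)) = u"
      if "u \<in> chart_domain i s" for u by (rule chart_inverse[OF i s that])
    show "chart i s ((1 / \<bar>form_coords \<Omega> $ of_nat i\<bar>) *\<^sub>R drop_index i (form_coords \<Omega>)) = \<Omega>"
      if "\<Omega> \<in> chart i s ` chart_domain i s" for \<Omega>
      using chart_image(2)[OF i s, of \<Omega>] that unfolding im by auto
  qed auto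
  show "continuous_on (chart_domain i s) (chart_derivative i s)"
  proof (rule continuous_on_blinfun_componentwise)
    fix b :: "real ^ 27" assume "b \<in> Basis"
    have "continuous_on (chart_domain i s) (\<lambda>u. radial_derivative (chart_slice i s u) (insert_zero i b))"
      unfolding radial_derivative_def
      by (intro continuous_intros continuous_chart_slice) (auto simp: chart_domain_def)
    then show "continuous_on (chart_domain i s) (\<lambda>u. blinfun_apply (chart_derivative i s u) b)"
      by (rule continuous_on_eq) (simp add: chart_derivative_apply)
  qed
  fix u assume u: "u \<in> chart_domain i s"
  show "(chart i s has_derivative blinfun_apply (chart_derivative i s u)) (at u)"
    unfolding chart_derivative_apply[OF u] by (rule has_derivative_chart[OF u])
  show "inj (blinfun_apply (chart_derivative i s u))"
  proof (rule linear_injective_0[OF bounded_linear.linear[OF blinfun.bounded_linear_right], THEN iffD2], intro allI impI)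
    fix h assume "blinfun_apply (chart_derivative i s u) h = 0"
    let ?x = "chart_slice i s u"
    define r c where "r = 1 / sqrt (coords_normalization ?x)"
      and "c = - 1 / (2 * coords_normalization ?x * sqrt (coords_normalization ?x)) *
        normalization_polar (param_form ?x) (param_form (insert_zero i h))"
    have r: "r \<noteq> 0" using u by (simp add: r_def chart_domain_def)
    have "r *\<^sub>R param_form (insert_zero i h) + c *\<^sub>R param_form ?x = 0"
      using \<open>blinfun_apply _ h = 0\<close> unfolding chart_derivative_apply[OF u] radial_derivative_def r_def c_def .
    then have "param_form (r *\<^sub>R insert_zero i h + c *\<^sub>R ?x) = 0"
      using bounded_linear.linear[OF bounded_linear_param_form] by (simp add: linear_add linear_scale)
    from arg_cong[OF this, of form_coords] have 0: "r *\<^sub>R insert_zero i h + c *\<^sub>R ?x = 0"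
      using linear_0[OF bounded_linear.linear[OF bounded_linear_form_coords]] by (simp add: form_coords_param_form)
    have "c * s = 0"
      using arg_cong[OF 0, of "\<lambda>x. x $ of_nat i"] i by (simp add: insert_zero_nth chart_slice_nth)
    then have "c = 0" using s by auto
    then have "insert_zero i h = 0" using 0 r by simp
    then show "h = 0"
      using drop_insert_zero[OF i, of h] linear_0[OF bounded_linear.linear[OF bounded_linear_drop_index]] by simp
  qed
qed

section \<open>Existence and uniqueness of the natural measure\<close>

definition is_natural_measure :: "trilinear measure \<Rightarrow> bool"
  where "is_natural_measure M \<longleftrightarrow> sets M = sets (restrict_space borel U1_plus) \<and>
    (\<forall>(U :: (real ^ 27) set) \<psi> D. local_parametrization U1_plus U \<psi> D \<longrightarrow>
      (\<forall>B\<in>sets borel. B \<subseteq> U \<longrightarrow>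
        emeasure M (\<psi> ` B) = (\<integral>\<^sup>+u\<in>B. ennreal \<bar>tangent_volume \<psi> D u\<bar> \<partial>lborel)))"

lemma is_natural_measure_cone: "is_natural_measure cone_measure"
  using cone_measure_parametrization by (simp add: is_natural_measure_def sets_cone_measure)

text \<open>
  Two measures with the prescribed values agree on measurable subsets of the image of a chart, and
  countably many charts cover the hypersurface.
\<close>

lemma is_natural_measure_unique:
  assumes M: "is_natural_measure M" and M': "is_natural_measure M'"
  shows "M = M'"
proof (rule measure_eqI)
  show sets_eq: "sets M = sets M'" using M M' by (simp add: is_natural_measure_def)
  fix X assume X: "X \<in> sets M"
  have sets_M: "sets M = sets (restrict_space borel U1_plus)" using M by (simp add: is_natural_measure_def)
  define s :: "nat \<Rightarrow> real" where "s n = (if even n then 1 else - 1)" for n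
  \<comment> \<open>The index n encodes the coordinate n div 2 and, through its parity, the sign; there are 56 charts.\<close>
  define V where "V n = (if n < 56 then U1_plus \<inter> {\<Omega>. s n * form_coords \<Omega> $ of_nat (n div 2) > 0} else {})" for n
  have s: "s n = 1 \<or> s n = - 1" for n by (simp add: s_def)
  have V_sets: "V n \<in> sets M" for n
  proof -
    have "open {\<Omega>. s n * form_coords \<Omega> $ of_nat (n div 2) > 0}"
      by (intro open_Collect_less continuous_intros)
    then show ?thesis by (auto simp: V_def sets_M sets_restrict_space)
  qed
  have cover: "U1_plus \<subseteq> (\<Union>n. V n)"
  proof
    fix \<Omega> assume \<Omega>: "\<Omega> \<in> U1_plus"
    have "form_coords \<Omega> \<noteq> 0"
    proof
      assume "form_coords \<Omega> = 0"
      then have "\<Omega> = 0"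
        using param_form_form_coords[OF U1_plus_primitive[OF \<Omega>]]
          linear_0[OF bounded_linear.linear[OF bounded_linear_param_form]] by simp
      then show False using \<Omega> normalization_scaleR[of 0 0] by (simp add: U1_plus_eq)
    qed
    then obtain k where "form_coords \<Omega> $ k \<noteq> 0" by (auto simp: vec_eq_iff)
    moreover obtain j where j: "j < 28" "k = of_nat j" by (rule of_nat_28_cases)
    ultimately have "\<Omega> \<in> V (if form_coords \<Omega> $ k > 0 then 2 * j else 2 * j + 1)"
      using \<Omega> by (auto simp: V_def s_def)
    then show "\<Omega> \<in> (\<Union>n. V n)" by blast
  qed
  have piece: "emeasure M Y = emeasure M' Y" if Y: "Y \<in> sets M" "Y \<subseteq> V n" for Y n
  proof (cases "n < 56")
    case True
    let ?i = "n div 2"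
    have i: "?i < 28" using True by simp
    have L: "local_parametrization U1_plus (chart_domain ?i (s n)) (chart ?i (s n)) (chart_derivative ?i (s n))"
      by (rule local_parametrization_chart[OF i s])
    define B where "B = {u \<in> chart_domain ?i (s n). chart ?i (s n) u \<in> Y}"
    have "Y \<subseteq> chart ?i (s n) ` chart_domain ?i (s n)"
      using Y(2) True by (simp add: V_def chart_image(1)[OF i s])
    then have img: "Y = chart ?i (s n) ` B" by (auto simp: B_def)
    obtain A where A: "A \<in> sets borel" "Y = U1_plus \<inter> A" using Y(1) by (auto simp: sets_M sets_restrict_space)
    have "continuous_on (chart_domain ?i (s n)) (chart ?i (s n))"
      using L by (auto simp: local_parametrization_def homeomorphism_def)
    then have "chart ?i (s n) \<in> borel_measurable (restrict_space borel (chart_domain ?i (s n)))"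
      by (rule borel_measurable_continuous_on_restrict)
    from measurable_sets[OF this A(1)]
    have "chart ?i (s n) -` A \<inter> chart_domain ?i (s n) \<in> sets borel"
      using open_chart_domain[of ?i "s n"] by (simp add: space_restrict_space sets_restrict_space_iff)
    moreover have "chart ?i (s n) -` A \<inter> chart_domain ?i (s n) = B"
      unfolding B_def A(2) by (auto simp: chart_def chart_domain_def radial_projection_U1_plus)
    ultimately have B: "B \<in> sets borel" by simp
    have BU: "B \<subseteq> chart_domain ?i (s n)" by (auto simp: B_def)
    show ?thesis
      unfolding img using M M' L B BU by (simp add: is_natural_measure_def)
  qed (use Y in \<open>simp add: V_def\<close>)
  define Y where "Y n = X \<inter> disjointed V n" for n
  have Y_sets: "Y n \<in> sets M" for n
    unfolding Y_def using sets.range_disjointed_sets[of V M] V_sets X by (auto simp: image_subset_iff)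
  have disj: "disjoint_family Y"
    using disjoint_family_disjointed[of V] unfolding Y_def disjoint_family_on_def by blast
  have "X \<subseteq> U1_plus" using X sets.sets_into_space[of X "restrict_space borel U1_plus"] by (simp add: sets_M space_restrict_space)
  then have "X \<inter> (\<Union>n. disjointed V n) = X"
    unfolding UN_disjointed_eq using cover by blast
  then have union: "(\<Union>n. Y n) = X" unfolding Y_def by simp
  have "emeasure M X = (\<Sum>n. emeasure M (Y n))"
    unfolding union[symmetric] by (rule suminf_emeasure[symmetric]) (use Y_sets disj in auto)
  also have "\<dots> = (\<Sum>n. emeasure M' (Y n))"
  proof (rule suminf_cong)
    fix n
    have "Y n \<subseteq> V n" using disjointed_subset[of V n] unfolding Y_def by auto
    then show "emeasure M (Y n) = emeasure M' (Y n)" by (rule piece[OF Y_sets])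
  qed
  also have "\<dots> = emeasure M' X"
    unfolding union[symmetric] by (rule suminf_emeasure) (use Y_sets disj sets_eq in auto)
  finally show "emeasure M X = emeasure M' X" .
qed

lemma natural_measure_eq_cone_measure: "natural_measure = cone_measure"
proof -
  have "natural_measure = (THE M. is_natural_measure M)"
    unfolding natural_measure_def is_natural_measure_def tangent_volume_def ..
  also have "\<dots> = cone_measure"
    by (rule the_equality) (auto intro: is_natural_measure_cone is_natural_measure_unique[OF _ is_natural_measure_cone])
  finally show ?thesis .
qed

section \<open>Invariance of the natural measure\<close>

text \<open>
  The common properties of the action of the integral symplectic group and of the action of
  \<open>SL(2,\<real>)\<close>.  Both are needed as measure-preserving maps of the hypersurface.
\<close>

locale symplectic_symmetry =
  fixes T T' :: "trilinear \<Rightarrow> trilinear"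
  assumes bl: "bounded_linear T" "bounded_linear T'"
    and inverse: "\<And>x. T' (T x) = x" "\<And>x. T (T' x) = x"
    and U1: "\<And>x. x \<in> U1_plus \<Longrightarrow> T x \<in> U1_plus" "\<And>x. x \<in> U1_plus \<Longrightarrow> T' x \<in> U1_plus"
    and sigma: "\<And>x y. x \<in> primitive_forms \<Longrightarrow> y \<in> primitive_forms \<Longrightarrow> sigma (T x) (T y) = sigma x y"
begin

lemma cont: "continuous_on S T" "continuous_on S T'"
  using bl by (auto intro: linear_continuous_on)

lemma vimage_eq: "X \<subseteq> U1_plus \<Longrightarrow> T' -` X \<inter> U1_plus = T ` X"
  using inverse U1 by (auto simp: image_iff) (metis subsetD)+

lemma measurable_T': "T' \<in> measurable (restrict_space borel U1_plus) (restrict_space borel U1_plus)"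
  by (rule measurable_restrict_space2)
    (auto simp: space_restrict_space U1 intro!: borel_measurable_continuous_on_restrict cont)

lemma image_sets: "X \<in> sets (restrict_space borel U1_plus) \<Longrightarrow> T ` X \<in> sets (restrict_space borel U1_plus)"
  using measurable_sets[OF measurable_T', of X] vimage_eq[of X]
    sets.sets_into_space[of X "restrict_space borel U1_plus"]
  by (simp add: space_restrict_space)

lemma parametrization:
  assumes L: "local_parametrization U1_plus U \<psi> D"
  shows "local_parametrization U1_plus U (\<lambda>u. T (\<psi> u)) (\<lambda>u. Blinfun T o\<^sub>L D u)"
  unfolding local_parametrization_def
proof (intro conjI ballI)
  have T: "blinfun_apply (Blinfun T) = T" using bl by (simp add: bounded_linear_Blinfun_apply)
  show "open U" using L by (simp add: local_parametrization_def)
  obtain \<phi> where \<phi>: "homeomorphism U (\<psi> ` U) \<psi> \<phi>" using L by (auto simp: local_parametrization_def)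
  obtain W where W: "open W" "\<psi> ` U = U1_plus \<inter> W" using L by (auto simp: local_parametrization_def openin_open)
  have im: "(\<lambda>u. T (\<psi> u)) ` U = T ` \<psi> ` U" by auto
  have "T ` \<psi> ` U = U1_plus \<inter> T' -` W"
    using vimage_eq[of "\<psi> ` U"] W U1 by auto
  moreover have "open (T' -` W)" by (rule open_vimage[OF W(1) cont(2)])
  ultimately show "openin (top_of_set U1_plus) ((\<lambda>u. T (\<psi> u)) ` U)"
    unfolding im by (simp add: openin_open_Int)
  have "homeomorphism (\<psi> ` U) (T ` \<psi> ` U) T T'"
    by (rule homeomorphismI) (auto simp: cont inverse)
  from homeomorphism_compose[OF \<phi> this]
  show "\<exists>\<phi>. homeomorphism U ((\<lambda>u. T (\<psi> u)) ` U) (\<lambda>u. T (\<psi> u)) \<phi>"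
    unfolding im o_def by blast
  show "continuous_on U (\<lambda>u. Blinfun T o\<^sub>L D u)"
    using L by (intro continuous_intros) (simp add: local_parametrization_def)
  fix u assume u: "u \<in> U"
  have D: "(\<psi> has_derivative blinfun_apply (D u)) (at u)" "inj (blinfun_apply (D u))"
    using L u by (auto simp: local_parametrization_def)
  show "((\<lambda>u. T (\<psi> u)) has_derivative blinfun_apply (Blinfun T o\<^sub>L D u)) (at u)"
    using bounded_linear.has_derivative[OF bl(1) D(1)] by (simp add: T blinfun_apply_blinfun_compose[abs_def] o_def)
  have "inj T" using inverse(1) by (metis injI)
  then show "inj (blinfun_apply (Blinfun T o\<^sub>L D u))"
    using D(2) by (auto simp: inj_def T)
qed

lemma tangent_volume:
  assumes L: "local_parametrization U1_plus U \<psi> D" and u: "u \<in> U"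
  shows "tangent_volume (\<lambda>u. T (\<psi> u)) (\<lambda>u. Blinfun T o\<^sub>L D u) u = tangent_volume \<psi> D u"
proof -
  have T: "blinfun_apply (Blinfun T) = T" using bl by (simp add: bounded_linear_Blinfun_apply)
  let ?v = "case_nat (\<psi> u) (\<lambda>i. blinfun_apply (D u) (coord_vec i))"
  have "\<psi> u \<in> primitive_forms"
    using L u by (auto simp: local_parametrization_def dest!: openin_imp_subset intro!: U1_plus_primitive)
  then have v: "?v i \<in> primitive_forms" for i
    using parametrization_tangent[OF L u] by (cases i) auto
  have "sigma_volume (\<lambda>i. T (?v i)) = sigma_volume ?v"
    unfolding sigma_volume_def liouville_form_def
    by (subst wedge_power_transport[where P = primitive_forms]) (use sigma v in auto)
  moreover have "(\<lambda>i. T (?v i)) = case_nat (T (\<psi> u)) (\<lambda>i. blinfun_apply (Blinfun T o\<^sub>L D u) (coord_vec i))"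
    by (auto simp: fun_eq_iff T split: nat.split)
  ultimately show ?thesis
    by (simp add: tangent_volume_def natural_volume_form_def interior_product_def euler_field_def)
qed

text \<open>
  Transport by \<open>T\<close> sends parametrisations to parametrisations and leaves the contracted volume form
  unchanged, so the transported measure satisfies the characterisation of the natural measure, which
  has only one solution.
\<close>

lemma emeasure_image:
  assumes X: "X \<in> sets natural_measure"
  shows "T ` X \<in> sets natural_measure" "emeasure natural_measure (T ` X) = emeasure natural_measure X"
proof -
  note M = is_natural_measure_cone[folded natural_measure_eq_cone_measure]
  have sets_M: "sets natural_measure = sets (restrict_space borel U1_plus)" using M by (simp add: is_natural_measure_def)
  let ?M' = "distr natural_measure (restrict_space borel U1_plus) T'"
  have meas: "T' \<in> measurable natural_measure (restrict_space borel U1_plus)"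
    using measurable_T' by (simp cong: measurable_cong_sets add: sets_M)
  have em: "emeasure ?M' X = emeasure natural_measure (T ` X)" if "X \<in> sets (restrict_space borel U1_plus)" for X
    using that sets.sets_into_space[OF that] vimage_eq[of X]
    by (subst emeasure_distr[OF meas]) (auto simp: sets_eq_imp_space_eq[OF sets_M] space_restrict_space)
  show "T ` X \<in> sets natural_measure" using X image_sets by (simp add: sets_M)
  have "is_natural_measure ?M'"
    unfolding is_natural_measure_def
  proof (intro conjI allI impI ballI)
    fix U :: "(real ^ 27) set" and \<psi> D B
    assume L: "local_parametrization U1_plus U \<psi> D" and B: "B \<in> sets borel" "B \<subseteq> U"
    have "emeasure ?M' (\<psi> ` B) = emeasure natural_measure (T ` \<psi> ` B)"
      by (rule em[OF parametrization_image_measurable[OF L B]])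
    also have "T ` \<psi> ` B = (\<lambda>u. T (\<psi> u)) ` B" by auto
    also have "emeasure natural_measure \<dots> = (\<integral>\<^sup>+u\<in>B. ennreal \<bar>tangent_volume (\<lambda>u. T (\<psi> u)) (\<lambda>u. Blinfun T o\<^sub>L D u) u\<bar> \<partial>lborel)"
      using M parametrization[OF L] B by (simp add: is_natural_measure_def)
    also have "\<dots> = (\<integral>\<^sup>+u\<in>B. ennreal \<bar>tangent_volume \<psi> D u\<bar> \<partial>lborel)"
      by (rule nn_integral_cong) (use tangent_volume[OF L] B(2) in \<open>auto simp: indicator_def\<close>)
    finally show "emeasure ?M' (\<psi> ` B) = \<dots>" .
  qed simp
  from is_natural_measure_unique[OF this M] have "?M' = natural_measure" .
  then show "emeasure natural_measure (T ` X) = emeasure natural_measure X"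
    using em[of X] X by (simp add: sets_M)
qed

end

section \<open>The integral symplectic group\<close>

lemma Sp6_int_symplectic: "A \<in> Sp6_int \<Longrightarrow> symplectic_matrix A"
  by (simp add: Sp6_int_def symplectic_matrix_def)

lemma pullback_mult: "pullback A (pullback B \<Omega>) = pullback (B ** A) \<Omega>"
  by (rule tri_eqI) (simp add: tri_pullback matrix_vector_mul_assoc)

lemma pullback_one: "pullback (mat 1) \<Omega> = \<Omega>"
  by (rule tri_eqI) (simp add: tri_pullback)

lemma Sp6_int_one: "mat 1 \<in> Sp6_int"
  by (simp add: Sp6_int_def) (simp add: mat_def)

lemma Sp6_int_mult:
  assumes "A \<in> Sp6_int" "B \<in> Sp6_int"
  shows "A ** B \<in> Sp6_int"
proof -
  have "omega ((A ** B) *v u) ((A ** B) *v v) = omega u v" for u v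
    using assms by (simp add: Sp6_int_def matrix_vector_mul_assoc[symmetric])
  moreover have "(A ** B) $ i $ j \<in> \<int>" for i j
    using assms by (auto simp: Sp6_int_def matrix_matrix_mult_def intro!: Ints_sum Ints_mult)
  ultimately show ?thesis by (simp add: Sp6_int_def)
qed

lemma linear_dual_vec: "linear dual_vec"
  by (rule linearI) (simp_all add: vec_eq_iff forall_6 dual_vec_nth)

text \<open>The inverse is \<open>- J A\<^sup>T J\<close> for the matrix \<open>J\<close> of \<open>dual_vec\<close>, which has integral entries.\<close>

lemma Sp6_int_inverse:
  assumes A: "A \<in> Sp6_int"
  obtains B where "B \<in> Sp6_int" "B ** A = mat 1" "A ** B = mat 1"
proof -
  define g where "g v = - dual_vec (transpose A *v dual_vec v)" for v
  have lin: "linear g"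
    by (rule linearI)
      (simp_all add: g_def linear_add[OF linear_dual_vec] linear_scale[OF linear_dual_vec]
        matrix_vector_right_distrib matrix_vector_mult_scaleR)
  define B where "B = matrix g"
  have "Vector_Spaces.linear (*s) (*s) g"
    using lin unfolding linear_def scalar_mult_eq_scaleR[abs_def] .
  then have B: "B *v v = g v" for v by (simp add: B_def matrix_works)
  have inv: "g (A *v y) = y" for y
  proof -
    have "x \<bullet> (transpose A *v dual_vec (A *v y)) = x \<bullet> dual_vec y" for x
    proof -
      have "x \<bullet> (transpose A *v dual_vec (A *v y)) = omega (A *v x) (A *v y)"
        by (simp add: omega_inner dot_lmul_matrix[symmetric] inner_commute dot_matrix_vector_mul)
          (metis dot_lmul_matrix inner_commute transpose_transpose vector_transpose_matrix)
      then show ?thesis using A by (simp add: Sp6_int_def omega_inner)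
    qed
    then have "transpose A *v dual_vec (A *v y) = dual_vec y"
      by (metis vector_eq_rdot inner_commute)
    then show ?thesis by (simp add: g_def dual_vec_dual_vec)
  qed
  have BA: "B ** A = mat 1"
    by (subst matrix_eq) (simp add: matrix_vector_mul_assoc[symmetric] B inv)
  then have AB: "A ** B = mat 1" by (simp add: matrix_left_right_inverse)
  have "omega (B *v u) (B *v v) = omega u v" for u v
  proof -
    have "omega (A *v (B *v u)) (A *v (B *v v)) = omega (B *v u) (B *v v)" using A by (simp add: Sp6_int_def)
    then show ?thesis by (simp add: matrix_vector_mul_assoc AB)
  qed
  moreover have "B $ i $ j \<in> \<int>" for i j
  proof -
    have dv: "(\<And>k. x $ k \<in> \<int>) \<Longrightarrow> dual_vec x $ k \<in> \<int>" for x k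
      by (simp add: dual_vec_def)
    have "dual_vec (axis j 1) $ k \<in> \<int>" for k by (rule dv) (simp add: axis_def)
    then have "(transpose A *v dual_vec (axis j 1)) $ k \<in> \<int>" for k
      using A by (auto simp: matrix_vector_mult_def transpose_def Sp6_int_def intro!: Ints_sum Ints_mult)
    then have "dual_vec (transpose A *v dual_vec (axis j 1)) $ i \<in> \<int>" by (rule dv)
    then show ?thesis by (simp add: B_def matrix_def g_def)
  qed
  ultimately have "B \<in> Sp6_int" by (simp add: Sp6_int_def)
  with BA AB show ?thesis by (intro that)
qed

definition sp_inverse :: "real ^ 6 ^ 6 \<Rightarrow> real ^ 6 ^ 6"
  where "sp_inverse A = (SOME B. B \<in> Sp6_int \<and> B ** A = mat 1 \<and> A ** B = mat 1)"

lemma sp_inverse: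
  assumes "A \<in> Sp6_int"
  shows "sp_inverse A \<in> Sp6_int" "sp_inverse A ** A = mat 1" "A ** sp_inverse A = mat 1"
proof -
  have "\<exists>B. B \<in> Sp6_int \<and> B ** A = mat 1 \<and> A ** B = mat 1" using Sp6_int_inverse[OF assms] by metis
  from someI_ex[OF this] show "sp_inverse A \<in> Sp6_int" "sp_inverse A ** A = mat 1" "A ** sp_inverse A = mat 1"
    by (auto simp: sp_inverse_def)
qed

lemma sp_inverse_unique:
  assumes "A \<in> Sp6_int" "B ** A = mat 1"
  shows "sp_inverse A = B"
  using assms sp_inverse[OF assms(1)] by (metis matrix_mul_assoc matrix_mul_lid matrix_mul_rid)

lemma sp_inverse_inverse: "A \<in> Sp6_int \<Longrightarrow> sp_inverse (sp_inverse A) = A"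
  by (rule sp_inverse_unique) (simp_all add: sp_inverse)

lemma bij_sp_inverse: "bij_betw sp_inverse Sp6_int Sp6_int"
  by (rule bij_betwI[of _ _ _ sp_inverse]) (auto simp: sp_inverse sp_inverse_inverse)

lemma pullback_symmetry:
  assumes "A \<in> Sp6_int"
  shows "symplectic_symmetry (pullback A) (pullback (sp_inverse A))"
proof (rule symplectic_symmetry.intro)
  note s = Sp6_int_symplectic[OF assms] Sp6_int_symplectic[OF sp_inverse(1)[OF assms]]
  show "bounded_linear (pullback A)" "bounded_linear (pullback (sp_inverse A))" by (rule bounded_linear_pullback)+
  show "pullback (sp_inverse A) (pullback A x) = x" "pullback A (pullback (sp_inverse A) x) = x" for x
    by (simp_all add: pullback_mult sp_inverse[OF assms] pullback_one)
  show "pullback A x \<in> U1_plus" "pullback (sp_inverse A) x \<in> U1_plus" if "x \<in> U1_plus" for x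
    using U1_plus_pullback[OF s(1) that] U1_plus_pullback[OF s(2) that] by auto
  show "sigma (pullback A x) (pullback A y) = sigma x y" if "x \<in> primitive_forms" "y \<in> primitive_forms" for x y
    by (rule sigma_pullback[OF s(1)]) (use that in \<open>auto intro: primitive_alternating\<close>)
qed

lemma countable_Sp6_int: "countable Sp6_int"
proof (rule countable_subset)
  show "Sp6_int \<subseteq> (\<lambda>f. \<chi> i j. real_of_int (f i j)) ` (UNIV :: (6 \<Rightarrow> 6 \<Rightarrow> int) set)"
  proof
    fix A assume "A \<in> Sp6_int"
    then have "A = (\<chi> i j. real_of_int \<lfloor>A $ i $ j\<rfloor>)" by (simp add: Sp6_int_def vec_eq_iff)
    then show "A \<in> (\<lambda>f. \<chi> i j. real_of_int (f i j)) ` (UNIV :: (6 \<Rightarrow> 6 \<Rightarrow> int) set)"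
      by (rule range_eqI[of _ _ "\<lambda>i j. \<lfloor>A $ i $ j\<rfloor>"])
  qed
qed simp

lemma finite_bounded_Sp6_int: "finite {A \<in> Sp6_int. \<forall>i j. \<bar>A $ i $ j\<bar> \<le> K}"
proof (rule finite_subset)
  let ?S = "{- \<lceil>K\<rceil>..\<lceil>K\<rceil>}"
  have "finite ((UNIV :: 6 set) \<rightarrow>\<^sub>E ((UNIV :: 6 set) \<rightarrow>\<^sub>E ?S))" by (intro finite_PiE) auto
  then show "finite ((\<lambda>f. \<chi> i j. real_of_int (f i j)) ` ((UNIV :: 6 set) \<rightarrow>\<^sub>E ((UNIV :: 6 set) \<rightarrow>\<^sub>E ?S)))" by simp
  show "{A \<in> Sp6_int. \<forall>i j. \<bar>A $ i $ j\<bar> \<le> K} \<subseteq> (\<lambda>f. \<chi> i j. real_of_int (f i j)) ` ((UNIV :: 6 set) \<rightarrow>\<^sub>E ((UNIV :: 6 set) \<rightarrow>\<^sub>E ?S))"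
  proof
    fix A assume A: "A \<in> {A \<in> Sp6_int. \<forall>i j. \<bar>A $ i $ j\<bar> \<le> K}"
    have "\<lfloor>A $ i $ j\<rfloor> \<in> ?S" for i j
    proof -
      have "\<bar>A $ i $ j\<bar> \<le> K" "of_int \<lfloor>A $ i $ j\<rfloor> = A $ i $ j" using A by (auto simp: Sp6_int_def)
      then show ?thesis unfolding atLeastAtMost_iff by linarith
    qed
    moreover have "A = (\<chi> i j. real_of_int \<lfloor>A $ i $ j\<rfloor>)" using A by (simp add: Sp6_int_def vec_eq_iff)
    ultimately show "A \<in> (\<lambda>f. \<chi> i j. real_of_int (f i j)) ` ((UNIV :: 6 set) \<rightarrow>\<^sub>E ((UNIV :: 6 set) \<rightarrow>\<^sub>E ?S))"
      by (intro image_eqI[of _ _ "\<lambda>i j. \<lfloor>A $ i $ j\<rfloor>"]) auto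
  qed
qed

section \<open>Properness of the action\<close>

lemma norm_dual_vec: "norm (dual_vec x) = norm x"
  by (simp add: norm_eq_sqrt_inner omega_dual_vec(3))

text \<open>Since \<open>\<bar>\<omega>(p, q)\<bar> \<le> \<parallel>p\<parallel> \<parallel>q\<parallel>\<close>, a symplectic pair cannot consist of two short vectors.\<close>

lemma omega_unit_large:
  assumes "\<bar>omega p q\<bar> = 1"
  shows "norm p \<ge> 1 \<or> norm q \<ge> 1"
proof (rule ccontr)
  assume "\<not> (norm p \<ge> 1 \<or> norm q \<ge> 1)"
  then have "norm p * norm q < 1 * 1" by (intro mult_strict_mono') auto
  moreover have "\<bar>omega p q\<bar> \<le> norm p * norm q"
    unfolding omega_inner using Cauchy_Schwarz_ineq2[of p "dual_vec q"] by (simp add: norm_dual_vec)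
  ultimately show False using assms by simp
qed

lemma unit_orthogonal_exists:
  assumes "finite S" "card S \<le> 5"
  obtains x where "norm x = 1" "\<And>s. s \<in> S \<Longrightarrow> s \<bullet> (x :: V) = 0"
proof -
  obtain x where "x \<noteq> 0" "\<And>s. s \<in> S \<Longrightarrow> s \<bullet> (x :: V) = 0" using orthogonal_vector_exists[OF assms] by blast
  then show ?thesis by (intro that[of "x /\<^sub>R norm x"]) auto
qed

lemma scaled_unitary_frame:
  assumes "u \<noteq> 0" "v \<noteq> 0" "w \<noteq> 0" "u \<bullet> v = 0" "u \<bullet> w = 0" "v \<bullet> w = 0" "isotropic3 u v w"
  shows "(u /\<^sub>R norm u, v /\<^sub>R norm v, w /\<^sub>R norm w) \<in> unitary_frames"
  using assms by (simp add: unitary_frames_def isotropic3_def omega_linear)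

text \<open>
  A form that is bounded below on unitary frames controls the size of a symplectic matrix.  Put
  \<open>a = A u\<close>.  In the \<open>\<omega>\<close>-complement of \<open>u\<close> a unit vector \<open>x1\<close> is chosen such that the component \<open>b\<close> of
  \<open>A x1\<close> orthogonal to \<open>a\<close> has norm at least \<open>1\<close>: removing multiples of \<open>a\<close> does not change \<open>\<omega>\<close> on this
  complement, and \<open>x\<close> and \<open>dual_vec x\<close> have pairing \<open>-1\<close>, so one of the two is long enough.  Repeating this gives
  \<open>z1\<close> and \<open>d\<close>.  Then \<open>a, b, d\<close> is an orthogonal basis of a Lagrangian subspace and
  \<open>c \<parallel>a\<parallel> \<le> \<bar>\<Omega>(a, b, d)\<bar> = \<bar>(A\<^sup>* \<Omega>)(u, x1, z1)\<bar> \<le> K\<close>.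
\<close>

lemma symplectic_norm_bound:
  assumes A: "symplectic_matrix A" and alt: "alternating \<Omega>" and c: "c > 0"
    and low: "\<And>u v w. (u, v, w) \<in> unitary_frames \<Longrightarrow> c \<le> norm (tri \<Omega> u v w)"
    and K: "norm (pullback A \<Omega>) \<le> K" and u: "norm u = 1"
  shows "norm (A *v u) \<le> K / c"
proof -
  have o: "omega (A *v x) (A *v y) = omega x y" for x y using A by (simp add: symplectic_matrix_def)
  define a where "a = A *v u"
  have "a \<noteq> 0" using symplectic_matrix_injective[OF A, of u] u by (auto simp: a_def)
  obtain x where x: "norm x = 1" "\<And>s. s \<in> {u, dual_vec u} \<Longrightarrow> s \<bullet> x = 0"
    by (rule unit_orthogonal_exists[of "{u, dual_vec u}"]) (use card_length[of "[u, dual_vec u]"] in auto)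
  define P where "P y = A *v y - ((A *v y) \<bullet> a / (a \<bullet> a)) *\<^sub>R a" for y
  have Pa: "P y \<bullet> a = 0" for y using \<open>a \<noteq> 0\<close> by (simp add: P_def inner_diff_left)
  have ux: "omega u x = 0" "omega u (dual_vec x) = 0"
    using x(2)[of u] x(2)[of "dual_vec u"] omega_anti[of u x] by (simp_all add: omega_dual_vec omega_inner[of x u] inner_commute)
  have oa: "omega a (A *v y) = omega u y" "omega (A *v y) a = - omega u y" for y
    using o[of u y] o[of y u] omega_anti[of y u] by (simp_all add: a_def)
  have oP: "omega (P y) (P z) = omega y z" if "omega u y = 0" "omega u z = 0" for y z
    using that by (simp add: P_def omega_linear oa o)
  have "\<bar>omega (P x) (P (dual_vec x))\<bar> = 1"
    unfolding oP[OF ux] omega_dual_vec using x(1) by (simp add: norm_eq_1)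
  from omega_unit_large[OF this] obtain x1 where x1: "x1 \<in> {x, dual_vec x}" "norm (P x1) \<ge> 1" by auto
  have ux1: "omega u x1 = 0" and nx1: "norm x1 = 1" using x1 ux x(1) by (auto simp: norm_dual_vec)
  obtain z where z: "norm z = 1" "\<And>s. s \<in> {u, dual_vec u, x, dual_vec x} \<Longrightarrow> s \<bullet> z = 0"
    by (rule unit_orthogonal_exists[of "{u, dual_vec u, x, dual_vec x}"])
      (use card_length[of "[u, dual_vec u, x, dual_vec x]"] in auto)
  have uz: "omega u z = 0" "omega u (dual_vec z) = 0"
    using z(2)[of u] z(2)[of "dual_vec u"] omega_anti[of u z]
    by (simp_all add: omega_dual_vec omega_inner[of z u] inner_commute)
  have xz: "omega x1 z = 0" "omega x1 (dual_vec z) = 0"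
  proof -
    have "omega x z = 0" "omega x (dual_vec z) = 0" "omega (dual_vec x) z = 0" "omega (dual_vec x) (dual_vec z) = 0"
      using z(2)[of x] z(2)[of "dual_vec x"] omega_anti[of x z] omega_anti[of "dual_vec x" z]
      by (simp_all add: omega_dual_vec omega_inner[of z x] omega_inner[of z "dual_vec x"] inner_commute dual_vec_dual_vec)
    then show "omega x1 z = 0" "omega x1 (dual_vec z) = 0" using x1 by auto
  qed
  define b where "b = P x1"
  have "b \<noteq> 0" using x1(2) by (auto simp: b_def)
  define Q where "Q y = P y - (P y \<bullet> b / (b \<bullet> b)) *\<^sub>R b" for y
  have Qb: "Q y \<bullet> b = 0" for y using \<open>b \<noteq> 0\<close> by (simp add: Q_def inner_diff_left)
  have Qa: "Q y \<bullet> a = 0" for y using Pa by (simp add: Q_def inner_diff_left b_def)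
  have oPb: "omega b (P y) = omega x1 y" "omega (P y) b = - omega x1 y" if "omega u y = 0" for y
    using oP[OF ux1 that] oP[OF that ux1] omega_anti[of y x1] by (simp_all add: b_def)
  have oQ: "omega (Q y) (Q y') = omega y y'"
    if "omega u y = 0" "omega u y' = 0" "omega x1 y = 0" "omega x1 y' = 0" for y y'
    using that by (simp add: Q_def omega_linear oPb oP)
  have "\<bar>omega (Q z) (Q (dual_vec z))\<bar> = 1"
    unfolding oQ[OF uz xz] omega_dual_vec using z(1) by (simp add: norm_eq_1)
  from omega_unit_large[OF this] obtain z1 where z1: "z1 \<in> {z, dual_vec z}" "norm (Q z1) \<ge> 1" by auto
  have uz1: "omega u z1 = 0" "omega x1 z1 = 0" and nz1: "norm z1 = 1"
    using z1 uz xz z(1) by (auto simp: norm_dual_vec)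
  define d where "d = Q z1"
  have "d \<noteq> 0" using z1(2) by (auto simp: d_def)
  have "isotropic3 a b d"
    using ux1 uz1 oPb(1)[OF uz1(1)] by (simp add: isotropic3_def b_def[symmetric])
      (simp add: b_def d_def Q_def P_def omega_linear oa o)
  then have frame: "(a /\<^sub>R norm a, b /\<^sub>R norm b, d /\<^sub>R norm d) \<in> unitary_frames"
    using \<open>a \<noteq> 0\<close> \<open>b \<noteq> 0\<close> \<open>d \<noteq> 0\<close> Pa[of x1] Qa[of z1] Qb[of z1]
    by (intro scaled_unitary_frame) (simp_all add: b_def[symmetric] d_def[symmetric] inner_commute)
  have zero: "tri \<Omega> s s t = 0" "tri \<Omega> s t s = 0" "tri \<Omega> t s s = 0" for s t
    using alt unfolding alternating_def by blast+
  have "tri \<Omega> a b d = tri \<Omega> a b (P z1)"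
    by (simp add: d_def Q_def tri_diff tri_scaleR zero)
  also have "\<dots> = tri \<Omega> a b (A *v z1)"
    by (simp add: P_def tri_diff tri_scaleR zero)
  also have "\<dots> = tri \<Omega> a (A *v x1) (A *v z1)"
    by (simp add: b_def P_def tri_diff tri_scaleR zero)
  also have "\<dots> = tri (pullback A \<Omega>) u x1 z1" by (simp add: tri_pullback a_def)
  finally have eq: "tri \<Omega> a b d = tri (pullback A \<Omega>) u x1 z1" .
  have "tri \<Omega> a b d = (norm a * norm b * norm d) *\<^sub>R tri \<Omega> (a /\<^sub>R norm a) (b /\<^sub>R norm b) (d /\<^sub>R norm d)"
  proof -
    have "(norm a * norm b * norm d) * (inverse (norm d) * (inverse (norm b) * inverse (norm a))) = 1"
      using \<open>a \<noteq> 0\<close> \<open>b \<noteq> 0\<close> \<open>d \<noteq> 0\<close> by (simp add: field_simps)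
    then show ?thesis by (simp add: tri_scaleR)
  qed
  then have "norm (tri \<Omega> a b d) = (norm a * norm b * norm d) * norm (tri \<Omega> (a /\<^sub>R norm a) (b /\<^sub>R norm b) (d /\<^sub>R norm d))"
    by (simp add: abs_mult)
  also have "\<dots> \<ge> (norm a * 1 * 1) * c"
    using x1(2) z1(2) c low[OF frame] by (intro mult_mono) (auto simp: b_def d_def)
  finally have "norm a * c \<le> norm (tri (pullback A \<Omega>) u x1 z1)" by (simp add: eq)
  also have "\<dots> \<le> norm (pullback A \<Omega>)"
    using norm_tri_le[of "pullback A \<Omega>" u x1 z1] u nx1 nz1 by simp
  finally show ?thesis using K c by (simp add: a_def pos_le_divide_eq)
qed

text \<open>
  Properness of the action: an element that brings a point of a small neighbourhood back has bounded
  entries, and there are only finitely many integral matrices with bounded entries.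
\<close>

lemma finitely_many_returns:
  assumes "\<Omega> \<in> U_forms"
  obtains c where "c > 0"
    "finite {A \<in> Sp6_int. \<exists>\<Omega>'. alternating \<Omega>' \<and> norm (\<Omega>' - \<Omega>) < c \<and> norm (pullback A \<Omega>' - \<Omega>) < c}"
proof -
  obtain c where c: "c > 0"
    "\<And>\<Omega>' u v w. norm (\<Omega>' - \<Omega>) < c \<Longrightarrow> (u, v, w) \<in> unitary_frames \<Longrightarrow> c \<le> norm (tri \<Omega>' u v w)"
    using U_forms_nearby[OF assms] by metis
  let ?K = "(norm \<Omega> + c) / c"
  show ?thesis
  proof (rule that[OF c(1)], rule finite_subset[OF _ finite_bounded_Sp6_int[of ?K]], safe)
    fix A \<Omega>' i j
    assume A: "A \<in> Sp6_int" and \<Omega>': "alternating \<Omega>'" "norm (\<Omega>' - \<Omega>) < c" "norm (pullback A \<Omega>' - \<Omega>) < c"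
    have "norm (pullback A \<Omega>') \<le> norm \<Omega> + norm (pullback A \<Omega>' - \<Omega>)" by (metis norm_triangle_sub)
    then have "norm (pullback A \<Omega>') \<le> norm \<Omega> + c" using \<Omega>'(3) by simp
    then have "norm (A *v axis j 1) \<le> ?K"
      by (intro symplectic_norm_bound[OF Sp6_int_symplectic[OF A] \<Omega>'(1) c(1)] c(2)[OF \<Omega>'(2)]) auto
    moreover have "\<bar>A $ i $ j\<bar> \<le> norm (A *v axis j 1)"
      using component_le_norm_cart[of "A *v axis j 1" i] by (simp add: matrix_vector_mult_basis column_def)
    ultimately show "\<bar>A $ i $ j\<bar> \<le> ?K" by linarith
  qed
qed

section \<open>Generic stabilisers are trivial\<close>

text \<open>
  A matrix that preserves \<open>dx\<^sub>a \<and> dx\<^sub>b \<and> dx\<^sub>c\<close> preserves the kernel of this form, which is a coordinate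
  subspace of dimension three.
\<close>

lemma elementary_kernel:
  assumes A: "A ** B = mat 1" and inv: "pullback A (elementary 1 a b c) = elementary 1 a b c"
    and ne: "a \<noteq> b" "a \<noteq> c" "b \<noteq> c" and u: "u $ a = 0" "u $ b = 0" "u $ c = 0"
  shows "(A *v u) $ a = 0 \<and> (A *v u) $ b = 0 \<and> (A *v u) $ c = 0"
proof -
  have "tri (elementary 1 a b c) (A *v u) y z = 0" for y z
  proof -
    have "tri (elementary 1 a b c) (A *v u) (A *v (B *v y)) (A *v (B *v z)) = tri (elementary 1 a b c) u (B *v y) (B *v z)"
      using inv tri_pullback[of A "elementary 1 a b c"] by metis
    then show ?thesis by (simp add: matrix_vector_mul_assoc A tri_elementary u)
  qed
  from this[of "\<e> b" "\<e> c"] this[of "\<e> a" "\<e> c"] this[of "\<e> a" "\<e> b"] show ?thesis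
    using ne by (simp add: tri_elementary axis_def)
qed

text \<open>
  The kernels of the eight decomposable basis forms are coordinate subspaces whose intersections
  are the six coordinate axes, so \<open>A\<close> is diagonal.  On a Darboux pair its entries are inverse to each
  other, and the forms \<open>dx\<^sub>a \<and> dx\<^sub>b \<and> dx\<^sub>c - dx\<^sub>a\<^sub>' \<and> dx\<^sub>b\<^sub>' \<and> dx\<^sub>c\<close>, in which \<open>(a, b)\<close> and
  \<open>(a', b')\<close> are Darboux pairs, show that the remaining entry for \<open>c\<close> is \<open>1\<close>.
\<close>

lemma trivial_action_imp_one:
  assumes A: "A \<in> Sp6_int" and triv: "\<And>\<Omega>. \<Omega> \<in> primitive_forms \<Longrightarrow> pullback A \<Omega> = \<Omega>"
  shows "A = mat 1"
proof -
  obtain B where B: "A ** B = mat 1" using Sp6_int_inverse[OF A] by metis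
  have fA: "pullback A (form_A 1 k) = form_A 1 k" and fB: "pullback A (form_B 1 k) = form_B 1 k" if "k < 7" for k
    using triv that primitive_form_A primitive_form_B by auto
  note k = elementary_kernel[OF B]
  have e: "pullback A (elementary 1 1 2 3) = elementary 1 1 2 3" "pullback A (elementary 1 4 2 3) = elementary 1 4 2 3"
    "pullback A (elementary 1 1 5 3) = elementary 1 1 5 3" "pullback A (elementary 1 1 2 6) = elementary 1 1 2 6"
    "pullback A (elementary 1 4 5 6) = elementary 1 4 5 6" "pullback A (elementary 1 1 5 6) = elementary 1 1 5 6"
    "pullback A (elementary 1 4 2 6) = elementary 1 4 2 6" "pullback A (elementary 1 4 5 3) = elementary 1 4 5 3"
    using fA[of 0] fA[of 1] fA[of 2] fA[of 3] fB[of 0] fB[of 1] fB[of 2] fB[of 3]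
    by (simp_all add: form_A_def form_B_def)
  have z1: "(A *v \<e> 1) $ 4 = 0 \<and> (A *v \<e> 1) $ 2 = 0 \<and> (A *v \<e> 1) $ 3 = 0 \<and> (A *v \<e> 1) $ 5 = 0 \<and> (A *v \<e> 1) $ 6 = 0"
    using k[OF e(2), of "\<e> 1"] k[OF e(5), of "\<e> 1"] by (simp add: unit_vec_nth)
  have z4: "(A *v \<e> 4) $ 1 = 0 \<and> (A *v \<e> 4) $ 2 = 0 \<and> (A *v \<e> 4) $ 3 = 0 \<and> (A *v \<e> 4) $ 5 = 0 \<and> (A *v \<e> 4) $ 6 = 0"
    using k[OF e(1), of "\<e> 4"] k[OF e(6), of "\<e> 4"] by (simp add: unit_vec_nth)
  have z2: "(A *v \<e> 2) $ 1 = 0 \<and> (A *v \<e> 2) $ 3 = 0 \<and> (A *v \<e> 2) $ 4 = 0 \<and> (A *v \<e> 2) $ 5 = 0 \<and> (A *v \<e> 2) $ 6 = 0"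
    using k[OF e(3), of "\<e> 2"] k[OF e(5), of "\<e> 2"] by (simp add: unit_vec_nth)
  have z5: "(A *v \<e> 5) $ 1 = 0 \<and> (A *v \<e> 5) $ 2 = 0 \<and> (A *v \<e> 5) $ 3 = 0 \<and> (A *v \<e> 5) $ 4 = 0 \<and> (A *v \<e> 5) $ 6 = 0"
    using k[OF e(1), of "\<e> 5"] k[OF e(7), of "\<e> 5"] by (simp add: unit_vec_nth)
  have z3: "(A *v \<e> 3) $ 1 = 0 \<and> (A *v \<e> 3) $ 2 = 0 \<and> (A *v \<e> 3) $ 4 = 0 \<and> (A *v \<e> 3) $ 5 = 0 \<and> (A *v \<e> 3) $ 6 = 0"
    using k[OF e(4), of "\<e> 3"] k[OF e(5), of "\<e> 3"] by (simp add: unit_vec_nth)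
  have z6: "(A *v \<e> 6) $ 1 = 0 \<and> (A *v \<e> 6) $ 2 = 0 \<and> (A *v \<e> 6) $ 3 = 0 \<and> (A *v \<e> 6) $ 4 = 0 \<and> (A *v \<e> 6) $ 5 = 0"
    using k[OF e(1), of "\<e> 6"] k[OF e(8), of "\<e> 6"] by (simp add: unit_vec_nth)
  define l where "l j = (A *v \<e> j) $ j" for j
  have diag: "A *v \<e> 1 = l 1 *\<^sub>R \<e> 1" "A *v \<e> 2 = l 2 *\<^sub>R \<e> 2" "A *v \<e> 3 = l 3 *\<^sub>R \<e> 3"
    "A *v \<e> 4 = l 4 *\<^sub>R \<e> 4" "A *v \<e> 5 = l 5 *\<^sub>R \<e> 5" "A *v \<e> 6 = l 6 *\<^sub>R \<e> 6"
    using z1 z2 z3 z4 z5 z6 by (simp_all add: vec_eq_iff forall_6 unit_vec_nth l_def)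
  have o: "omega (A *v x) (A *v y) = omega x y" for x y using A by (simp add: Sp6_int_def)
  have pair: "l 1 * l 4 = 1" "l 2 * l 5 = 1" "l 3 * l 6 = 1"
    using o[of "\<e> 1" "\<e> 4"] o[of "\<e> 2" "\<e> 5"] o[of "\<e> 3" "\<e> 6"]
    by (simp_all add: diag omega_eq unit_vec_nth)
  have ev: "tri \<Omega> (A *v u) (A *v v) (A *v w) = tri \<Omega> u v w" if "pullback A \<Omega> = \<Omega>" for \<Omega> u v w
    using that tri_pullback[of A \<Omega> u v w] by simp
  have "l 3 = 1"
    using ev[OF fA[of 4], of "\<e> 1" "\<e> 4" "\<e> 3"] pair(1)
    by (simp add: form_A_def tri_diff tri_elementary diag unit_vec_nth complex_eq_iff)
  moreover have "l 2 = 1"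
    using ev[OF fA[of 5], of "\<e> 3" "\<e> 6" "\<e> 2"] pair(3)
    by (simp add: form_A_def tri_diff tri_elementary diag unit_vec_nth complex_eq_iff)
  moreover have "l 1 = 1"
    using ev[OF fA[of 6], of "\<e> 2" "\<e> 5" "\<e> 1"] pair(2)
    by (simp add: form_A_def tri_diff tri_elementary diag unit_vec_nth complex_eq_iff)
  ultimately have "l 4 = 1" "l 5 = 1" "l 6 = 1" "l 1 = 1" "l 2 = 1" "l 3 = 1" using pair by simp_all
  then have "\<forall>j. A *v \<e> j = \<e> j"
    unfolding forall_6 using diag by simp
  then have "A *v \<e> j = \<e> j" for j by blast
  then have "column j A = column j (mat 1)" for j
    by (metis matrix_vector_mult_basis matrix_vector_mul_lid)
  then show ?thesis by (simp add: vec_eq_iff column_def)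
qed

text \<open>
  The cone over the fixed points lies in the space of fixed vectors of a linear map other than the
  identity, a proper subspace of \<open>\<real>\<^sup>2\<^sup>8\<close>.
\<close>

lemma fixed_set_null:
  assumes A: "A \<in> Sp6_int" "A \<noteq> mat 1"
  shows "{\<Omega> \<in> U1_plus. pullback A \<Omega> = \<Omega>} \<in> null_sets natural_measure"
proof -
  let ?X = "{\<Omega> \<in> U1_plus. pullback A \<Omega> = \<Omega>}"
  have "closed {\<Omega>. pullback A \<Omega> = \<Omega>}"
    by (intro closed_Collect_eq linear_continuous_on bounded_linear_pullback continuous_on_id)
  then have X: "?X \<in> sets (restrict_space borel U1_plus)"
    by (auto simp: sets_restrict_space intro!: image_eqI[of _ _ "{\<Omega>. pullback A \<Omega> = \<Omega>}"])
  let ?S = "{x. form_coords (pullback A (param_form x)) = x}"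
  have lin: "linear (\<lambda>x. form_coords (pullback A (param_form x)))"
    using linear_compose[OF linear_compose[OF bounded_linear.linear[OF bounded_linear_param_form]
        bounded_linear.linear[OF bounded_linear_pullback]] bounded_linear.linear[OF bounded_linear_form_coords]]
    by (simp add: o_def)
  have sub: "subspace ?S"
    by (rule subspaceI) (simp_all add: linear_0[OF lin] linear_add[OF lin] linear_scale[OF lin])
  have "?S \<noteq> UNIV"
  proof
    assume S: "?S = UNIV"
    have "pullback A \<Omega> = \<Omega>" if \<Omega>: "\<Omega> \<in> primitive_forms" for \<Omega>
    proof -
      have "form_coords \<Omega> \<in> ?S" unfolding S by simp
      then have "form_coords (pullback A \<Omega>) = form_coords \<Omega>" using \<Omega> by (simp add: param_form_form_coords)
      then show ?thesis
        using param_form_form_coords[OF \<Omega>] param_form_form_coords[OF primitive_pullback[OF Sp6_int_symplectic[OF A(1)] \<Omega>]] by simp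
    qed
    from trivial_action_imp_one[OF A(1) this] A(2) show False by simp
  qed
  then have "span ?S \<noteq> UNIV"
    unfolding span_eq_iff[THEN iffD2, OF sub] .
  then have "dim ?S \<noteq> DIM(real ^ 28)"
    unfolding dim_eq_full .
  then have "negligible ?S" using dim_subset_UNIV[of ?S] by (intro negligible_lowdim) simp
  then have nullS: "?S \<in> null_sets lebesgue" by (simp add: negligible_iff_null_sets)
  have "{x \<in> positive_cone. radial_projection x \<in> ?X} \<subseteq> ?S"
  proof
    fix x assume "x \<in> {x \<in> positive_cone. radial_projection x \<in> ?X}"
    then have x: "coords_normalization x > 0" "pullback A (radial_projection x) = radial_projection x"
      by (auto simp: positive_cone_def)
    let ?r = "1 / sqrt (coords_normalization x)"
    have "?r *\<^sub>R pullback A (param_form x) = ?r *\<^sub>R param_form x"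
      using x(2) linear_scale[OF bounded_linear.linear[OF bounded_linear_pullback[of A]]]
      by (simp add: radial_projection_def)
    then have "pullback A (param_form x) = param_form x" using x(1) by simp
    then show "x \<in> ?S" by (simp add: form_coords_param_form)
  qed
  then have "{x \<in> positive_cone. radial_projection x \<in> ?X} \<in> null_sets lebesgue"
    using borel_cone_over[OF X] by (intro null_sets_subset[OF nullS]) auto
  then have "emeasure lebesgue {x \<in> positive_cone. radial_projection x \<in> ?X} = 0"
    by (rule null_setsD1)
  then have "emeasure lborel {x \<in> positive_cone. radial_projection x \<in> ?X} = 0"
    using borel_cone_over[OF X] by simp
  then show ?thesis
    using X emeasure_cone_measure[OF X]
    by (auto simp: null_sets_def natural_measure_eq_cone_measure sets_cone_measure)
qed

lemma sets_natural_measure: "sets natural_measure = sets (restrict_space borel U1_plus)"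
  by (simp add: natural_measure_eq_cone_measure sets_cone_measure)

lemma space_natural_measure: "space natural_measure = U1_plus"
  using sets_eq_imp_space_eq[OF sets_natural_measure] by (simp add: space_restrict_space)

lemma open_sets_natural_measure: "open W \<Longrightarrow> U1_plus \<inter> W \<in> sets natural_measure"
  by (auto simp: sets_natural_measure sets_restrict_space)

lemma pullback_image_sets: "A \<in> Sp6_int \<Longrightarrow> X \<in> sets natural_measure \<Longrightarrow> pullback A ` X \<in> sets natural_measure"
  by (rule symplectic_symmetry.emeasure_image(1)[OF pullback_symmetry])

lemma emeasure_pullback_image:
  "A \<in> Sp6_int \<Longrightarrow> X \<in> sets natural_measure \<Longrightarrow> emeasure natural_measure (pullback A ` X) = emeasure natural_measure X"
  by (rule symplectic_symmetry.emeasure_image(2)[OF pullback_symmetry])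

lemma pullback_inverse:
  assumes "A \<in> Sp6_int"
  shows "pullback (sp_inverse A) (pullback A x) = x" "pullback A (pullback (sp_inverse A) x) = x"
  using assms by (simp_all add: pullback_mult sp_inverse pullback_one)

section \<open>A fundamental domain\<close>

text \<open>
  Properness leaves finitely many elements that could return a point to a neighbourhood of \<open>\<Omega>\<close>.  As each of
  them moves \<open>\<Omega>\<close>, they are excluded by shrinking the neighbourhood.
\<close>

lemma wandering_neighbourhood:
  assumes \<Omega>: "\<Omega> \<in> U1_plus" and free: "\<And>A. A \<in> Sp6_int \<Longrightarrow> A \<noteq> mat 1 \<Longrightarrow> pullback A \<Omega> \<noteq> \<Omega>"
  obtains W where "open W" "\<Omega> \<in> W"
    "\<And>A \<Omega>'. A \<in> Sp6_int \<Longrightarrow> A \<noteq> mat 1 \<Longrightarrow> \<Omega>' \<in> U1_plus \<Longrightarrow> \<Omega>' \<in> W \<Longrightarrow> pullback A \<Omega>' \<notin> W"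
proof -
  have "\<Omega> \<in> U_forms" using \<Omega> by (simp add: U1_plus_eq U_plus_eq)
  from finitely_many_returns[OF this] obtain c where c: "c > 0"
    "finite {A \<in> Sp6_int. \<exists>\<Omega>'. alternating \<Omega>' \<and> norm (\<Omega>' - \<Omega>) < c \<and> norm (pullback A \<Omega>' - \<Omega>) < c}" (is "finite ?R") by blast
  have "\<exists>W. open W \<and> \<Omega> \<in> W \<and> (\<forall>\<Omega>'\<in>W. pullback A \<Omega>' \<notin> W)" if A: "A \<in> Sp6_int" "A \<noteq> mat 1" for A
  proof -
    have ne: "\<Omega> \<noteq> pullback A \<Omega>" using free[OF A] by simp
    obtain P Q where PQ: "open P" "open Q" "\<Omega> \<in> P" "pullback A \<Omega> \<in> Q" "P \<inter> Q = {}"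
      using iffD1[OF separation_t2 ne] by blast
    have "open (pullback A -` Q)"
      by (rule open_vimage[OF PQ(2) linear_continuous_on[OF bounded_linear_pullback]])
    then show ?thesis
      using PQ by (intro exI[of _ "P \<inter> pullback A -` Q"]) auto
  qed
  then obtain W where W: "\<And>A. A \<in> Sp6_int \<Longrightarrow> A \<noteq> mat 1 \<Longrightarrow> open (W A) \<and> \<Omega> \<in> W A \<and> (\<forall>\<Omega>'\<in>W A. pullback A \<Omega>' \<notin> W A)"
    by metis
  let ?F = "?R - {mat 1}"
  let ?W = "ball \<Omega> c \<inter> (\<Inter>A\<in>?F. W A)"
  show ?thesis
  proof (rule that)
    show "open ?W" using c(2) W by (intro open_Int open_INT) auto
    show "\<Omega> \<in> ?W" using c(1) W by auto
    fix A \<Omega>' assume A: "A \<in> Sp6_int" "A \<noteq> mat 1" and \<Omega>': "\<Omega>' \<in> U1_plus" "\<Omega>' \<in> ?W"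
    show "pullback A \<Omega>' \<notin> ?W"
    proof
      assume in_W: "pullback A \<Omega>' \<in> ?W"
      have "alternating \<Omega>'" using \<Omega>'(1) by (intro primitive_alternating U1_plus_primitive)
      then have "A \<in> ?F" using A \<Omega>' in_W by (auto simp: dist_norm norm_minus_commute)
      then show False using W[OF A] \<Omega>'(2) in_W by auto
    qed
  qed
qed

definition free_points :: "trilinear set"
  where "free_points = {\<Omega> \<in> U1_plus. \<forall>A\<in>Sp6_int. A \<noteq> mat 1 \<longrightarrow> pullback A \<Omega> \<noteq> \<Omega>}"

lemma non_free_null: "U1_plus - free_points \<in> null_sets natural_measure"
proof -
  have "U1_plus - free_points = (\<Union>A\<in>Sp6_int - {mat 1}. {\<Omega> \<in> U1_plus. pullback A \<Omega> = \<Omega>})"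
    by (auto simp: free_points_def)
  also have "\<dots> \<in> null_sets natural_measure"
    using countable_Sp6_int fixed_set_null by (intro null_sets_UN') auto
  finally show ?thesis .
qed

text \<open>The Lindeloef property is used in the coordinates \<open>\<real>\<^sup>2\<^sup>8\<close>, whose topology has a countable basis.\<close>

lemma wandering_cover:
  obtains W :: "nat \<Rightarrow> trilinear set" where "\<And>n. open (W n)" "free_points \<subseteq> (\<Union>n. W n)"
    "\<And>n A \<Omega>'. A \<in> Sp6_int \<Longrightarrow> A \<noteq> mat 1 \<Longrightarrow> \<Omega>' \<in> U1_plus \<Longrightarrow> \<Omega>' \<in> W n \<Longrightarrow> pullback A \<Omega>' \<notin> W n"
proof -
  define wandering where "wandering W \<longleftrightarrow> open W \<and>
    (\<forall>A \<Omega>'. A \<in> Sp6_int \<longrightarrow> A \<noteq> mat 1 \<longrightarrow> \<Omega>' \<in> U1_plus \<longrightarrow> \<Omega>' \<in> W \<longrightarrow> pullback A \<Omega>' \<notin> W)" for W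
  have ex: "\<exists>W. wandering W \<and> \<Omega> \<in> W" if \<Omega>: "\<Omega> \<in> free_points" for \<Omega>
  proof -
    have in_U1: "\<Omega> \<in> U1_plus" and free: "\<And>A. A \<in> Sp6_int \<Longrightarrow> A \<noteq> mat 1 \<Longrightarrow> pullback A \<Omega> \<noteq> \<Omega>"
      using \<Omega> by (simp_all add: free_points_def)
    obtain W where "open W" "\<Omega> \<in> W"
      "\<And>A \<Omega>'. A \<in> Sp6_int \<Longrightarrow> A \<noteq> mat 1 \<Longrightarrow> \<Omega>' \<in> U1_plus \<Longrightarrow> \<Omega>' \<in> W \<Longrightarrow> pullback A \<Omega>' \<notin> W"
      by (rule wandering_neighbourhood[OF in_U1]) (erule (1) free, rule that)
    then have "wandering W" unfolding wandering_def by simp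
    with \<open>\<Omega> \<in> W\<close> show ?thesis by (intro exI[of _ W] conjI)
  qed
  let ?F = "(\<lambda>W. param_form -` W) ` Collect wandering"
  have "open S" if S: "S \<in> ?F" for S
  proof -
    obtain W where "S = param_form -` W" "open W" using S by (auto simp: wandering_def)
    then show ?thesis by (simp add: open_vimage linear_continuous_on[OF bounded_linear_param_form])
  qed
  from Lindelof[of ?F, OF this] obtain F' where F': "F' \<subseteq> ?F" "countable F'" "\<Union>F' = \<Union>?F" by blast
  obtain \<W> where \<W>: "countable \<W>" "\<W> \<subseteq> Collect wandering" "F' = (\<lambda>W. param_form -` W) ` \<W>"
    using countable_subset_image[of F' "\<lambda>W. param_form -` W" "Collect wandering"] F'(1,2) by auto
  have empty: "wandering {}" by (simp add: wandering_def)
  define W where "W = from_nat_into (insert {} \<W>)"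
  have rng: "range W = insert {} \<W>"
    unfolding W_def by (rule range_from_nat_into) (use \<W>(1) in auto)
  have wan: "wandering (W n)" for n
  proof -
    have "W n \<in> insert {} \<W>" unfolding rng[symmetric] by (rule rangeI)
    also have "\<dots> \<subseteq> Collect wandering" using empty \<W>(2) by simp
    finally show ?thesis by (rule CollectD)
  qed
  show ?thesis
  proof (rule that)
    show "open (W n)" for n using wan by (simp add: wandering_def)
    show "pullback A \<Omega>' \<notin> W n" if "A \<in> Sp6_int" "A \<noteq> mat 1" "\<Omega>' \<in> U1_plus" "\<Omega>' \<in> W n" for n A \<Omega>'
      using wan[of n] that by (simp add: wandering_def)
    show "free_points \<subseteq> (\<Union>n. W n)"
    proof
      fix \<Omega> assume \<Omega>: "\<Omega> \<in> free_points"
      then have p: "param_form (form_coords \<Omega>) = \<Omega>"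
        by (intro param_form_form_coords U1_plus_primitive) (simp add: free_points_def)
      obtain W' where "wandering W'" "\<Omega> \<in> W'" using ex[OF \<Omega>] by blast
      then have "form_coords \<Omega> \<in> \<Union>?F" using p by auto
      then have "form_coords \<Omega> \<in> \<Union>F'" using F'(3) by simp
      then obtain W'' where "W'' \<in> \<W>" "form_coords \<Omega> \<in> param_form -` W''" unfolding \<W>(3) by auto
      then have "W'' \<in> range W" "\<Omega> \<in> W''" using rng p by auto
      then show "\<Omega> \<in> (\<Union>n. W n)" by blast
    qed
  qed
qed

text \<open>
  Along a countable cover by wandering sets, the fundamental domain takes from each set the points
  whose orbit has not met an earlier one.  Every free orbit is hit exactly once.
\<close>

lemma fundamental_domain_exists: "\<exists>F. fundamental_domain Sp6_int pullback natural_measure F"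
proof -
  obtain W :: "nat \<Rightarrow> trilinear set" where W: "\<And>n. open (W n)" "free_points \<subseteq> (\<Union>n. W n)"
    "\<And>n A \<Omega>'. A \<in> Sp6_int \<Longrightarrow> A \<noteq> mat 1 \<Longrightarrow> \<Omega>' \<in> U1_plus \<Longrightarrow> \<Omega>' \<in> W n \<Longrightarrow> pullback A \<Omega>' \<notin> W n"
    using wandering_cover by blast
  define B where "B n = U1_plus \<inter> W n" for n
  \<comment> \<open>The union of the orbits that meet B n.\<close>
  define GB where "GB n = (\<Union>A\<in>Sp6_int. pullback A ` B n)" for n
  define F where "F = (\<Union>n. B n - (\<Union>m<n. GB m))"
  have B: "B n \<in> sets natural_measure" for n
    unfolding B_def by (rule open_sets_natural_measure[OF W(1)])
  have GB: "GB n \<in> sets natural_measure" for n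
    unfolding GB_def by (rule sets.countable_UN''[OF countable_Sp6_int]) (rule pullback_image_sets[OF _ B])
  have F: "F \<in> sets natural_measure"
    unfolding F_def by (intro sets.countable_UN sets.Diff sets.finite_UN image_subsetI B GB) auto
  have GB_inv: "pullback A x \<in> GB n" if x: "x \<in> GB n" and A: "A \<in> Sp6_int" for x A n
  proof -
    obtain A' b where "A' \<in> Sp6_int" "b \<in> B n" "x = pullback A' b" using x by (auto simp: GB_def)
    then show ?thesis
      using A Sp6_int_mult[of A' A] by (auto simp: GB_def pullback_mult)
  qed
  have B_GB: "B n \<subseteq> GB n" for n
    using Sp6_int_one pullback_one by (auto simp: GB_def intro!: bexI[of _ "mat 1"] image_eqI)
  have wander: "pullback A x \<notin> F" if A: "A \<in> Sp6_int" "A \<noteq> mat 1" and x: "x \<in> F" for A x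
  proof
    assume "pullback A x \<in> F"
    then obtain m where m: "pullback A x \<in> B m" "\<And>k. k < m \<Longrightarrow> pullback A x \<notin> GB k" by (auto simp: F_def)
    obtain n where n: "x \<in> B n" "\<And>k. k < n \<Longrightarrow> x \<notin> GB k" using x by (auto simp: F_def)
    consider "m < n" | "n < m" | "m = n" by linarith
    then show False
    proof cases
      case 1
      have "pullback (sp_inverse A) (pullback A x) \<in> GB m"
        by (rule GB_inv[OF subsetD[OF B_GB m(1)] sp_inverse(1)[OF A(1)]])
      then show False using n(2)[OF 1] A by (simp add: pullback_inverse)
    next
      case 2
      have "pullback A x \<in> GB n" by (rule GB_inv[OF subsetD[OF B_GB n(1)] A(1)])
      then show False using m(2)[OF 2] by simp
    next
      case 3
      then show False using W(3)[OF A, of x n] m(1) n(1) by (auto simp: B_def)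
    qed
  qed
  have overlap: "pullback A ` F \<inter> pullback A' ` F = {}" if "A \<in> Sp6_int" "A' \<in> Sp6_int" "A \<noteq> A'" for A A'
  proof (rule ccontr)
    assume "pullback A ` F \<inter> pullback A' ` F \<noteq> {}"
    then obtain x y where xy: "x \<in> F" "y \<in> F" "pullback A x = pullback A' y" by auto
    have "y = pullback (A ** sp_inverse A') x"
      using pullback_inverse(1)[OF that(2), of y] by (simp add: xy(3)[symmetric] pullback_mult)
    moreover have "A ** sp_inverse A' \<in> Sp6_int" using that sp_inverse Sp6_int_mult by blast
    moreover have "A ** sp_inverse A' \<noteq> mat 1"
    proof
      assume "A ** sp_inverse A' = mat 1"
      then have "(A ** sp_inverse A') ** A' = A'" by simp
      then show False using that sp_inverse(2)[OF that(2)] by (simp add: matrix_mul_assoc[symmetric])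
    qed
    ultimately show False using wander[of "A ** sp_inverse A'" x] xy by simp
  qed
  have cover: "free_points \<subseteq> (\<Union>A\<in>Sp6_int. pullback A ` F)"
  proof
    fix x assume x: "x \<in> free_points"
    then obtain n0 where "x \<in> B n0" using W(2) by (auto simp: B_def free_points_def)
    then have "\<exists>n. x \<in> GB n" using B_GB by blast
    then obtain n where n: "x \<in> GB n" "\<And>k. k < n \<Longrightarrow> x \<notin> GB k"
      using exists_least_iff[of "\<lambda>n. x \<in> GB n"] by blast
    then obtain A b where Ab: "A \<in> Sp6_int" "b \<in> B n" "x = pullback A b" by (auto simp: GB_def)
    have "b \<in> F" unfolding F_def using Ab n(2) GB_inv by blast
    then show "x \<in> (\<Union>A\<in>Sp6_int. pullback A ` F)" using Ab by blast
  qed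
  have "U1_plus - (\<Union>A\<in>Sp6_int. pullback A ` F) \<in> null_sets natural_measure"
  proof (rule null_sets_subset[OF non_free_null])
    have "U1_plus \<in> sets natural_measure" using sets.top[of natural_measure] by (simp add: space_natural_measure)
    then show "U1_plus - (\<Union>A\<in>Sp6_int. pullback A ` F) \<in> sets natural_measure"
      by (rule sets.Diff) (rule sets.countable_UN''[OF countable_Sp6_int], rule pullback_image_sets[OF _ F])
  qed (use cover in blast)
  then have "fundamental_domain Sp6_int pullback natural_measure F"
    unfolding fundamental_domain_def space_natural_measure using F overlap by auto
  then show ?thesis by blast
qed

section \<open>Comparing fundamental domains\<close>

text \<open>
  The translates of a fundamental domain cover the space up to a null set, and they are disjoint after the
  null set of all overlaps has been removed.
\<close>

lemma emeasure_by_translates: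
  assumes F: "fundamental_domain Sp6_int pullback natural_measure F" and Y: "Y \<in> sets natural_measure"
  shows "emeasure natural_measure Y =
    (\<integral>\<^sup>+ A. emeasure natural_measure (Y \<inter> pullback A ` F) \<partial>count_space Sp6_int)"
proof -
  let ?M = natural_measure
  define N where "N = (\<Union>A\<in>Sp6_int. \<Union>A'\<in>Sp6_int - {A}. pullback A ` F \<inter> pullback A' ` F)"
  have N: "N \<in> null_sets ?M"
    unfolding N_def using F countable_Sp6_int
    by (intro null_sets_UN') (auto simp: fundamental_domain_def)
  have Fs: "F \<in> sets ?M" using F by (simp add: fundamental_domain_def)
  define Z where "Z = space ?M - (\<Union>A\<in>Sp6_int. pullback A ` F)"
  have Z: "Z \<in> null_sets ?M" using F by (simp add: fundamental_domain_def Z_def)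
  define P where "P A = Y \<inter> pullback A ` F - N" for A
  have P: "P A \<in> sets ?M" if "A \<in> Sp6_int" for A
    unfolding P_def
    by (rule sets.Diff[OF sets.Int[OF Y pullback_image_sets[OF that Fs]] null_setsD2[OF N]])
  have UP: "(\<Union>A\<in>Sp6_int. P A) \<in> sets ?M"
    using countable_Sp6_int P by (intro sets.countable_UN') auto
  have "emeasure ?M Y = emeasure ?M (\<Union>A\<in>Sp6_int. P A)"
  proof (rule emeasure_eq_AE)
    have "AE x in ?M. x \<notin> N \<union> Z" by (rule AE_not_in) (use N Z in auto)
    then show "AE x in ?M. x \<in> Y \<longleftrightarrow> x \<in> (\<Union>A\<in>Sp6_int. P A)"
      by (rule AE_mp) (rule AE_I2, auto simp: P_def Z_def)
  qed (use Y UP in auto)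
  also have "\<dots> = (\<integral>\<^sup>+ A. emeasure ?M (P A) \<partial>count_space Sp6_int)"
  proof (rule emeasure_UN_countable)
    show "disjoint_family_on P Sp6_int"
      unfolding disjoint_family_on_def P_def N_def by blast
  qed (use P countable_Sp6_int in auto)
  also have "\<dots> = (\<integral>\<^sup>+ A. emeasure ?M (Y \<inter> pullback A ` F) \<partial>count_space Sp6_int)"
  proof (rule nn_integral_cong)
    fix A assume "A \<in> space (count_space Sp6_int)"
    then have "A \<in> Sp6_int" by simp
    then have "Y \<inter> pullback A ` F \<in> sets ?M" by (rule sets.Int[OF Y pullback_image_sets[OF _ Fs]])
    then show "emeasure ?M (P A) = emeasure ?M (Y \<inter> pullback A ` F)"
      unfolding P_def by (rule emeasure_Diff_null_set[OF N])
  qed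
  finally show ?thesis .
qed

lemma pullback_image_invariant:
  assumes "\<And>A. A \<in> Sp6_int \<Longrightarrow> pullback A ` X \<subseteq> X" and A: "A \<in> Sp6_int"
  shows "pullback A ` X = X"
proof
  show "X \<subseteq> pullback A ` X"
  proof
    fix x assume "x \<in> X"
    then have "pullback (sp_inverse A) x \<in> X" using assms(1)[OF sp_inverse(1)[OF A]] by blast
    then show "x \<in> pullback A ` X" using pullback_inverse(2)[OF A, of x] by (metis imageI)
  qed
qed (rule assms(1)[OF A])

text \<open>
  Unfolding: \<open>F \<inter> X\<close> is cut by the translates of \<open>F'\<close>, each piece is moved back by the inverse group
  element, and the pieces obtained are those into which the translates of \<open>F\<close> cut \<open>F' \<inter> X\<close>.
\<close>

lemma fundamental_domain_measure_unique:
  assumes F: "fundamental_domain Sp6_int pullback natural_measure F"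
    and F': "fundamental_domain Sp6_int pullback natural_measure F'"
    and X: "X \<in> sets natural_measure" "\<And>A. A \<in> Sp6_int \<Longrightarrow> pullback A ` X \<subseteq> X"
  shows "emeasure natural_measure (F \<inter> X) = emeasure natural_measure (F' \<inter> X)"
proof -
  let ?M = natural_measure
  have Fs: "F \<in> sets ?M" "F' \<in> sets ?M" using F F' by (auto simp: fundamental_domain_def)
  have "emeasure ?M (F \<inter> X) = (\<integral>\<^sup>+ A. emeasure ?M (F \<inter> X \<inter> pullback A ` F') \<partial>count_space Sp6_int)"
    by (rule emeasure_by_translates[OF F']) (use Fs X in auto)
  also have "\<dots> = (\<integral>\<^sup>+ A. emeasure ?M (F' \<inter> X \<inter> pullback (sp_inverse A) ` F) \<partial>count_space Sp6_int)"
  proof (rule nn_integral_cong)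
    fix A assume "A \<in> space (count_space Sp6_int)"
    then have A: "A \<in> Sp6_int" by simp
    let ?T = "pullback (sp_inverse A)"
    have inj: "inj ?T" using pullback_inverse(2)[OF A] by (metis injI)
    have "?T ` pullback A ` F' = F'" by (simp add: image_image pullback_inverse[OF A])
    moreover have "?T ` X = X" by (rule pullback_image_invariant[OF X(2) sp_inverse(1)[OF A]])
    ultimately have "?T ` (F \<inter> X \<inter> pullback A ` F') = F' \<inter> X \<inter> ?T ` F"
      by (simp add: image_Int[OF inj] Int_ac)
    moreover have "emeasure ?M (?T ` (F \<inter> X \<inter> pullback A ` F')) = emeasure ?M (F \<inter> X \<inter> pullback A ` F')"
      by (rule emeasure_pullback_image[OF sp_inverse(1)[OF A]])
        (use Fs X A in \<open>auto intro: pullback_image_sets\<close>)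
    ultimately show "emeasure ?M (F \<inter> X \<inter> pullback A ` F') = emeasure ?M (F' \<inter> X \<inter> ?T ` F)" by simp
  qed
  also have "\<dots> = (\<integral>\<^sup>+ A. emeasure ?M (F' \<inter> X \<inter> pullback A ` F) \<partial>count_space Sp6_int)"
    by (rule nn_integral_bij_count_space[OF bij_sp_inverse])
  also have "\<dots> = emeasure ?M (F' \<inter> X)"
    by (rule emeasure_by_translates[OF F, symmetric]) (use Fs X in auto)
  finally show ?thesis .
qed

text \<open>Otherwise \<open>X\<close> would be covered, up to a null set, by countably many null translates.\<close>

lemma fundamental_domain_positive:
  assumes F: "fundamental_domain Sp6_int pullback natural_measure F"
    and X: "X \<in> sets natural_measure" "\<And>A. A \<in> Sp6_int \<Longrightarrow> pullback A ` X \<subseteq> X" and pos: "emeasure natural_measure X > 0"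
  shows "emeasure natural_measure (F \<inter> X) > 0"
proof (rule ccontr)
  let ?M = natural_measure
  assume "\<not> emeasure ?M (F \<inter> X) > 0"
  then have 0: "emeasure ?M (F \<inter> X) = 0" by simp
  have Fs: "F \<in> sets ?M" using F by (auto simp: fundamental_domain_def)
  have "emeasure ?M X = (\<integral>\<^sup>+ A. emeasure ?M (X \<inter> pullback A ` F) \<partial>count_space Sp6_int)"
    by (rule emeasure_by_translates[OF F X(1)])
  also have "\<dots> = (\<integral>\<^sup>+ A. 0 \<partial>count_space Sp6_int)"
  proof (rule nn_integral_cong)
    fix A assume "A \<in> space (count_space Sp6_int)"
    then have A: "A \<in> Sp6_int" by simp
    have inj: "inj (pullback A)" using pullback_inverse(1)[OF A] by (metis injI)
    have "pullback A ` (F \<inter> X) = X \<inter> pullback A ` F"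
      by (simp add: image_Int[OF inj] pullback_image_invariant[OF X(2) A] Int_commute)
    then show "emeasure ?M (X \<inter> pullback A ` F) = 0"
      using emeasure_pullback_image[OF A, of "F \<inter> X"] Fs X(1) 0 by simp
  qed
  finally show False using pos by simp
qed

section \<open>A quartic invariant of the real part\<close>

text \<open>The matrix equation \<open>A J A\<^sup>T = J\<close>: transposes of symplectic matrices are symplectic.\<close>

lemma symplectic_transpose:
  assumes A: "A \<in> Sp6_int"
  shows "A *v dual_vec (transpose A *v y) = dual_vec y"
proof -
  obtain B where B: "A ** B = mat 1" using Sp6_int_inverse[OF A] by metis
  have o: "omega (A *v x) (A *v z) = omega x z" for x z using A by (simp add: Sp6_int_def)
  have "x \<bullet> dual_vec (A *v dual_vec (transpose A *v y)) = x \<bullet> dual_vec (dual_vec y)" for x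
  proof -
    have x: "A *v (B *v x) = x" by (simp add: matrix_vector_mul_assoc B)
    have "x \<bullet> dual_vec (A *v dual_vec (transpose A *v y)) = omega (A *v (B *v x)) (A *v dual_vec (transpose A *v y))"
      by (simp add: x omega_inner)
    also have "\<dots> = - ((B *v x) \<bullet> (transpose A *v y))" by (simp add: o omega_dual_vec)
    also have "(B *v x) \<bullet> (transpose A *v y) = (A *v (B *v x)) \<bullet> y"
      by (metis dot_lmul_matrix inner_commute transpose_matrix_vector)
    also have "- \<dots> = x \<bullet> dual_vec (dual_vec y)" by (simp add: x dual_vec_dual_vec)
    finally show ?thesis .
  qed
  then have "dual_vec (A *v dual_vec (transpose A *v y)) = dual_vec (dual_vec y)"
    by (metis vector_eq_rdot inner_commute)
  then have "dual_vec (dual_vec (A *v dual_vec (transpose A *v y))) = dual_vec (dual_vec (dual_vec y))" by simp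
  then show ?thesis by (simp add: dual_vec_dual_vec linear_neg[OF linear_dual_vec])
qed

definition bilinear_real :: "(V \<Rightarrow> V \<Rightarrow> real) \<Rightarrow> bool"
  where "bilinear_real \<beta> \<longleftrightarrow> (\<forall>y. linear (\<lambda>x. \<beta> x y)) \<and> (\<forall>x. linear (\<beta> x))"

lemma sum_basis_expansion: "(u :: V) = (\<Sum>k\<in>UNIV. (u $ k) *\<^sub>R \<e> k)"
  by (simp add: sum_6 V_expansion[symmetric])

text \<open>
  Up to sign the sum is the contraction of \<open>\<beta>\<close> with the Poisson bivector of \<open>\<omega>\<close>, which symplectic
  matrices preserve.
\<close>

lemma poisson_contraction_invariant:
  assumes \<beta>: "bilinear_real \<beta>" and A: "A \<in> Sp6_int"
  shows "(\<Sum>i\<in>UNIV. \<beta> (A *v \<e> i) (A *v dual_vec (\<e> i))) = (\<Sum>i\<in>UNIV. \<beta> (\<e> i) (dual_vec (\<e> i)))"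
proof -
  have lin1: "linear (\<lambda>x. \<beta> x y)" and lin2: "linear (\<beta> x)" for x y using \<beta> by (auto simp: bilinear_real_def)
  have "\<beta> (A *v \<e> i) y = (\<Sum>k\<in>UNIV. A $ k $ i * \<beta> (\<e> k) y)" for i y
  proof -
    have "A *v \<e> i = (\<Sum>k\<in>UNIV. (A $ k $ i) *\<^sub>R \<e> k)"
      by (subst sum_basis_expansion) (simp add: matrix_vector_mult_basis column_def)
    then show ?thesis by (simp add: linear_sum[OF lin1] linear_scale[OF lin1])
  qed
  then have "(\<Sum>i\<in>UNIV. \<beta> (A *v \<e> i) (A *v dual_vec (\<e> i))) =
      (\<Sum>i\<in>UNIV. \<Sum>k\<in>UNIV. A $ k $ i * \<beta> (\<e> k) (A *v dual_vec (\<e> i)))" by simp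
  also have "\<dots> = (\<Sum>k\<in>UNIV. \<Sum>i\<in>UNIV. A $ k $ i * \<beta> (\<e> k) (A *v dual_vec (\<e> i)))"
    by (rule sum.swap)
  also have "\<dots> = (\<Sum>k\<in>UNIV. \<beta> (\<e> k) (dual_vec (\<e> k)))"
  proof (rule sum.cong[OF refl])
    fix k :: 6
    have t: "transpose A *v \<e> k = (\<Sum>i\<in>UNIV. (A $ k $ i) *\<^sub>R \<e> i)"
      by (subst sum_basis_expansion) (simp add: matrix_vector_mult_basis column_def transpose_def)
    have lin: "linear (\<lambda>x. \<beta> (\<e> k) (A *v dual_vec x))"
      using linear_compose[OF linear_compose[OF linear_dual_vec matrix_vector_mul_linear[of A]] lin2[of "\<e> k"]]
      by (simp add: o_def)
    have "(\<Sum>i\<in>UNIV. A $ k $ i * \<beta> (\<e> k) (A *v dual_vec (\<e> i))) = \<beta> (\<e> k) (A *v dual_vec (transpose A *v \<e> k))"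
      unfolding t linear_sum[OF lin] linear_scale[OF lin] by simp
    then show "(\<Sum>i\<in>UNIV. A $ k $ i * \<beta> (\<e> k) (A *v dual_vec (\<e> i))) = \<beta> (\<e> k) (dual_vec (\<e> k))"
      by (simp only: symplectic_transpose[OF A])
  qed
  finally show ?thesis .
qed

definition re_tri :: "trilinear \<Rightarrow> V \<Rightarrow> V \<Rightarrow> V \<Rightarrow> real" where "re_tri \<Omega> u v w = Re (tri \<Omega> u v w)"

text \<open>
  The real part is contracted twice with itself through the Poisson bivector, which leaves a bilinear
  form on \<open>V\<close>; \<open>quartic\<close> contracts this bilinear form with itself in the same way.  Both are built from
  symplectic data only, so \<open>quartic\<close> is invariant.
\<close>

definition contraction :: "trilinear \<Rightarrow> V \<Rightarrow> V \<Rightarrow> real"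
  where "contraction \<Omega> u v = (\<Sum>i\<in>UNIV. \<Sum>j\<in>UNIV. re_tri \<Omega> u (\<e> i) (\<e> j) * re_tri \<Omega> v (dual_vec (\<e> i)) (dual_vec (\<e> j)))"

definition quartic :: "trilinear \<Rightarrow> real"
  where "quartic \<Omega> = (\<Sum>i\<in>UNIV. \<Sum>j\<in>UNIV. contraction \<Omega> (\<e> i) (\<e> j) * contraction \<Omega> (dual_vec (\<e> i)) (dual_vec (\<e> j)))"

lemma re_tri_linear:
  "re_tri \<Omega> (x + y) v w = re_tri \<Omega> x v w + re_tri \<Omega> y v w" "re_tri \<Omega> (c *\<^sub>R x) v w = c * re_tri \<Omega> x v w"
  "re_tri \<Omega> v (x + y) w = re_tri \<Omega> v x w + re_tri \<Omega> v y w" "re_tri \<Omega> v (c *\<^sub>R x) w = c * re_tri \<Omega> v x w"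
  "re_tri \<Omega> v w (x + y) = re_tri \<Omega> v w x + re_tri \<Omega> v w y" "re_tri \<Omega> v w (c *\<^sub>R x) = c * re_tri \<Omega> v w x"
  by (simp_all add: re_tri_def tri_add tri_scaleR)

lemma contraction_linear:
  "contraction \<Omega> (x + y) v = contraction \<Omega> x v + contraction \<Omega> y v" "contraction \<Omega> (c *\<^sub>R x) v = c * contraction \<Omega> x v"
  "contraction \<Omega> v (x + y) = contraction \<Omega> v x + contraction \<Omega> v y" "contraction \<Omega> v (c *\<^sub>R x) = c * contraction \<Omega> v x"
  by (simp_all add: contraction_def re_tri_linear sum.distrib sum_distrib_left algebra_simps)

lemma contraction_pullback:
  assumes A: "A \<in> Sp6_int"
  shows "contraction (pullback A \<Omega>) u v = contraction \<Omega> (A *v u) (A *v v)"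
proof -
  let ?r = "re_tri \<Omega>" and ?u = "A *v u" and ?v = "A *v v"
  have "contraction (pullback A \<Omega>) u v =
      (\<Sum>i\<in>UNIV. \<Sum>j\<in>UNIV. ?r ?u (A *v \<e> i) (A *v \<e> j) * ?r ?v (A *v dual_vec (\<e> i)) (A *v dual_vec (\<e> j)))"
    by (simp add: contraction_def re_tri_def tri_pullback)
  also have "\<dots> = (\<Sum>i\<in>UNIV. \<Sum>j\<in>UNIV. ?r ?u (A *v \<e> i) (\<e> j) * ?r ?v (A *v dual_vec (\<e> i)) (dual_vec (\<e> j)))"
    by (rule sum.cong[OF refl],
        rule poisson_contraction_invariant[OF _ A, where \<beta> = "\<lambda>x y. ?r ?u (A *v \<e> i) x * ?r ?v (A *v dual_vec (\<e> i)) y" for i])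
      (auto simp: bilinear_real_def re_tri_linear algebra_simps intro!: linearI)
  also have "\<dots> = (\<Sum>i\<in>UNIV. \<Sum>j\<in>UNIV. ?r ?u (\<e> i) (\<e> j) * ?r ?v (dual_vec (\<e> i)) (dual_vec (\<e> j)))"
    by (rule poisson_contraction_invariant[OF _ A, where \<beta> = "\<lambda>x y. \<Sum>j\<in>UNIV. ?r ?u x (\<e> j) * ?r ?v y (dual_vec (\<e> j))"])
      (auto simp: bilinear_real_def re_tri_linear sum.distrib sum_distrib_left algebra_simps intro!: linearI)
  finally show ?thesis by (simp add: contraction_def)
qed

lemma quartic_pullback:
  assumes A: "A \<in> Sp6_int"
  shows "quartic (pullback A \<Omega>) = quartic \<Omega>"
proof -
  let ?b = "contraction \<Omega>"
  have "quartic (pullback A \<Omega>) =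
      (\<Sum>i\<in>UNIV. \<Sum>j\<in>UNIV. ?b (A *v \<e> i) (A *v \<e> j) * ?b (A *v dual_vec (\<e> i)) (A *v dual_vec (\<e> j)))"
    by (simp add: quartic_def contraction_pullback[OF A])
  also have "\<dots> = (\<Sum>i\<in>UNIV. \<Sum>j\<in>UNIV. ?b (A *v \<e> i) (\<e> j) * ?b (A *v dual_vec (\<e> i)) (dual_vec (\<e> j)))"
    by (rule sum.cong[OF refl],
        rule poisson_contraction_invariant[OF _ A, where \<beta> = "\<lambda>x y. ?b (A *v \<e> i) x * ?b (A *v dual_vec (\<e> i)) y" for i])
      (auto simp: bilinear_real_def contraction_linear algebra_simps intro!: linearI)
  also have "\<dots> = (\<Sum>i\<in>UNIV. \<Sum>j\<in>UNIV. ?b (\<e> i) (\<e> j) * ?b (dual_vec (\<e> i)) (dual_vec (\<e> j)))"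
    by (rule poisson_contraction_invariant[OF _ A, where \<beta> = "\<lambda>x y. \<Sum>j\<in>UNIV. ?b x (\<e> j) * ?b y (dual_vec (\<e> j))"])
      (auto simp: bilinear_real_def contraction_linear sum.distrib sum_distrib_left algebra_simps intro!: linearI)
  finally show ?thesis by (simp add: quartic_def)
qed

lemma quartic_homogeneous:
  assumes "\<And>u v w. re_tri \<Omega>' u v w = c * re_tri \<Omega> u v w"
  shows "quartic \<Omega>' = c ^ 4 * quartic \<Omega>"
proof -
  have "contraction \<Omega>' u v = c\<^sup>2 * contraction \<Omega> u v" for u v
    by (simp add: contraction_def assms sum_distrib_left power2_eq_square algebra_simps)
  then show ?thesis
    by (simp add: quartic_def sum_distrib_left power2_eq_square power4_eq_xxxx algebra_simps)
qed

lemma quartic_stretch: "quartic (postcompose (stretch c) \<Omega>) = c ^ 4 * quartic \<Omega>"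
  by (rule quartic_homogeneous) (simp add: re_tri_def tri_postcompose linear_stretch stretch_def)

lemma quartic_scaleR: "quartic (c *\<^sub>R \<Omega>) = c ^ 4 * quartic \<Omega>"
  by (rule quartic_homogeneous) (simp add: re_tri_def tri_scaleR)

lemma continuous_quartic: "continuous_on S quartic"
  unfolding quartic_def contraction_def re_tri_def
  by (intro continuous_intros linear_continuous_on[OF bounded_linear_tri])

section \<open>The standard complex volume form\<close>

definition holomorphic_coord :: "nat \<Rightarrow> V \<Rightarrow> complex"
  where "holomorphic_coord k u = [Complex (u $ 1) (u $ 4), Complex (u $ 2) (u $ 5), Complex (u $ 3) (u $ 6)] ! k"

text \<open>The form \<open>dz\<^sub>1 \<and> dz\<^sub>2 \<and> dz\<^sub>3\<close>, expanded in the Darboux basis of the primitive forms.\<close>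

definition complex_volume_form :: trilinear
  where "complex_volume_form = form_A 1 0 + form_A \<i> 1 + form_A \<i> 2 + form_A \<i> 3
    + form_B (- 1) 1 + form_B (- 1) 2 + form_B (- 1) 3 + form_B (- \<i>) 0"

lemma tri_complex_volume_form:
  "tri complex_volume_form u v w =
    holomorphic_coord 0 u * holomorphic_coord 1 v * holomorphic_coord 2 w
    + holomorphic_coord 1 u * holomorphic_coord 2 v * holomorphic_coord 0 w
    + holomorphic_coord 2 u * holomorphic_coord 0 v * holomorphic_coord 1 w
    - holomorphic_coord 0 u * holomorphic_coord 2 v * holomorphic_coord 1 w
    - holomorphic_coord 1 u * holomorphic_coord 0 v * holomorphic_coord 2 w
    - holomorphic_coord 2 u * holomorphic_coord 1 v * holomorphic_coord 0 w"
  by (simp add: complex_volume_form_def tri_add form_A_def form_B_def tri_elementary holomorphic_coord_def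
      complex_eq_iff algebra_simps)

lemma complex_volume_form_primitive: "complex_volume_form \<in> primitive_forms"
  unfolding complex_volume_form_def
  by (intro subspace_add[OF subspace_primitive] primitive_form_A primitive_form_B) auto

text \<open>
  The value on a frame is the determinant of its matrix over \<open>\<complex>\<close>.  The Hermitian product on \<open>\<complex>\<^sup>3\<close> has the Euclidean inner
  product as real part and \<open>- \<omega>\<close> as imaginary part, so this matrix is unitary.
\<close>

lemma complex_volume_form_unitary:
  assumes "(u, v, w) \<in> unitary_frames"
  shows "tri complex_volume_form u v w \<noteq> 0"
proof
  assume 0: "tri complex_volume_form u v w = 0"
  let ?z = holomorphic_coord
  define X :: "complex ^ 3 ^ 3" where
    "X = vector [vector [?z 0 u, ?z 1 u, ?z 2 u], vector [?z 0 v, ?z 1 v, ?z 2 v], vector [?z 0 w, ?z 1 w, ?z 2 w]]"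
  define Y :: "complex ^ 3 ^ 3" where "Y = (\<chi> i j. cnj (X $ j $ i))"
  have herm: "?z 0 x * cnj (?z 0 y) + ?z (Suc 0) x * cnj (?z (Suc 0) y) + ?z 2 x * cnj (?z 2 y) = Complex (x \<bullet> y) (- omega x y)" for x y
    by (simp add: holomorphic_coord_def complex_eq_iff inner_V omega_eq)
  have o: "omega v u = 0" "omega w u = 0" "omega w v = 0"
    using assms omega_anti[of v u] omega_anti[of w u] omega_anti[of w v] by (auto simp: unitary_frames_def)
  have "X ** Y = mat 1"
    using assms o
    by (simp add: vec_eq_iff forall_3 matrix_matrix_mult_def sum_3 X_def Y_def mat_def vector_3 herm
        unitary_frames_def inner_commute norm_eq_1 Complex_eq_0 Complex_eq_1)
  then have "det X * det Y = 1" by (metis det_mul det_I)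
  moreover have "det X = tri complex_volume_form u v w"
    by (simp add: det_3 X_def vector_3 tri_complex_volume_form algebra_simps)
  ultimately show False using 0 by simp
qed

lemma complex_volume_form_U1_plus: "complex_volume_form \<in> U1_plus"
proof -
  have "complex_volume_form \<in> U_forms"
    using complex_volume_form_primitive complex_volume_form_unitary by (auto simp: U_forms_iff)
  moreover have "orientation complex_volume_form (\<e> 2) (\<e> 3) (\<e> 1) (\<e> 4) > 0"
    by (simp add: orientation_def tri_complex_volume_form holomorphic_coord_def unit_vec_nth)
  moreover have "normalization complex_volume_form = 1"
    by (simp add: normalization_def lessThan_7 coord_A_def coord_B_def pairing_weight_def tri_complex_volume_form
        holomorphic_coord_def unit_vec_nth)
  ultimately show ?thesis by (simp add: U1_plus_eq U_plus_eq)
qed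

lemma holomorphic_coord_dual_vec: "k < 3 \<Longrightarrow> holomorphic_coord k (dual_vec u) = - \<i> * holomorphic_coord k u"
proof -
  assume "k < 3"
  then have "k = 0 \<or> k = 1 \<or> k = 2" by auto
  then show ?thesis by (auto simp: holomorphic_coord_def dual_vec_nth complex_eq_iff)
qed

lemma tri_complex_volume_form_dual_vec:
  "tri complex_volume_form (dual_vec u) v w = - \<i> * tri complex_volume_form u v w"
  "tri complex_volume_form u (dual_vec v) w = - \<i> * tri complex_volume_form u v w"
  "tri complex_volume_form u v (dual_vec w) = - \<i> * tri complex_volume_form u v w"
  by (simp_all add: tri_complex_volume_form holomorphic_coord_dual_vec[of 0] holomorphic_coord_dual_vec[of 1, simplified]
      holomorphic_coord_dual_vec[of 2] algebra_simps)

text \<open>Up to signs \<open>dual_vec\<close> permutes the standard basis.\<close>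

lemma sum_dual_vec_even:
  assumes "\<And>x. \<phi> (- x) = \<phi> x"
  shows "(\<Sum>i\<in>UNIV. \<phi> (dual_vec (\<e> i))) = (\<Sum>i\<in>UNIV. \<phi> (\<e> i) :: real)"
proof -
  have "dual_vec (\<e> 1) = - \<e> 4" "dual_vec (\<e> 2) = - \<e> 5" "dual_vec (\<e> 3) = - \<e> 6"
    "dual_vec (\<e> 4) = \<e> 1" "dual_vec (\<e> 5) = \<e> 2" "dual_vec (\<e> 6) = \<e> 3"
    by (simp_all add: vec_eq_iff forall_6 dual_vec_nth unit_vec_nth)
  then show ?thesis by (simp add: sum_6 assms)
qed

text \<open>
  The form is complex trilinear and \<open>dual_vec\<close> is multiplication by \<open>- \<i>\<close>, so every occurrence of
  \<open>dual_vec\<close> can be absorbed: the contraction is minus a Gram matrix and the quartic is a sum of squares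
  of its entries.
\<close>

lemma quartic_complex_volume_form: "quartic complex_volume_form > 0"
proof -
  let ?r = "re_tri complex_volume_form" and ?b = "contraction complex_volume_form"
  have b: "?b u v = - (\<Sum>i\<in>UNIV. \<Sum>j\<in>UNIV. ?r u (\<e> i) (\<e> j) * ?r v (\<e> i) (\<e> j))" for u v
    by (simp add: contraction_def re_tri_def tri_complex_volume_form_dual_vec sum_negf)
  have "?b (dual_vec u) (dual_vec v) = ?b u v" for u v
  proof -
    have "?r (dual_vec u) x y = ?r u (dual_vec x) y" for u x y
      by (simp add: re_tri_def tri_complex_volume_form_dual_vec)
    then have "?b (dual_vec u) (dual_vec v) =
        - (\<Sum>i\<in>UNIV. \<Sum>j\<in>UNIV. ?r u (dual_vec (\<e> i)) (\<e> j) * ?r v (dual_vec (\<e> i)) (\<e> j))"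
      unfolding b by simp
    also have "(\<Sum>i\<in>UNIV. \<Sum>j\<in>UNIV. ?r u (dual_vec (\<e> i)) (\<e> j) * ?r v (dual_vec (\<e> i)) (\<e> j)) =
        (\<Sum>i\<in>UNIV. \<Sum>j\<in>UNIV. ?r u (\<e> i) (\<e> j) * ?r v (\<e> i) (\<e> j))"
      by (rule sum_dual_vec_even[where \<phi> = "\<lambda>x. \<Sum>j\<in>UNIV. ?r u x (\<e> j) * ?r v x (\<e> j)"])
        (simp add: re_tri_def tri_minus)
    finally show ?thesis by (simp add: b)
  qed
  then have "quartic complex_volume_form = (\<Sum>i\<in>UNIV. \<Sum>j\<in>UNIV. (?b (\<e> i) (\<e> j))\<^sup>2)"
    by (simp add: quartic_def power2_eq_square)
  also have "\<dots> \<ge> (\<Sum>j\<in>UNIV. (?b (\<e> 1) (\<e> j))\<^sup>2)"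
    by (rule member_le_sum) (auto intro: sum_nonneg)
  also have "(\<Sum>j\<in>UNIV. (?b (\<e> 1) (\<e> j))\<^sup>2) \<ge> (?b (\<e> 1) (\<e> 1))\<^sup>2"
    by (rule member_le_sum) auto
  finally have "quartic complex_volume_form \<ge> (?b (\<e> 1) (\<e> 1))\<^sup>2" .
  moreover have "?b (\<e> 1) (\<e> 1) \<noteq> 0"
  proof -
    have "1 = (?r (\<e> 1) (\<e> 2) (\<e> 3))\<^sup>2"
      by (simp add: re_tri_def tri_complex_volume_form holomorphic_coord_def unit_vec_nth)
    also have "\<dots> \<le> (\<Sum>j\<in>UNIV. (?r (\<e> 1) (\<e> 2) (\<e> j))\<^sup>2)" by (rule member_le_sum) auto
    also have "\<dots> \<le> (\<Sum>i\<in>UNIV. \<Sum>j\<in>UNIV. (?r (\<e> 1) (\<e> i) (\<e> j))\<^sup>2)"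
      by (rule member_le_sum[of 2 UNIV "\<lambda>i. \<Sum>j\<in>UNIV. (?r (\<e> 1) (\<e> i) (\<e> j))\<^sup>2"]) (auto intro: sum_nonneg)
    finally show ?thesis by (auto simp: b power2_eq_square)
  qed
  ultimately show ?thesis by (meson less_le_trans zero_less_power2)
qed

section \<open>Infinite volume\<close>

lemma stretch_symmetry:
  assumes "c > 0"
  shows "symplectic_symmetry (postcompose (stretch c)) (postcompose (stretch (1 / c)))"
proof (rule symplectic_symmetry.intro)
  show "bounded_linear (postcompose (stretch c))" "bounded_linear (postcompose (stretch (1 / c)))"
    by (simp_all add: bounded_linear_postcompose linear_stretch)
  show "postcompose (stretch (1 / c)) (postcompose (stretch c) x) = x"
    "postcompose (stretch c) (postcompose (stretch (1 / c)) x) = x" for x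
    using assms by (auto intro!: tri_eqI simp: tri_postcompose linear_stretch stretch_def)
  show "postcompose (stretch c) x \<in> U1_plus" "postcompose (stretch (1 / c)) x \<in> U1_plus" if "x \<in> U1_plus" for x
    using assms that by (auto intro: U1_plus_stretch)
  show "sigma (postcompose (stretch c) x) (postcompose (stretch c) y) = sigma x y"
    if "x \<in> primitive_forms" "y \<in> primitive_forms" for x y
    using sigma_stretch[of c x y] assms that by simp
qed

text \<open>A measure-preserving map that commutes with the group permutes the fundamental domains.\<close>

lemma fundamental_domain_transport:
  assumes F: "fundamental_domain Sp6_int pullback natural_measure F" and T: "symplectic_symmetry T T'"
    and comm: "\<And>A x. T (pullback A x) = pullback A (T x)"
  shows "fundamental_domain Sp6_int pullback natural_measure (T ` F)"
proof -
  let ?M = natural_measure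
  interpret symplectic_symmetry T T' by (rule T)
  have inj: "inj T" using inverse(1) by (metis injI)
  have null: "T ` X \<in> null_sets ?M" if "X \<in> null_sets ?M" for X
    using that emeasure_image[of X] by (simp add: null_sets_def)
  have im: "pullback A ` T ` F = T ` pullback A ` F" for A
    by (simp add: image_image comm)
  have "T ` U1_plus = U1_plus"
    using U1 inverse(2) by (auto simp: image_iff) metis
  then have "U1_plus - (\<Union>A\<in>Sp6_int. pullback A ` T ` F) = T ` (U1_plus - (\<Union>A\<in>Sp6_int. pullback A ` F))"
    unfolding im image_set_diff[OF inj] by (simp add: image_UN)
  moreover have "pullback A ` T ` F \<inter> pullback A' ` T ` F = T ` (pullback A ` F \<inter> pullback A' ` F)" for A A'
    unfolding im image_Int[OF inj] ..
  ultimately show ?thesis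
    using F emeasure_image(1) null unfolding fundamental_domain_def space_natural_measure by auto
qed

text \<open>
  The stretch by \<open>1 / 2\<^sup>k\<close> divides the quartic by \<open>16\<^sup>k\<close>.  The width is chosen such that the upper bound of a shell
  does not exceed the lower bound of the next one.
\<close>

definition quartic_shell :: "nat \<Rightarrow> trilinear set"
  where "quartic_shell k = U1_plus \<inter> {\<Omega>. 16 ^ k * (quartic complex_volume_form / 2) < quartic \<Omega> \<and>
    quartic \<Omega> < 16 ^ k * (2 * quartic complex_volume_form)}"

lemma quartic_shell_sets: "quartic_shell k \<in> sets natural_measure"
  unfolding quartic_shell_def
  by (intro open_sets_natural_measure open_Collect_conj open_Collect_less continuous_on_const continuous_quartic)

lemma quartic_shell_invariant: "A \<in> Sp6_int \<Longrightarrow> pullback A ` quartic_shell k \<subseteq> quartic_shell k"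
  using U1_plus_pullback[OF Sp6_int_symplectic] by (auto simp: quartic_shell_def quartic_pullback)

lemma quartic_shell_disjoint: "disjoint_family quartic_shell"
proof -
  let ?q = "quartic complex_volume_form"
  have "quartic_shell m \<inter> quartic_shell n = {}" if "m < n" for m n
  proof -
    have "(16 :: real) ^ Suc m \<le> 16 ^ n" using that by (intro power_increasing) auto
    then have "16 ^ m * (2 * ?q) \<le> 16 ^ n * (?q / 2)"
      using quartic_complex_volume_form by (simp add: field_simps) (smt (verit) mult_right_mono zero_le_power)
    then show ?thesis by (auto simp: quartic_shell_def)
  qed
  then show ?thesis
    by (auto simp: disjoint_family_on_def) (metis disjoint_iff linorder_neqE_nat)
qed

lemma quartic_shell_stretch: "postcompose (stretch (1 / 2 ^ k)) ` quartic_shell k = quartic_shell 0"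
proof -
  interpret symplectic_symmetry "postcompose (stretch (2 ^ k))" "postcompose (stretch (1 / 2 ^ k))"
    by (rule stretch_symmetry) simp
  have pow: "((2 :: real) ^ k) ^ 4 = 16 ^ k" by (simp add: power_mult[symmetric] mult.commute[of k] power_mult)
  have q: "quartic (postcompose (stretch (1 / 2 ^ k)) \<Omega>) = quartic \<Omega> / 16 ^ k" for \<Omega>
    using pow by (simp add: quartic_stretch power_divide)
  have q': "quartic (postcompose (stretch (2 ^ k)) \<Omega>) = 16 ^ k * quartic \<Omega>" for \<Omega>
    using pow by (simp add: quartic_stretch)
  show ?thesis
  proof
    show "postcompose (stretch (1 / 2 ^ k)) ` quartic_shell k \<subseteq> quartic_shell 0"
      using U1(2) by (auto simp: quartic_shell_def q field_simps)
    show "quartic_shell 0 \<subseteq> postcompose (stretch (1 / 2 ^ k)) ` quartic_shell k"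
    proof
      fix \<Omega> assume "\<Omega> \<in> quartic_shell 0"
      then have "postcompose (stretch (2 ^ k)) \<Omega> \<in> quartic_shell k"
        using U1(1) by (simp add: quartic_shell_def q')
      then show "\<Omega> \<in> postcompose (stretch (1 / 2 ^ k)) ` quartic_shell k"
        using inverse(1)[of \<Omega>] by (metis imageI)
    qed
  qed
qed

text \<open>The cone over the shell contains a non-empty open set of \<open>\<real>\<^sup>2\<^sup>8\<close>.\<close>

lemma quartic_shell_positive: "emeasure natural_measure (quartic_shell 0) > 0"
proof -
  let ?q = "quartic complex_volume_form"
  let ?N = coords_normalization
  let ?Q = "\<lambda>x. quartic (param_form x)"
  \<comment> \<open>The quartic has degree 4 and the normalisation has degree 2, so the radial projection divides the quartic by the square of the normalisation.\<close>
  define W where "W = {x. param_form x \<in> U_plus} \<inter> {x. 0 < ?N x \<and> ?N x < 1 \<and>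
    (?q / 2) * (?N x)\<^sup>2 < ?Q x \<and> ?Q x < (2 * ?q) * (?N x)\<^sup>2}"
  have cQ: "continuous_on UNIV ?Q"
    by (rule continuous_on_compose2[OF continuous_quartic[of UNIV]]) (auto intro!: continuous_intros)
  have "open W"
    unfolding W_def by (intro open_Int open_U_plus_coords open_Collect_conj open_Collect_less continuous_intros cQ)
  \<comment> \<open>The factor 1/2 moves the point from the boundary of the cone into its interior.\<close>
  moreover have "form_coords ((1 / 2) *\<^sub>R complex_volume_form) \<in> W"
  proof -
    have p: "param_form (form_coords ((1 / 2) *\<^sub>R complex_volume_form)) = (1 / 2) *\<^sub>R complex_volume_form"
      using complex_volume_form_primitive by (intro param_form_form_coords subspace_scale[OF subspace_primitive])
    have "normalization complex_volume_form = 1" "complex_volume_form \<in> U_plus"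
      using complex_volume_form_U1_plus by (auto simp: U1_plus_eq)
    then show ?thesis
      unfolding W_def Int_iff mem_Collect_eq p using quartic_complex_volume_form
      by (simp add: normalization_scaleR quartic_scaleR U_plus_scaleR power2_eq_square power4_eq_xxxx)
  qed
  ultimately have "\<not> negligible W" using open_not_negligible by blast
  then have W: "emeasure lborel W \<noteq> 0"
    using \<open>open W\<close> by (auto simp: negligible_iff_null_sets null_sets_def)
  have X: "quartic_shell 0 \<in> sets (restrict_space borel U1_plus)"
    using quartic_shell_sets by (simp add: sets_natural_measure)
  have "W \<subseteq> {x \<in> positive_cone. radial_projection x \<in> quartic_shell 0}"
  proof
    fix x assume x: "x \<in> W"
    then have N: "0 < ?N x" by (simp add: W_def)
    have "quartic (radial_projection x) = ?Q x / (?N x)\<^sup>2"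
    proof -
      have "(sqrt (?N x)) ^ 4 = ((sqrt (?N x))\<^sup>2)\<^sup>2" by (simp add: power_mult[symmetric])
      then have "(sqrt (?N x)) ^ 4 = (?N x)\<^sup>2" using N by simp
      then show ?thesis by (simp add: radial_projection_def quartic_scaleR power_divide)
    qed
    then show "x \<in> {x \<in> positive_cone. radial_projection x \<in> quartic_shell 0}"
      using x N by (simp add: W_def positive_cone_def quartic_shell_def radial_projection_U1_plus
          pos_less_divide_eq pos_divide_less_eq)
  qed
  then have "emeasure lborel W \<le> emeasure lborel {x \<in> positive_cone. radial_projection x \<in> quartic_shell 0}"
    using borel_cone_over[OF X] by (intro emeasure_mono) auto
  then have "emeasure lborel {x \<in> positive_cone. radial_projection x \<in> quartic_shell 0} \<noteq> 0"
    using W by (metis le_zero_eq)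
  then have "emeasure natural_measure (quartic_shell 0) \<noteq> 0"
    unfolding natural_measure_eq_cone_measure emeasure_cone_measure[OF X] by simp
  then show ?thesis by (simp add: zero_less_iff_neq_zero)
qed

text \<open>
  The stretch carries the part of \<open>F\<close> in the \<open>k\<close>-th shell to the part in the shell of index \<open>0\<close> of another fundamental
  domain.  All fundamental domains meet this shell in the same positive measure, so \<open>F\<close> contains
  infinitely many disjoint sets of equal positive measure.
\<close>

lemma fundamental_domain_infinite:
  assumes F: "fundamental_domain Sp6_int pullback natural_measure F"
  shows "emeasure natural_measure F = \<infinity>"
proof -
  let ?M = natural_measure
  have Fs: "F \<in> sets ?M" using F by (simp add: fundamental_domain_def)
  let ?m = "emeasure ?M (F \<inter> quartic_shell 0)"
  have same: "emeasure ?M (F \<inter> quartic_shell k) = ?m" for k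
  proof -
    let ?T = "postcompose (stretch (1 / 2 ^ k))"
    have sym: "symplectic_symmetry ?T (postcompose (stretch (2 ^ k)))"
      using stretch_symmetry[of "1 / 2 ^ k"] by simp
    interpret symplectic_symmetry ?T "postcompose (stretch (2 ^ k))" by (rule sym)
    have inj: "inj ?T" using inverse(1) by (metis injI)
    have F': "fundamental_domain Sp6_int pullback ?M (?T ` F)"
      by (rule fundamental_domain_transport[OF F sym]) (simp add: postcompose_pullback linear_stretch)
    have "emeasure ?M (F \<inter> quartic_shell k) = emeasure ?M (?T ` (F \<inter> quartic_shell k))"
      by (rule emeasure_image(2)[symmetric]) (use Fs quartic_shell_sets in auto)
    also have "?T ` (F \<inter> quartic_shell k) = ?T ` F \<inter> quartic_shell 0"
      by (simp only: image_Int[OF inj] quartic_shell_stretch)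
    also have "emeasure ?M (?T ` F \<inter> quartic_shell 0) = ?m"
      by (rule fundamental_domain_measure_unique[OF F' F quartic_shell_sets quartic_shell_invariant])
    finally show ?thesis .
  qed
  have "(\<Sum>k :: nat. ?m) = (\<Sum>k. emeasure ?M (F \<inter> quartic_shell k))"
    by (intro arg_cong[of _ _ suminf] ext) (rule same[symmetric])
  also have "\<dots> = emeasure ?M (\<Union>k. F \<inter> quartic_shell k)"
    by (rule suminf_emeasure)
      (use Fs quartic_shell_sets quartic_shell_disjoint in \<open>auto simp: disjoint_family_on_def\<close>)
  also have "\<dots> \<le> emeasure ?M F"
    by (rule emeasure_mono) (use Fs in auto)
  finally have "(\<Sum>k :: nat. ?m) \<le> emeasure ?M F" .
  moreover have "(\<Sum>k :: nat. ?m) = \<infinity>"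
  proof -
    have "?m > 0"
      by (rule fundamental_domain_positive[OF F quartic_shell_sets quartic_shell_invariant quartic_shell_positive])
    then show ?thesis
      by (simp add: nn_integral_count_space_nat[symmetric] ennreal_mult_top)
  qed
  ultimately show ?thesis by (simp add: top_unique)
qed

theorem theorem1p3:
  shows "quotient_volume Sp6_int pullback natural_measure = \<infinity>"
  unfolding quotient_volume_def
  using fundamental_domain_exists fundamental_domain_infinite by (intro the_equality) auto

end
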